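(* Let $\omega\subset\mathbb{R}^2$ be a bounded domain with $C^2$-boundary containing the origin, let $\beta\in\mathbb{R}$, and let $E_1(p,\beta)$ be the lowest eigenvalue of the operator $h_\beta(p)$ defined in the context. Then $\partial_pE_1(0,\beta)=0$ and $$\mu(\beta):=\tfrac12\,\partial_p^2E_1(0,\beta)>0.$$ As a consequence, $$E_1(p,\beta)=E_1(0,\beta)+\mu(\beta)p^2+O(p^3),\qquad p\to0.$$ Moreover, for each $p\in\mathbb{R}$ with $p\ne0$ we have $E_1(p,\beta)>E_1(0,\beta)$.
   Context: A domain is a connected open set. Write $x_t=(x_1,x_2)$, $\nabla_t=(\partial_1,\partial_2)^T$, $\Delta_t=\partial_1^2+\partial_2^2$, $\partial_\varphi=x_1\partial_2-x_2\partial_1$. For $p,\beta\in\mathbb{R}$, $h_\beta(p)=-\Delta_t-(\beta\partial_\varphi+ip)^2$ is the self-adjoint operator in $L^2(\omega)$ generated by the closed quadratic form $$q_{p,\beta}[u]=\int_\omega\left(|\nabla_t u|^2+|i\beta\partial_\varphi u-pu|^2\right)dx_t,\qquad u\in H^1_0(\omega).$$ Its spectrum is purely discrete, and $E_1(p,\beta)$ denotes its lowest eigenvalue. The eigenvalue $E_1(0,\beta)$ is simple, and $p\mapsto E_1(p,\beta)$ is analytic in a neighbourhood of $p=0$, so the derivatives above are well defined. *)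

theory Defs
  imports "HOL-Analysis.Analysis" "HOL-Library.Landau_Symbols"
begin

text \<open>Functions that are \<open>k\<close> times continuously differentiable on the whole space.\<close>

primrec Ck :: "nat \<Rightarrow> ('a::euclidean_space \<Rightarrow> 'b::real_normed_vector) \<Rightarrow> bool" where
  "Ck 0 f \<longleftrightarrow> continuous_on UNIV f"
| "Ck (Suc k) f \<longleftrightarrow>
     (\<forall>x. f differentiable at x) \<and> (\<forall>b\<in>Basis. Ck k (\<lambda>x. frechet_derivative f (at x) b))"

text \<open>Near every boundary point, in suitable Cartesian coordinates with axes \<open>a\<close> and \<open>b\<close>, the
  set is the region strictly above the graph of a \<open>C\<^sup>2\<close> function.\<close>

definition C2_boundary :: "(real^2) set \<Rightarrow> bool" where
  "C2_boundary \<Omega> \<longleftrightarrow>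
     (\<forall>z\<in>frontier \<Omega>. \<exists>r>0. \<exists>a b. \<exists>\<gamma>::real \<Rightarrow> real.
        norm a = 1 \<and> norm b = 1 \<and> a \<bullet> b = 0 \<and> Ck 2 \<gamma> \<and>
        \<Omega> \<inter> ball z r = {x \<in> ball z r. \<gamma> (x \<bullet> a) < x \<bullet> b})"

text \<open>Elements of \<open>L\<^sup>2(\<Omega>)\<close> and of the Sobolev spaces are represented by functions on the whole
  plane; values outside \<open>\<Omega>\<close> and on null sets are irrelevant to everything below.\<close>

definition L2 :: "(real^2) set \<Rightarrow> (real^2 \<Rightarrow> complex) set" where
  "L2 \<Omega> = {u \<in> borel_measurable (lebesgue_on \<Omega>). integrable (lebesgue_on \<Omega>) (\<lambda>x. (cmod (u x))\<^sup>2)}"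

definition L2_inner :: "(real^2) set \<Rightarrow> (real^2 \<Rightarrow> complex) \<Rightarrow> (real^2 \<Rightarrow> complex) \<Rightarrow> complex" where
  "L2_inner \<Omega> u v = (LINT x|lebesgue_on \<Omega>. u x * cnj (v x))"

definition test_functions :: "(real^2) set \<Rightarrow> (real^2 \<Rightarrow> complex) set" where
  "test_functions \<Omega> =
     {\<phi>. (\<forall>k. Ck k \<phi>) \<and> compact (closure {x. \<phi> x \<noteq> 0}) \<and> closure {x. \<phi> x \<noteq> 0} \<subseteq> \<Omega>}"

definition pderiv_classical :: "2 \<Rightarrow> (real^2 \<Rightarrow> complex) \<Rightarrow> real^2 \<Rightarrow> complex" where
  "pderiv_classical i \<phi> x = frechet_derivative \<phi> (at x) (axis i 1)"

definition has_weak_pderiv ::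
    "(real^2) set \<Rightarrow> 2 \<Rightarrow> (real^2 \<Rightarrow> complex) \<Rightarrow> (real^2 \<Rightarrow> complex) \<Rightarrow> bool" where
  "has_weak_pderiv \<Omega> i u g \<longleftrightarrow>
     (\<forall>\<phi>\<in>test_functions \<Omega>.
        (LINT x|lebesgue_on \<Omega>. u x * pderiv_classical i \<phi> x) = - (LINT x|lebesgue_on \<Omega>. g x * \<phi> x))"

definition H1 :: "(real^2) set \<Rightarrow> (real^2 \<Rightarrow> complex) set" where
  "H1 \<Omega> = {u \<in> L2 \<Omega>. \<forall>i. \<exists>g\<in>L2 \<Omega>. has_weak_pderiv \<Omega> i u g}"

text \<open>For \<open>u\<close> in \<open>H1 \<Omega>\<close> with \<open>\<Omega>\<close> open, the choice is unique up to null sets of \<open>\<Omega>\<close>.\<close>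

definition wpderiv :: "(real^2) set \<Rightarrow> 2 \<Rightarrow> (real^2 \<Rightarrow> complex) \<Rightarrow> real^2 \<Rightarrow> complex" where
  "wpderiv \<Omega> i u = (SOME g. g \<in> L2 \<Omega> \<and> has_weak_pderiv \<Omega> i u g)"

text \<open>The closure of the test functions in the \<open>H\<^sup>1\<close> norm.\<close>

definition H10 :: "(real^2) set \<Rightarrow> (real^2 \<Rightarrow> complex) set" where
  "H10 \<Omega> = {u \<in> H1 \<Omega>. \<exists>\<phi>. (\<forall>n::nat. \<phi> n \<in> test_functions \<Omega>) \<and>
     (\<lambda>n. LINT x|lebesgue_on \<Omega>. (cmod (u x - \<phi> n x))\<^sup>2
            + (\<Sum>i\<in>UNIV. (cmod (wpderiv \<Omega> i u x - pderiv_classical i (\<phi> n) x))\<^sup>2)) \<longlonglongrightarrow> 0}"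

definition angular_deriv :: "(real^2) set \<Rightarrow> (real^2 \<Rightarrow> complex) \<Rightarrow> real^2 \<Rightarrow> complex" where
  "angular_deriv \<Omega> u x = of_real (x$1) * wpderiv \<Omega> 2 u x - of_real (x$2) * wpderiv \<Omega> 1 u x"

definition qform :: "(real^2) set \<Rightarrow> real \<Rightarrow> real \<Rightarrow> (real^2 \<Rightarrow> complex) \<Rightarrow> real" where
  "qform \<Omega> p \<beta> u =
     (LINT x|lebesgue_on \<Omega>. (\<Sum>i\<in>UNIV. (cmod (wpderiv \<Omega> i u x))\<^sup>2)
        + (cmod (\<i> * of_real \<beta> * angular_deriv \<Omega> u x - of_real p * u x))\<^sup>2)"

definition sform ::
    "(real^2) set \<Rightarrow> real \<Rightarrow> real \<Rightarrow> (real^2 \<Rightarrow> complex) \<Rightarrow> (real^2 \<Rightarrow> complex) \<Rightarrow> complex" where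
  "sform \<Omega> p \<beta> u v =
     (LINT x|lebesgue_on \<Omega>. (\<Sum>i\<in>UNIV. wpderiv \<Omega> i u x * cnj (wpderiv \<Omega> i v x))
        + (\<i> * of_real \<beta> * angular_deriv \<Omega> u x - of_real p * u x)
          * cnj (\<i> * of_real \<beta> * angular_deriv \<Omega> v x - of_real p * v x))"

lemma sform_diagonal: "sform \<Omega> p \<beta> u u = of_real (qform \<Omega> p \<beta> u)"
proof -
  have "sform \<Omega> p \<beta> u u =
     (LINT x|lebesgue_on \<Omega>. complex_of_real ((\<Sum>i\<in>UNIV. (cmod (wpderiv \<Omega> i u x))\<^sup>2)
        + (cmod (\<i> * of_real \<beta> * angular_deriv \<Omega> u x - of_real p * u x))\<^sup>2))"
    unfolding sform_def by (simp only: complex_norm_square of_real_add of_real_sum)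
  then show ?thesis
    unfolding qform_def by (simp only: integral_complex_of_real)
qed

text \<open>The operator generated by a sesquilinear form \<open>a\<close> with form domain \<open>D\<close>, given by its graph:
  \<open>u\<close> is in the operator domain with image \<open>f\<close> iff \<open>a(u,v) = \<langle>f,v\<rangle>\<close> for all \<open>v\<close> in \<open>D\<close>.\<close>

definition form_operator ::
    "(real^2) set \<Rightarrow> (real^2 \<Rightarrow> complex) set \<Rightarrow>
     ((real^2 \<Rightarrow> complex) \<Rightarrow> (real^2 \<Rightarrow> complex) \<Rightarrow> complex) \<Rightarrow>
     ((real^2 \<Rightarrow> complex) \<times> (real^2 \<Rightarrow> complex)) set" where
  "form_operator \<Omega> D a = {(u, f). u \<in> D \<and> f \<in> L2 \<Omega> \<and> (\<forall>v\<in>D. a u v = L2_inner \<Omega> f v)}"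

definition h_op ::
    "(real^2) set \<Rightarrow> real \<Rightarrow> real \<Rightarrow> ((real^2 \<Rightarrow> complex) \<times> (real^2 \<Rightarrow> complex)) set" where
  "h_op \<Omega> p \<beta> = form_operator \<Omega> (H10 \<Omega>) (sform \<Omega> p \<beta>)"

definition is_eigenvalue ::
    "(real^2) set \<Rightarrow> ((real^2 \<Rightarrow> complex) \<times> (real^2 \<Rightarrow> complex)) set \<Rightarrow> complex \<Rightarrow> bool" where
  "is_eigenvalue \<Omega> T c \<longleftrightarrow>
     (\<exists>u. (u, \<lambda>x. c * u x) \<in> T \<and> \<not> (AE x in lebesgue_on \<Omega>. u x = 0))"

definition E1 :: "(real^2) set \<Rightarrow> real \<Rightarrow> real \<Rightarrow> real" where
  "E1 \<Omega> p \<beta> = (LEAST e. is_eigenvalue \<Omega> (h_op \<Omega> p \<beta>) (of_real e))"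

definition mu :: "(real^2) set \<Rightarrow> real \<Rightarrow> real" where
  "mu \<Omega> \<beta> = 1/2 * deriv (deriv (\<lambda>p. E1 \<Omega> p \<beta>)) 0"

end

theory Submission
  imports Defs
begin

text \<open>On \<open>H\<^sup>1\<^sub>0\<close> the quadratic form of the operator is a polynomial in \<open>p\<close>: expanding the square,
\<open>q_p = A + p B + p\<^sup>2 N\<close>, where \<open>A\<close> is the form at \<open>p = 0\<close>, \<open>N\<close> is the \<open>L\<^sup>2\<close> inner product and
\<open>B(u,v) = - \<langle>i\<beta>\<partial>\<^sub>\<phi> u, v\<rangle> - \<langle>u, i\<beta>\<partial>\<^sub>\<phi> v\<rangle>\<close>. Since bounded sets of the form domain are precompact in \<open>L\<^sup>2\<close>
(\<open>rellich_compactness\<close>), the infimum \<open>E(p)\<close> of the Rayleigh quotient is attained, and it is the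
lowest eigenvalue (\<open>E1_ground_state\<close>). Three ingredients then give the theorem.

The first is the bound \<open>E(p) \<ge> E(0) + c p\<^sup>2\<close> with \<open>c = 1/(1 + \<beta>\<^sup>2R\<^sup>2)\<close>, where \<open>R\<close> bounds the norm
on the domain (\<open>E1_lower_bound\<close>). Write \<open>u = r exp(i\<theta>)\<close>. The amplitude contributes to \<open>q_p[u]\<close>
exactly \<open>q_0[r]\<close>, and the phase contributes the integral of
\<open>r\<^sup>2 (|\<nabla>\<theta>|\<^sup>2 + (\<beta>\<partial>\<^sub>\<phi>\<theta> + p)\<^sup>2)\<close>. The rotation of the phase can cancel \<open>p\<close> only if \<open>\<nabla>\<theta>\<close> is large, because
\<open>|\<partial>\<^sub>\<phi>\<theta>| \<le> R|\<nabla>\<theta>|\<close>; so the phase costs at least \<open>c p\<^sup>2 r\<^sup>2\<close> at every point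
(\<open>diamagnetic_inequality\<close>). This settles the strict inequality for all \<open>p \<noteq> 0\<close>.

The second is that the eigenvalue \<open>E(0)\<close> is simple (\<open>ground_state_simple\<close>). At \<open>p = 0\<close> passing to
the modulus does not increase the form, so the modulus of a ground state is a ground state. A
nonnegative ground state is a supersolution, hence its logarithm has locally bounded energy, and
by the Poincare inequality a bounded oscillation in mean square; so it cannot vanish on a part of
a small box without vanishing on the whole box, and connectedness spreads this over the domain
(\<open>ground_nonzero\<close>). Consequently a real ground state has a constant sign, and none is orthogonal
to the positive one.

The third is perturbation theory for a simple lowest eigenvalue of a quadratic pencil of forms
(\<open>second_order_expansion\<close>). With a normalised ground state \<open>u0\<close> at \<open>p = 0\<close> and eigenvectors
\<open>u0 + v_p\<close>, where \<open>v_p\<close> is orthogonal to \<open>u0\<close>, the spectral gap makes \<open>v_p\<close> of size \<open>O(p)\<close> and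
\<open>v_p/p\<close> convergent. This yields \<open>E(p) = E(0) + k p\<^sup>2 + O(p\<^sup>3)\<close> and \<open>E'(p) = 2 k p + O(p\<^sup>2)\<close>; there is
no linear term, since the lower bound leaves room for none, and the same bound gives \<open>k \<ge> c > 0\<close>.\<close>

section \<open>Functions of class \<open>C\<^sup>k\<close>\<close>

lemma Ck_SucI:
  assumes "\<And>x. (f has_derivative f' x) (at x)" "\<And>b. b \<in> Basis \<Longrightarrow> Ck k (\<lambda>x. f' x b)"
  shows "Ck (Suc k) f"
proof -
  have "frechet_derivative f (at x) = f' x" for x
    using frechet_derivative_at[OF assms(1)] by simp
  then show ?thesis using assms unfolding differentiable_def by (auto simp: differentiable_def)
qed

lemma Ck_SucD:
  assumes "Ck (Suc k) f"
  shows "(f has_derivative frechet_derivative f (at x)) (at x)"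
    "b \<in> Basis \<Longrightarrow> Ck k (\<lambda>x. frechet_derivative f (at x) b)"
  using assms by (auto simp: frechet_derivative_works)

lemma Ck_continuous: "Ck k f \<Longrightarrow> continuous_on UNIV f"
proof (cases k)
  case (Suc j)
  assume "Ck k f"
  then have "isCont f x" for x using Suc differentiable_imp_continuous_within by auto
  then show ?thesis by (simp add: continuous_at_imp_continuous_on)
qed auto

lemma Ck_Suc_imp: "Ck (Suc k) f \<Longrightarrow> Ck k f"
proof (induction k arbitrary: f)
  case 0 then show ?case using Ck_continuous[of "Suc 0" f] by (simp only: Ck.simps(1) One_nat_def)
next
  case (Suc k)
  show ?case
    by (rule Ck_SucI[OF Ck_SucD(1)[OF Suc.prems]]) (rule Suc.IH, rule Ck_SucD(2)[OF Suc.prems])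
qed

lemma Ck_const: "Ck k (\<lambda>x. c)"
proof (induction k arbitrary: c)
  case (Suc k) show ?case by (rule Ck_SucI[where f' = "\<lambda>x h. 0"]) (auto intro: Suc)
qed simp

lemma Ck_add: "Ck k f \<Longrightarrow> Ck k g \<Longrightarrow> Ck k (\<lambda>x. f x + g x)"
proof (induction k arbitrary: f g)
  case 0 then show ?case by (auto intro!: continuous_on_add continuous_on_mult)
next
  case (Suc k)
  show ?case
    by (rule Ck_SucI[OF has_derivative_add[OF Ck_SucD(1)[OF Suc.prems(1)] Ck_SucD(1)[OF Suc.prems(2)]]])
      (intro Suc.IH Ck_SucD(2)[OF Suc.prems(1)] Ck_SucD(2)[OF Suc.prems(2)])
qed

lemma Ck_bounded_linear:
  assumes "bounded_linear L" shows "Ck k f \<Longrightarrow> Ck k (\<lambda>x. L (f x))"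
proof (induction k arbitrary: f)
  case 0 then show ?case using bounded_linear.continuous_on[OF assms] by auto
next
  case (Suc k)
  show ?case
    by (rule Ck_SucI[OF bounded_linear.has_derivative[OF assms Ck_SucD(1)[OF Suc.prems]]])
      (intro Suc.IH Ck_SucD(2)[OF Suc.prems])
qed

lemma Ck_mult:
  fixes f g :: "'a::euclidean_space \<Rightarrow> 'b::real_normed_algebra"
  shows "Ck k f \<Longrightarrow> Ck k g \<Longrightarrow> Ck k (\<lambda>x. f x * g x)"
proof (induction k arbitrary: f g)
  case 0 then show ?case by (auto intro!: continuous_on_add continuous_on_mult)
next
  case (Suc k)
  show ?case
    by (rule Ck_SucI[OF has_derivative_mult[OF Ck_SucD(1)[OF Suc.prems(1)] Ck_SucD(1)[OF Suc.prems(2)]]])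
      (intro Ck_add Suc.IH Ck_SucD(2)[OF Suc.prems(1)] Ck_SucD(2)[OF Suc.prems(2)] Suc.prems[THEN Ck_Suc_imp])
qed

lemma has_derivative_powr_const:
  fixes f :: "'a::real_normed_vector \<Rightarrow> real"
  assumes "(f has_derivative f') (at x)" "0 < f x"
  shows "((\<lambda>x. f x powr r) has_derivative (\<lambda>h. f' h * (r * f x powr (r - 1)))) (at x)"
  using DERIV_compose_FDERIV[OF has_real_derivative_powr[OF assms(2), of r] assms(1)] .

lemma Ck_powr:
  fixes f :: "'a::euclidean_space \<Rightarrow> real"
  assumes pos: "\<And>x. 0 < f x"
  shows "Ck k f \<Longrightarrow> Ck k (\<lambda>x. f x powr r)"
proof (induction k arbitrary: r)
  case 0
  then show ?case using pos by (auto intro!: continuous_on_powr continuous_on_const) (metis less_irrefl)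
next
  case (Suc k)
  show ?case
    by (rule Ck_SucI[OF has_derivative_powr_const[OF Ck_SucD(1)[OF Suc.prems] pos]])
      (intro Ck_mult Ck_const Suc.IH Ck_SucD(2)[OF Suc.prems] Suc.prems[THEN Ck_Suc_imp])
qed

lemma Ck_compose_affine:
  fixes f :: "real \<Rightarrow> real" and l :: "'a::euclidean_space \<Rightarrow> real"
  assumes l: "bounded_linear l"
  shows "Ck k f \<Longrightarrow> Ck k (\<lambda>x. f (l x + c))"
proof (induction k arbitrary: f)
  case 0
  have "continuous_on UNIV (\<lambda>x. l x + c)" by (intro continuous_intros bounded_linear.continuous_on[OF l])
  then show ?case using continuous_on_compose2[of UNIV f UNIV "\<lambda>x. l x + c"] 0 by auto
next
  case (Suc k)
  let ?f' = "\<lambda>t. frechet_derivative f (at t) 1"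
  have d: "(f has_real_derivative ?f' t) (at t)" for t
  proof -
    have D: "(f has_derivative frechet_derivative f (at t)) (at t)" by (rule Ck_SucD(1)[OF Suc.prems])
    have "frechet_derivative f (at t) h = ?f' t * h" for h
      using linear_scale[OF has_derivative_linear[OF D], of h 1] by (simp add: mult.commute)
    then show ?thesis using D unfolding has_field_derivative_def by (metis (no_types, lifting) ext)
  qed
  have "((\<lambda>x. l x + c) has_derivative l) (at x)" for x
    by (auto intro!: derivative_eq_intros bounded_linear_imp_has_derivative l)
  then have *: "((\<lambda>x. f (l x + c)) has_derivative (\<lambda>h. l h * ?f' (l x + c))) (at x)" for x
    using DERIV_compose_FDERIV[OF d] by blast
  show ?case
    by (rule Ck_SucI[OF *], intro Ck_mult Ck_const Suc.IH Ck_SucD(2)[OF Suc.prems]) simp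
qed

section \<open>Bump functions\<close>

text \<open>The functions \<open>exp (-1/t)/t\<^sup>n\<close>, extended by \<open>0\<close> to \<open>t \<le> 0\<close>. Admitting every power of \<open>1/t\<close> makes the
family closed under differentiation up to linear combinations, so smoothness is a plain induction.\<close>

definition flat :: "nat \<Rightarrow> real \<Rightarrow> real" where
  "flat n t = (if t \<le> 0 then 0 else inverse t ^ n * exp (- inverse t))"

lemma flat_tendsto_0: "((\<lambda>t. inverse t ^ n * exp (- inverse t)) \<longlongrightarrow> 0) (at_right (0::real))"
proof -
  have "((\<lambda>t. inverse t ^ n / exp (inverse t)) \<longlongrightarrow> 0) (at_right (0::real))"
    by (rule filterlim_compose[OF tendsto_power_div_exp_0 filterlim_inverse_at_top_right])
  then show ?thesis by (simp add: exp_minus divide_inverse)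
qed

lemma flat_has_derivative:
  "(flat n has_real_derivative flat (n + 2) t - real n * flat (n + 1) t) (at t)"
proof (cases t "0::real" rule: linorder_cases)
  case less
  have "((\<lambda>t. 0) has_real_derivative 0) (at t)" by simp
  then have "(flat n has_real_derivative 0) (at t)"
    by (rule has_field_derivative_transform_within_open[of _ _ _ "{..<0}"]) (use less in \<open>auto simp: flat_def\<close>)
  then show ?thesis using less by (simp add: flat_def)
next
  case greater
  have "((\<lambda>t. inverse t ^ n * exp (- inverse t)) has_real_derivative
      (inverse t ^ (n + 2) * exp (- inverse t)) - real n * (inverse t ^ (n + 1) * exp (- inverse t))) (at t)"
  proof -
    have p: "((\<lambda>t. inverse t ^ n) has_real_derivative real n * (- (inverse t ^ Suc (Suc 0)) * inverse t ^ (n - Suc 0))) (at t)"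
      using greater by (intro DERIV_power DERIV_inverse) auto
    have e: "((\<lambda>t. exp (- inverse t)) has_real_derivative exp (- inverse t) * inverse t ^ 2) (at t)"
      using greater by (auto intro!: derivative_eq_intros simp: power2_eq_square)
    show ?thesis
      by (rule DERIV_cong[OF DERIV_mult[OF p e]]) (cases n; simp add: power2_eq_square algebra_simps)
  qed
  then have "(flat n has_real_derivative
      (inverse t ^ (n + 2) * exp (- inverse t)) - real n * (inverse t ^ (n + 1) * exp (- inverse t))) (at t)"
    by (rule has_field_derivative_transform_within_open[of _ _ _ "{0<..}"]) (use greater in \<open>auto simp: flat_def\<close>)
  then show ?thesis using greater by (simp add: flat_def)
next
  case equal
  have "((\<lambda>h. flat n h / h) \<longlongrightarrow> 0) (at_right 0)"
    by (rule Lim_transform_eventually[OF flat_tendsto_0[of "Suc n"]])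
      (auto simp: flat_def eventually_at_filter divide_inverse intro!: always_eventually)
  moreover have "((\<lambda>h. flat n h / h) \<longlongrightarrow> 0) (at_left 0)"
    by (rule Lim_transform_eventually[OF tendsto_const]) (auto simp: flat_def eventually_at_filter)
  ultimately have "((\<lambda>h. flat n h / h) \<longlongrightarrow> 0) (at 0)" by (simp add: filterlim_split_at)
  then show ?thesis using equal by (simp add: has_field_derivative_iff flat_def)
qed

lemma Ck_flat: "Ck k (flat n)"
proof (induction k arbitrary: n)
  case 0
  then show ?case using flat_has_derivative
    by (metis Ck.simps(1) DERIV_isCont continuous_at_imp_continuous_on)
next
  case (Suc k)
  have "Ck k (\<lambda>x. flat (n + 2) x + (- real n) * flat (n + 1) x)"
    by (intro Ck_add Ck_mult Ck_const Suc)
  then show ?case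
    by (intro Ck_SucI[OF flat_has_derivative[unfolded has_field_derivative_def]]) auto
qed

lemma flat0_bounds: "0 \<le> flat 0 t" "flat 0 t \<le> 1" "0 < flat 0 t \<longleftrightarrow> 0 < t"
  by (auto simp: flat_def)

lemma flat0_scaled_tendsto: "0 < t \<Longrightarrow> (\<lambda>m. flat 0 (real m * t)) \<longlonglongrightarrow> 1"
proof -
  assume t: "0 < t"
  have "filterlim (\<lambda>m. real m * t) at_top sequentially"
    by (intro filterlim_at_top_mult_tendsto_pos[OF tendsto_const t] filterlim_real_sequentially)
  then have "(\<lambda>m. exp (- inverse (real m * t))) \<longlonglongrightarrow> exp (- 0)"
    by (intro tendsto_exp tendsto_minus tendsto_inverse_0_at_top)
  moreover have "\<forall>\<^sub>F m in sequentially. exp (- inverse (real m * t)) = flat 0 (real m * t)"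
    using eventually_gt_at_top[of 0] by eventually_elim (use t in \<open>auto simp: flat_def not_le\<close>)
  ultimately show ?thesis using Lim_transform_eventually by fastforce
qed

text \<open>The factor \<open>m\<close> steepens the four edges, so that the bumps converge to the indicator of the box.\<close>

definition box_bump :: "nat \<Rightarrow> real^2 \<Rightarrow> real^2 \<Rightarrow> real^2 \<Rightarrow> real" where
  "box_bump m a b x = flat 0 (real m * (x$1 - a$1)) * flat 0 (real m * (b$1 - x$1)) *
      (flat 0 (real m * (x$2 - a$2)) * flat 0 (real m * (b$2 - x$2)))"

lemma Ck_box_bump: "Ck k (box_bump m a b)"
proof -
  have p: "Ck k (\<lambda>x::real^2. flat 0 (real m * (x$i - c)))" for i c
  proof -
    have "bounded_linear (\<lambda>x::real^2. real m * x$i)"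
      by (intro bounded_linear_mult_right[THEN bounded_linear_compose] bounded_linear_vec_nth)
    from Ck_compose_affine[OF this Ck_flat, of k 0 "- real m * c"] show ?thesis
      by (simp add: algebra_simps)
  qed
  have q: "Ck k (\<lambda>x::real^2. flat 0 (real m * (c - x$i)))" for i c
  proof -
    have "bounded_linear (\<lambda>x::real^2. (- real m) * x$i)"
      by (intro bounded_linear_mult_right[THEN bounded_linear_compose] bounded_linear_vec_nth)
    from Ck_compose_affine[OF this Ck_flat, of k 0 "real m * c"] show ?thesis
      by (simp add: algebra_simps)
  qed
  show ?thesis unfolding box_bump_def[abs_def] by (intro Ck_mult p q)
qed

lemma box_bump_bounds: "0 \<le> box_bump m a b x" "box_bump m a b x \<le> 1"
  unfolding box_bump_def by (auto intro!: mult_nonneg_nonneg mult_le_one flat0_bounds)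

lemma mem_box_2: "(x::real^2) \<in> box a b \<longleftrightarrow> a$1 < x$1 \<and> x$1 < b$1 \<and> a$2 < x$2 \<and> x$2 < b$2"
  by (auto simp: mem_box_cart forall_2)

lemma box_bump_pos_iff: "m > 0 \<Longrightarrow> 0 < box_bump m a b x \<longleftrightarrow> x \<in> box a b"
proof -
  assume m: "m > 0"
  have *: "0 < p * q * (r * s) \<longleftrightarrow> 0 < p \<and> 0 < q \<and> 0 < r \<and> 0 < s"
    if "0 \<le> p" "0 \<le> q" "0 \<le> r" "0 \<le> s" for p q r s :: real
  proof -
    have "0 \<le> p * q" "0 \<le> r * s" using that by simp_all
    then have "0 < p * q * (r * s) \<longleftrightarrow> 0 < p * q \<and> 0 < r * s" by (auto simp: zero_less_mult_iff)
    also have "\<dots> \<longleftrightarrow> 0 < p \<and> 0 < q \<and> 0 < r \<and> 0 < s" using that by (auto simp: zero_less_mult_iff)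
    finally show ?thesis .
  qed
  show ?thesis unfolding box_bump_def mem_box_2 *[OF flat0_bounds(1) flat0_bounds(1) flat0_bounds(1) flat0_bounds(1)]
    using m by (simp add: flat0_bounds(3) zero_less_mult_iff)
qed

lemma box_bump_0: "x \<notin> box a b \<Longrightarrow> box_bump m a b x = 0"
proof (cases "m = 0")
  case True then show ?thesis by (simp add: box_bump_def flat_def)
next
  case False
  moreover assume "x \<notin> box a b"
  ultimately show ?thesis using box_bump_pos_iff[of m a b x] box_bump_bounds(1)[of m a b x] by linarith
qed

lemma box_bump_tendsto: "(\<lambda>m. box_bump m a b x) \<longlonglongrightarrow> indicat_real (box a b) x"
proof (cases "x \<in> box a b")
  case True
  then have "(\<lambda>m. box_bump m a b x) \<longlonglongrightarrow> 1 * 1 * (1 * 1)"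
    unfolding box_bump_def mem_box_2 by (intro tendsto_mult flat0_scaled_tendsto) auto
  then show ?thesis using True by simp
qed (simp add: box_bump_0)

lemma axis_one_in_Basis [simp]: "(axis i 1 :: real^2) \<in> Basis"
  by (simp add: axis_in_Basis_iff)

section \<open>Test functions\<close>

lemma test_functionsD:
  assumes "\<phi> \<in> test_functions \<Omega>"
  shows "Ck k \<phi>" "continuous_on UNIV \<phi>" "(\<phi> has_derivative frechet_derivative \<phi> (at x)) (at x)"
    "x \<notin> \<Omega> \<Longrightarrow> \<phi> x = 0" "compact (closure {x. \<phi> x \<noteq> 0})" "closure {x. \<phi> x \<noteq> 0} \<subseteq> \<Omega>"
proof -
  show k: "Ck k \<phi>" for k using assms by (simp add: test_functions_def)
  show "continuous_on UNIV \<phi>" by (rule Ck_continuous[OF k[of 0]])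
  show "(\<phi> has_derivative frechet_derivative \<phi> (at x)) (at x)" by (rule Ck_SucD(1)[OF k])
  show *: "compact (closure {x. \<phi> x \<noteq> 0})" "closure {x. \<phi> x \<noteq> 0} \<subseteq> \<Omega>"
    using assms by (auto simp: test_functions_def)
  show "x \<notin> \<Omega> \<Longrightarrow> \<phi> x = 0" using *(2) closure_subset[of "{x. \<phi> x \<noteq> 0}"] by auto
qed

lemma test_functionsI:
  assumes "\<And>k. Ck k f" "{x. f x \<noteq> 0} \<subseteq> S" "compact S" "S \<subseteq> \<Omega>"
  shows "f \<in> test_functions \<Omega>"
proof -
  have "closure {x. f x \<noteq> 0} \<subseteq> S"
    using assms(2) compact_imp_closed[OF assms(3)] by (rule closure_minimal)
  then show ?thesis using assms compact_closure[of "{x. f x \<noteq> 0}"] bounded_subset[OF compact_imp_bounded[OF assms(3)] assms(2)]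
    by (auto simp: test_functions_def)
qed

text \<open>The support of \<open>f\<close> is inside that of \<open>\<phi>\<close>. All test functions built below, such as smoothed moduli
and quotients, are smooth expressions that vanish wherever a given test function does.\<close>

lemma test_functions_dominated:
  assumes "\<phi> \<in> test_functions \<Omega>" "\<And>k. Ck k f" "\<And>x. \<phi> x = 0 \<Longrightarrow> f x = 0"
  shows "f \<in> test_functions \<Omega>"
  by (rule test_functionsI[OF assms(2) _ test_functionsD(5,6)[OF assms(1)]])
    (use assms(3) closure_subset[of "{x. \<phi> x \<noteq> 0}"] in auto)

lemma test_functions_mult:
  assumes "\<phi> \<in> test_functions \<Omega>" "\<And>k. Ck k f"
  shows "(\<lambda>x. f x * \<phi> x) \<in> test_functions \<Omega>"
  by (rule test_functions_dominated[OF assms(1)]) (auto intro!: Ck_mult assms test_functionsD(1)[OF assms(1)])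

lemma test_functions_add:
  assumes "\<phi> \<in> test_functions \<Omega>" "\<psi> \<in> test_functions \<Omega>"
  shows "(\<lambda>x. \<phi> x + \<psi> x) \<in> test_functions \<Omega>"
proof (rule test_functionsI[where S = "closure {x. \<phi> x \<noteq> 0} \<union> closure {x. \<psi> x \<noteq> 0}"])
  show "Ck k (\<lambda>x. \<phi> x + \<psi> x)" for k
    by (intro Ck_add test_functionsD(1)[OF assms(1)] test_functionsD(1)[OF assms(2)])
  have "{x. \<phi> x + \<psi> x \<noteq> 0} \<subseteq> {x. \<phi> x \<noteq> 0} \<union> {x. \<psi> x \<noteq> 0}" by auto
  then show "{x. \<phi> x + \<psi> x \<noteq> 0} \<subseteq> closure {x. \<phi> x \<noteq> 0} \<union> closure {x. \<psi> x \<noteq> 0}"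
    using closure_subset[of "{x. \<phi> x \<noteq> 0}"] closure_subset[of "{x. \<psi> x \<noteq> 0}"] by blast
qed (use test_functionsD(5,6)[OF assms(1)] test_functionsD(5,6)[OF assms(2)] in \<open>auto intro!: compact_Un\<close>)

lemma test_functions_lc:
  assumes "\<phi> \<in> test_functions \<Omega>" "\<psi> \<in> test_functions \<Omega>"
  shows "(\<lambda>x. a * \<phi> x + b * \<psi> x) \<in> test_functions \<Omega>"
  by (intro test_functions_add test_functions_mult assms Ck_const)

lemma test_functions_bounded_linear:
  assumes "\<phi> \<in> test_functions \<Omega>" "bounded_linear L"
  shows "(\<lambda>x. L (\<phi> x)) \<in> test_functions \<Omega>"
proof (rule test_functions_dominated[OF assms(1)])
  show "Ck k (\<lambda>x. L (\<phi> x))" for k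
    by (rule Ck_bounded_linear[OF assms(2) test_functionsD(1)[OF assms(1)]])
qed (simp add: linear_0[OF bounded_linear.linear[OF assms(2)]])

lemma box_bump_test_function:
  assumes "cbox a b \<subseteq> \<Omega>" shows "(\<lambda>x. of_real (box_bump m a b x)) \<in> test_functions \<Omega>"
proof (rule test_functionsI[where S = "cbox a b"])
  show "Ck k (\<lambda>x. complex_of_real (box_bump m a b x))" for k
    by (rule Ck_bounded_linear[OF bounded_linear_of_real Ck_box_bump])
  show "{x. complex_of_real (box_bump m a b x) \<noteq> 0} \<subseteq> cbox a b"
    using box_bump_0[of _ a b m] box_subset_cbox[of a b] by auto
qed (use assms in auto)

lemma pderiv_classical_test_function:
  assumes "\<phi> \<in> test_functions \<Omega>" shows "pderiv_classical i \<phi> \<in> test_functions \<Omega>"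
proof (rule test_functionsI[OF _ _ test_functionsD(5,6)[OF assms]])
  show "Ck k (pderiv_classical i \<phi>)" for k
    using Ck_SucD(2)[OF test_functionsD(1)[OF assms, of "Suc k"]] by (simp add: pderiv_classical_def[abs_def])
  show "{x. pderiv_classical i \<phi> x \<noteq> 0} \<subseteq> closure {x. \<phi> x \<noteq> 0}"
  proof (rule subsetI, rule ccontr)
    fix x assume x: "x \<in> {x. pderiv_classical i \<phi> x \<noteq> 0}" "x \<notin> closure {x. \<phi> x \<noteq> 0}"
    have "((\<lambda>x. 0) has_derivative (\<lambda>h. 0)) (at x)" by simp
    then have "(\<phi> has_derivative (\<lambda>h. 0)) (at x)"
      by (rule has_derivative_transform_within_open[where s = "- closure {x. \<phi> x \<noteq> 0}"])
        (use x closure_subset[of "{x. \<phi> x \<noteq> 0}"] in auto)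
    then have "frechet_derivative \<phi> (at x) = (\<lambda>h. 0)" by (rule frechet_derivative_at[symmetric])
    then show False using x by (simp add: pderiv_classical_def)
  qed
qed

lemma pderiv_classical_eq: "(f has_derivative f') (at x) \<Longrightarrow> pderiv_classical i f x = f' (axis i 1)"
  using frechet_derivative_at unfolding pderiv_classical_def by metis

lemma pderiv_classical_mult:
  assumes "\<phi> \<in> test_functions \<Omega>" "\<psi> \<in> test_functions \<Omega>"
  shows "pderiv_classical i (\<lambda>x. \<phi> x * \<psi> x) x = \<phi> x * pderiv_classical i \<psi> x + pderiv_classical i \<phi> x * \<psi> x"
  using pderiv_classical_eq[OF has_derivative_mult[OF test_functionsD(3)[OF assms(1)] test_functionsD(3)[OF assms(2)]]]
  by (simp add: pderiv_classical_def)

lemma pderiv_classical_lc: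
  assumes "\<phi> \<in> test_functions \<Omega>" "\<psi> \<in> test_functions \<Omega>"
  shows "pderiv_classical i (\<lambda>x. a * \<phi> x + b * \<psi> x) x = a * pderiv_classical i \<phi> x + b * pderiv_classical i \<psi> x"
  using pderiv_classical_eq[OF has_derivative_add[OF has_derivative_mult_right[OF test_functionsD(3)[OF assms(1)], of a]
     has_derivative_mult_right[OF test_functionsD(3)[OF assms(2)], of b]]]
  by (simp add: pderiv_classical_def)

lemma pderiv_classical_bounded_linear:
  assumes "\<phi> \<in> test_functions \<Omega>" "bounded_linear L"
  shows "pderiv_classical i (\<lambda>x. L (\<phi> x)) x = L (pderiv_classical i \<phi> x)"
  using pderiv_classical_eq[OF bounded_linear.has_derivative[OF assms(2) test_functionsD(3)[OF assms(1)]]]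
  by (simp add: pderiv_classical_def)

section \<open>Hermitian forms\<close>

text \<open>Vectors are functions that form a set and not a type, and the weak derivative of a linear
combination is only determined almost everywhere. Linear combinations \<open>a u + b v\<close> therefore enter
as an abstract operation \<open>lc a u b v\<close> on the domain, and linearity is an axiom about the form.\<close>

locale hermitian_form =
  fixes D :: "'v set" and lc :: "complex \<Rightarrow> 'v \<Rightarrow> complex \<Rightarrow> 'v \<Rightarrow> 'v"
    and F :: "'v \<Rightarrow> 'v \<Rightarrow> complex"
  assumes lc_closed: "u \<in> D \<Longrightarrow> v \<in> D \<Longrightarrow> lc a u b v \<in> D"
    and lin: "u \<in> D \<Longrightarrow> v \<in> D \<Longrightarrow> w \<in> D \<Longrightarrow> F (lc a u b v) w = a * F u w + b * F v w"
    and herm: "u \<in> D \<Longrightarrow> v \<in> D \<Longrightarrow> F v u = cnj (F u v)"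
begin

lemma lin_right:
  assumes "u \<in> D" "v \<in> D" "w \<in> D"
  shows "F w (lc a u b v) = cnj a * F w u + cnj b * F w v"
  using assms by (simp add: herm[of _ w] lin lc_closed)

lemma diag_real: "u \<in> D \<Longrightarrow> Im (F u u) = 0"
  using herm[of u u] by (metis cnj.simps(2) neg_equal_zero)

lemma diag_of_real: "u \<in> D \<Longrightarrow> F u u = of_real (Re (F u u))"
  using diag_real[of u] by (simp add: complex_eq_iff)

lemma diag_lc:
  assumes "u \<in> D" "v \<in> D"
  shows "Re (F (lc a u b v) (lc a u b v)) =
    (cmod a)\<^sup>2 * Re (F u u) + (cmod b)\<^sup>2 * Re (F v v) + 2 * Re (a * cnj b * F u v)"
proof -
  have 1: "F (lc a u b v) (lc a u b v)
      = a * cnj a * F u u + b * cnj b * F v v + (a * cnj b * F u v + cnj (a * cnj b * F u v))"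
    using assms by (simp add: lin lin_right lc_closed herm[of u v] algebra_simps)
  have 2: "a * cnj a * F u u = of_real ((cmod a)\<^sup>2 * Re (F u u))"
          "b * cnj b * F v v = of_real ((cmod b)\<^sup>2 * Re (F v v))"
    using diag_of_real assms by (metis complex_norm_square of_real_mult)+
  have 3: "Re (z + cnj z) = 2 * Re z" for z by simp
  show ?thesis unfolding 1 plus_complex.simps(1)[of "_ + _"] 3 unfolding 2 by simp
qed

lemma Cauchy_Schwarz:
  assumes pos: "\<And>u. u \<in> D \<Longrightarrow> 0 \<le> Re (F u u)" and uv: "u \<in> D" "v \<in> D"
  shows "(cmod (F u v))\<^sup>2 \<le> Re (F u u) * Re (F v v)"
proof -
  \<comment> \<open>the quadratic polynomial in \<open>t\<close> obtained from the vector \<open>u - t f v\<close> is nonnegative\<close>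
  define f where "f = F u v"
  have *: "0 \<le> Re (F u u) - 2 * t * (cmod f)\<^sup>2 + t\<^sup>2 * (cmod f)\<^sup>2 * Re (F v v)" for t
  proof -
    have "0 \<le> Re (F (lc 1 u (- of_real t * f) v) (lc 1 u (- of_real t * f) v))"
      using uv by (intro pos lc_closed)
    also have "\<dots> = Re (F u u) + t\<^sup>2 * (cmod f)\<^sup>2 * Re (F v v)
        + 2 * Re (cnj (- of_real t * f) * f)"
      using uv by (simp add: diag_lc norm_mult power_mult_distrib f_def)
    also have "cnj (- of_real t * f) * f = - of_real (t * (cmod f)\<^sup>2)"
      using complex_norm_square[of f] by (simp add: mult_ac)
    finally show ?thesis by simp
  qed
  have pv: "0 \<le> Re (F v v)" using pos uv by simp
  show ?thesis
  proof (cases "Re (F v v) = 0")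
    case True
    \<comment> \<open>a degenerate direction: the polynomial is affine, and a large \<open>t\<close> makes it negative unless \<open>f = 0\<close>\<close>
    have "f = 0"
    proof (rule ccontr)
      assume "f \<noteq> 0"
      then have c: "(cmod f)\<^sup>2 > 0" by simp
      have "0 \<le> Re (F u u) - 2 * ((Re (F u u) + 1) / (2 * (cmod f)\<^sup>2)) * (cmod f)\<^sup>2"
        using *[of "(Re (F u u) + 1) / (2 * (cmod f)\<^sup>2)"] True by simp
      then show False using c by (simp add: field_simps)
    qed
    then show ?thesis using True by (simp add: f_def)
  next
    case False
    then have c: "Re (F v v) > 0" using pv by simp
    have "0 \<le> Re (F u u) - (cmod f)\<^sup>2 / Re (F v v)"
      using *[of "1 / Re (F v v)"] c by (simp add: power2_eq_square field_simps)
    then show ?thesis using c by (simp add: field_simps f_def)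
  qed
qed

text \<open>The source of the eigenvalue equation. A minimiser \<open>u\<close> of the Rayleigh quotient of \<open>Q\<close>, with
minimum \<open>l\<close>, is a null vector of the nonnegative form \<open>Q - l N\<close>; by Cauchy-Schwarz it then
annihilates every vector, with no need to differentiate the quotient.\<close>

lemma null_right:
  assumes "\<And>u. u \<in> D \<Longrightarrow> 0 \<le> Re (F u u)" "u \<in> D" "v \<in> D" "Re (F u u) = 0"
  shows "F u v = 0"
  using Cauchy_Schwarz[OF assms(1-3)] assms(4) by simp

end

lemma hermitian_form_subset:
  assumes "hermitian_form D lc F" "K \<subseteq> D" "\<And>u v a b. u \<in> K \<Longrightarrow> v \<in> K \<Longrightarrow> lc a u b v \<in> K"
  shows "hermitian_form K lc F"
  using assms unfolding hermitian_form_def by (meson subsetD)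

lemma hermitian_form_add_scaled:
  assumes "hermitian_form D lc F" "hermitian_form D lc G"
  shows "hermitian_form D lc (\<lambda>u v. F u v + of_real t * G u v)"
proof -
  interpret F: hermitian_form D lc F by fact
  interpret G: hermitian_form D lc G by fact
  show ?thesis
  proof
    fix u v assume uv: "u \<in> D" "v \<in> D"
    show "F v u + of_real t * G v u = cnj (F u v + of_real t * G u v)"
      using F.herm[OF uv] G.herm[OF uv] by simp
  qed (simp_all add: F.lc_closed F.lin G.lin algebra_simps)
qed

section \<open>Quadratic pencils of forms\<close>

text \<open>The setting for \<open>A + p B + p\<^sup>2 N\<close>. The squared form norm is \<open>A + N\<close>: the domain is complete in it, and
its bounded sets are precompact in the weaker norm given by \<open>N\<close>. The bound on \<open>B\<close> is of mixed type,
so that \<open>B\<close> is dominated by \<open>A\<close> with an arbitrarily small constant.\<close>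

locale form_pencil =
  A: hermitian_form D lc A + B: hermitian_form D lc B + N: hermitian_form D lc N
  for D :: "'v set" and lc A B N +
  assumes A_nonneg: "u \<in> D \<Longrightarrow> 0 \<le> Re (A u u)"
    and N_nonneg: "u \<in> D \<Longrightarrow> 0 \<le> Re (N u u)"
    and B_bound: "u \<in> D \<Longrightarrow> v \<in> D \<Longrightarrow>
      cmod (B u v) \<le> sqrt (Re (A u u)) * sqrt (Re (N v v)) + sqrt (Re (N u u)) * sqrt (Re (A v v))"
    and complete: "\<And>s. (\<And>n::nat. s n \<in> D) \<Longrightarrow>
      (\<And>e. e > 0 \<Longrightarrow> \<exists>M. \<forall>m\<ge>M. \<forall>n\<ge>M. Re (A (lc 1 (s m) (-1) (s n)) (lc 1 (s m) (-1) (s n)))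
            + Re (N (lc 1 (s m) (-1) (s n)) (lc 1 (s m) (-1) (s n))) < e) \<Longrightarrow>
      \<exists>u\<in>D. (\<lambda>n. Re (A (lc 1 (s n) (-1) u) (lc 1 (s n) (-1) u))
            + Re (N (lc 1 (s n) (-1) u) (lc 1 (s n) (-1) u))) \<longlonglongrightarrow> 0"
    and compact: "\<And>s C. (\<And>n::nat. s n \<in> D) \<Longrightarrow> (\<And>n. Re (A (s n) (s n)) + Re (N (s n) (s n)) \<le> C) \<Longrightarrow>
      \<exists>r::nat \<Rightarrow> nat. strict_mono r \<and> (\<forall>e>0. \<exists>M. \<forall>m\<ge>M. \<forall>n\<ge>M.
          Re (N (lc 1 (s (r m)) (-1) (s (r n))) (lc 1 (s (r m)) (-1) (s (r n)))) < e)"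
begin

definition W :: "'v \<Rightarrow> real" where "W u = Re (A u u) + Re (N u u)"
definition nrm :: "'v \<Rightarrow> real" where "nrm u = sqrt (W u)"
definition Q :: "real \<Rightarrow> 'v \<Rightarrow> 'v \<Rightarrow> complex" where
  "Q p u v = A u v + of_real p * B u v + of_real (p\<^sup>2) * N u v"
definition dif :: "'v \<Rightarrow> 'v \<Rightarrow> 'v" where "dif u v = lc 1 u (-1) v"

definition V_converges :: "(nat \<Rightarrow> 'v) \<Rightarrow> 'v \<Rightarrow> bool" where
  "V_converges s u \<longleftrightarrow> (\<lambda>n. W (dif (s n) u)) \<longlonglongrightarrow> 0"

definition closed_subspace :: "'v set \<Rightarrow> bool" where
  "closed_subspace K \<longleftrightarrow> K \<subseteq> D \<and> (\<forall>u\<in>K. \<forall>v\<in>K. \<forall>a b. lc a u b v \<in> K) \<and>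
    (\<forall>s. \<forall>u\<in>D. (\<forall>n. s n \<in> K) \<longrightarrow> V_converges s u \<longrightarrow> u \<in> K)"

lemma dif_in: "u \<in> D \<Longrightarrow> v \<in> D \<Longrightarrow> dif u v \<in> D"
  unfolding dif_def by (rule A.lc_closed)

lemma W_nonneg: "u \<in> D \<Longrightarrow> 0 \<le> W u"
  using A_nonneg N_nonneg by (simp add: W_def)

lemma nrm_nonneg: "u \<in> D \<Longrightarrow> 0 \<le> nrm u"
  using W_nonneg by (simp add: nrm_def)

lemma nrm_sq: "u \<in> D \<Longrightarrow> (nrm u)\<^sup>2 = W u"
  using W_nonneg by (simp add: nrm_def)

lemma W_form: "hermitian_form D lc (\<lambda>u v. A u v + of_real 1 * N u v)"
  by (rule hermitian_form_add_scaled) unfold_locales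

lemma Q_form: "hermitian_form D lc (Q p)"
proof -
  have "hermitian_form D lc (\<lambda>u v. (A u v + of_real p * B u v) + of_real (p\<^sup>2) * N u v)"
    by (intro hermitian_form_add_scaled) unfold_locales
  then show ?thesis unfolding Q_def .
qed

lemma A_le: "u \<in> D \<Longrightarrow> v \<in> D \<Longrightarrow> cmod (A u v) \<le> nrm u * nrm v"
  and N_le: "u \<in> D \<Longrightarrow> v \<in> D \<Longrightarrow> cmod (N u v) \<le> nrm u * nrm v"
  and B_le: "u \<in> D \<Longrightarrow> v \<in> D \<Longrightarrow> cmod (B u v) \<le> 2 * nrm u * nrm v"
proof -
  assume uv: "u \<in> D" "v \<in> D"
  have a: "sqrt (Re (A u u)) \<le> nrm u" "sqrt (Re (A v v)) \<le> nrm v"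
       "sqrt (Re (N u u)) \<le> nrm u" "sqrt (Re (N v v)) \<le> nrm v"
    using A_nonneg N_nonneg uv by (auto simp: nrm_def W_def)
  have nn: "0 \<le> nrm u" "0 \<le> nrm v" using nrm_nonneg uv by auto
  have "cmod (A u v) \<le> sqrt (Re (A u u)) * sqrt (Re (A v v))"
    using A.Cauchy_Schwarz[OF A_nonneg uv] by (metis real_le_rsqrt real_sqrt_mult)
  also have "\<dots> \<le> nrm u * nrm v" using a nn A_nonneg uv by (intro mult_mono) auto
  finally show "cmod (A u v) \<le> nrm u * nrm v" .
  have "cmod (N u v) \<le> sqrt (Re (N u u)) * sqrt (Re (N v v))"
    using N.Cauchy_Schwarz[OF N_nonneg uv] by (metis real_le_rsqrt real_sqrt_mult)
  also have "\<dots> \<le> nrm u * nrm v" using a nn N_nonneg uv by (intro mult_mono) auto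
  finally show "cmod (N u v) \<le> nrm u * nrm v" .
  have "cmod (B u v) \<le> sqrt (Re (A u u)) * sqrt (Re (N v v)) + sqrt (Re (N u u)) * sqrt (Re (A v v))"
    by (rule B_bound[OF uv])
  also have "\<dots> \<le> nrm u * nrm v + nrm u * nrm v"
    using a nn A_nonneg N_nonneg uv by (intro add_mono mult_mono) auto
  finally show "cmod (B u v) \<le> 2 * nrm u * nrm v" by simp
qed

text \<open>Garding's inequality. The mixed bound on \<open>B\<close> gives
\<open>|p B(u,u)| \<le> 2|p| sqrt A sqrt N \<le> A/2 + 2 p\<^sup>2 N\<close>, so half of \<open>A\<close> survives in \<open>Q p\<close>.\<close>

lemma A_le_Q:
  assumes "u \<in> D" shows "Re (A u u) \<le> 2 * Re (Q p u u) + 2 * p\<^sup>2 * Re (N u u)"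
proof -
  define a n where "a = sqrt (Re (A u u))" and "n = sqrt (Re (N u u))"
  have an: "Re (A u u) = a\<^sup>2" "Re (N u u) = n\<^sup>2" "0 \<le> a" "0 \<le> n"
    using A_nonneg N_nonneg assms by (auto simp: a_def n_def)
  have "\<bar>Re (B u u)\<bar> \<le> 2 * a * n"
    using B_bound[OF assms assms] abs_Re_le_cmod[of "B u u"] by (simp add: a_def n_def mult_ac)
  then have "\<bar>p * Re (B u u)\<bar> \<le> \<bar>p\<bar> * (2 * a * n)"
    unfolding abs_mult by (rule mult_left_mono) simp
  moreover have "0 \<le> (a - 2 * \<bar>p\<bar> * n)\<^sup>2" by simp
  then have "4 * (\<bar>p\<bar> * a * n) \<le> a\<^sup>2 + 4 * (p\<^sup>2 * n\<^sup>2)"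
    by (simp add: power2_diff power_mult_distrib algebra_simps)
  ultimately have "- (2 * p * Re (B u u)) \<le> a\<^sup>2 + 4 * (p\<^sup>2 * n\<^sup>2)" by (simp add: algebra_simps)
  then show ?thesis
    unfolding Q_def using an by (simp add: algebra_simps)
qed

text \<open>All the forms are bounded by the form norm and hence continuous in it.\<close>

lemma N_dif_tendsto:
  assumes "\<And>n. s n \<in> D" "u \<in> D" "V_converges s u" "v \<in> D"
  shows "(\<lambda>n. N (s n) v) \<longlonglongrightarrow> N u v" "(\<lambda>n. Q p (s n) (s n)) \<longlonglongrightarrow> Q p u u"
    "(\<lambda>n. N (s n) (s n)) \<longlonglongrightarrow> N u u"
proof -
  have lim: "(\<lambda>n. nrm (dif (s n) u)) \<longlonglongrightarrow> 0"
    using assms(3) unfolding V_converges_def nrm_def using tendsto_real_sqrt by force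
  have key: "(\<lambda>n. F (dif (s n) u) v) \<longlonglongrightarrow> 0 \<and> (\<lambda>n. F (s n) v) \<longlonglongrightarrow> F u v
      \<and> (\<lambda>n. F (s n) (s n)) \<longlonglongrightarrow> F u u"
    if F: "hermitian_form D lc F" and c: "\<And>u v. u \<in> D \<Longrightarrow> v \<in> D \<Longrightarrow> cmod (F u v) \<le> c * nrm u * nrm v"
      and v: "v \<in> D" for F c v
  proof -
    interpret F: hermitian_form D lc F by fact
    have d: "F (dif (s n) u) w = F (s n) w - F u w" if "w \<in> D" for n w
      using assms that by (simp add: dif_def F.lin)
    have z: "(\<lambda>n. F (dif (s n) u) v) \<longlonglongrightarrow> 0" if v: "v \<in> D" for v
    proof (rule Lim_null_comparison)
      show "\<forall>\<^sub>F n in sequentially. norm (F (dif (s n) u) v) \<le> c * nrm (dif (s n) u) * nrm v"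
        using c assms dif_in v by auto
      show "(\<lambda>n. c * nrm (dif (s n) u) * nrm v) \<longlonglongrightarrow> 0"
        using tendsto_mult[OF tendsto_mult[OF tendsto_const lim] tendsto_const] by fastforce
    qed
    have l: "(\<lambda>n. F (s n) v) \<longlonglongrightarrow> F u v" if "v \<in> D" for v
      using z[OF that] unfolding d[OF that] by (simp add: LIM_zero_iff)
    have zz: "(\<lambda>n. F (dif (s n) u) (dif (s n) u)) \<longlonglongrightarrow> 0"
    proof (rule Lim_null_comparison)
      show "\<forall>\<^sub>F n in sequentially. norm (F (dif (s n) u) (dif (s n) u)) \<le> c * nrm (dif (s n) u) * nrm (dif (s n) u)"
        using c assms dif_in by auto
      show "(\<lambda>n. c * nrm (dif (s n) u) * nrm (dif (s n) u)) \<longlonglongrightarrow> 0"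
        using tendsto_mult[OF tendsto_mult[OF tendsto_const lim] lim] by fastforce
    qed
    have e: "F (s n) (s n) = F (dif (s n) u) (dif (s n) u) + F (s n) u + cnj (F (s n) u) - F u u" for n
      using assms by (simp add: dif_def F.lin F.lin_right F.lc_closed F.herm[of "s n" u])
    have "(\<lambda>n. F (s n) (s n)) \<longlonglongrightarrow> 0 + F u u + cnj (F u u) - F u u"
      unfolding e by (intro tendsto_intros zz l tendsto_cnj assms)
    then show ?thesis using z l v F.herm[OF assms(2) assms(2)] by simp
  qed
  have N: "hermitian_form D lc N" by unfold_locales
  show "(\<lambda>n. N (s n) v) \<longlonglongrightarrow> N u v" "(\<lambda>n. N (s n) (s n)) \<longlonglongrightarrow> N u u"
    using key[OF N, of 1 v] N_le assms by auto
  have qb: "cmod (Q p u v) \<le> (1 + 2 * \<bar>p\<bar> + p\<^sup>2) * nrm u * nrm v" if "u \<in> D" "v \<in> D" for u v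
  proof -
    have "cmod (Q p u v) \<le> cmod (A u v) + cmod (of_real p * B u v) + cmod (of_real (p\<^sup>2) * N u v)"
      unfolding Q_def by (meson norm_triangle_mono norm_triangle_ineq order_refl order_trans)
    also have "\<dots> \<le> nrm u * nrm v + \<bar>p\<bar> * (2 * nrm u * nrm v) + p\<^sup>2 * (nrm u * nrm v)"
      unfolding norm_mult norm_of_real abs_power2
      by (intro add_mono mult_left_mono A_le B_le N_le that) auto
    finally show ?thesis by (simp add: algebra_simps)
  qed
  show "(\<lambda>n. Q p (s n) (s n)) \<longlonglongrightarrow> Q p u u"
    using key[OF Q_form qb, of v] assms by auto
qed

text \<open>The compactness argument of the direct method, without weak topologies. By Garding's inequality
the sequence is bounded in the form norm, so a subsequence is Cauchy for \<open>N\<close>. The parallelogram law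
for \<open>Q p\<close> together with the lower bound at the midpoints bounds \<open>Q p\<close> of the differences by a
quantity that tends to \<open>0\<close> plus a multiple of \<open>N\<close> of the differences. By Garding again the
subsequence is Cauchy in the form norm, and completeness provides the limit.\<close>

lemma minimizing_sequence_converges:
  assumes K: "closed_subspace K" and s: "\<And>n. s n \<in> K"
    and low: "\<And>v. v \<in> K \<Longrightarrow> l * Re (N v v) \<le> Re (Q p v v)"
    and sN: "(\<lambda>n. Re (N (s n) (s n))) \<longlonglongrightarrow> 1" and sQ: "(\<lambda>n. Re (Q p (s n) (s n))) \<longlonglongrightarrow> l"
  shows "\<exists>u\<in>K. \<exists>r::nat \<Rightarrow> nat. strict_mono r \<and> V_converges (s \<circ> r) u \<and> Re (N u u) = 1 \<and> Re (Q p u u) = l"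
proof -
  interpret Q: hermitian_form D lc "Q p" by (rule Q_form)
  have KD: "K \<subseteq> D" and Kl: "\<And>u v a b. u \<in> K \<Longrightarrow> v \<in> K \<Longrightarrow> lc a u b v \<in> K"
    using K by (auto simp: closed_subspace_def)
  have sD: "s n \<in> D" for n using s KD by blast
  have "Bseq (\<lambda>n. Re (N (s n) (s n)))" "Bseq (\<lambda>n. Re (Q p (s n) (s n)))"
    using sN sQ convergent_imp_Bseq convergent_def by blast+
  then obtain c1 c2 where c: "\<And>n. \<bar>Re (N (s n) (s n))\<bar> \<le> c1" "\<And>n. \<bar>Re (Q p (s n) (s n))\<bar> \<le> c2"
    by (auto simp: Bseq_def)
  have bd: "Re (A (s n) (s n)) + Re (N (s n) (s n)) \<le> 2 * c2 + 2 * p\<^sup>2 * c1 + c1" for n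
  proof -
    have "2 * p\<^sup>2 * Re (N (s n) (s n)) \<le> 2 * p\<^sup>2 * c1"
      using c(1)[of n] by (intro mult_left_mono) auto
    then show ?thesis using A_le_Q[OF sD[of n], of p] c(1)[of n] c(2)[of n] by linarith
  qed
  obtain r :: "nat \<Rightarrow> nat" where rr: "strict_mono r \<and> (\<forall>e>0. \<exists>M. \<forall>m\<ge>M. \<forall>n\<ge>M.
      Re (N (lc 1 (s (r m)) (-1) (s (r n))) (lc 1 (s (r m)) (-1) (s (r n)))) < e)"
    using compact[OF sD bd] ..
  note r = conjunct1[OF rr] and rc = conjunct2[OF rr, rule_format]
  define t where "t = s \<circ> r"
  have tK: "t n \<in> K" and tD: "t n \<in> D" for n using s sD by (auto simp: t_def)
  have tN: "(\<lambda>n. Re (N (t n) (t n))) \<longlonglongrightarrow> 1" and tQ: "(\<lambda>n. Re (Q p (t n) (t n))) \<longlonglongrightarrow> l"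
    using LIMSEQ_subseq_LIMSEQ[OF sN r] LIMSEQ_subseq_LIMSEQ[OF sQ r] by (simp_all add: t_def o_def)
  have "\<exists>M. \<forall>m\<ge>M. \<forall>n\<ge>M. W (dif (t m) (t n)) < e" if e: "e > 0" for e
  proof -
    \<comment> \<open>a positive bound for the coefficient \<open>2 l + 2 p\<^sup>2 + 1\<close> that \<open>N\<close> of a difference acquires below\<close>
    define k where "k = 2 * \<bar>l\<bar> + 2 * p\<^sup>2 + 1"
    have kp: "k > 0" by (simp add: k_def add_nonneg_pos)
    obtain M1 where M1: "\<And>m n. m \<ge> M1 \<Longrightarrow> n \<ge> M1 \<Longrightarrow> Re (N (dif (t m) (t n)) (dif (t m) (t n))) < e / (2 * k)"
      using rc[of "e / (2 * k)"] e kp by (auto simp: dif_def t_def)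
    define g where "g n = 2 * (2 * Re (Q p (t n) (t n))  - 2 * l * Re (N (t n) (t n)))" for n
    have "g \<longlonglongrightarrow> 2 * (2 * l - 2 * l * 1)"
      unfolding g_def by (intro tendsto_intros tN tQ)
    then have "\<exists>M. \<forall>n\<ge>M. norm (g n - 0) < e / 4" using e LIMSEQ_D[of g 0 "e/4"] by simp
    then obtain M2 where M2: "\<And>n. n \<ge> M2 \<Longrightarrow> \<bar>g n\<bar> < e / 4" by auto
    have "W (dif (t m) (t n)) < e" if "m \<ge> max M1 M2" "n \<ge> max M1 M2" for m n
    proof -
      let ?d = "dif (t m) (t n)" and ?s = "lc 1 (t m) 1 (t n)"
      have par: "Re (F ?d ?d) = 2 * Re (F (t m) (t m)) + 2 * Re (F (t n) (t n)) - Re (F ?s ?s)"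
        if "hermitian_form D lc F" for F
        unfolding dif_def using hermitian_form.diag_lc[OF that tD tD] by simp
      have N: "hermitian_form D lc N" by unfold_locales
      have "l * Re (N ?s ?s) \<le> Re (Q p ?s ?s)" using low Kl tK by blast
      then have "Re (Q p ?d ?d) \<le> 2 * Re (Q p (t m) (t m)) + 2 * Re (Q p (t n) (t n))
          - l * (2 * Re (N (t m) (t m)) + 2 * Re (N (t n) (t n)) - Re (N ?d ?d))"
        using par[OF Q_form] par[OF N] by simp
      also have "\<dots> = (g m + g n) / 2 + l * Re (N ?d ?d)" by (simp add: g_def field_simps)
      finally have 1: "Re (Q p ?d ?d) \<le> (g m + g n) / 2 + l * Re (N ?d ?d)" .
      have nd: "0 \<le> Re (N ?d ?d)" using N_nonneg dif_in tD by blast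
      have "W ?d \<le> (g m + g n) + (2 * l + 2 * p\<^sup>2 + 1) * Re (N ?d ?d)"
        using 1 A_le_Q[OF dif_in[OF tD tD], of m n p] by (simp add: W_def field_simps)
      also have "\<dots> \<le> (g m + g n) + k * Re (N ?d ?d)"
        unfolding k_def by (intro add_left_mono mult_right_mono nd) auto
      also have "\<dots> < e"
      proof -
        have "k * Re (N ?d ?d) < k * (e / (2 * k))" using M1 that kp by (intro mult_strict_left_mono) auto
        also have "\<dots> = e / 2" using kp by simp
        finally show ?thesis using M2[of m] M2[of n] that by auto
      qed
      finally show ?thesis .
    qed
    then show ?thesis by blast
  qed
  then obtain u where u: "u \<in> D" "V_converges t u"
    using complete[of t] tD unfolding V_converges_def W_def dif_def by blast
  have uK: "u \<in> K" using K u tK unfolding closed_subspace_def by blast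
  have "Re (N u u) = 1"
    using LIMSEQ_unique[OF tendsto_Re[OF N_dif_tendsto(3)[OF tD u u(1)]] tN] .
  moreover have "Re (Q p u u) = l"
    using LIMSEQ_unique[OF tendsto_Re[OF N_dif_tendsto(2)[OF tD u u(1)]] tQ] .
  ultimately show ?thesis using uK r u unfolding t_def by blast
qed

lemma lc_zero_diag:
  assumes "hermitian_form D lc F" "v \<in> D"
  shows "Re (F (lc a v 0 v) (lc a v 0 v)) = (cmod a)\<^sup>2 * Re (F v v)"
  using hermitian_form.diag_lc[OF assms(1) assms(2) assms(2), of a 0] by simp

text \<open>By Garding's inequality the Rayleigh quotient is bounded below by \<open>-p\<^sup>2\<close>, so it has an infimum, and
a normalised minimising sequence converges to a minimiser. The subspace is arbitrary because the
spectral gap comes from minimising over the orthogonal complement of the ground state.\<close>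

lemma minimizer_exists:
  assumes K: "closed_subspace K" and v0: "v0 \<in> K" "Re (N v0 v0) > 0"
  shows "\<exists>u\<in>K. Re (N u u) = 1 \<and> (\<forall>v\<in>K. Re (Q p u u) * Re (N v v) \<le> Re (Q p v v))"
proof -
  interpret Q: hermitian_form D lc "Q p" by (rule Q_form)
  have N: "hermitian_form D lc N" by unfold_locales
  have KD: "K \<subseteq> D" and Kl: "\<And>u v a b. u \<in> K \<Longrightarrow> v \<in> K \<Longrightarrow> lc a u b v \<in> K"
    using K by (auto simp: closed_subspace_def)
  define S where "S = {Re (Q p v v) | v. v \<in> K \<and> Re (N v v) = 1}"
  have norma: "lc (of_real (1 / sqrt (Re (N v v)))) v 0 v \<in> K \<and>
     Re (F (lc (of_real (1 / sqrt (Re (N v v)))) v 0 v) (lc (of_real (1 / sqrt (Re (N v v)))) v 0 v))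
       = Re (F v v) / Re (N v v)"
    if "v \<in> K" "Re (N v v) > 0" "hermitian_form D lc F" for v F
    using that KD Kl lc_zero_diag[OF that(3), of v] by (auto simp: norm_divide power_divide)
  have Sne: "S \<noteq> {}"
  proof -
    let ?v = "lc (of_real (1 / sqrt (Re (N v0 v0)))) v0 0 v0"
    have "?v \<in> K" "Re (N ?v ?v) = 1" using norma[OF v0 N] v0(2) by auto
    then show ?thesis unfolding S_def by blast
  qed
  have Slow: "bdd_below S"
  proof (rule bdd_belowI)
    fix x assume "x \<in> S"
    then obtain v where v: "v \<in> K" "Re (N v v) = 1" "x = Re (Q p v v)" by (auto simp: S_def)
    then show "- p\<^sup>2 \<le> x" using A_le_Q[of v p] A_nonneg[of v] KD by auto
  qed
  define l where "l = Inf S"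
  have low: "l * Re (N v v) \<le> Re (Q p v v)" if v: "v \<in> K" for v
  proof (cases "Re (N v v) = 0")
    case True
    then show ?thesis using A_le_Q[of v p] A_nonneg[of v] KD v by auto
  next
    case False
    then have pos: "Re (N v v) > 0" using N_nonneg[of v] KD v by auto
    let ?v = "lc (of_real (1 / sqrt (Re (N v v)))) v 0 v"
    have "?v \<in> K" "Re (N ?v ?v) = 1" "Re (Q p ?v ?v) = Re (Q p v v) / Re (N v v)"
      using norma[OF v pos N] norma[OF v pos Q_form] pos by auto
    then have "Re (Q p v v) / Re (N v v) \<in> S" unfolding S_def by (smt (verit) mem_Collect_eq)
    then have "l \<le> Re (Q p v v) / Re (N v v)" unfolding l_def using Slow by (rule cInf_lower)
    then show ?thesis using pos by (simp add: field_simps)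
  qed
  have "\<exists>v. v \<in> K \<and> Re (N v v) = 1 \<and> Re (Q p v v) < l + 1 / real (n + 1)" for n
  proof -
    have "Inf S < l + 1 / real (n + 1)" by (simp add: l_def)
    then obtain x where "x \<in> S" "x < l + 1 / real (n + 1)" using Sne Slow by (meson cInf_less_iff)
    then show ?thesis by (auto simp: S_def)
  qed
  then obtain s where s: "\<And>n::nat. s n \<in> K" "\<And>n. Re (N (s n) (s n)) = 1"
      "\<And>n. Re (Q p (s n) (s n)) < l + 1 / real (n + 1)" by metis
  have "(\<lambda>n. Re (Q p (s n) (s n))) \<longlonglongrightarrow> l"
  proof (rule real_tendsto_sandwich)
    show "\<forall>\<^sub>F n in sequentially. l \<le> Re (Q p (s n) (s n))" using low[OF s(1)] s(2) by simp
    show "\<forall>\<^sub>F n in sequentially. Re (Q p (s n) (s n)) \<le> l + 1 / real (n + 1)"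
      using s(3) less_imp_le by (intro always_eventually) blast
    have "(\<lambda>n. 1 / real (n + 1)) \<longlonglongrightarrow> 0" using LIMSEQ_ignore_initial_segment[OF lim_1_over_n, of 1] by simp
    then show "(\<lambda>n. l + 1 / real (n + 1)) \<longlonglongrightarrow> l" using tendsto_add[OF tendsto_const] by fastforce
  qed simp
  moreover have "(\<lambda>n. Re (N (s n) (s n))) \<longlonglongrightarrow> 1" using s(2) by simp
  ultimately obtain u where "u \<in> K" "Re (N u u) = 1" "Re (Q p u u) = l"
    using minimizing_sequence_converges[of K s l p, OF K s(1) low] by blast
  then show ?thesis using low by auto
qed

text \<open>The Euler-Lagrange equation, obtained from the null vector principle for \<open>Q p - l N\<close>.\<close>

lemma minimizer_equation:
  assumes K: "K \<subseteq> D" "\<And>u v a b. u \<in> K \<Longrightarrow> v \<in> K \<Longrightarrow> lc a u b v \<in> K"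
    and low: "\<And>v. v \<in> K \<Longrightarrow> l * Re (N v v) \<le> Re (Q p v v)"
    and u: "u \<in> K" "Re (Q p u u) = l * Re (N u u)" and v: "v \<in> K"
  shows "Q p u v = of_real l * N u v"
proof -
  have N: "hermitian_form D lc N" by unfold_locales
  have "hermitian_form K lc (\<lambda>u v. Q p u v + of_real (- l) * N u v)"
    by (rule hermitian_form_subset[OF hermitian_form_add_scaled[OF Q_form N] K])
  from hermitian_form.null_right[OF this _ u(1) v] have "Q p u v + of_real (- l) * N u v = 0"
    using low u by simp
  then show ?thesis by simp
qed

end

section \<open>Perturbation of a simple lowest eigenvalue\<close>

text \<open>Cauchy's criterion at \<open>0\<close>, keeping the rate: the hypothesis passes to the limit \<open>s \<rightarrow> 0\<close>.\<close>

lemma limit_of_linear_oscillation: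
  fixes f :: "real \<Rightarrow> real"
  assumes d: "d > 0" and C: "0 \<le> C"
    and f: "\<And>p s. 0 < \<bar>p\<bar> \<Longrightarrow> \<bar>p\<bar> < d \<Longrightarrow> 0 < \<bar>s\<bar> \<Longrightarrow> \<bar>s\<bar> < d \<Longrightarrow> \<bar>f p - f s\<bar> \<le> C * (\<bar>p\<bar> + \<bar>s\<bar>)"
  shows "\<exists>k. \<forall>p. 0 < \<bar>p\<bar> \<longrightarrow> \<bar>p\<bar> < d \<longrightarrow> \<bar>f p - k\<bar> \<le> C * \<bar>p\<bar>"
proof -
  define s where "s n = d / real (n + 2)" for n :: nat
  have s: "0 < s n" "s n < d" for n
    using d by (auto simp: s_def field_simps add_pos_nonneg)
  have s0: "s \<longlonglongrightarrow> 0"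
    unfolding s_def using LIMSEQ_ignore_initial_segment[OF lim_const_over_n[of d], of 2] by simp
  have "Cauchy (\<lambda>n. f (s n))"
  proof (rule CauchyI)
    fix e :: real assume e: "e > 0"
    have "\<exists>M. \<forall>n\<ge>M. norm (s n - 0) < e / (2 * (C + 1))" using LIMSEQ_D[OF s0, of "e / (2 * (C + 1))"] e C by simp
    then obtain M where M: "\<And>n. n \<ge> M \<Longrightarrow> s n < e / (2 * (C + 1))" by fastforce
    have "norm (f (s m) - f (s n)) < e" if "m \<ge> M" "n \<ge> M" for m n
    proof -
      have "\<bar>f (s m) - f (s n)\<bar> \<le> C * (s m + s n)" using f[of "s m" "s n"] s[of m] s[of n] by simp
      also have "\<dots> \<le> (C + 1) * (s m + s n)" using s[of m] s[of n] by (intro mult_right_mono) auto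
      also have "\<dots> < (C + 1) * (e / (2 * (C + 1)) + e / (2 * (C + 1)))"
        using M that C by (intro mult_strict_left_mono add_strict_mono) auto
      also have "(C + 1) * (e / (2 * (C + 1)) + e / (2 * (C + 1))) = 2 * (C + 1) * (e / (2 * (C + 1)))"
        by (simp only: mult_2 distrib_left distrib_right)
      also have "\<dots> = e" using C by simp
      finally show ?thesis unfolding real_norm_def .
    qed
    then show "\<exists>M. \<forall>m\<ge>M. \<forall>n\<ge>M. norm (f (s m) - f (s n)) < e" by blast
  qed
  then obtain k where k: "(\<lambda>n. f (s n)) \<longlonglongrightarrow> k" using Cauchy_convergent convergent_def by blast
  have "\<bar>f p - k\<bar> \<le> C * \<bar>p\<bar>" if p: "0 < \<bar>p\<bar>" "\<bar>p\<bar> < d" for p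
  proof (rule LIMSEQ_le)
    show "(\<lambda>n. \<bar>f p - f (s n)\<bar>) \<longlonglongrightarrow> \<bar>f p - k\<bar>" by (intro tendsto_intros k)
    have "(\<lambda>n. C * (\<bar>p\<bar> + s n)) \<longlonglongrightarrow> C * (\<bar>p\<bar> + 0)" by (intro tendsto_intros s0)
    then show "(\<lambda>n. C * (\<bar>p\<bar> + s n)) \<longlonglongrightarrow> C * \<bar>p\<bar>" by simp
    show "\<exists>N. \<forall>n\<ge>N. \<bar>f p - f (s n)\<bar> \<le> C * (\<bar>p\<bar> + s n)"
    proof (intro exI[of _ 0] allI impI)
      show "\<bar>f p - f (s n)\<bar> \<le> C * (\<bar>p\<bar> + s n)" for n
        using f[OF p, of "s n"] s[of n] by simp
    qed
  qed
  then show ?thesis by blast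
qed

text \<open>\<open>E p\<close> is the lowest eigenvalue of \<open>Q p\<close> and \<open>u0\<close> a normalised eigenvector at \<open>p = 0\<close>, up to
multiples the only one: a minimiser orthogonal to it has norm \<open>0\<close>. The quadratic lower bound for
\<open>E\<close> replaces any symmetry argument for the vanishing of the first derivative.\<close>

locale simple_ground_state = form_pencil +
  fixes E :: "real \<Rightarrow> real" and u0 and c :: real
  assumes eigenvector: "\<exists>u\<in>D. Re (N u u) = 1 \<and> (\<forall>v\<in>D. Q p u v = of_real (E p) * N u v)"
    and E_min: "v \<in> D \<Longrightarrow> E p * Re (N v v) \<le> Re (Q p v v)"
    and c: "c > 0" and E_low: "E 0 + c * p\<^sup>2 \<le> E p"
    and u0: "u0 \<in> D" "N u0 u0 = 1" and u0_eq: "v \<in> D \<Longrightarrow> Q 0 u0 v = of_real (E 0) * N u0 v"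
    and simple: "u \<in> D \<Longrightarrow> Re (Q 0 u u) = E 0 * Re (N u u) \<Longrightarrow> N u u0 = 0 \<Longrightarrow> Re (N u u) = 0"
begin

text \<open>Subtracting the ground state energy makes \<open>P = A - E(0) N\<close> a nonnegative form with null vector \<open>u0\<close>.
In terms of it and of \<open>e(p) = E(p) - E(0) - p\<^sup>2\<close> the eigenvalue equation at \<open>p\<close> reads
\<open>P + p B = e(p) N\<close>, and \<open>e\<close> has to be expanded. \<open>K\<close> is the orthogonal complement of \<open>u0\<close>.\<close>

definition P :: "'a \<Rightarrow> 'a \<Rightarrow> complex" where "P u v = A u v - of_real (E 0) * N u v"
definition K :: "'a set" where "K = {v \<in> D. N v u0 = 0}"
definition e :: "real \<Rightarrow> real" where "e p = E p - p\<^sup>2 - E 0"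

lemma K_sub: "K \<subseteq> D" by (auto simp: K_def)

lemma K_lc: "u \<in> K \<Longrightarrow> v \<in> K \<Longrightarrow> lc a u b v \<in> K"
  using u0 by (auto simp: K_def N.lin A.lc_closed)

lemma K_closed: "closed_subspace K"
  unfolding closed_subspace_def
proof (intro conjI allI ballI impI)
  fix s u assume s: "u \<in> D" "\<forall>n. s n \<in> K" "V_converges s u"
  have "(\<lambda>n. N (s n) u0) \<longlonglongrightarrow> N u u0"
    using s K_sub u0 by (intro N_dif_tendsto) auto
  moreover have "N (s n) u0 = 0" for n using s by (simp add: K_def)
  ultimately have "N u u0 = 0" by (simp add: LIMSEQ_const_iff)
  then show "u \<in> K" using s by (simp add: K_def)
qed (use K_sub K_lc in auto)

lemma Q0: "Q 0 u v = A u v" by (simp add: Q_def)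

lemma P_form: "hermitian_form D lc P"
proof -
  have "hermitian_form D lc (\<lambda>u v. A u v + of_real (- E 0) * N u v)"
    by (intro hermitian_form_add_scaled) unfold_locales
  then show ?thesis by (simp add: P_def[abs_def])
qed

sublocale P: hermitian_form D lc P by (rule P_form)

lemma E0_nonneg: "0 \<le> E 0"
  using E_min[of u0 0] eigenvector[of 0] A_nonneg unfolding Q0
  by (metis E_min Q0 Re_complex_of_real mult.right_neutral one_complex.sel(1) u0 u0_eq)

lemma P_u0: "v \<in> D \<Longrightarrow> P u0 v = 0" "v \<in> D \<Longrightarrow> P v u0 = 0"
  using u0_eq[of v] P.herm[of u0 v] u0 by (auto simp: P_def Q0)

text \<open>Minimising over \<open>K\<close> gives a second level \<open>l \<ge> E 0\<close>, and \<open>l = E 0\<close> would contradict simplicity. On \<open>K\<close>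
one has \<open>A \<ge> l N\<close>, hence \<open>A - E(0) N \<ge> (1 - E(0)/l) A\<close>, and \<open>A\<close> controls the full form norm there.\<close>

lemma spectral_gap: "\<exists>g>0. \<forall>v\<in>K. g * W v \<le> Re (P v v)"
proof (cases "\<exists>v\<in>K. Re (N v v) > 0")
  case False
  then have "Re (N v v) = 0" if "v \<in> K" for v
    using N_nonneg[of v] K_sub that by force
  then show ?thesis by (intro exI[of _ 1]) (auto simp: W_def P_def)
next
  case True
  then obtain v1 where v1: "v1 \<in> K" "Re (N v1 v1) = 1"
      "\<And>v. v \<in> K \<Longrightarrow> Re (Q 0 v1 v1) * Re (N v v) \<le> Re (Q 0 v v)"
    using minimizer_exists[OF K_closed, of _ 0] by blast
  define l where "l = Re (A v1 v1)"
  have l: "l * Re (N v v) \<le> Re (A v v)" if "v \<in> K" for v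
    using v1(3)[OF that] by (simp add: l_def Q0)
  have "E 0 \<le> l" using E_min[of v1 0] v1 K_sub by (auto simp: l_def Q0)
  moreover have "E 0 \<noteq> l" using simple[of v1] v1 by (auto simp: l_def Q0 K_def)
  ultimately have l0: "E 0 < l" by simp
  have lp: "l > 0" using l0 E0_nonneg by simp
  define k where "k = 1 - E 0 / l"
  have k: "k > 0" using l0 lp by (simp add: k_def)
  define g where "g = k * (min 1 l / 2)"
  have "g * W v \<le> Re (P v v)" if v: "v \<in> K" for v
  proof -
    have nn: "0 \<le> Re (A v v)" "0 \<le> Re (N v v)" using A_nonneg N_nonneg v K_sub by auto
    have "min 1 l * Re (A v v) \<le> 1 * Re (A v v)" "min 1 l * Re (N v v) \<le> l * Re (N v v)"
      using nn by (intro mult_right_mono; simp)+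
    then have "(min 1 l / 2) * W v \<le> Re (A v v)" using l[OF v] by (simp add: W_def algebra_simps)
    then have 1: "g * W v \<le> k * Re (A v v)"
      unfolding g_def mult.assoc using k by (intro mult_left_mono) auto
    have "E 0 * Re (N v v) = (E 0 / l) * (l * Re (N v v))" using lp by simp
    also have "\<dots> \<le> (E 0 / l) * Re (A v v)"
      using l[OF v] E0_nonneg lp by (intro mult_left_mono) auto
    finally have "k * Re (A v v) \<le> Re (P v v)" by (simp add: P_def k_def algebra_simps)
    then show ?thesis using 1 by simp
  qed
  moreover have "g > 0" using k lp by (simp add: g_def)
  ultimately show ?thesis by blast
qed

text \<open>The eigenvector \<open>u0\<close> serves as a trial vector at \<open>p\<close>.\<close>

lemma E_le_trial: "E p \<le> E 0 + p * Re (B u0 u0) + p\<^sup>2"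
  using E_min[of u0 p] u0 u0_eq[of u0] by (simp add: Q_def)

text \<open>The trial bound is an upper bound for \<open>E\<close> with linear term \<open>p B(u0,u0)\<close>, whereas the lower bound
has none; letting \<open>p\<close> tend to \<open>0\<close> from both sides leaves only \<open>B(u0,u0) = 0\<close>.\<close>

lemma B_u0: "B u0 u0 = 0"
proof -
  define b where "b = Re (B u0 u0)"
  have le: "\<bar>b\<bar> \<le> t" if t: "t > 0" for t
  proof -
    have "c * t\<^sup>2 \<le> t * b + t\<^sup>2" "c * t\<^sup>2 \<le> - t * b + t\<^sup>2"
      using E_low[of t] E_le_trial[of t] E_low[of "-t"] E_le_trial[of "-t"] by (auto simp: b_def)
    moreover have "0 \<le> c * t\<^sup>2" using c by simp
    ultimately have "t * \<bar>b\<bar> \<le> t * t" unfolding power2_eq_square by (cases "b < 0") auto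
    then show ?thesis by (rule mult_left_le_imp_le[OF _ t])
  qed
  have "\<bar>b\<bar> \<le> 0" by (rule field_le_epsilon) (unfold add_0, rule le)
  then show ?thesis using B.diag_of_real[OF u0(1)] by (simp add: b_def)
qed

lemma e_bound: "\<bar>e p\<bar> \<le> p\<^sup>2"
proof -
  have "0 \<le> c * p\<^sup>2" using c by simp
  moreover have "E p \<le> E 0 + p\<^sup>2" using E_le_trial[of p] B_u0 by simp
  moreover have "0 \<le> p\<^sup>2" by simp
  ultimately show ?thesis using E_low[of p] unfolding e_def abs_le_iff by linarith
qed

lemma Q_P: "Q p u v = of_real (E p) * N u v \<longleftrightarrow> P u v + of_real p * B u v = of_real (e p) * N u v"
  by (simp add: Q_def P_def e_def algebra_simps)

text \<open>For small \<open>p\<close> the pencil stays coercive on \<open>K\<close>, so an eigenvector at \<open>p\<close> has a component along \<open>u0\<close>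
and can be scaled to \<open>w p = u0 + v p\<close> with \<open>v p\<close> in \<open>K\<close>. Testing its equation with \<open>v p\<close> gives
\<open>v p = O(p)\<close>, and testing it with \<open>u0\<close> gives \<open>e p = p B(v p, u0)\<close>. The quotients \<open>v p / p\<close> solve
equations on \<open>K\<close> that agree up to \<open>O(p)\<close>, so by coercivity they converge linearly, and so does
\<open>e p / p\<^sup>2\<close>; the limit plus \<open>1\<close> is the coefficient \<open>k\<close>.

Differentiability near \<open>0\<close> comes from the identity \<open>(p - s) B(w p, w s) = (e p - e s) N(w p, w s)\<close>,
in which the symmetric form \<open>P\<close> has cancelled: dividing and letting \<open>s\<close> tend to \<open>p\<close> gives
\<open>e' p = B(w p, w p) / N(w p, w p)\<close>, which is expanded with the estimates already obtained.\<close>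

proposition second_order_expansion:
  "\<exists>k d M E'. d > 0 \<and> k > 0 \<and> (\<forall>p. \<bar>p\<bar> < d \<longrightarrow> (E has_real_derivative E' p) (at p)
      \<and> \<bar>E' p - 2 * k * p\<bar> \<le> M * p\<^sup>2 \<and> \<bar>E p - E 0 - k * p\<^sup>2\<bar> \<le> M * \<bar>p\<bar> ^ 3)"
proof -
  obtain g where g: "g > 0" and gap: "\<And>v. v \<in> K \<Longrightarrow> g * W v \<le> Re (P v v)"
    using spectral_gap by blast
  \<comment> \<open>on \<open>K\<close> the terms \<open>p B\<close> and \<open>e p N\<close> cost at most \<open>3 |p|\<close> times the squared form norm, that is at most \<open>3/8\<close> of the gap\<close>
  define d0 where "d0 = min 1 (g / 8)"
  have d0: "d0 > 0" "d0 \<le> 1" "8 * d0 \<le> g" using g by (auto simp: d0_def)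
  have coercive: "(g / 2) * W v \<le> Re (P v v + of_real p * B v v - of_real (e p) * N v v)"
    if v: "v \<in> K" and p: "\<bar>p\<bar> < d0" for v p
  proof -
    have vD: "v \<in> D" using v K_sub by auto
    have "\<bar>p * Re (B v v)\<bar> \<le> \<bar>p\<bar> * (2 * W v)"
      unfolding abs_mult using B_le[OF vD vD] abs_Re_le_cmod[of "B v v"] nrm_sq[OF vD]
      by (intro mult_left_mono) (auto simp: power2_eq_square)
    moreover have "\<bar>e p * Re (N v v)\<bar> \<le> \<bar>p\<bar> * W v"
    proof -
      have "p\<^sup>2 \<le> \<bar>p\<bar> * 1" unfolding power2_eq_square
        using p d0 by (metis abs_ge_zero abs_mult_self_eq less_eq_real_def mult_left_mono order_trans)
      then show ?thesis unfolding abs_mult using e_bound[of p] N_nonneg[OF vD] A_nonneg[OF vD]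
        by (intro mult_mono) (auto simp: W_def)
    qed
    moreover have "3 * (\<bar>p\<bar> * W v) \<le> 3 * (g / 8 * W v)"
      using p d0 W_nonneg[OF vD] by (intro mult_left_mono mult_right_mono) auto
    moreover have "0 \<le> g * W v" using g W_nonneg[OF vD] by simp
    ultimately show ?thesis using gap[OF v] by (simp add: algebra_simps abs_if split: if_splits)
  qed
  \<comment> \<open>a bounded functional on \<open>K\<close> has a bounded preimage under the coercive form\<close>
  have coercive_bound: "nrm v \<le> 2 * k / g"
    if v: "v \<in> K" and p: "\<bar>p\<bar> < d0" and k: "0 \<le> k"
      and b: "cmod (P v v + of_real p * B v v - of_real (e p) * N v v) \<le> k * nrm v" for v p k
  proof (cases "nrm v = 0")
    case True then show ?thesis using k g by simp
  next
    case False
    have vD: "v \<in> D" using v K_sub by auto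
    have "(g / 2) * (nrm v)\<^sup>2 \<le> k * nrm v"
      using coercive[OF v p] complex_Re_le_cmod[of "P v v + of_real p * B v v - of_real (e p) * N v v"] b nrm_sq[OF vD]
      by simp
    then have "(g / 2 * nrm v) * nrm v \<le> k * nrm v" by (simp add: power2_eq_square mult_ac)
    then have "g / 2 * nrm v \<le> k" using False nrm_nonneg[OF vD] by simp
    then show ?thesis using g by (simp add: field_simps)
  qed
  have "\<exists>v. v \<in> K \<and> (\<forall>f\<in>D. P (lc 1 u0 1 v) f + of_real p * B (lc 1 u0 1 v) f = of_real (e p) * N (lc 1 u0 1 v) f)"
    if p: "\<bar>p\<bar> < d0" for p
  proof -
    obtain u where u: "u \<in> D" "Re (N u u) = 1" and eq: "\<And>f. f \<in> D \<Longrightarrow> Q p u f = of_real (E p) * N u f"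
      using eigenvector by blast
    \<comment> \<open>an eigenvector orthogonal to \<open>u0\<close> would lie in \<open>K\<close> and vanish by coercivity; otherwise it is divided by its component\<close>
    define a where "a = N u u0"
    have "a \<noteq> 0"
    proof
      assume "a = 0"
      then have uK: "u \<in> K" using u by (simp add: K_def a_def)
      have "nrm u \<le> 2 * 0 / g"
        by (rule coercive_bound[OF uK p]) (use eq[OF u(1)] in \<open>simp_all add: Q_P\<close>)
      then have "W u \<le> 0" using nrm_sq[OF u(1)] nrm_nonneg[OF u(1)] by simp
      then show False using u A_nonneg[OF u(1)] by (simp add: W_def)
    qed
    define v where "v = lc (1 / a) u (-1) u0"
    have vD: "v \<in> D" using u u0 by (simp add: v_def A.lc_closed)
    have "v \<in> K" using u u0 \<open>a \<noteq> 0\<close> vD by (simp add: K_def v_def N.lin a_def)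
    moreover have "P (lc 1 u0 1 v) f + of_real p * B (lc 1 u0 1 v) f = of_real (e p) * N (lc 1 u0 1 v) f"
      if f: "f \<in> D" for f
    proof -
      have *: "F (lc 1 u0 1 v) f = F u f / a" if "hermitian_form D lc F" for F
        using u u0 vD f by (simp add: v_def hermitian_form.lin[OF that])
      have N: "hermitian_form D lc N" and B: "hermitian_form D lc B" by unfold_locales
      have "(P u f + of_real p * B u f) / a = of_real (e p) * N u f / a"
        using eq[OF f] by (simp add: Q_P)
      then show ?thesis unfolding *[OF P_form] *[OF N] *[OF B] by (simp add: add_divide_distrib)
    qed
    ultimately show ?thesis by blast
  qed
  then obtain v where vK: "\<And>p. \<bar>p\<bar> < d0 \<Longrightarrow> v p \<in> K"
    and veq: "\<And>p f. \<bar>p\<bar> < d0 \<Longrightarrow> f \<in> D \<Longrightarrow>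
      P (lc 1 u0 1 (v p)) f + of_real p * B (lc 1 u0 1 (v p)) f = of_real (e p) * N (lc 1 u0 1 (v p)) f"
    by metis
  have vD: "v p \<in> D" if "\<bar>p\<bar> < d0" for p using vK[OF that] K_sub by auto
  \<comment> \<open>the equation tested on \<open>K\<close>, where the terms \<open>P u0\<close> and \<open>N u0\<close> drop out\<close>
  have eqK: "P (v p) f = of_real (e p) * N (v p) f - of_real p * B (v p) f - of_real p * B u0 f"
    if p: "\<bar>p\<bar> < d0" and f: "f \<in> K" for p f
  proof -
    have fD: "f \<in> D" and n: "N u0 f = 0" using f N.herm[of f u0] u0 by (auto simp: K_def)
    show ?thesis using veq[OF p fD] vD[OF p] u0 fD n P_u0(1)[OF fD]
      by (simp add: P.lin B.lin N.lin algebra_simps add_eq_0_iff2 eq_neg_iff_add_eq_0) 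
  qed
  have u0n: "0 \<le> nrm u0" using nrm_nonneg u0 by simp
  define C1 where "C1 = 4 * nrm u0 / g"
  have C1: "0 \<le> C1" using u0n g by (simp add: C1_def)
  have vn: "nrm (v p) \<le> C1 * \<bar>p\<bar>" if p: "\<bar>p\<bar> < d0" for p
  proof -
    have "nrm (v p) \<le> 2 * (2 * \<bar>p\<bar> * nrm u0) / g"
    proof (rule coercive_bound[OF vK[OF p] p])
      have "P (v p) (v p) + of_real p * B (v p) (v p) - of_real (e p) * N (v p) (v p) = - of_real p * B u0 (v p)"
        using eqK[OF p vK[OF p]] by simp
      then show "cmod (P (v p) (v p) + of_real p * B (v p) (v p) - of_real (e p) * N (v p) (v p)) \<le> 2 * \<bar>p\<bar> * nrm u0 * nrm (v p)"
        using mult_left_mono[OF B_le[OF u0(1) vD[OF p]], of "\<bar>p\<bar>"] by (simp add: norm_mult mult_ac)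
    qed (use u0n in simp)
    then show ?thesis by (simp add: C1_def mult_ac)
  qed
  \<comment> \<open>the equation tested with \<open>u0\<close>\<close>
  have ev: "of_real (e p) = of_real p * B (v p) u0" if p: "\<bar>p\<bar> < d0" for p
    using veq[OF p u0(1)] vD[OF p] vK[OF p] u0 P_u0(2) B_u0
    by (simp add: P.lin B.lin N.lin K_def)
  have eK: "e p / p\<^sup>2 = Re (B (v p) u0) / p" if p: "\<bar>p\<bar> < d0" "p \<noteq> 0" for p
    using arg_cong[OF ev[OF p(1)], of Re] p(2) by (simp add: power2_eq_square)
  define C2 where "C2 = 12 * C1 * nrm u0 / g"
  have C2: "0 \<le> C2" using C1 u0n g by (simp add: C2_def)
  have osc: "\<bar>e p / p\<^sup>2 - e s / s\<^sup>2\<bar> \<le> C2 * (\<bar>p\<bar> + \<bar>s\<bar>)"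
    if p: "0 < \<bar>p\<bar>" "\<bar>p\<bar> < d0" and s: "0 < \<bar>s\<bar>" "\<bar>s\<bar> < d0" for p s
  proof -
    \<comment> \<open>the leading terms \<open>- B u0\<close> of the equations for \<open>v p / p\<close> and \<open>v s / s\<close> cancel in those for the difference\<close>
    define z where "z = lc (of_real (1/p)) (v p) (of_real (-1/s)) (v s)"
    have zK: "z \<in> K" unfolding z_def by (intro K_lc vK p s)
    have zD: "z \<in> D" using zK K_sub by auto
    have rest: "cmod (of_real (e q / q) * N (v q) z - B (v q) z) \<le> 3 * C1 * \<bar>q\<bar> * nrm z"
      if q: "0 < \<bar>q\<bar>" "\<bar>q\<bar> < d0" for q
    proof -
      have "\<bar>e q / q\<bar> \<le> \<bar>q\<bar>" using e_bound[of q] q by (simp add: abs_divide pos_divide_le_eq power2_eq_square)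
      then have q1: "\<bar>e q / q\<bar> \<le> 1" using q d0 by linarith
      have "cmod (of_real (e q / q) * N (v q) z - B (v q) z) \<le> \<bar>e q / q\<bar> * cmod (N (v q) z) + cmod (B (v q) z)"
        by (metis norm_mult norm_of_real norm_triangle_ineq4)
      also have "\<dots> \<le> 1 * (nrm (v q) * nrm z) + 2 * nrm (v q) * nrm z"
        using q1 N_le[OF vD[OF q(2)] zD] B_le[OF vD[OF q(2)] zD] by (intro add_mono mult_mono) auto
      also have "\<dots> = 3 * (nrm (v q) * nrm z)" by simp
      also have "\<dots> \<le> 3 * (C1 * \<bar>q\<bar> * nrm z)"
        using vn[OF q(2)] nrm_nonneg[OF zD] by (intro mult_left_mono mult_right_mono) auto
      finally show ?thesis by simp
    qed
    have Pz: "P z z = (of_real (e p / p) * N (v p) z - B (v p) z) - (of_real (e s / s) * N (v s) z - B (v s) z)"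
    proof -
      have "P (v q) z / of_real q = of_real (e q / q) * N (v q) z - B (v q) z - B u0 z"
        if q: "0 < \<bar>q\<bar>" "\<bar>q\<bar> < d0" for q
        using eqK[OF q(2) zK] q(1) by (simp add: field_simps)
      note q = this[OF p] this[OF s]
      have "P z w = of_real (1/p) * P (v p) w + of_real (-1/s) * P (v s) w" if "w \<in> D" for w
        unfolding z_def by (rule P.lin[OF vD[OF p(2)] vD[OF s(2)] that])
      from this[OF zD] have "P z z = P (v p) z / of_real p - P (v s) z / of_real s" by simp
      then show ?thesis unfolding q by simp
    qed
    have "nrm z \<le> 2 * (3 * C1 * (\<bar>p\<bar> + \<bar>s\<bar>)) / g"
    proof (rule coercive_bound[OF zK, of 0])
      have "e 0 = 0" by (simp add: e_def)
      have "cmod (P z z) \<le> 3 * C1 * \<bar>p\<bar> * nrm z + 3 * C1 * \<bar>s\<bar> * nrm z"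
        unfolding Pz using norm_triangle_le_diff rest[OF p] rest[OF s] by (meson add_mono norm_triangle_ineq4 order_trans)
      then show "cmod (P z z + of_real 0 * B z z - of_real (e 0) * N z z) \<le> 3 * C1 * (\<bar>p\<bar> + \<bar>s\<bar>) * nrm z"
        by (simp add: algebra_simps \<open>e 0 = 0\<close>)
    qed (use d0 C1 in simp_all)
    then have "2 * nrm z * nrm u0 \<le> 2 * (2 * (3 * C1 * (\<bar>p\<bar> + \<bar>s\<bar>)) / g) * nrm u0"
      using u0n by (intro mult_right_mono mult_left_mono) auto
    moreover have "e p / p\<^sup>2 - e s / s\<^sup>2 = Re (B z u0)"
      using eK[of p] eK[of s] p s B.lin[OF vD[OF p(2)] vD[OF s(2)] u0(1)] by (simp add: z_def)
    ultimately show ?thesis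
      using B_le[OF zD u0(1)] abs_Re_le_cmod[of "B z u0"] by (simp add: C2_def algebra_simps)
  qed
  obtain k0 where k0: "\<And>p. 0 < \<bar>p\<bar> \<Longrightarrow> \<bar>p\<bar> < d0 \<Longrightarrow> \<bar>e p / p\<^sup>2 - k0\<bar> \<le> C2 * \<bar>p\<bar>"
    using limit_of_linear_oscillation[OF d0(1) C2, of "\<lambda>p. e p / p\<^sup>2"] osc by blast
  have ek: "\<bar>e p - k0 * p\<^sup>2\<bar> \<le> C2 * \<bar>p\<bar> ^ 3" if p: "\<bar>p\<bar> < d0" for p
  proof (cases "p = 0")
    case True then show ?thesis by (simp add: e_def)
  next
    case False
    have "e p - k0 * p\<^sup>2 = (e p / p\<^sup>2 - k0) * p\<^sup>2" using False by (simp add: left_diff_distrib)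
    then have "\<bar>e p - k0 * p\<^sup>2\<bar> = \<bar>e p / p\<^sup>2 - k0\<bar> * p\<^sup>2" by (simp only: abs_mult abs_power2)
    also have "\<dots> \<le> C2 * \<bar>p\<bar> * p\<^sup>2" using k0 p False by (intro mult_right_mono) auto
    also have "\<dots> = C2 * (\<bar>p\<bar> * \<bar>p\<bar>\<^sup>2)" by simp
    also have "\<bar>p\<bar> * \<bar>p\<bar>\<^sup>2 = \<bar>p\<bar> ^ 3" by (simp only: power3_eq_cube power2_eq_square mult.assoc)
    finally show ?thesis .
  qed
  \<comment> \<open>the lower bound \<open>E 0 + c p\<^sup>2 \<le> E p\<close>, divided by \<open>p\<^sup>2\<close>\<close>
  have kpos: "1 + k0 \<ge> c"
  proof (rule field_le_epsilon)
    fix t :: real assume t: "t > 0"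
    define p where "p = min (d0 / 2) (t / (C2 + 1))"
    have p: "0 < p" "p < d0" "p \<le> t / (C2 + 1)" using d0 t C2 by (auto simp: p_def)
    have "c - 1 \<le> e p / p\<^sup>2" using E_low[of p] p by (simp add: e_def field_simps)
    moreover have "C2 * p \<le> t"
    proof -
      have "C2 * p \<le> (C2 + 1) * p" using p by simp
      also have "\<dots> \<le> (C2 + 1) * (t / (C2 + 1))" using p C2 by (intro mult_left_mono) auto
      finally show ?thesis using C2 by simp
    qed
    ultimately show "c \<le> 1 + k0 + t" using k0[of p] p by (auto simp: abs_if split: if_splits)
  qed
  \<comment> \<open>small enough for \<open>nrm (v p) \<le> 1/2\<close>, which keeps \<open>N (w p) (w s)\<close> away from \<open>0\<close>\<close>
  define d where "d = min d0 (1 / (1 + 2 * C1))"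
  have d: "0 < d" "d \<le> d0" using d0 C1 by (auto simp: d_def)
  have dC: "C1 * d \<le> 1 / 2"
  proof -
    have "C1 * d \<le> C1 * (1 / (1 + 2 * C1))" using C1 by (intro mult_left_mono) (auto simp: d_def)
    also have "\<dots> \<le> 1 / 2" using C1 by (simp add: field_simps)
    finally show ?thesis .
  qed
  define w where "w p = lc 1 u0 1 (v p)" for p
  have wD: "w p \<in> D" if "\<bar>p\<bar> < d0" for p using vD[OF that] u0 by (simp add: w_def A.lc_closed)
  have Nw: "N (w p) (w s) = 1 + N (v p) (v s)" if "\<bar>p\<bar> < d0" "\<bar>s\<bar> < d0" for p s
    using vK[OF that(1)] vK[OF that(2)] vD[OF that(1)] vD[OF that(2)] u0 N.herm[of "v s" u0]
    by (simp add: w_def N.lin N.lin_right A.lc_closed K_def)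
  have vhalf: "nrm (v p) \<le> 1 / 2" if p: "\<bar>p\<bar> < d" for p
  proof -
    have "nrm (v p) \<le> C1 * \<bar>p\<bar>" using vn p d by simp
    also have "\<dots> \<le> C1 * d" using p C1 by (intro mult_left_mono) auto
    finally show ?thesis using dC by simp
  qed
  have Nwb: "cmod (N (w p) (w s)) \<ge> 1 / 2" if p: "\<bar>p\<bar> < d" and s: "\<bar>s\<bar> < d" for p s
  proof -
    have "cmod (N (v p) (v s)) \<le> nrm (v p) * nrm (v s)" using N_le vD p s d by simp
    also have "\<dots> \<le> 1/2 * (1/2)" using vhalf p s nrm_nonneg vD d by (intro mult_mono) auto
    finally show ?thesis using Nw[of p s] p s d norm_triangle_ineq4[of "1 + N (v p) (v s)" "N (v p) (v s)"] by simp
  qed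
  \<comment> \<open>the equation at \<open>p\<close> is tested with \<open>w s\<close> and the one at \<open>s\<close> with \<open>w p\<close>; by symmetry \<open>P\<close> drops out of the difference\<close>
  have cross: "of_real (p - s) * B (w p) (w s) = of_real (e p - e s) * N (w p) (w s)"
    if p: "\<bar>p\<bar> < d" and s: "\<bar>s\<bar> < d" for p s
  proof -
    have D: "w p \<in> D" "w s \<in> D" using wD p s d by auto
    have 1: "P (w p) (w s) + of_real p * B (w p) (w s) = of_real (e p) * N (w p) (w s)"
      using veq[of p "w s"] D p d by (simp add: w_def)
    have "P (w s) (w p) + of_real s * B (w s) (w p) = of_real (e s) * N (w s) (w p)"
      using veq[of s "w p"] D s d by (simp add: w_def)
    then have "cnj (P (w s) (w p) + of_real s * B (w s) (w p)) = cnj (of_real (e s) * N (w s) (w p))" by simp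
    then have 2: "P (w p) (w s) + of_real s * B (w p) (w s) = of_real (e s) * N (w p) (w s)"
      using P.herm[OF D] B.herm[OF D] N.herm[OF D] by simp
    have "P (w p) (w s) + of_real p * B (w p) (w s) - (P (w p) (w s) + of_real s * B (w p) (w s))
        = of_real (e p) * N (w p) (w s) - of_real (e s) * N (w p) (w s)" unfolding 1 2 ..
    then show ?thesis by (simp add: algebra_simps)
  qed
  have wn: "cmod (B (w p) f) \<le> 2 * (nrm u0 + 1) * nrm f" if p: "\<bar>p\<bar> < d" and f: "f \<in> D" for p f
  proof -
    have "B (w p) f = B u0 f + B (v p) f" using vD[of p] p d u0 f by (simp add: w_def B.lin)
    then have "cmod (B (w p) f) \<le> cmod (B u0 f) + cmod (B (v p) f)" by (metis norm_triangle_ineq)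
    also have "\<dots> \<le> 2 * nrm u0 * nrm f + 2 * nrm (v p) * nrm f"
      using B_le u0 vD p d f by (intro add_mono) auto
    also have "\<dots> \<le> 2 * nrm u0 * nrm f + 2 * 1 * nrm f"
      using vhalf[OF p] nrm_nonneg[OF f] by (intro add_left_mono mult_right_mono) auto
    finally show ?thesis by (simp add: algebra_simps)
  qed
  define C3 where "C3 = 2 * (nrm u0 + 1) * (nrm u0 + 1)"
  have C3: "0 \<le> C3" using u0n by (simp add: C3_def)
  have nw: "nrm (w p) \<le> nrm u0 + 1" if p: "\<bar>p\<bar> < d" for p
  proof -
    have D: "v p \<in> D" "w p \<in> D" using vD wD p d by auto
    have "W (w p) = W u0 + W (v p) + 2 * Re (A u0 (v p) + N u0 (v p))"
      using A.diag_lc[OF u0(1) D(1), of 1 1] N.diag_lc[OF u0(1) D(1), of 1 1] by (simp add: W_def w_def)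
    also have "Re (A u0 (v p) + N u0 (v p)) \<le> nrm u0 * nrm (v p)"
    proof -
      interpret WW: hermitian_form D lc "\<lambda>u v. A u v + of_real 1 * N u v" by (rule W_form)
      have "(cmod (A u0 (v p) + of_real 1 * N u0 (v p)))\<^sup>2 \<le> W u0 * W (v p)"
        using WW.Cauchy_Schwarz[OF _ u0(1) D(1)] A_nonneg N_nonneg by (simp add: W_def)
      also have "\<dots> = (nrm u0 * nrm (v p))\<^sup>2" using nrm_sq u0 D by (simp add: power_mult_distrib)
      finally have "cmod (A u0 (v p) + N u0 (v p)) \<le> nrm u0 * nrm (v p)"
        using nrm_nonneg u0 D by (simp add: power2_le_iff_abs_le)
      then show ?thesis using complex_Re_le_cmod order_trans by blast
    qed
    finally have "(nrm (w p))\<^sup>2 \<le> (nrm u0 + nrm (v p))\<^sup>2"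
      using nrm_sq[OF D(1)] nrm_sq[OF D(2)] nrm_sq[OF u0(1)] by (simp add: power2_sum)
    then have "nrm (w p) \<le> nrm u0 + nrm (v p)"
      using u0n nrm_nonneg[OF D(1)] power2_le_imp_le by fastforce
    then show ?thesis using vhalf[OF p] by simp
  qed
  \<comment> \<open>the identity \<open>cross\<close> makes \<open>e\<close> locally Lipschitz, and coercivity transfers this to \<open>v\<close>\<close>
  have lip: "\<bar>e p - e s\<bar> \<le> 2 * C3 * \<bar>p - s\<bar>" if p: "\<bar>p\<bar> < d" and s: "\<bar>s\<bar> < d" for p s
  proof -
    have sD: "w s \<in> D" using wD s d by auto
    have "\<bar>e p - e s\<bar> * (1/2) \<le> \<bar>e p - e s\<bar> * cmod (N (w p) (w s))"
      using Nwb[OF p s] by (intro mult_left_mono) auto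
    also have "\<dots> = \<bar>p - s\<bar> * cmod (B (w p) (w s))"
      using arg_cong[OF cross[OF p s], of cmod] by (simp add: norm_mult flip: of_real_diff)
    also have "\<dots> \<le> \<bar>p - s\<bar> * C3"
    proof (rule mult_left_mono)
      have "cmod (B (w p) (w s)) \<le> 2 * (nrm u0 + 1) * nrm (w s)" by (rule wn[OF p sD])
      also have "\<dots> \<le> C3" unfolding C3_def using nw[OF s] u0n by (intro mult_left_mono) auto
      finally show "cmod (B (w p) (w s)) \<le> C3" .
    qed simp
    finally show ?thesis by (simp add: mult_ac)
  qed
  define C4 where "C4 = 2 * (2 * (nrm u0 + 1) + 2 * C3) / g"
  have vlip: "nrm (dif (v p) (v s)) \<le> C4 * \<bar>p - s\<bar>" if p: "\<bar>p\<bar> < d" and s: "\<bar>s\<bar> < d" for p s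
  proof -
    define z where "z = dif (v p) (v s)"
    have p0: "\<bar>p\<bar> < d0" "\<bar>s\<bar> < d0" using p s d by auto
    have zK: "z \<in> K" unfolding z_def dif_def by (intro K_lc vK p0)
    have zD: "z \<in> D" using zK K_sub by auto
    have Dz: "F z z = F (v p) z - F (v s) z" if "hermitian_form D lc F" for F
      using hermitian_form.lin[OF that vD[OF p0(1)] vD[OF p0(2)] zD, of 1 "-1"] by (simp add: z_def dif_def)
    have Bf: "hermitian_form D lc B" and Nf: "hermitian_form D lc N" by unfold_locales
    have ws: "B (w s) z = B u0 z + B (v s) z" using vD[OF p0(2)] u0 zD by (simp add: w_def B.lin)
    have eqz: "P z z + of_real p * B z z - of_real (e p) * N z z
       = - of_real (p - s) * B (w s) z + of_real (e p - e s) * N (v s) z"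
      unfolding Dz[OF P_form] Dz[OF Bf] Dz[OF Nf] ws eqK[OF p0(1) zK] eqK[OF p0(2) zK]
      by (simp add: algebra_simps)
    have "cmod (P z z + of_real p * B z z - of_real (e p) * N z z)
        \<le> \<bar>p - s\<bar> * cmod (B (w s) z) + \<bar>e p - e s\<bar> * cmod (N (v s) z)"
      unfolding eqz by (rule order_trans[OF norm_triangle_ineq]) (simp add: norm_mult del: of_real_diff)
    also have "\<dots> \<le> \<bar>p - s\<bar> * (2 * (nrm u0 + 1) * nrm z) + (2 * C3 * \<bar>p - s\<bar>) * (1 * nrm z)"
    proof (intro add_mono mult_mono)
      show "cmod (B (w s) z) \<le> 2 * (nrm u0 + 1) * nrm z" by (rule wn[OF s zD])
      show "\<bar>e p - e s\<bar> \<le> 2 * C3 * \<bar>p - s\<bar>" by (rule lip[OF p s])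
      have "cmod (N (v s) z) \<le> nrm (v s) * nrm z" using N_le vD p0 zD by simp
      also have "\<dots> \<le> 1 * nrm z" using vhalf[OF s] nrm_nonneg[OF zD] by (intro mult_right_mono) auto
      finally show "cmod (N (v s) z) \<le> 1 * nrm z" .
    qed (use C3 in auto)
    finally have "cmod (P z z + of_real p * B z z - of_real (e p) * N z z) \<le> ((2 * (nrm u0 + 1) + 2 * C3) * \<bar>p - s\<bar>) * nrm z"
      by (simp add: algebra_simps)
    then have "nrm z \<le> 2 * ((2 * (nrm u0 + 1) + 2 * C3) * \<bar>p - s\<bar>) / g"
      using C3 u0n by (intro coercive_bound[OF zK p0(1)]) auto
    also have "\<dots> = C4 * \<bar>p - s\<bar>" unfolding C4_def by (simp only: mult.assoc times_divide_eq_left)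
    finally show ?thesis unfolding z_def .
  qed
  define e' where "e' p = Re (B (w p) (w p)) / Re (N (w p) (w p))" for p
  have der: "(e has_real_derivative e' p) (at p)" if p: "\<bar>p\<bar> < d" for p
  proof -
    have p0: "\<bar>p\<bar> < d0" using p d by simp
    have near: "\<forall>\<^sub>F s in at p. \<bar>s\<bar> < d \<and> s \<noteq> p"
    proof -
      have "\<forall>\<^sub>F s in at p. s \<in> {-d<..<d} - {p}"
        using p by (intro eventually_at_in_open) auto
      then show ?thesis by eventually_elim auto
    qed
    \<comment> \<open>continuity of \<open>w\<close> at \<open>p\<close>, in the weak form needed for the quotient\<close>
    have cont: "((\<lambda>s. F (w p) (w s)) \<longlongrightarrow> F (w p) (w p)) (at p)"
      if F: "hermitian_form D lc F" and Fb: "\<And>f. f \<in> D \<Longrightarrow> cmod (F (w p) f) \<le> k * nrm f" for F k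
    proof (rule Lim_transform_eventually[where f = "\<lambda>s. F (w p) (w p) - F (w p) (dif (v p) (v s))"])
      have "((\<lambda>s. F (w p) (dif (v p) (v s))) \<longlongrightarrow> 0) (at p)"
      proof (rule Lim_null_comparison)
        show "\<forall>\<^sub>F s in at p. norm (F (w p) (dif (v p) (v s))) \<le> \<bar>k\<bar> * (C4 * \<bar>p - s\<bar>)"
          using near
        proof eventually_elim
          case (elim s)
          have zD: "dif (v p) (v s) \<in> D" using vD[OF p0] vD[of s] elim d by (simp add: dif_in)
          have "norm (F (w p) (dif (v p) (v s))) \<le> k * nrm (dif (v p) (v s))" by (rule Fb[OF zD])
          also have "\<dots> \<le> \<bar>k\<bar> * nrm (dif (v p) (v s))" using nrm_nonneg[OF zD] by (intro mult_right_mono) auto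
          also have "\<dots> \<le> \<bar>k\<bar> * (C4 * \<bar>p - s\<bar>)" using vlip[OF p] elim by (intro mult_left_mono) auto
          finally show ?case .
        qed
        have "((\<lambda>s. \<bar>k\<bar> * (C4 * \<bar>p - s\<bar>)) \<longlongrightarrow> \<bar>k\<bar> * (C4 * \<bar>p - p\<bar>)) (at p)" by (intro tendsto_intros)
        then show "((\<lambda>s. \<bar>k\<bar> * (C4 * \<bar>p - s\<bar>)) \<longlongrightarrow> 0) (at p)" by simp
      qed
      then show "((\<lambda>s. F (w p) (w p) - F (w p) (dif (v p) (v s))) \<longlongrightarrow> F (w p) (w p)) (at p)"
        using tendsto_diff[OF tendsto_const] by fastforce
      show "\<forall>\<^sub>F s in at p. F (w p) (w p) - F (w p) (dif (v p) (v s)) = F (w p) (w s)"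
        using near
      proof eventually_elim
        case (elim s)
        then have s0: "v s \<in> D" using vD d by auto
        show ?case using vD[OF p0] s0 u0 wD[OF p0]
            hermitian_form.lin_right[OF F u0(1) vD[OF p0] wD[OF p0], of 1 1]
            hermitian_form.lin_right[OF F u0(1) s0 wD[OF p0], of 1 1]
            hermitian_form.lin_right[OF F vD[OF p0] s0 wD[OF p0], of 1 "-1"]
          by (simp add: dif_def w_def)
      qed
    qed
    have Bf: "hermitian_form D lc B" and Nf: "hermitian_form D lc N" by unfold_locales
    have Nne: "N (w p) (w p) \<noteq> 0" using Nwb[OF p p] by auto
    have "((\<lambda>s. B (w p) (w s) / N (w p) (w s)) \<longlongrightarrow> B (w p) (w p) / N (w p) (w p)) (at p)"
      by (intro tendsto_divide Nne cont[OF Bf, of "2 * nrm (w p)"] cont[OF Nf, of "nrm (w p)"])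
        (use B_le N_le wD[OF p0] in auto)
    then have "((\<lambda>s. Re (B (w p) (w s) / N (w p) (w s))) \<longlongrightarrow> Re (B (w p) (w p) / N (w p) (w p))) (at p)"
      by (rule tendsto_Re)
    also have "Re (B (w p) (w p) / N (w p) (w p)) = e' p"
      using B.diag_of_real[OF wD[OF p0]] N.diag_of_real[OF wD[OF p0]]
      by (metis Re_complex_of_real e'_def of_real_divide)
    finally have "((\<lambda>s. Re (B (w p) (w s) / N (w p) (w s))) \<longlongrightarrow> e' p) (at p)" .
    moreover have "\<forall>\<^sub>F s in at p. Re (B (w p) (w s) / N (w p) (w s)) = (e s - e p) / (s - p)"
      using near
    proof eventually_elim
      case (elim s)
      then have s: "\<bar>s\<bar> < d" "s \<noteq> p" by auto
      have "N (w p) (w s) \<noteq> 0" using Nwb[OF p s(1)] by auto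
      then have "B (w p) (w s) / N (w p) (w s) = of_real ((e p - e s) / (p - s))"
        using cross[OF p s(1)] s(2) by (simp add: field_simps)
      then have "Re (B (w p) (w s) / N (w p) (w s)) = (e p - e s) / (p - s)" by (metis Re_complex_of_real)
      also have "\<dots> = (e s - e p) / (s - p)" by (metis minus_diff_eq minus_divide_divide)
      finally show ?case .
    qed
    ultimately have "((\<lambda>s. (e s - e p) / (s - p)) \<longlongrightarrow> e' p) (at p)"
      by (rule Lim_transform_eventually)
    then show ?thesis by (simp add: has_field_derivative_iff)
  qed
  define C5 where "C5 = 2 * C2 + 2 * C1\<^sup>2 + 2 * \<bar>k0\<bar> * C1\<^sup>2"
  \<comment> \<open>numerator \<open>2 Re B(v p, u0) + B(v p, v p)\<close> and denominator \<open>1 + N(v p, v p)\<close>, each known up to \<open>O(p\<^sup>2)\<close>\<close>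
  have e'b: "\<bar>e' p - 2 * k0 * p\<bar> \<le> C5 * p\<^sup>2" if p: "\<bar>p\<bar> < d" for p
  proof (cases "p = 0")
    case True
    have "nrm (v 0) \<le> 0" using vn[of 0] d0 by simp
    then have "nrm (v 0) = 0" using nrm_nonneg[OF vD[of 0]] d0 by simp
    have "\<bar>Re (B (w 0) (w 0))\<bar> \<le> 0"
    proof -
      have D: "v 0 \<in> D" using vD d0 by simp
      have "B (w 0) (w 0) = B u0 u0 + B u0 (v 0) + B (v 0) u0 + B (v 0) (v 0)"
        using u0 D by (simp add: w_def B.lin B.lin_right A.lc_closed)
      moreover have "cmod (B u0 (v 0)) \<le> 0" "cmod (B (v 0) u0) \<le> 0" "cmod (B (v 0) (v 0)) \<le> 0"
        using B_le[OF u0(1) D] B_le[OF D u0(1)] B_le[OF D D] \<open>nrm (v 0) = 0\<close> by auto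
      ultimately show ?thesis using B_u0 by simp
    qed
    then show ?thesis using True by (simp add: e'_def)
  next
    case False
    have p0: "\<bar>p\<bar> < d0" using p d by simp
    have D: "v p \<in> D" using vD p0 by simp
    define n where "n = Re (N (w p) (w p))"
    define nv where "nv = Re (N (v p) (v p))"
    have n1: "n = 1 + nv" using Nw[OF p0 p0] by (simp add: n_def nv_def)
    have vsq: "nrm (v p) * nrm (v p) \<le> C1\<^sup>2 * p\<^sup>2"
      using mult_mono[OF vn[OF p0] vn[OF p0]] nrm_nonneg[OF D] C1 by (simp add: power2_eq_square mult_ac)
    have nv: "0 \<le> nv" "nv \<le> C1\<^sup>2 * p\<^sup>2"
      using N_nonneg[OF D] N_le[OF D D] complex_Re_le_cmod[of "N (v p) (v p)"] vsq by (auto simp: nv_def)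
    have Bw: "Re (B (w p) (w p)) = 2 * Re (B (v p) u0) + Re (B (v p) (v p))"
      using u0 D B_u0 B.herm[of "v p" u0] by (simp add: w_def B.lin B.lin_right A.lc_closed)
    have b1: "\<bar>Re (B (v p) u0) - k0 * p\<bar> \<le> C2 * p\<^sup>2"
    proof -
      have "\<bar>Re (B (v p) u0) / p - k0\<bar> \<le> C2 * \<bar>p\<bar>" using k0[of p] eK[OF p0 False] False p0 by simp
      then have "\<bar>Re (B (v p) u0) / p - k0\<bar> * \<bar>p\<bar> \<le> C2 * \<bar>p\<bar> * \<bar>p\<bar>" by (intro mult_right_mono) auto
      moreover have "\<bar>Re (B (v p) u0) / p - k0\<bar> * \<bar>p\<bar> = \<bar>Re (B (v p) u0) - k0 * p\<bar>"
        using False by (simp add: abs_mult[symmetric] left_diff_distrib)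
      ultimately show ?thesis by (simp add: power2_eq_square mult.assoc)
    qed
    have b2: "\<bar>Re (B (v p) (v p))\<bar> \<le> 2 * C1\<^sup>2 * p\<^sup>2"
      using B_le[OF D D] abs_Re_le_cmod[of "B (v p) (v p)"] vsq by simp
    have b3: "\<bar>2 * k0 * p * nv\<bar> \<le> 2 * \<bar>k0\<bar> * C1\<^sup>2 * p\<^sup>2"
    proof -
      have "\<bar>2 * k0 * p * nv\<bar> = (2 * \<bar>k0\<bar>) * (\<bar>p\<bar> * nv)" using nv by (simp add: abs_mult)
      also have "\<dots> \<le> (2 * \<bar>k0\<bar>) * (1 * (C1\<^sup>2 * p\<^sup>2))"
        using nv p0 d0 by (intro mult_left_mono mult_mono) auto
      finally show ?thesis by simp
    qed
    have quot: "e' p - 2 * k0 * p = (Re (B (w p) (w p)) - 2 * k0 * p * n) / n"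
      using n1 nv by (simp add: e'_def n_def[symmetric] field_simps)
    have "\<bar>e' p - 2 * k0 * p\<bar> \<le> \<bar>Re (B (w p) (w p)) - 2 * k0 * p * n\<bar> / 1"
      unfolding quot abs_divide using n1 nv by (intro divide_left_mono) auto
    also have "\<dots> = \<bar>2 * (Re (B (v p) u0) - k0 * p) + Re (B (v p) (v p)) - 2 * k0 * p * nv\<bar>"
      unfolding Bw n1 by (simp add: algebra_simps)
    also have "\<dots> \<le> 2 * (C2 * p\<^sup>2) + 2 * C1\<^sup>2 * p\<^sup>2 + 2 * \<bar>k0\<bar> * C1\<^sup>2 * p\<^sup>2"
    proof -
      have "\<bar>2 * x + y - z\<bar> \<le> 2 * a + b + c" if "\<bar>x\<bar> \<le> a" "\<bar>y\<bar> \<le> b" "\<bar>z\<bar> \<le> c" for x y z a b c :: real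
        using that by linarith
      from this[OF b1 b2 b3] show ?thesis .
    qed
    also have "\<dots> = C5 * p\<^sup>2" by (simp add: C5_def algebra_simps)
    finally show ?thesis .
  qed
  define M where "M = C5 + C2"
  have C5: "0 \<le> C5" using C2 by (simp add: C5_def)
  show ?thesis
  proof (rule exI[of _ "1 + k0"], rule exI[of _ d], rule exI[of _ M], rule exI[of _ "\<lambda>p. e' p + 2 * p"],
      intro conjI allI impI)
    show "0 < d" by (rule d)
    show "0 < 1 + k0" using kpos c by simp
    fix p assume p: "\<bar>p\<bar> < d"
    have Ee: "E = (\<lambda>p. e p + p\<^sup>2 + E 0)" by (auto simp: e_def)
    show "(E has_real_derivative e' p + 2 * p) (at p)"
      by (subst Ee) (auto intro!: derivative_eq_intros der[OF p])
    have "C5 * p\<^sup>2 \<le> M * p\<^sup>2" using C2 by (intro mult_right_mono) (auto simp: M_def)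
    then show "\<bar>e' p + 2 * p - 2 * (1 + k0) * p\<bar> \<le> M * p\<^sup>2"
      using e'b[OF p] by (simp add: algebra_simps)
    have "C2 * \<bar>p\<bar> ^ 3 \<le> M * \<bar>p\<bar> ^ 3" using C5 by (intro mult_right_mono) (auto simp: M_def)
    then show "\<bar>E p - E 0 - (1 + k0) * p\<^sup>2\<bar> \<le> M * \<bar>p\<bar> ^ 3"
      using ek[of p] p d by (simp add: e_def algebra_simps)
  qed
qed

end

section \<open>The space \<open>L\<^sup>2\<close>\<close>

text \<open>The concrete instance of the linear combinations in the theory of forms above. The difference
\<open>u - v\<close> appears throughout as \<open>lcf 1 u (-1) v\<close>.\<close>

definition lcf :: "complex \<Rightarrow> ('a \<Rightarrow> complex) \<Rightarrow> complex \<Rightarrow> ('a \<Rightarrow> complex) \<Rightarrow> 'a \<Rightarrow> complex" where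
  "lcf a u b v = (\<lambda>x. a * u x + b * v x)"

definition sqnorm :: "(real^2) set \<Rightarrow> (real^2 \<Rightarrow> complex) \<Rightarrow> real" where
  "sqnorm \<Omega> u = (LINT x|lebesgue_on \<Omega>. (cmod (u x))\<^sup>2)"

lemma sqnorm_inner: "L2_inner \<Omega> u u = of_real (sqnorm \<Omega> u)" "Re (L2_inner \<Omega> u u) = sqnorm \<Omega> u"
proof -
  show "L2_inner \<Omega> u u = of_real (sqnorm \<Omega> u)"
    unfolding L2_inner_def sqnorm_def complex_norm_square[symmetric] by (simp only: integral_complex_of_real)
  then show "Re (L2_inner \<Omega> u u) = sqnorm \<Omega> u" by simp
qed

lemma sqnorm_nonneg: "0 \<le> sqnorm \<Omega> u"
  unfolding sqnorm_def by simp

lemma borel_measurable_cnj [measurable]: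
  "f \<in> borel_measurable M \<Longrightarrow> (\<lambda>x. cnj (f x)) \<in> borel_measurable M"
  by (rule measurable_compose[OF _ borel_measurable_continuous_onI[OF continuous_on_cnj[OF continuous_on_id]]])

lemma L2I: "u \<in> borel_measurable (lebesgue_on \<Omega>) \<Longrightarrow> integrable (lebesgue_on \<Omega>) (\<lambda>x. (cmod (u x))\<^sup>2) \<Longrightarrow> u \<in> L2 \<Omega>"
  by (simp add: L2_def)

lemma L2_measurable: "u \<in> L2 \<Omega> \<Longrightarrow> u \<in> borel_measurable (lebesgue_on \<Omega>)"
  and L2_integrable_sq: "u \<in> L2 \<Omega> \<Longrightarrow> integrable (lebesgue_on \<Omega>) (\<lambda>x. (cmod (u x))\<^sup>2)"
  by (simp_all add: L2_def)

lemma L2_dominated: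
  assumes "f \<in> L2 \<Omega>" "u \<in> borel_measurable (lebesgue_on \<Omega>)" "\<And>x. x \<in> \<Omega> \<Longrightarrow> cmod (u x) \<le> C * cmod (f x)"
  shows "u \<in> L2 \<Omega>"
proof (rule L2I[OF assms(2)])
  show "integrable (lebesgue_on \<Omega>) (\<lambda>x. (cmod (u x))\<^sup>2)"
  proof (rule Bochner_Integration.integrable_bound)
    show "integrable (lebesgue_on \<Omega>) (\<lambda>x. C\<^sup>2 * (cmod (f x))\<^sup>2)"
      using L2_integrable_sq[OF assms(1)] by simp
    show "AE x in lebesgue_on \<Omega>. norm ((cmod (u x))\<^sup>2) \<le> norm (C\<^sup>2 * (cmod (f x))\<^sup>2)"
      using power_mono[OF assms(3) norm_ge_zero, of _ 2] by (intro AE_I2) (simp add: power_mult_distrib)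
  qed (use assms(2) in measurable)
qed

lemma L2_mult_integrable:
  assumes "u \<in> L2 \<Omega>" "v \<in> L2 \<Omega>"
  shows "integrable (lebesgue_on \<Omega>) (\<lambda>x. u x * v x)" "integrable (lebesgue_on \<Omega>) (\<lambda>x. u x * cnj (v x))"
proof -
  note m = L2_measurable[OF assms(1)] L2_measurable[OF assms(2)]
  have i: "integrable (lebesgue_on \<Omega>) (\<lambda>x. (cmod (u x))\<^sup>2 + (cmod (v x))\<^sup>2)"
    using L2_integrable_sq assms by auto
  have b: "cmod a * cmod b \<le> (cmod a)\<^sup>2 + (cmod b)\<^sup>2" for a b
    using sum_squares_bound[of "cmod a" "cmod b"] zero_le_power2[of "cmod a"] zero_le_power2[of "cmod b"]
      mult_nonneg_nonneg[OF norm_ge_zero[of a] norm_ge_zero[of b]] by linarith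
  show "integrable (lebesgue_on \<Omega>) (\<lambda>x. u x * v x)"
    by (rule Bochner_Integration.integrable_bound[OF i]) (use m b in \<open>auto simp: norm_mult\<close>)
  show "integrable (lebesgue_on \<Omega>) (\<lambda>x. u x * cnj (v x))"
    by (rule Bochner_Integration.integrable_bound[OF i]) (use m b in \<open>auto simp: norm_mult\<close>)
qed

lemma cmod_lcf_sq: "(cmod (lcf a u b v x))\<^sup>2 \<le> 2 * (cmod a)\<^sup>2 * (cmod (u x))\<^sup>2 + 2 * (cmod b)\<^sup>2 * (cmod (v x))\<^sup>2"
proof -
  have "cmod (lcf a u b v x) \<le> cmod a * cmod (u x) + cmod b * cmod (v x)"
    unfolding lcf_def using norm_triangle_ineq[of "a * u x" "b * v x"] by (simp add: norm_mult)
  then have "(cmod (lcf a u b v x))\<^sup>2 \<le> (cmod a * cmod (u x) + cmod b * cmod (v x))\<^sup>2"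
    by (intro power_mono) auto
  also have "\<dots> \<le> 2 * (cmod a * cmod (u x))\<^sup>2 + 2 * (cmod b * cmod (v x))\<^sup>2"
    using sum_squares_bound[of "cmod a * cmod (u x)" "cmod b * cmod (v x)"] by (simp add: power2_sum)
  finally show ?thesis by (simp add: power_mult_distrib)
qed

lemma L2_lcf:
  assumes "u \<in> L2 \<Omega>" "v \<in> L2 \<Omega>"
  shows "lcf a u b v \<in> L2 \<Omega>"
proof (rule L2I)
  note [measurable] = L2_measurable[OF assms(1)] L2_measurable[OF assms(2)]
  show m[measurable]: "lcf a u b v \<in> borel_measurable (lebesgue_on \<Omega>)"
    unfolding lcf_def by measurable
  show "integrable (lebesgue_on \<Omega>) (\<lambda>x. (cmod (lcf a u b v x))\<^sup>2)"
  proof (rule Bochner_Integration.integrable_bound)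
    show "integrable (lebesgue_on \<Omega>) (\<lambda>x. 2 * (cmod a)\<^sup>2 * (cmod (u x))\<^sup>2 + 2 * (cmod b)\<^sup>2 * (cmod (v x))\<^sup>2)"
      using L2_integrable_sq assms by auto
  qed (use cmod_lcf_sq[of a u b v] in auto)
qed

lemma L2_form: "hermitian_form (L2 \<Omega>) lcf (L2_inner \<Omega>)"
proof
  fix u v w a b assume uvw: "u \<in> L2 \<Omega>" "v \<in> L2 \<Omega>" "w \<in> L2 \<Omega>"
  show "L2_inner \<Omega> (lcf a u b v) w = a * L2_inner \<Omega> u w + b * L2_inner \<Omega> v w"
    unfolding L2_inner_def lcf_def distrib_right mult.assoc
    using L2_mult_integrable(2) uvw by (subst Bochner_Integration.integral_add) auto
next
  fix u v assume "u \<in> L2 \<Omega>" "v \<in> L2 \<Omega>"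
  show "L2_inner \<Omega> v u = cnj (L2_inner \<Omega> u v)"
    unfolding L2_inner_def by (subst Bochner_Integration.integral_cnj[symmetric]) (simp add: mult.commute)
qed (rule L2_lcf)

interpretation L2: hermitian_form "L2 \<Omega>" lcf "L2_inner \<Omega>" for \<Omega> by (rule L2_form)

lemma L2_Cauchy_Schwarz:
  assumes "u \<in> L2 \<Omega>" "v \<in> L2 \<Omega>"
  shows "cmod (L2_inner \<Omega> u v) \<le> sqrt (sqnorm \<Omega> u) * sqrt (sqnorm \<Omega> v)"
  using L2.Cauchy_Schwarz[OF _ assms] sqnorm_nonneg
  by (simp add: sqnorm_inner(2) real_le_rsqrt flip: real_sqrt_mult)

lemma sqnorm_lcf_le:
  assumes "u \<in> L2 \<Omega>" "v \<in> L2 \<Omega>"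
  shows "sqnorm \<Omega> (lcf a u b v) \<le> 2 * (cmod a)\<^sup>2 * sqnorm \<Omega> u + 2 * (cmod b)\<^sup>2 * sqnorm \<Omega> v"
proof -
  have "sqnorm \<Omega> (lcf a u b v) \<le> (LINT x|lebesgue_on \<Omega>. 2 * (cmod a)\<^sup>2 * (cmod (u x))\<^sup>2 + 2 * (cmod b)\<^sup>2 * (cmod (v x))\<^sup>2)"
    unfolding sqnorm_def using L2_integrable_sq assms L2_lcf
    by (intro Bochner_Integration.integral_mono cmod_lcf_sq) auto
  also have "\<dots> = 2 * (cmod a)\<^sup>2 * sqnorm \<Omega> u + 2 * (cmod b)\<^sup>2 * sqnorm \<Omega> v"
    using L2_integrable_sq assms by (simp add: sqnorm_def)
  finally show ?thesis .
qed

lemma sqnorm_triangle: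
  assumes "u \<in> L2 \<Omega>" "v \<in> L2 \<Omega>" "w \<in> L2 \<Omega>"
  shows "sqnorm \<Omega> (lcf 1 u (-1) w) \<le> 2 * sqnorm \<Omega> (lcf 1 u (-1) v) + 2 * sqnorm \<Omega> (lcf 1 v (-1) w)"
proof -
  have "lcf 1 u (-1) w = lcf 1 (lcf 1 u (-1) v) 1 (lcf 1 v (-1) w)" by (auto simp: lcf_def)
  then show ?thesis using sqnorm_lcf_le[where a = 1 and b = 1, OF L2_lcf[where a = 1 and b = "-1", OF assms(1,2)]
      L2_lcf[where a = 1 and b = "-1", OF assms(2,3)]] by simp
qed

lemma L2_inner_cong_AE:
  assumes "AE x in lebesgue_on \<Omega>. u x = u' x" "AE x in lebesgue_on \<Omega>. v x = v' x"
    and "u \<in> L2 \<Omega>" "u' \<in> L2 \<Omega>" "v \<in> L2 \<Omega>" "v' \<in> L2 \<Omega>"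
  shows "L2_inner \<Omega> u v = L2_inner \<Omega> u' v'"
proof -
  note [measurable] = assms(3-)[THEN L2_measurable]
  have "AE x in lebesgue_on \<Omega>. u x * cnj (v x) = u' x * cnj (v' x)" using assms(1,2) by eventually_elim simp
  then show ?thesis unfolding L2_inner_def by (intro integral_cong_AE) auto
qed

lemma sqnorm_cong_AE:
  assumes "AE x in lebesgue_on \<Omega>. u x = u' x" "u \<in> L2 \<Omega>" "u' \<in> L2 \<Omega>"
  shows "sqnorm \<Omega> u = sqnorm \<Omega> u'"
  using L2_inner_cong_AE[OF assms(1) assms(1) assms(2,3,2,3)] by (simp add: sqnorm_inner(1))

lemma sqnorm_eq_0: "u \<in> L2 \<Omega> \<Longrightarrow> sqnorm \<Omega> u = 0 \<longleftrightarrow> (AE x in lebesgue_on \<Omega>. u x = 0)"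
  unfolding sqnorm_def using integral_nonneg_eq_0_iff_AE[OF L2_integrable_sq[of u \<Omega>]] by simp

lemma L2_cnj: "u \<in> L2 \<Omega> \<Longrightarrow> (\<lambda>x. cnj (u x)) \<in> L2 \<Omega>"
  by (rule L2_dominated[where f = u and C = 1]) (auto dest: L2_measurable)

lemma L2_inner_tendsto:
  assumes "\<And>n. s n \<in> L2 \<Omega>" "u \<in> L2 \<Omega>" "v \<in> L2 \<Omega>" "(\<lambda>n. sqnorm \<Omega> (lcf 1 (s n) (-1) u)) \<longlonglongrightarrow> 0"
  shows "(\<lambda>n. L2_inner \<Omega> (s n) v) \<longlonglongrightarrow> L2_inner \<Omega> u v"
proof -
  have "(\<lambda>n. L2_inner \<Omega> (lcf 1 (s n) (-1) u) v) \<longlonglongrightarrow> 0"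
  proof (rule Lim_null_comparison)
    show "\<forall>\<^sub>F n in sequentially. norm (L2_inner \<Omega> (lcf 1 (s n) (-1) u) v) \<le> sqrt (sqnorm \<Omega> (lcf 1 (s n) (-1) u)) * sqrt (sqnorm \<Omega> v)"
      using L2_Cauchy_Schwarz L2_lcf assms by auto
    show "(\<lambda>n. sqrt (sqnorm \<Omega> (lcf 1 (s n) (-1) u)) * sqrt (sqnorm \<Omega> v)) \<longlonglongrightarrow> 0"
      using tendsto_mult[OF tendsto_real_sqrt[OF assms(4)] tendsto_const] by fastforce
  qed
  then show ?thesis using assms by (simp add: L2.lin LIM_zero_iff)
qed

lemma sqnorm_tendsto:
  assumes "\<And>n. s n \<in> L2 \<Omega>" "u \<in> L2 \<Omega>" "(\<lambda>n. sqnorm \<Omega> (lcf 1 (s n) (-1) u)) \<longlonglongrightarrow> 0"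
  shows "(\<lambda>n. sqnorm \<Omega> (s n)) \<longlonglongrightarrow> sqnorm \<Omega> u"
proof -
  have e: "sqnorm \<Omega> (s n) = sqnorm \<Omega> (lcf 1 (s n) (-1) u) + 2 * Re (L2_inner \<Omega> (s n) u) - sqnorm \<Omega> u" for n
    using L2.diag_lc[OF assms(1)[of n] assms(2), of 1 "-1"] by (simp add: sqnorm_inner(2))
  have "(\<lambda>n. sqnorm \<Omega> (s n)) \<longlonglongrightarrow> 0 + 2 * Re (L2_inner \<Omega> u u) - sqnorm \<Omega> u"
    unfolding e by (intro tendsto_intros assms(3) L2_inner_tendsto[OF assms(1,2,2,3)])
  then show ?thesis by (simp add: sqnorm_inner(2))
qed

locale bounded_open =
  fixes \<Omega> :: "(real^2) set"
  assumes op: "open \<Omega>" and bd: "bounded \<Omega>"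
begin

abbreviation "M \<equiv> lebesgue_on \<Omega>"

lemma sets_Omega [measurable]: "\<Omega> \<in> sets lebesgue" using op by simp

lemma finite_M: "finite_measure M"
proof
  have "emeasure lebesgue \<Omega> < \<infinity>" using bd op by (metis bounded_set_imp_lmeasurable fmeasurableD2 lmeasurable_open top.not_eq_extremum infinity_ennreal_def)
  then show "emeasure M (space M) \<noteq> \<infinity>" by (simp add: emeasure_restrict_space)
qed

sublocale M: finite_measure M by (rule finite_M)

lemma L2_bounded:
  assumes "u \<in> borel_measurable M" "\<And>x. x \<in> \<Omega> \<Longrightarrow> cmod (u x) \<le> C" shows "u \<in> L2 \<Omega>"
proof (rule L2I[OF assms(1)])
  note [measurable] = assms(1)
  show "integrable M (\<lambda>x. (cmod (u x))\<^sup>2)"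
    by (rule M.integrable_const_bound[of _ "C\<^sup>2"])
      (use assms(2) in \<open>auto intro!: AE_I2 power_mono\<close>)
qed

lemma L2_const: "(\<lambda>x. c) \<in> L2 \<Omega>" by (rule L2_bounded[where C = "cmod c"]) auto

lemma L2_integrable: "u \<in> L2 \<Omega> \<Longrightarrow> integrable M u"
  using L2_mult_integrable(1)[OF _ L2_const[of 1], of u] by simp

text \<open>The Riesz-Fischer theorem. A subsequence with summable consecutive distances has integrable total
variation, since the measure is finite, so it converges almost everywhere; by Fatou's lemma the
limit is the limit in mean square of the whole sequence.\<close>

lemma L2_complete:
  assumes s: "\<And>n. s n \<in> L2 \<Omega>"
    and C: "\<And>e. e > 0 \<Longrightarrow> \<exists>K. \<forall>m\<ge>K. \<forall>n\<ge>K. sqnorm \<Omega> (lcf 1 (s m) (-1) (s n)) < e"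
  shows "\<exists>u\<in>L2 \<Omega>. (\<lambda>n. sqnorm \<Omega> (lcf 1 (s n) (-1) u)) \<longlonglongrightarrow> 0"
proof -
  note [measurable] = s[THEN L2_measurable]
  have "\<exists>K. \<forall>m\<ge>K. \<forall>n\<ge>K. sqnorm \<Omega> (lcf 1 (s m) (-1) (s n)) < (1/4) ^ k" for k :: nat by (rule C) simp
  then obtain r0 where r0: "\<And>k m n. m \<ge> r0 k \<Longrightarrow> n \<ge> r0 k \<Longrightarrow> sqnorm \<Omega> (lcf 1 (s m) (-1) (s n)) < (1/4) ^ k" by metis
  \<comment> \<open>summing the thresholds makes them monotone; the squared distance \<open>4\<^sup>-\<^sup>k\<close> is the distance \<open>2\<^sup>-\<^sup>k\<close>\<close>
  define r where "r k = (\<Sum>j\<le>k. r0 j) + k" for k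
  have r_ge: "r0 k \<le> r k" for k unfolding r_def by (intro trans_le_add1 member_le_sum) auto
  have r_mono: "r k \<le> r (Suc k)" for k by (simp add: r_def)
  have r_k: "k \<le> r k" for k by (simp add: r_def)
  define d where "d k x = cmod (s (r (Suc k)) x - s (r k) x)" for k x
  define c where "c = sqrt (sqnorm \<Omega> (\<lambda>x. 1))"
  have dL2: "(\<lambda>x. complex_of_real (d k x)) \<in> L2 \<Omega>" for k
    by (rule L2_dominated[OF L2_lcf[OF s s], where C = 1 and a1 = 1 and b1 = "-1"])
      (auto simp: d_def lcf_def)
  have dint: "(LINT x|M. d k x) \<le> c * (1/2) ^ k" and dI: "integrable M (d k)" for k
  proof -
    have "sqnorm \<Omega> (\<lambda>x. complex_of_real (d k x)) = sqnorm \<Omega> (lcf 1 (s (r (Suc k))) (-1) (s (r k)))"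
      by (simp add: sqnorm_def d_def lcf_def)
    also have "\<dots> \<le> ((1/2) ^ k)\<^sup>2"
      using r0[of k "r (Suc k)" "r k"] r_ge[of k] r_mono[of k] by (simp add: power2_eq_square flip: power_mult_distrib)
    finally have "sqrt (sqnorm \<Omega> (\<lambda>x. complex_of_real (d k x))) \<le> (1/2) ^ k" by (simp add: real_le_lsqrt)
    then have "sqrt (sqnorm \<Omega> (\<lambda>x. complex_of_real (d k x))) * c \<le> (1/2) ^ k * c"
      by (rule mult_right_mono) (simp add: c_def sqnorm_nonneg)
    moreover have "L2_inner \<Omega> (\<lambda>x. complex_of_real (d k x)) (\<lambda>x. 1) = of_real (LINT x|M. d k x)"
      by (simp add: L2_inner_def)
    ultimately show "(LINT x|M. d k x) \<le> c * (1/2) ^ k"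
      using L2_Cauchy_Schwarz[OF dL2[of k] L2_const[of 1]] by (simp add: c_def mult.commute)
    show "integrable M (d k)" using integrable_norm[OF L2_integrable[OF dL2[of k]]] by (simp add: d_def[abs_def])
  qed
  have dm[measurable]: "d k \<in> borel_measurable M" for k using dI by (rule borel_measurable_integrable)
  have c0: "0 \<le> c" by (simp add: c_def sqnorm_nonneg)
  have "(\<integral>\<^sup>+x. (\<Sum>k. ennreal (d k x)) \<partial>M) = (\<Sum>k. \<integral>\<^sup>+x. ennreal (d k x) \<partial>M)"
    by (rule nn_integral_suminf) measurable
  also have "\<dots> \<le> (\<Sum>k. ennreal (c * (1/2) ^ k))"
  proof (rule suminf_le)
    show "(\<integral>\<^sup>+x. ennreal (d k x) \<partial>M) \<le> ennreal (c * (1/2) ^ k)" for k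
    proof (subst nn_integral_eq_integral[OF dI])
      show "AE x in M. 0 \<le> d k x" by (simp add: d_def)
      show "ennreal (LINT x|M. d k x) \<le> ennreal (c * (1/2) ^ k)" by (rule ennreal_leI[OF dint])
    qed
  qed auto
  also have "\<dots> = ennreal (\<Sum>k. c * (1/2) ^ k)"
    by (rule suminf_ennreal2) (use c0 in \<open>auto intro!: summable_mult summable_geometric\<close>)
  finally have fin: "(\<integral>\<^sup>+x. (\<Sum>k. ennreal (d k x)) \<partial>M) \<noteq> \<infinity>" by (auto simp: top_unique)
  have "AE x in M. (\<Sum>k. ennreal (d k x)) \<noteq> \<infinity>"
    by (rule nn_integral_PInf_AE[OF _ fin]) measurable
  then have conv: "AE x in M. (\<lambda>k. s (r k) x) \<longlonglongrightarrow> lim (\<lambda>k. s (r k) x)"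
  proof eventually_elim
    case (elim x)
    have "summable (\<lambda>k. d k x)" by (rule summable_suminf_not_top) (use elim in \<open>auto simp: d_def\<close>)
    then have "summable (\<lambda>k. s (r (Suc k)) x - s (r k) x)"
      unfolding d_def by (rule summable_norm_cancel)
    then have "convergent (\<lambda>k. s (r k) x - s (r 0) x)"
      using sum_lessThan_telescope[of "\<lambda>k. s (r k) x"] by (simp add: summable_iff_convergent)
    then have "convergent (\<lambda>k. s (r k) x)" by (simp add: convergent_diff_const_right_iff)
    then show ?case by (simp add: convergent_LIMSEQ_iff)
  qed
  define u where "u x = lim (\<lambda>k. s (r k) x)" for x
  have um[measurable]: "u \<in> borel_measurable M" unfolding u_def by measurable
  have key: "(\<integral>\<^sup>+x. ennreal ((cmod (lcf 1 (s n) (-1) u x))\<^sup>2) \<partial>M) \<le> ennreal e"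
    if K: "\<And>m n. m \<ge> K \<Longrightarrow> n \<ge> K \<Longrightarrow> sqnorm \<Omega> (lcf 1 (s m) (-1) (s n)) < e" and n: "n \<ge> K" for K n e
  proof -
    have "(\<integral>\<^sup>+x. ennreal ((cmod (lcf 1 (s n) (-1) u x))\<^sup>2) \<partial>M)
        = (\<integral>\<^sup>+x. liminf (\<lambda>k. ennreal ((cmod (lcf 1 (s n) (-1) (s (r k)) x))\<^sup>2)) \<partial>M)"
    proof (rule nn_integral_cong_AE)
      show "AE x in M. ennreal ((cmod (lcf 1 (s n) (-1) u x))\<^sup>2) = liminf (\<lambda>k. ennreal ((cmod (lcf 1 (s n) (-1) (s (r k)) x))\<^sup>2))"
        using conv
      proof eventually_elim
        case (elim x)
        have "(\<lambda>k. ennreal ((cmod (lcf 1 (s n) (-1) (s (r k)) x))\<^sup>2)) \<longlonglongrightarrow> ennreal ((cmod (lcf 1 (s n) (-1) u x))\<^sup>2)"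
          unfolding lcf_def u_def by (intro tendsto_intros tendsto_ennrealI elim)
        then show ?case by (metis lim_imp_Liminf trivial_limit_sequentially)
      qed
    qed
    also have "\<dots> \<le> liminf (\<lambda>k. \<integral>\<^sup>+x. ennreal ((cmod (lcf 1 (s n) (-1) (s (r k)) x))\<^sup>2) \<partial>M)"
      by (rule nn_integral_liminf) (simp add: lcf_def)
    also have "\<dots> \<le> liminf (\<lambda>k. ennreal e)"
    proof (rule Liminf_mono)
      show "\<forall>\<^sub>F k in sequentially. (\<integral>\<^sup>+x. ennreal ((cmod (lcf 1 (s n) (-1) (s (r k)) x))\<^sup>2) \<partial>M) \<le> ennreal e"
        using eventually_ge_at_top[of K]
      proof eventually_elim
        case (elim k)
        have "sqnorm \<Omega> (lcf 1 (s n) (-1) (s (r k))) < e" using K[OF n, of "r k"] r_k[of k] elim by simp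
        then show ?case
          using nn_integral_eq_integral[OF L2_integrable_sq[OF L2_lcf[where a = 1 and b = "-1", OF s[of n] s[of "r k"]]]]
          by (simp add: sqnorm_def ennreal_leI)
      qed
    qed
    also have "\<dots> = ennreal e" by (simp add: Liminf_const)
    finally show ?thesis .
  qed
  have dL: "lcf 1 (s n) (-1) u \<in> L2 \<Omega>" if K: "\<And>m n. m \<ge> K \<Longrightarrow> n \<ge> K \<Longrightarrow> sqnorm \<Omega> (lcf 1 (s m) (-1) (s n)) < e" and n: "n \<ge> K" for K n e
  proof (rule L2I)
    show "lcf 1 (s n) (-1) u \<in> borel_measurable M" unfolding lcf_def by measurable
    then show "integrable M (\<lambda>x. (cmod (lcf 1 (s n) (-1) u x))\<^sup>2)"
      using key[OF K n] by (intro integrableI_bounded) (auto simp: top_unique intro: le_less_trans)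
  qed
  obtain K1 where K1: "\<And>m n. m \<ge> K1 \<Longrightarrow> n \<ge> K1 \<Longrightarrow> sqnorm \<Omega> (lcf 1 (s m) (-1) (s n)) < 1" using C[of 1] by auto
  have "u = lcf 1 (s K1) (-1) (lcf 1 (s K1) (-1) u)" by (auto simp: lcf_def)
  then have uL2: "u \<in> L2 \<Omega>" using L2_lcf[OF s dL[OF K1]] by (metis order_refl)
  have "(\<lambda>n. sqnorm \<Omega> (lcf 1 (s n) (-1) u)) \<longlonglongrightarrow> 0"
  proof (rule LIMSEQ_I)
    fix e :: real assume e: "e > 0"
    then obtain K where K: "\<And>m n. m \<ge> K \<Longrightarrow> n \<ge> K \<Longrightarrow> sqnorm \<Omega> (lcf 1 (s m) (-1) (s n)) < e / 2" using C[of "e/2"] by auto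
    have le: "sqnorm \<Omega> (lcf 1 (s n) (-1) u) \<le> e / 2" if n: "n \<ge> K" for n
      using key[OF K n] nn_integral_eq_integral[OF L2_integrable_sq[OF dL[OF K n]]] e
      by (simp add: sqnorm_def)
    show "\<exists>K. \<forall>n\<ge>K. norm (sqnorm \<Omega> (lcf 1 (s n) (-1) u) - 0) < e"
    proof (intro exI[of _ K] allI impI)
      fix n assume "n \<ge> K"
      from le[OF this] show "norm (sqnorm \<Omega> (lcf 1 (s n) (-1) u) - 0) < e"
        using e sqnorm_nonneg[of \<Omega> "lcf 1 (s n) (-1) u"] by simp
    qed
  qed
  then show ?thesis using uL2 by blast
qed

end

context bounded_open begin

section \<open>Weak derivatives\<close>

text \<open>Test functions live on the whole plane, so their integrals can be moved between the domain with
Lebesgue measure and the plane with Borel measure, where Fubini's theorem and translation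
invariance are available.\<close>

lemma test_integral:
  assumes f: "f \<in> test_functions \<Omega>"
  shows "integrable lborel f" "(LINT x|M. f x) = (LINT x|lborel. f x)" "f \<in> borel_measurable borel"
    "integrable M f"
proof -
  let ?K = "closure {x. f x \<noteq> 0}"
  have "integrable lborel (\<lambda>x. indicator ?K x *\<^sub>R f x)"
    by (rule borel_integrable_compact) (use test_functionsD[OF f] in \<open>auto intro: continuous_on_subset\<close>)
  also have "(\<lambda>x. indicator ?K x *\<^sub>R f x) = f"
    using closure_subset[of "{x. f x \<noteq> 0}"] by (auto simp: indicator_def fun_eq_iff)
  finally show i: "integrable lborel f" .
  then show b: "f \<in> borel_measurable borel" using borel_measurable_integrable by fastforce
  have e: "(\<lambda>x. if x \<in> \<Omega> then f x else 0) = f" using test_functionsD(4)[OF f] by auto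
  have "(LINT x|M. f x) = (LINT x|lebesgue. f x)"
    using Lebesgue_Measure.integral_restrict_UNIV[OF sets_Omega, of f] unfolding e by simp
  then show "(LINT x|M. f x) = (LINT x|lborel. f x)" using b by (simp add: integral_completion)
  have "integrable lebesgue f" using i b by (simp add: integrable_completion)
  then show "integrable M f" using Lebesgue_Measure.integrable_restrict_UNIV[OF sets_Omega, of f] unfolding e by simp
qed

lemma borel_measurable_M: "f \<in> borel_measurable borel \<Longrightarrow> f \<in> borel_measurable M"
  by (intro measurable_restrict_space1 measurable_completion) simp

lemma test_measurable: "f \<in> test_functions \<Omega> \<Longrightarrow> f \<in> borel_measurable M"
  using borel_measurable_M test_integral(3) by blast

lemma test_bounded:
  assumes "f \<in> test_functions \<Omega>" obtains C where "C \<ge> 0" "\<And>x. cmod (f x) \<le> C"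
proof -
  have "compact (f ` closure {x. f x \<noteq> 0})"
    using test_functionsD[OF assms] by (intro compact_continuous_image) (auto intro: continuous_on_subset)
  then obtain C where C: "C > 0" "\<forall>y\<in>f ` closure {x. f x \<noteq> 0}. norm y \<le> C"
    using compact_imp_bounded bounded_pos by metis
  have "cmod (f x) \<le> C" for x
    using C closure_subset[of "{x. f x \<noteq> 0}"] by (cases "f x = 0") auto
  then show ?thesis using that C by (meson less_imp_le)
qed

lemma test_L2: "f \<in> test_functions \<Omega> \<Longrightarrow> f \<in> L2 \<Omega>"
  by (metis L2_bounded test_bounded test_measurable)

text \<open>By translation invariance every difference quotient of \<open>f\<close> has integral \<open>0\<close>. The quotients are
bounded by the supremum of the derivative and supported in a fixed ball, so dominated convergence
carries this over to the derivative.\<close>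

lemma integral_pderiv_test:
  assumes f: "f \<in> test_functions \<Omega>"
  shows "(LINT x|M. pderiv_classical i f x) = 0"
proof -
  define e :: "real^2" where "e = axis i 1"
  have ne: "norm e = 1" by (simp add: e_def)
  define g where "g = pderiv_classical i f"
  have g: "g \<in> test_functions \<Omega>" unfolding g_def by (rule pderiv_classical_test_function[OF f])
  obtain C where C: "C \<ge> 0" "\<And>x. cmod (g x) \<le> C" using test_bounded[OF g] by blast
  obtain R where R: "\<And>x. x \<in> \<Omega> \<Longrightarrow> norm x \<le> R" using bd bounded_iff by blast
  define t where "t n = inverse (real (Suc n))" for n
  have t: "0 < t n" "t n \<le> 1" for n by (auto simp: t_def field_simps)
  have t0: "t \<longlonglongrightarrow> 0" unfolding t_def by (rule LIMSEQ_inverse_real_of_nat)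
  define q where "q n x = (f (t n *\<^sub>R e + x) - f x) /\<^sub>R t n" for n x
  have df: "((\<lambda>s. f (x + s *\<^sub>R e)) has_vector_derivative g (x + s *\<^sub>R e)) (at s within S)" for x s S
  proof -
    let ?D = "frechet_derivative f (at (x + s *\<^sub>R e))"
    have D: "(f has_derivative ?D) (at (x + s *\<^sub>R e))" by (rule test_functionsD(3)[OF f])
    have "((\<lambda>s. x + s *\<^sub>R e) has_derivative (\<lambda>h. h *\<^sub>R e)) (at s within S)"
      by (auto intro!: derivative_eq_intros)
    from has_derivative_compose[OF this D]
    have "((\<lambda>s. f (x + s *\<^sub>R e)) has_derivative (\<lambda>h. ?D (h *\<^sub>R e))) (at s within S)" .
    moreover have "?D (h *\<^sub>R e) = h *\<^sub>R g (x + s *\<^sub>R e)" for h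
      using linear_scale[OF has_derivative_linear[OF D]] by (simp add: g_def pderiv_classical_def e_def)
    ultimately show ?thesis by (simp add: has_vector_derivative_def)
  qed
  have qlim: "(\<lambda>n. q n x) \<longlonglongrightarrow> g x" for x
  proof -
    have "((\<lambda>s. f (x + s *\<^sub>R e)) has_vector_derivative g x) (at 0)" using df[of x 0 UNIV] by simp
    then have "((\<lambda>h. norm (f (x + h *\<^sub>R e) - f x - h *\<^sub>R g x) / norm h) \<longlongrightarrow> 0) (at 0)"
      by (simp add: has_vector_derivative_def has_derivative_at)
    moreover have "\<forall>\<^sub>F h in at 0. norm (f (x + h *\<^sub>R e) - f x - h *\<^sub>R g x) / norm h
        = norm ((f (x + h *\<^sub>R e) - f x) /\<^sub>R h - g x)"
    proof (rule eventually_at_filter[THEN iffD2], intro always_eventually allI impI)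
      fix h :: real assume "h \<noteq> 0"
      then have "(f (x + h *\<^sub>R e) - f x) /\<^sub>R h - g x = (f (x + h *\<^sub>R e) - f x - h *\<^sub>R g x) /\<^sub>R h"
        by (simp add: scaleR_diff_right)
      then show "norm (f (x + h *\<^sub>R e) - f x - h *\<^sub>R g x) / norm h
        = norm ((f (x + h *\<^sub>R e) - f x) /\<^sub>R h - g x)" by (simp add: divide_inverse mult.commute)
    qed
    ultimately have "((\<lambda>h. norm ((f (x + h *\<^sub>R e) - f x) /\<^sub>R h - g x)) \<longlongrightarrow> 0) (at 0)"
      by (rule Lim_transform_eventually)
    then have "((\<lambda>h. (f (x + h *\<^sub>R e) - f x) /\<^sub>R h) \<longlongrightarrow> g x) (at 0)"
      by (rule LIM_zero_cancel[OF tendsto_norm_zero_cancel])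
    moreover have "filterlim t (at 0) sequentially"
      using t0 t by (auto simp: filterlim_at intro!: always_eventually) (metis less_irrefl)
    ultimately have "(\<lambda>n. (f (x + t n *\<^sub>R e) - f x) /\<^sub>R t n) \<longlonglongrightarrow> g x" by (rule filterlim_compose)
    then show ?thesis by (simp add: q_def add.commute)
  qed
  have qb: "cmod (q n x) \<le> C * indicator (cball 0 (R + 1)) x" for n x
  proof (cases "norm x \<le> R + 1")
    case True
    have "cmod (f (x + t n *\<^sub>R e) - f (x + 0 *\<^sub>R e)) \<le> C * norm (t n - 0)"
    proof (rule differentiable_bound[of "{0..1}" _ "\<lambda>s h. h *\<^sub>R g (x + s *\<^sub>R e)"])
      show "((\<lambda>s. f (x + s *\<^sub>R e)) has_derivative (\<lambda>h. h *\<^sub>R g (x + s *\<^sub>R e))) (at s within {0..1})" for s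
        using df by (simp add: has_vector_derivative_def)
      show "onorm (\<lambda>h. h *\<^sub>R g (x + s *\<^sub>R e)) \<le> C" for s
        by (rule onorm_bound) (use C in \<open>simp_all add: mult.commute[of C] mult_left_mono\<close>)
    qed (use t[of n] in auto)
    then have "cmod (f (t n *\<^sub>R e + x) - f x) \<le> C * t n" using t[of n] by (simp add: add.commute)
    moreover have "cmod (q n x) = cmod (f (t n *\<^sub>R e + x) - f x) / t n"
      using t[of n] by (simp add: q_def divide_inverse mult.commute)
    ultimately have "cmod (q n x) \<le> C" using t[of n] by (simp add: pos_divide_le_eq)
    then show ?thesis using True by (simp add: indicator_def)
  next
    case False
    have "norm (t n *\<^sub>R e + x) \<ge> norm x - 1"
      using norm_triangle_ineq2[of x "- (t n *\<^sub>R e)"] t[of n] ne by (simp add: add.commute)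
    then have "t n *\<^sub>R e + x \<notin> \<Omega>" "x \<notin> \<Omega>" using False R[of x] R[of "t n *\<^sub>R e + x"] by auto
    then show ?thesis using False test_functionsD(4)[OF f] by (simp add: q_def indicator_def)
  qed
  note fm[measurable] = test_integral(3)[OF f] and gm[measurable] = test_integral(3)[OF g]
  have "(\<lambda>n. LINT x|lborel. q n x) \<longlonglongrightarrow> (LINT x|lborel. g x)"
  proof (rule integral_dominated_convergence[where w = "\<lambda>x. C * indicator (cball 0 (R + 1)) x"])
    show "integrable lborel (\<lambda>x::real^2. C * indicator (cball 0 (R + 1)) x)"
      by (intro integrable_mult_right integrable_real_indicator) (auto intro!: emeasure_bounded_finite[unfolded infinity_ennreal_def])
    show "q n \<in> borel_measurable lborel" for n unfolding q_def by measurable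
  qed (use qlim qb in auto)
  moreover have "(LINT x|lborel. q n x) = 0" for n
  proof -
    have i: "integrable lborel f" by (rule test_integral(1)[OF f])
    have "(LINT x|lborel. f (t n *\<^sub>R e + x)) = (LINT x|distr lborel borel ((+) (t n *\<^sub>R e)). f x)"
      by (subst integral_distr) auto
    then have 1: "(LINT x|lborel. f (t n *\<^sub>R e + x)) = (LINT x|lborel. f x)" by (simp add: lborel_distr_plus)
    have "integrable (distr lborel borel ((+) (t n *\<^sub>R e))) f" using i by (simp add: lborel_distr_plus)
    then have "integrable lborel (\<lambda>x. f (t n *\<^sub>R e + x))" by (subst (asm) integrable_distr_eq) auto
    then show ?thesis using i 1 by (simp add: q_def)
  qed
  ultimately have "(LINT x|lborel. g x) = 0" by (simp add: LIMSEQ_const_iff)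
  then show ?thesis using test_integral(2)[OF g] by (simp add: g_def)
qed

text \<open>Integration by parts: the integral of the derivative of a product of test functions vanishes.\<close>

lemma test_weak_pderiv:
  assumes f: "f \<in> test_functions \<Omega>"
  shows "has_weak_pderiv \<Omega> i f (pderiv_classical i f)"
  unfolding has_weak_pderiv_def
proof
  fix \<phi> assume p: "\<phi> \<in> test_functions \<Omega>"
  have fp: "(\<lambda>x. f x * \<phi> x) \<in> test_functions \<Omega>" by (rule test_functions_mult[OF p test_functionsD(1)[OF f]])
  note d = pderiv_classical_test_function
  have "0 = (LINT x|M. f x * pderiv_classical i \<phi> x + pderiv_classical i f x * \<phi> x)"
    using integral_pderiv_test[OF fp, of i] by (simp add: pderiv_classical_mult[OF f p])
  also have "\<dots> = (LINT x|M. f x * pderiv_classical i \<phi> x) + (LINT x|M. pderiv_classical i f x * \<phi> x)"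
    by (intro Bochner_Integration.integral_add L2_mult_integrable test_L2 f p d)
  finally show "(LINT x|M. f x * pderiv_classical i \<phi> x) = - (LINT x|M. pderiv_classical i f x * \<phi> x)"
    by (simp add: eq_neg_iff_add_eq_0)
qed

text \<open>Box bumps converge to indicators, so \<open>g\<close> has integral \<open>0\<close> over every closed box inside the domain,
and Lebesgue's differentiation theorem recovers \<open>g\<close> from its averages over small boxes.\<close>

lemma fundamental_lemma:
  assumes g: "g \<in> L2 \<Omega>" and z: "\<And>\<phi>. \<phi> \<in> test_functions \<Omega> \<Longrightarrow> (LINT x|M. g x * \<phi> x) = 0"
  shows "AE x in M. g x = 0"
proof -
  note gm[measurable] = L2_measurable[OF g]
  define G where "G x = (if x \<in> \<Omega> then g x else 0)" for x
  have gi: "integrable M g" by (rule L2_integrable[OF g])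
  have Gi: "integrable lebesgue G"
    using gi Lebesgue_Measure.integrable_restrict_UNIV[OF sets_Omega, of g] by (simp add: G_def[abs_def])
  have box0: "integral (cbox a b) G = 0" if ab: "cbox a b \<subseteq> \<Omega>" for a b
  proof -
    have "(\<lambda>m. LINT x|M. g x * of_real (box_bump m a b x)) \<longlonglongrightarrow> (LINT x|M. g x * of_real (indicat_real (box a b) x))"
    proof (rule integral_dominated_convergence[where w = "\<lambda>x. cmod (g x)"])
      show "AE x in M. (\<lambda>m. g x * of_real (box_bump m a b x)) \<longlonglongrightarrow> g x * of_real (indicat_real (box a b) x)"
        by (intro AE_I2 tendsto_intros box_bump_tendsto)
      show "AE x in M. norm (g x * of_real (box_bump m a b x)) \<le> cmod (g x)" for m
        using box_bump_bounds[of m a b] by (intro AE_I2) (simp add: norm_mult mult_left_le)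
      show "(\<lambda>x. g x * of_real (box_bump m a b x)) \<in> borel_measurable M" for m
        using test_measurable[OF box_bump_test_function[OF ab, of m]] gm by (rule borel_measurable_times[rotated])
      have "indicat_real (box a b) \<in> borel_measurable M" by (rule borel_measurable_M) simp
      then show "(\<lambda>x. g x * of_real (indicat_real (box a b) x)) \<in> borel_measurable M" by measurable
    qed (use gi in auto)
    moreover have "(LINT x|M. g x * of_real (box_bump m a b x)) = 0" for m
      by (rule z[OF box_bump_test_function[OF ab]])
    ultimately have "(LINT x|M. g x * of_real (indicat_real (box a b) x)) = 0" by (simp add: LIMSEQ_const_iff)
    moreover have "(LINT x|M. g x * of_real (indicat_real (box a b) x)) = (LINT x|lebesgue. (if x \<in> box a b then G x else 0))"
      using box_subset_cbox[of a b] ab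
      by (subst Lebesgue_Measure.integral_restrict_UNIV[OF sets_Omega, symmetric])
        (auto intro!: Bochner_Integration.integral_cong simp: G_def indicator_def)
    moreover have "(LINT x|lebesgue. (if x \<in> box a b then G x else 0)) = (LINT x|lebesgue_on (box a b). G x)"
      by (rule Lebesgue_Measure.integral_restrict_UNIV) simp
    moreover have "(LINT x|lebesgue_on (box a b). G x) = integral (box a b) G"
    proof (rule lebesgue_integral_eq_integral)
      show "integrable (lebesgue_on (box a b)) G"
        using Gi by (subst integrable_restrict_space) (auto intro: integrable_mult_indicator)
    qed simp
    ultimately show ?thesis by (simp add: integral_open_interval)
  qed
  have "G integrable_on cbox a b" for a b
    using integrable_on_lebesgue[OF Gi] integrable_on_subcbox by blast
  then obtain N where N: "negligible N" and Nx: "\<And>x e. \<lbrakk>x \<notin> N; 0 < e\<rbrakk> \<Longrightarrow>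
      \<exists>d>0. \<forall>h. 0 < h \<and> h < d \<longrightarrow> norm (integral (cbox x (x + h *\<^sub>R One)) G /\<^sub>R h ^ DIM(real^2) - G x) < e"
    using integrable_ccontinuous_explicit[of G] by blast
  have zero: "G x = 0" if x: "x \<notin> N" "x \<in> \<Omega>" for x
  proof (rule ccontr)
    assume "G x \<noteq> 0"
    then obtain d where d: "d > 0" "\<And>h. 0 < h \<Longrightarrow> h < d \<Longrightarrow>
        norm (integral (cbox x (x + h *\<^sub>R One)) G /\<^sub>R h ^ DIM(real^2) - G x) < norm (G x)"
      using Nx[OF x(1), of "norm (G x)"] by auto
    obtain r where r: "r > 0" "cball x r \<subseteq> \<Omega>" using op x(2) open_contains_cball by blast
    define h where "h = min (d / 2) (r / 2)"
    have h: "0 < h" "h < d" "2 * h \<le> r" using d r by (auto simp: h_def)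
    have "cbox x (x + h *\<^sub>R One) \<subseteq> cball x r"
    proof
      fix y assume y: "y \<in> cbox x (x + h *\<^sub>R One)"
      have "\<bar>(y - x) \<bullet> b\<bar> \<le> h" if "b \<in> Basis" for b
        using y that h by (auto simp: mem_box inner_simps)
      then have "norm (y - x) \<le> (\<Sum>b\<in>(Basis::(real^2) set). h)"
        by (intro order_trans[OF norm_le_l1] sum_mono) auto
      then show "y \<in> cball x r" using h by (simp add: dist_norm norm_minus_commute)
    qed
    then have "integral (cbox x (x + h *\<^sub>R One)) G = 0" using box0 r by blast
    then show False using d(2)[OF h(1,2)] by simp
  qed
  have "AE x in lebesgue. x \<notin> N" using N by (metis AE_not_in negligible_iff_null_sets)
  then have "AE x in lebesgue. x \<in> \<Omega> \<longrightarrow> g x = 0"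
    by eventually_elim (use zero in \<open>auto simp: G_def\<close>)
  then show ?thesis by (subst AE_restrict_space_iff) auto
qed

lemma weak_pderiv_unique:
  assumes "g \<in> L2 \<Omega>" "h \<in> L2 \<Omega>" "has_weak_pderiv \<Omega> i u g" "has_weak_pderiv \<Omega> i u h"
  shows "AE x in M. g x = h x"
proof -
  have "AE x in M. lcf 1 g (-1) h x = 0"
  proof (rule fundamental_lemma[OF L2_lcf[OF assms(1,2)]])
    fix \<phi> assume p: "\<phi> \<in> test_functions \<Omega>"
    have "(LINT x|M. g x * \<phi> x) = (LINT x|M. h x * \<phi> x)"
    proof -
      have "- (LINT x|M. g x * \<phi> x) = - (LINT x|M. h x * \<phi> x)"
        using assms(3,4) p unfolding has_weak_pderiv_def by simp
      then show ?thesis by simp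
    qed
    moreover have "(LINT x|M. lcf 1 g (-1) h x * \<phi> x) = (LINT x|M. g x * \<phi> x) - (LINT x|M. h x * \<phi> x)"
      unfolding lcf_def using L2_mult_integrable(1)[OF assms(1) test_L2[OF p]] L2_mult_integrable(1)[OF assms(2) test_L2[OF p]]
      by (simp add: left_diff_distrib)
    ultimately show "(LINT x|M. lcf 1 g (-1) h x * \<phi> x) = 0" by simp
  qed
  then show ?thesis by eventually_elim (simp add: lcf_def)
qed

lemma H1_L2: "u \<in> H1 \<Omega> \<Longrightarrow> u \<in> L2 \<Omega>" by (simp add: H1_def)

lemma H1_wpderiv:
  assumes "u \<in> H1 \<Omega>"
  shows "wpderiv \<Omega> i u \<in> L2 \<Omega>" "has_weak_pderiv \<Omega> i u (wpderiv \<Omega> i u)"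
proof -
  obtain g where "g \<in> L2 \<Omega> \<and> has_weak_pderiv \<Omega> i u g" using assms by (auto simp: H1_def)
  from someI[of "\<lambda>g. g \<in> L2 \<Omega> \<and> has_weak_pderiv \<Omega> i u g", OF this]
  show "wpderiv \<Omega> i u \<in> L2 \<Omega>" "has_weak_pderiv \<Omega> i u (wpderiv \<Omega> i u)" by (auto simp: wpderiv_def)
qed

lemma H1I:
  assumes "u \<in> L2 \<Omega>" "\<And>i. g i \<in> L2 \<Omega>" "\<And>i. has_weak_pderiv \<Omega> i u (g i)"
  shows "u \<in> H1 \<Omega>" "AE x in M. wpderiv \<Omega> i u x = g i x"
proof -
  show u: "u \<in> H1 \<Omega>" using assms by (auto simp: H1_def)
  show "AE x in M. wpderiv \<Omega> i u x = g i x"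
    by (rule weak_pderiv_unique[OF H1_wpderiv(1)[OF u] assms(2) H1_wpderiv(2)[OF u] assms(3)])
qed

lemma weak_pderiv_limit:
  assumes "\<And>n. s n \<in> L2 \<Omega>" "u \<in> L2 \<Omega>" "\<And>n. g n \<in> L2 \<Omega>" "h \<in> L2 \<Omega>" "\<And>n. has_weak_pderiv \<Omega> i (s n) (g n)"
    "(\<lambda>n. sqnorm \<Omega> (lcf 1 (s n) (-1) u)) \<longlonglongrightarrow> 0" "(\<lambda>n. sqnorm \<Omega> (lcf 1 (g n) (-1) h)) \<longlonglongrightarrow> 0"
  shows "has_weak_pderiv \<Omega> i u h"
  unfolding has_weak_pderiv_def
proof
  fix \<phi> assume p: "\<phi> \<in> test_functions \<Omega>"
  have pL: "(\<lambda>x. cnj (\<phi> x)) \<in> L2 \<Omega>" "(\<lambda>x. cnj (pderiv_classical i \<phi> x)) \<in> L2 \<Omega>"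
    using p pderiv_classical_test_function test_L2 L2_cnj by auto
  have "(\<lambda>n. (LINT x|M. s n x * pderiv_classical i \<phi> x)) \<longlonglongrightarrow> (LINT x|M. u x * pderiv_classical i \<phi> x)"
    using L2_inner_tendsto[OF assms(1,2) pL(2) assms(6)] by (simp add: L2_inner_def)
  moreover have "(\<lambda>n. - (LINT x|M. g n x * \<phi> x)) \<longlonglongrightarrow> - (LINT x|M. h x * \<phi> x)"
    using L2_inner_tendsto[OF assms(3,4) pL(1) assms(7)] by (intro tendsto_minus) (simp add: L2_inner_def)
  moreover have "(LINT x|M. s n x * pderiv_classical i \<phi> x) = - (LINT x|M. g n x * \<phi> x)" for n
    using assms(5)[of n] p by (simp add: has_weak_pderiv_def)
  ultimately show "(LINT x|M. u x * pderiv_classical i \<phi> x) = - (LINT x|M. h x * \<phi> x)"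
    using LIMSEQ_unique by fastforce
qed

section \<open>The Sobolev space \<open>H\<^sup>1\<^sub>0\<close>\<close>

text \<open>The domain of the form is the closure, in \<open>L\<^sup>2\<close>, of the graph of the classical gradient on test
functions. This and the next lemma move between that description and the definition through the
chosen weak derivatives; all further properties are proved for test functions and passed to the
limit.\<close>

lemma H10I:
  assumes u: "u \<in> L2 \<Omega>" and g: "\<And>i. g i \<in> L2 \<Omega>" and p: "\<And>n. \<phi> n \<in> test_functions \<Omega>"
    and 0: "(\<lambda>n. sqnorm \<Omega> (lcf 1 (\<phi> n) (-1) u)) \<longlonglongrightarrow> 0"
    and 1: "\<And>i. (\<lambda>n. sqnorm \<Omega> (lcf 1 (pderiv_classical i (\<phi> n)) (-1) (g i))) \<longlonglongrightarrow> 0"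
  shows "u \<in> H10 \<Omega>" "AE x in M. wpderiv \<Omega> i u x = g i x"
proof -
  note pd = pderiv_classical_test_function[OF p]
  have w: "has_weak_pderiv \<Omega> i u (g i)" for i
    by (rule weak_pderiv_limit[OF test_L2[OF p] u test_L2[OF pd] g test_weak_pderiv[OF p] 0 1])
  have uH: "u \<in> H1 \<Omega>" and ae: "\<And>i. AE x in M. wpderiv \<Omega> i u x = g i x" using H1I[OF u g w] by auto
  show "AE x in M. wpderiv \<Omega> i u x = g i x" by (rule ae)
  have e: "(LINT x|M. (cmod (u x - \<phi> n x))\<^sup>2 + (\<Sum>i\<in>UNIV. (cmod (wpderiv \<Omega> i u x - pderiv_classical i (\<phi> n) x))\<^sup>2))
     = sqnorm \<Omega> (lcf 1 (\<phi> n) (-1) u) + (\<Sum>i\<in>UNIV. sqnorm \<Omega> (lcf 1 (pderiv_classical i (\<phi> n)) (-1) (g i)))" for n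
  proof -
    have L: "lcf 1 (\<phi> n) (-1) u \<in> L2 \<Omega>" "\<And>i. lcf 1 (pderiv_classical i (\<phi> n)) (-1) (wpderiv \<Omega> i u) \<in> L2 \<Omega>"
       "\<And>i. lcf 1 (pderiv_classical i (\<phi> n)) (-1) (g i) \<in> L2 \<Omega>"
      by (intro L2_lcf test_L2 p u pd H1_wpderiv(1)[OF uH] g)+
    have "(LINT x|M. (cmod (u x - \<phi> n x))\<^sup>2 + (\<Sum>i\<in>UNIV. (cmod (wpderiv \<Omega> i u x - pderiv_classical i (\<phi> n) x))\<^sup>2))
      = (LINT x|M. (cmod (lcf 1 (\<phi> n) (-1) u x))\<^sup>2 + (\<Sum>i\<in>UNIV. (cmod (lcf 1 (pderiv_classical i (\<phi> n)) (-1) (wpderiv \<Omega> i u) x))\<^sup>2))"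
      by (simp add: lcf_def norm_minus_commute)
    also have "\<dots> = sqnorm \<Omega> (lcf 1 (\<phi> n) (-1) u) + (\<Sum>i\<in>UNIV. sqnorm \<Omega> (lcf 1 (pderiv_classical i (\<phi> n)) (-1) (wpderiv \<Omega> i u)))"
      unfolding sqnorm_def using L[THEN L2_integrable_sq] by (subst Bochner_Integration.integral_add) (auto intro!: Bochner_Integration.integral_sum)
    also have "\<dots> = sqnorm \<Omega> (lcf 1 (\<phi> n) (-1) u) + (\<Sum>i\<in>UNIV. sqnorm \<Omega> (lcf 1 (pderiv_classical i (\<phi> n)) (-1) (g i)))"
    proof (intro arg_cong2[where f = "(+)"] sum.cong refl)
      show "sqnorm \<Omega> (lcf 1 (pderiv_classical i (\<phi> n)) (-1) (wpderiv \<Omega> i u)) = sqnorm \<Omega> (lcf 1 (pderiv_classical i (\<phi> n)) (-1) (g i))" for i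
        by (rule sqnorm_cong_AE[OF _ L(2,3)]) (use ae[of i] in \<open>eventually_elim, simp add: lcf_def\<close>)
    qed
    finally show ?thesis .
  qed
  have "(\<lambda>n. sqnorm \<Omega> (lcf 1 (\<phi> n) (-1) u) + (\<Sum>i\<in>UNIV. sqnorm \<Omega> (lcf 1 (pderiv_classical i (\<phi> n)) (-1) (g i)))) \<longlonglongrightarrow> 0 + (\<Sum>i\<in>(UNIV::2 set). 0)"
    by (intro tendsto_add tendsto_sum 0 1)
  then show "u \<in> H10 \<Omega>" using uH p unfolding H10_def e[symmetric] by auto
qed

lemma H10E:
  assumes "u \<in> H10 \<Omega>"
  obtains \<phi> where "\<And>n::nat. \<phi> n \<in> test_functions \<Omega>" "(\<lambda>n. sqnorm \<Omega> (lcf 1 (\<phi> n) (-1) u)) \<longlonglongrightarrow> 0"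
    "\<And>i. (\<lambda>n. sqnorm \<Omega> (lcf 1 (pderiv_classical i (\<phi> n)) (-1) (wpderiv \<Omega> i u))) \<longlonglongrightarrow> 0"
proof -
  have uH: "u \<in> H1 \<Omega>" using assms by (simp add: H10_def)
  obtain \<phi> where p: "\<And>n::nat. \<phi> n \<in> test_functions \<Omega>" and l: "(\<lambda>n. LINT x|M. (cmod (u x - \<phi> n x))\<^sup>2
            + (\<Sum>i\<in>UNIV. (cmod (wpderiv \<Omega> i u x - pderiv_classical i (\<phi> n) x))\<^sup>2)) \<longlonglongrightarrow> 0"
    using assms by (auto simp: H10_def)
  note pd = pderiv_classical_test_function[OF p]
  have L: "lcf 1 (\<phi> n) (-1) u \<in> L2 \<Omega>" "lcf 1 (pderiv_classical i (\<phi> n)) (-1) (wpderiv \<Omega> i u) \<in> L2 \<Omega>" for n i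
    by (intro L2_lcf test_L2 p pd H1_wpderiv(1)[OF uH] H1_L2[OF uH])+
  have e: "(LINT x|M. (cmod (u x - \<phi> n x))\<^sup>2 + (\<Sum>i\<in>UNIV. (cmod (wpderiv \<Omega> i u x - pderiv_classical i (\<phi> n) x))\<^sup>2))
     = sqnorm \<Omega> (lcf 1 (\<phi> n) (-1) u) + (\<Sum>i\<in>UNIV. sqnorm \<Omega> (lcf 1 (pderiv_classical i (\<phi> n)) (-1) (wpderiv \<Omega> i u)))" (is "_ = ?r n") for n
  proof -
    have "(LINT x|M. (cmod (u x - \<phi> n x))\<^sup>2 + (\<Sum>i\<in>UNIV. (cmod (wpderiv \<Omega> i u x - pderiv_classical i (\<phi> n) x))\<^sup>2))
      = (LINT x|M. (cmod (lcf 1 (\<phi> n) (-1) u x))\<^sup>2 + (\<Sum>i\<in>UNIV. (cmod (lcf 1 (pderiv_classical i (\<phi> n)) (-1) (wpderiv \<Omega> i u) x))\<^sup>2))"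
      by (simp add: lcf_def norm_minus_commute)
    also have "\<dots> = ?r n"
      unfolding sqnorm_def using L[THEN L2_integrable_sq] by (subst Bochner_Integration.integral_add) (auto intro!: Bochner_Integration.integral_sum)
    finally show ?thesis .
  qed
  have l': "?r \<longlonglongrightarrow> 0" using l unfolding e .
  have S: "0 \<le> (\<Sum>i\<in>UNIV. sqnorm \<Omega> (lcf 1 (pderiv_classical i (\<phi> n)) (-1) (wpderiv \<Omega> i u)))" for n
    by (intro sum_nonneg sqnorm_nonneg)
  show ?thesis
  proof (rule that[OF p])
    show "(\<lambda>n. sqnorm \<Omega> (lcf 1 (\<phi> n) (-1) u)) \<longlonglongrightarrow> 0"
      by (rule tendsto_sandwich[OF _ _ tendsto_const l']) (use S in \<open>auto simp: sqnorm_nonneg\<close>)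
    fix i
    have "sqnorm \<Omega> (lcf 1 (pderiv_classical i (\<phi> n)) (-1) (wpderiv \<Omega> i u)) \<le> ?r n" for n
      using member_le_sum[of i UNIV "\<lambda>i. sqnorm \<Omega> (lcf 1 (pderiv_classical i (\<phi> n)) (-1) (wpderiv \<Omega> i u))"]
        sqnorm_nonneg[of \<Omega> "lcf 1 (\<phi> n) (-1) u"] by (simp add: sqnorm_nonneg add_increasing)
    then show "(\<lambda>n. sqnorm \<Omega> (lcf 1 (pderiv_classical i (\<phi> n)) (-1) (wpderiv \<Omega> i u))) \<longlonglongrightarrow> 0"
      by (intro tendsto_sandwich[OF _ _ tendsto_const l']) (auto simp: sqnorm_nonneg)
  qed
qed

lemma H10_H1: "u \<in> H10 \<Omega> \<Longrightarrow> u \<in> H1 \<Omega>" by (simp add: H10_def)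
lemma H10_L2: "u \<in> H10 \<Omega> \<Longrightarrow> u \<in> L2 \<Omega>" by (simp add: H10_def H1_def)
lemma H10_wpderiv_L2: "u \<in> H10 \<Omega> \<Longrightarrow> wpderiv \<Omega> i u \<in> L2 \<Omega>" by (rule H1_wpderiv(1)[OF H10_H1])

lemma sqnorm_lcf_self: "sqnorm \<Omega> (lcf 1 u (-1) u) = 0"
  by (simp add: sqnorm_def lcf_def)

lemma test_H10:
  assumes "f \<in> test_functions \<Omega>"
  shows "f \<in> H10 \<Omega>" "AE x in M. wpderiv \<Omega> i f x = pderiv_classical i f x"
  using H10I[of f "\<lambda>i. pderiv_classical i f" "\<lambda>n. f"] assms test_L2 pderiv_classical_test_function
  by (auto simp: sqnorm_lcf_self)

lemma lcf_tendsto: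
  assumes "\<And>n. s n \<in> L2 \<Omega>" "u \<in> L2 \<Omega>" "\<And>n. t n \<in> L2 \<Omega>" "v \<in> L2 \<Omega>"
    "(\<lambda>n. sqnorm \<Omega> (lcf 1 (s n) (-1) u)) \<longlonglongrightarrow> 0" "(\<lambda>n. sqnorm \<Omega> (lcf 1 (t n) (-1) v)) \<longlonglongrightarrow> 0"
  shows "(\<lambda>n. sqnorm \<Omega> (lcf 1 (lcf a (s n) b (t n)) (-1) (lcf a u b v))) \<longlonglongrightarrow> 0"
proof (rule tendsto_sandwich[OF _ _ tendsto_const])
  show "(\<lambda>n. 2 * (cmod a)\<^sup>2 * sqnorm \<Omega> (lcf 1 (s n) (-1) u) + 2 * (cmod b)\<^sup>2 * sqnorm \<Omega> (lcf 1 (t n) (-1) v)) \<longlonglongrightarrow> 0"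
    using tendsto_add[OF tendsto_mult[OF tendsto_const assms(5)] tendsto_mult[OF tendsto_const assms(6)]] by fastforce
  have "lcf 1 (lcf a (s n) b (t n)) (-1) (lcf a u b v) = lcf a (lcf 1 (s n) (-1) u) b (lcf 1 (t n) (-1) v)" for n
    by (auto simp: lcf_def algebra_simps)
  then show "\<forall>\<^sub>F n in sequentially. sqnorm \<Omega> (lcf 1 (lcf a (s n) b (t n)) (-1) (lcf a u b v))
      \<le> 2 * (cmod a)\<^sup>2 * sqnorm \<Omega> (lcf 1 (s n) (-1) u) + 2 * (cmod b)\<^sup>2 * sqnorm \<Omega> (lcf 1 (t n) (-1) v)"
    using sqnorm_lcf_le[OF L2_lcf L2_lcf] assms by simp
qed (simp add: sqnorm_nonneg)

lemma H10_lcf: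
  assumes u: "u \<in> H10 \<Omega>" and v: "v \<in> H10 \<Omega>"
  shows "lcf a u b v \<in> H10 \<Omega>"
    "AE x in M. wpderiv \<Omega> i (lcf a u b v) x = lcf a (wpderiv \<Omega> i u) b (wpderiv \<Omega> i v) x"
proof -
  obtain \<phi> where p: "\<And>n::nat. \<phi> n \<in> test_functions \<Omega>" "(\<lambda>n. sqnorm \<Omega> (lcf 1 (\<phi> n) (-1) u)) \<longlonglongrightarrow> 0"
    "\<And>i. (\<lambda>n. sqnorm \<Omega> (lcf 1 (pderiv_classical i (\<phi> n)) (-1) (wpderiv \<Omega> i u))) \<longlonglongrightarrow> 0" using H10E[OF u] by blast
  obtain \<psi> where q: "\<And>n::nat. \<psi> n \<in> test_functions \<Omega>" "(\<lambda>n. sqnorm \<Omega> (lcf 1 (\<psi> n) (-1) v)) \<longlonglongrightarrow> 0"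
    "\<And>i. (\<lambda>n. sqnorm \<Omega> (lcf 1 (pderiv_classical i (\<psi> n)) (-1) (wpderiv \<Omega> i v))) \<longlonglongrightarrow> 0" using H10E[OF v] by blast
  have d: "pderiv_classical i (lcf a (\<phi> n) b (\<psi> n)) = lcf a (pderiv_classical i (\<phi> n)) b (pderiv_classical i (\<psi> n))" for i n
    by (rule ext) (simp add: lcf_def pderiv_classical_lc[OF p(1) q(1)])
  have t: "lcf a (\<phi> n) b (\<psi> n) \<in> test_functions \<Omega>" for n
    unfolding lcf_def by (rule test_functions_lc[OF p(1) q(1)])
  have lim: "(\<lambda>n. sqnorm \<Omega> (lcf 1 (lcf a (\<phi> n) b (\<psi> n)) (-1) (lcf a u b v))) \<longlonglongrightarrow> 0"
    by (rule lcf_tendsto[OF test_L2[OF p(1)] H10_L2[OF u] test_L2[OF q(1)] H10_L2[OF v] p(2) q(2)])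
  have lim1: "(\<lambda>n. sqnorm \<Omega> (lcf 1 (pderiv_classical i (lcf a (\<phi> n) b (\<psi> n))) (-1) (lcf a (wpderiv \<Omega> i u) b (wpderiv \<Omega> i v)))) \<longlonglongrightarrow> 0" for i
    unfolding d by (rule lcf_tendsto) (intro test_L2 pderiv_classical_test_function p q H10_wpderiv_L2 u v)+
  show "lcf a u b v \<in> H10 \<Omega>"
    "AE x in M. wpderiv \<Omega> i (lcf a u b v) x = lcf a (wpderiv \<Omega> i u) b (wpderiv \<Omega> i v) x"
    using H10I[OF L2_lcf[OF H10_L2[OF u] H10_L2[OF v]] L2_lcf[OF H10_wpderiv_L2[OF u] H10_wpderiv_L2[OF v]] t lim lim1] by auto
qed

text \<open>A diagonal sequence: each \<open>s n\<close> is replaced by a test function within \<open>1/(n+1)\<close> of it.\<close>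

lemma H10_complete:
  assumes s: "\<And>n. s n \<in> H10 \<Omega>" and u: "u \<in> L2 \<Omega>" "\<And>i. g i \<in> L2 \<Omega>"
    and 0: "(\<lambda>n. sqnorm \<Omega> (lcf 1 (s n) (-1) u)) \<longlonglongrightarrow> 0"
    and 1: "\<And>i. (\<lambda>n. sqnorm \<Omega> (lcf 1 (wpderiv \<Omega> i (s n)) (-1) (g i))) \<longlonglongrightarrow> 0"
  shows "u \<in> H10 \<Omega>" "AE x in M. wpderiv \<Omega> i u x = g i x"
proof -
  have "\<exists>\<phi>\<in>test_functions \<Omega>. sqnorm \<Omega> (lcf 1 \<phi> (-1) (s n)) < inverse (real (Suc n)) \<and>
     (\<forall>i. sqnorm \<Omega> (lcf 1 (pderiv_classical i \<phi>) (-1) (wpderiv \<Omega> i (s n))) < inverse (real (Suc n)))" for n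
  proof -
    obtain \<phi> where p: "\<And>n::nat. \<phi> n \<in> test_functions \<Omega>" "(\<lambda>k. sqnorm \<Omega> (lcf 1 (\<phi> k) (-1) (s n))) \<longlonglongrightarrow> 0"
      "\<And>i. (\<lambda>k. sqnorm \<Omega> (lcf 1 (pderiv_classical i (\<phi> k)) (-1) (wpderiv \<Omega> i (s n)))) \<longlonglongrightarrow> 0" using H10E[OF s] by blast
    have "\<forall>\<^sub>F k in sequentially. sqnorm \<Omega> (lcf 1 (\<phi> k) (-1) (s n)) < inverse (real (Suc n)) \<and>
     (\<forall>i. sqnorm \<Omega> (lcf 1 (pderiv_classical i (\<phi> k)) (-1) (wpderiv \<Omega> i (s n))) < inverse (real (Suc n)))"
      by (intro eventually_conj eventually_all_finite order_tendstoD(2)[OF p(2)] order_tendstoD(2)[OF p(3)]) auto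
    then show ?thesis using p(1) eventually_happens'[OF sequentially_bot] by (metis (no_types, lifting))
  qed
  then obtain \<phi> where p: "\<And>n. \<phi> n \<in> test_functions \<Omega>"
    "\<And>n. sqnorm \<Omega> (lcf 1 (\<phi> n) (-1) (s n)) < inverse (real (Suc n))"
    "\<And>n i. sqnorm \<Omega> (lcf 1 (pderiv_classical i (\<phi> n)) (-1) (wpderiv \<Omega> i (s n))) < inverse (real (Suc n))" by metis
  have tri: "(\<lambda>n. sqnorm \<Omega> (lcf 1 (f n) (-1) w)) \<longlonglongrightarrow> 0"
    if "\<And>n. f n \<in> L2 \<Omega>" "\<And>n. t n \<in> L2 \<Omega>" "w \<in> L2 \<Omega>" "\<And>n. sqnorm \<Omega> (lcf 1 (f n) (-1) (t n)) < inverse (real (Suc n))"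
      "(\<lambda>n. sqnorm \<Omega> (lcf 1 (t n) (-1) w)) \<longlonglongrightarrow> 0" for f t w
  proof (rule tendsto_sandwich[OF _ _ tendsto_const])
    show "(\<lambda>n. 2 * inverse (real (Suc n)) + 2 * sqnorm \<Omega> (lcf 1 (t n) (-1) w)) \<longlonglongrightarrow> 0"
      using tendsto_add[OF tendsto_mult[OF tendsto_const[of 2] LIMSEQ_inverse_real_of_nat] tendsto_mult[OF tendsto_const[of 2] that(5)]] by simp
    show "\<forall>\<^sub>F n in sequentially. sqnorm \<Omega> (lcf 1 (f n) (-1) w) \<le> 2 * inverse (real (Suc n)) + 2 * sqnorm \<Omega> (lcf 1 (t n) (-1) w)"
    proof (intro always_eventually allI)
      show "sqnorm \<Omega> (lcf 1 (f n) (-1) w) \<le> 2 * inverse (real (Suc n)) + 2 * sqnorm \<Omega> (lcf 1 (t n) (-1) w)" for n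
        using sqnorm_triangle[OF that(1)[of n] that(2)[of n] that(3)] that(4)[of n] by linarith
    qed
  qed (simp add: sqnorm_nonneg)
  note L = test_L2[OF p(1)] test_L2[OF pderiv_classical_test_function[OF p(1)]]
  show "u \<in> H10 \<Omega>" "AE x in M. wpderiv \<Omega> i u x = g i x"
    using H10I[OF u p(1) tri[OF L(1) H10_L2[OF s] u(1) p(2) 0] tri[OF L(2) H10_wpderiv_L2[OF s] u(2) p(3) 1]] by auto
qed

end

section \<open>The Poincare inequality on convex sets\<close>

lemma nn_integral_lborel_affine:
  fixes f :: "'a::euclidean_space \<Rightarrow> ennreal"
  assumes [measurable]: "f \<in> borel_measurable borel" and c: "c \<noteq> 0"
  shows "(\<integral>\<^sup>+x. f x \<partial>lborel) = ennreal (\<bar>c\<bar> ^ DIM('a)) * (\<integral>\<^sup>+x. f (t + c *\<^sub>R x) \<partial>lborel)"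
  by (subst lborel_affine[OF c, of t]) (simp add: nn_integral_density nn_integral_distr nn_integral_cmult)

text \<open>The Jacobian \<open>c\<^sup>2\<close> is at least \<open>1/4\<close>.\<close>

lemma nn_integral_affine_le:
  fixes f :: "real^2 \<Rightarrow> ennreal"
  assumes [measurable]: "f \<in> borel_measurable borel" and c: "1/2 \<le> c"
  shows "(\<integral>\<^sup>+x. f (t + c *\<^sub>R x) \<partial>lborel) \<le> 4 * (\<integral>\<^sup>+x. f x \<partial>lborel)"
proof -
  let ?I = "\<integral>\<^sup>+x. f (t + c *\<^sub>R x) \<partial>lborel"
  have "1 \<le> 4 * c\<^sup>2" using power_mono[OF c, of 2] by (simp add: power2_eq_square)
  then have "1 * ?I \<le> ennreal (4 * c\<^sup>2) * ?I" by (intro mult_right_mono) auto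
  also have "\<dots> = 4 * (ennreal (c\<^sup>2) * ?I)" by (simp add: ennreal_mult mult.assoc)
  also have "ennreal (c\<^sup>2) * ?I = (\<integral>\<^sup>+x. f x \<partial>lborel)"
    using nn_integral_lborel_affine[of f c t] c by simp
  finally show ?thesis by simp
qed

text \<open>The fundamental theorem of calculus along the segment from \<open>y\<close> to \<open>x\<close>, followed by the
Cauchy-Schwarz inequality in \<open>t\<close>. The function \<open>F\<close> dominates the squared norm of the gradient.\<close>

lemma cmod_diff_sq_le_line_integral:
  fixes u :: "real^2 \<Rightarrow> complex" and F :: "real^2 \<Rightarrow> real"
  assumes u: "\<And>x. (u has_derivative u' x) (at x)"
    and F: "continuous_on UNIV F" "\<And>x. 0 \<le> F x" and b: "\<And>x h. (cmod (u' x h))\<^sup>2 \<le> F x * (norm h)\<^sup>2"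
    and d: "norm (x - y) \<le> d"
  shows "ennreal ((cmod (u x - u y))\<^sup>2) \<le> (\<integral>\<^sup>+t. ennreal (d\<^sup>2 * F ((1 - t) *\<^sub>R y + t *\<^sub>R x)) * indicator {0..1} t \<partial>lborel)"
proof -
  define p where "p t = (1 - t) *\<^sub>R y + t *\<^sub>R x" for t
  have pd: "(p has_vector_derivative (x - y)) (at t within S)" for t S
    unfolding p_def by (auto intro!: derivative_eq_intros simp: algebra_simps)
  have pc: "continuous_on S p" for S unfolding p_def by (intro continuous_intros)
  define k where "k t = d * sqrt (F (p t))" for t
  have kc: "continuous_on S k" for S
    unfolding k_def by (intro continuous_intros continuous_on_compose2[OF F(1) pc]) auto
  have d0: "0 \<le> d" using d norm_ge_zero order_trans by blast
  have k0: "0 \<le> k t" for t using F d0 by (simp add: k_def)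
  define m where "m = integral {0..1} k"
  have "norm (u (p 1) - u (p 0)) \<le> integral {0..1} k - integral {0..0} k"
  proof (rule differentiable_bound_general[where f = "\<lambda>t. u (p t)" and \<phi> = "\<lambda>t. integral {0..t} k" and \<phi>' = k and f' = "\<lambda>t. u' (p t) (x - y)"])
    have "isCont u z" for z using u has_derivative_continuous by blast
    then have "continuous_on UNIV u" by (simp add: continuous_at_imp_continuous_on)
    then show "continuous_on {0..1} (\<lambda>t. u (p t))" by (rule continuous_on_compose2[OF _ pc]) auto
    show "continuous_on {0..1} (\<lambda>t. integral {0..t} k)"
      by (rule indefinite_integral_continuous_1[OF integrable_continuous_real[OF kc]])
    show "((\<lambda>t. integral {0..t} k) has_vector_derivative k t) (at t)" if "0 < t" "t < 1" for t
      using integral_has_vector_derivative[OF kc, of t 0 1] that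
      by (simp add: at_within_Icc_at)
    show "((\<lambda>t. u (p t)) has_vector_derivative u' (p t) (x - y)) (at t)" for t
    proof -
      have "((\<lambda>t. u (p t)) has_derivative (\<lambda>h. u' (p t) (h *\<^sub>R (x - y)))) (at t)"
        using has_derivative_compose[OF pd[unfolded has_vector_derivative_def] u] .
      then show ?thesis
        using linear_scale[OF has_derivative_linear[OF u]] by (simp add: has_vector_derivative_def)
    qed
    show "norm (u' (p t) (x - y)) \<le> k t" for t
    proof -
      have "(cmod (u' (p t) (x - y)))\<^sup>2 \<le> F (p t) * (norm (x - y))\<^sup>2" by (rule b)
      also have "\<dots> \<le> F (p t) * d\<^sup>2" using d F by (intro mult_left_mono power_mono) auto
      also have "\<dots> = (k t)\<^sup>2" using F by (simp add: k_def power_mult_distrib)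
      finally show ?thesis using k0 by (rule power2_le_imp_le)
    qed
  qed simp
  then have "cmod (u x - u y) \<le> m" by (simp add: p_def m_def)
  then have "(cmod (u x - u y))\<^sup>2 \<le> m\<^sup>2" by (intro power_mono) auto
  also have "m\<^sup>2 \<le> integral {0..1} (\<lambda>t. (k t)\<^sup>2)"
  proof -
    have i: "k integrable_on {0..1}" "(\<lambda>t. (k t)\<^sup>2) integrable_on {0..1}"
      by (intro integrable_continuous_real continuous_intros kc)+
    have i3: "(\<lambda>t. 2 * m * k t - m\<^sup>2) integrable_on {0..1}"
      by (intro integrable_continuous_real continuous_intros kc)
    have "integral {0..1} (\<lambda>t. 2 * m * k t - m\<^sup>2) \<le> integral {0..1} (\<lambda>t. (k t)\<^sup>2)"
    proof (rule integral_le[OF i3 i(2)])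
      show "2 * m * k t - m\<^sup>2 \<le> (k t)\<^sup>2" for t
        using zero_le_power2[of "k t - m"] by (simp add: power2_diff algebra_simps)
    qed
    moreover have "integral {0..1} (\<lambda>t. 2 * m * k t - m\<^sup>2) = 2 * m * m - m\<^sup>2"
      using i by (subst Henstock_Kurzweil_Integration.integral_diff) (auto simp: m_def intro: integrable_on_mult_right)
    ultimately show ?thesis by (simp add: power2_eq_square)
  qed
  also have "integral {0..1} (\<lambda>t. (k t)\<^sup>2) = (LINT t|lborel. indicator {0..1} t *\<^sub>R (k t)\<^sup>2)"
    using set_borel_integral_eq_integral(2)[OF borel_integrable_atLeastAtMost'[of 0 1 "\<lambda>t. (k t)\<^sup>2"]] kc
    by (simp add: set_lebesgue_integral_def continuous_on_power)
  finally have "ennreal ((cmod (u x - u y))\<^sup>2) \<le> ennreal (LINT t|lborel. indicator {0..1} t *\<^sub>R (k t)\<^sup>2)"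
    by (rule ennreal_leI)
  also have "\<dots> = (\<integral>\<^sup>+t. ennreal (indicator {0..1} t *\<^sub>R (k t)\<^sup>2) \<partial>lborel)"
  proof (rule nn_integral_eq_integral[symmetric])
    show "integrable lborel (\<lambda>t. indicator {0..1} t *\<^sub>R (k t)\<^sup>2)"
      using borel_integrable_atLeastAtMost'[of 0 1 "\<lambda>t. (k t)\<^sup>2"] kc
      by (simp add: set_integrable_def continuous_on_power)
  qed auto
  also have "\<dots> = (\<integral>\<^sup>+t. ennreal (d\<^sup>2 * F ((1 - t) *\<^sub>R y + t *\<^sub>R x)) * indicator {0..1} t \<partial>lborel)"
    using F by (intro nn_integral_cong) (auto simp: k_def p_def power_mult_distrib indicator_def)
  finally show ?thesis .
qed

text \<open>The difference \<open>u x - u y\<close> is an integral of the gradient over the segment, which stays in the convex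
set. For fixed \<open>t\<close> the point \<open>(1-t) y + t x\<close> is taken as new variable in place of \<open>y\<close> if \<open>t \<le> 1/2\<close> and in
place of \<open>x\<close> otherwise; the Jacobian is at least \<open>1/4\<close> in either case, and the variable that
remains contributes the measure of the set.\<close>

proposition poincare_double_integral:
  fixes u :: "real^2 \<Rightarrow> complex" and F :: "real^2 \<Rightarrow> real"
  assumes u: "\<And>x. (u has_derivative u' x) (at x)"
    and F: "continuous_on UNIV F" "\<And>x. 0 \<le> F x" and b: "\<And>x h. (cmod (u' x h))\<^sup>2 \<le> F x * (norm h)\<^sup>2"
    and S: "S \<in> sets borel" "convex S" and d: "\<And>x y. x \<in> S \<Longrightarrow> y \<in> S \<Longrightarrow> norm (x - y) \<le> d"
  shows "(\<integral>\<^sup>+x. indicator S x * (\<integral>\<^sup>+y. indicator S y * ennreal ((cmod (u x - u y))\<^sup>2) \<partial>lborel) \<partial>lborel)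
    \<le> ennreal (4 * d\<^sup>2) * emeasure lborel S * (\<integral>\<^sup>+x. indicator S x * ennreal (F x) \<partial>lborel)"
proof -
  have Fm[measurable]: "F \<in> borel_measurable borel" using F(1) by (rule borel_measurable_continuous_onI)
  note S(1)[measurable]
  define I where "I = (\<integral>\<^sup>+x. indicator S x * ennreal (F x) \<partial>lborel)"
  define G where "G t x y = indicator S x * (indicator S y * ennreal (F ((1 - t) *\<^sub>R y + t *\<^sub>R x)))" for t :: real and x y
  have Gm[measurable]: "(\<lambda>(t, x, y). G t x y) \<in> borel_measurable (borel \<Otimes>\<^sub>M borel \<Otimes>\<^sub>M borel)"
    unfolding G_def by measurable
  have slice: "(\<integral>\<^sup>+x. (\<integral>\<^sup>+y. G t x y \<partial>lborel) \<partial>lborel) \<le> 4 * I * emeasure lborel S" if t: "0 \<le> t" "t \<le> 1" for t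
  proof -
    have conv: "(1 - t) *\<^sub>R y + t *\<^sub>R x \<in> S" if "x \<in> S" "y \<in> S" for x y
      using S(2) that t by (intro convexD) auto
    define H where "H z = indicator S z * ennreal (F z)" for z
    have Hm[measurable]: "H \<in> borel_measurable borel" unfolding H_def by measurable
    have GH: "G t x y \<le> indicator S x * H ((1 - t) *\<^sub>R y + t *\<^sub>R x)" "G t x y \<le> indicator S y * H ((1 - t) *\<^sub>R y + t *\<^sub>R x)" for x y
      using conv by (auto simp: G_def H_def indicator_def)
    have IH: "I = (\<integral>\<^sup>+z. H z \<partial>lborel)" by (simp add: I_def H_def)
    show ?thesis
    proof (cases "t \<le> 1/2")
      case True
      have "(\<integral>\<^sup>+y. G t x y \<partial>lborel) \<le> indicator S x * (4 * I)" for x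
      proof -
        have "(\<integral>\<^sup>+y. G t x y \<partial>lborel) \<le> (\<integral>\<^sup>+y. indicator S x * H ((1 - t) *\<^sub>R y + t *\<^sub>R x) \<partial>lborel)"
          by (intro nn_integral_mono GH)
        also have "\<dots> = indicator S x * (\<integral>\<^sup>+y. H (t *\<^sub>R x + (1 - t) *\<^sub>R y) \<partial>lborel)"
          by (subst nn_integral_cmult) (auto simp: add.commute)
        also have "\<dots> \<le> indicator S x * (4 * I)"
          unfolding IH using True by (intro mult_left_mono nn_integral_affine_le) auto
        finally show ?thesis .
      qed
      then have "(\<integral>\<^sup>+x. (\<integral>\<^sup>+y. G t x y \<partial>lborel) \<partial>lborel) \<le> (\<integral>\<^sup>+x. indicator S x * (4 * I) \<partial>lborel)"
        by (intro nn_integral_mono)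
      also have "\<dots> = 4 * I * emeasure lborel S" by (subst nn_integral_multc) (auto simp: mult.commute)
      finally show ?thesis .
    next
      case False
      have "(\<integral>\<^sup>+x. G t x y \<partial>lborel) \<le> indicator S y * (4 * I)" for y
      proof -
        have "(\<integral>\<^sup>+x. G t x y \<partial>lborel) \<le> (\<integral>\<^sup>+x. indicator S y * H ((1 - t) *\<^sub>R y + t *\<^sub>R x) \<partial>lborel)"
          by (intro nn_integral_mono GH)
        also have "\<dots> = indicator S y * (\<integral>\<^sup>+x. H ((1 - t) *\<^sub>R y + t *\<^sub>R x) \<partial>lborel)"
          by (subst nn_integral_cmult) auto
        also have "\<dots> \<le> indicator S y * (4 * I)"
          unfolding IH using False by (intro mult_left_mono nn_integral_affine_le) auto
        finally show ?thesis .
      qed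
      then have "(\<integral>\<^sup>+y. (\<integral>\<^sup>+x. G t x y \<partial>lborel) \<partial>lborel) \<le> (\<integral>\<^sup>+y. indicator S y * (4 * I) \<partial>lborel)"
        by (intro nn_integral_mono)
      also have "\<dots> = 4 * I * emeasure lborel S" by (subst nn_integral_multc) (auto simp: mult.commute)
      finally show ?thesis
        by (subst lborel_pair.Fubini') (auto simp: G_def)
    qed
  qed
  have "(\<integral>\<^sup>+x. indicator S x * (\<integral>\<^sup>+y. indicator S y * ennreal ((cmod (u x - u y))\<^sup>2) \<partial>lborel) \<partial>lborel)
    \<le> (\<integral>\<^sup>+x. (\<integral>\<^sup>+y. (\<integral>\<^sup>+t. ennreal (d\<^sup>2) * (G t x y * indicator {0..1} t) \<partial>lborel) \<partial>lborel) \<partial>lborel)"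
  proof (rule nn_integral_mono)
    fix x
    have uc: "continuous_on UNIV u" using u has_derivative_continuous by (metis continuous_at_imp_continuous_on)
    have um[measurable]: "u \<in> borel_measurable borel" using uc by (rule borel_measurable_continuous_onI)
    have "indicator S x * (\<integral>\<^sup>+y. indicator S y * ennreal ((cmod (u x - u y))\<^sup>2) \<partial>lborel)
       = (\<integral>\<^sup>+y. indicator S x * (indicator S y * ennreal ((cmod (u x - u y))\<^sup>2)) \<partial>lborel)"
      by (subst nn_integral_cmult) auto
    also have "\<dots> \<le> (\<integral>\<^sup>+y. (\<integral>\<^sup>+t. ennreal (d\<^sup>2) * (G t x y * indicator {0..1} t) \<partial>lborel) \<partial>lborel)"
    proof (rule nn_integral_mono)
      fix y
      show "indicator S x * (indicator S y * ennreal ((cmod (u x - u y))\<^sup>2)) \<le> (\<integral>\<^sup>+t. ennreal (d\<^sup>2) * (G t x y * indicator {0..1} t) \<partial>lborel)"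
      proof (cases "x \<in> S \<and> y \<in> S")
        case True
        then have "ennreal ((cmod (u x - u y))\<^sup>2) \<le> (\<integral>\<^sup>+t. ennreal (d\<^sup>2 * F ((1 - t) *\<^sub>R y + t *\<^sub>R x)) * indicator {0..1} t \<partial>lborel)"
          by (intro cmod_diff_sq_le_line_integral[OF u F b d]) auto
        also have "\<dots> = (\<integral>\<^sup>+t. ennreal (d\<^sup>2) * (G t x y * indicator {0..1} t) \<partial>lborel)"
          using True F by (intro nn_integral_cong) (auto simp: G_def ennreal_mult mult.assoc)
        finally show ?thesis using True by simp
      qed (auto simp: indicator_def)
    qed
    finally show "indicator S x * (\<integral>\<^sup>+y. indicator S y * ennreal ((cmod (u x - u y))\<^sup>2) \<partial>lborel)
       \<le> (\<integral>\<^sup>+y. (\<integral>\<^sup>+t. ennreal (d\<^sup>2) * (G t x y * indicator {0..1} t) \<partial>lborel) \<partial>lborel)" .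
  qed
  also have "\<dots> = (\<integral>\<^sup>+x. (\<integral>\<^sup>+t. (\<integral>\<^sup>+y. ennreal (d\<^sup>2) * (G t x y * indicator {0..1} t) \<partial>lborel) \<partial>lborel) \<partial>lborel)"
    by (intro nn_integral_cong lborel_pair.Fubini'[symmetric]) (simp add: G_def)
  also have "\<dots> = (\<integral>\<^sup>+t. (\<integral>\<^sup>+x. (\<integral>\<^sup>+y. ennreal (d\<^sup>2) * (G t x y * indicator {0..1} t) \<partial>lborel) \<partial>lborel) \<partial>lborel)"
    by (rule lborel_pair.Fubini'[symmetric]) (simp add: G_def)
  also have "\<dots> = (\<integral>\<^sup>+t. ennreal (d\<^sup>2) * indicator {0..1} t * (\<integral>\<^sup>+x. (\<integral>\<^sup>+y. G t x y \<partial>lborel) \<partial>lborel) \<partial>lborel)"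
  proof (intro nn_integral_cong)
    fix t :: real
    let ?c = "ennreal (d\<^sup>2) * indicator {0..1} t"
    have "(\<integral>\<^sup>+x. (\<integral>\<^sup>+y. ennreal (d\<^sup>2) * (G t x y * indicator {0..1} t) \<partial>lborel) \<partial>lborel)
        = (\<integral>\<^sup>+x. (\<integral>\<^sup>+y. ?c * G t x y \<partial>lborel) \<partial>lborel)" by (simp add: mult_ac)
    also have "\<dots> = (\<integral>\<^sup>+x. ?c * (\<integral>\<^sup>+y. G t x y \<partial>lborel) \<partial>lborel)"
      by (intro nn_integral_cong nn_integral_cmult) (simp add: G_def)
    also have "\<dots> = ?c * (\<integral>\<^sup>+x. (\<integral>\<^sup>+y. G t x y \<partial>lborel) \<partial>lborel)"
      by (rule nn_integral_cmult) (simp add: G_def)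
    finally show "(\<integral>\<^sup>+x. (\<integral>\<^sup>+y. ennreal (d\<^sup>2) * (G t x y * indicator {0..1} t) \<partial>lborel) \<partial>lborel)
        = ?c * (\<integral>\<^sup>+x. (\<integral>\<^sup>+y. G t x y \<partial>lborel) \<partial>lborel)" .
  qed
  also have "\<dots> \<le> (\<integral>\<^sup>+t. (ennreal (d\<^sup>2) * (4 * I * emeasure lborel S)) * indicator {0..1} t \<partial>(lborel::real measure))"
    using slice by (intro nn_integral_mono) (auto simp: indicator_def intro!: mult_left_mono)
  also have "\<dots> = ennreal (d\<^sup>2) * (4 * I * emeasure lborel S) * emeasure (lborel::real measure) {0..1}"
    by (subst nn_integral_cmult_indicator) auto
  also have "\<dots> = ennreal (4 * d\<^sup>2) * emeasure lborel S * I"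
    by (simp add: ennreal_mult mult_ac)
  finally show ?thesis by (simp add: I_def)
qed

text \<open>Expanding the square, the double integral equals \<open>2|S| \<integral>|u|\<^sup>2 - 2|\<integral>u|\<^sup>2\<close>.\<close>

lemma variance_le_gradient:
  fixes u :: "real^2 \<Rightarrow> complex" and F :: "real^2 \<Rightarrow> real"
  assumes u: "\<And>x. (u has_derivative u' x) (at x)"
    and F: "continuous_on UNIV F" "\<And>x. 0 \<le> F x" and b: "\<And>x h. (cmod (u' x h))\<^sup>2 \<le> F x * (norm h)\<^sup>2"
    and S: "S \<in> sets borel" "convex S" "bounded S" and d: "\<And>x y. x \<in> S \<Longrightarrow> y \<in> S \<Longrightarrow> norm (x - y) \<le> d"
  shows "(LINT x|lborel. indicat_real S x * (cmod (u x))\<^sup>2) \<le> 2 * d\<^sup>2 * (LINT x|lborel. indicat_real S x * F x)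
      + (cmod (LINT x|lborel. complex_of_real (indicat_real S x) * u x))\<^sup>2 / measure lborel S"
proof -
  note S(1)[measurable]
  have fin: "emeasure lborel S < \<infinity>" by (rule emeasure_bounded_finite[OF S(3)])
  define m where "m = measure lborel S"
  have em: "emeasure lborel S = ennreal m"
    unfolding m_def by (rule emeasure_eq_ennreal_measure) (use fin in auto)
  have uc: "continuous_on UNIV u" using u has_derivative_continuous by (metis continuous_at_imp_continuous_on)
  have um[measurable]: "u \<in> borel_measurable borel" using uc by (rule borel_measurable_continuous_onI)
  have Fm[measurable]: "F \<in> borel_measurable borel" using F(1) by (rule borel_measurable_continuous_onI)
  have integrable_cut: "integrable lborel (\<lambda>x. indicat_real S x *\<^sub>R f x)"
    if f: "continuous_on UNIV f" for f :: "real^2 \<Rightarrow> 'b::{banach, second_countable_topology}"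
  proof -
    have [measurable]: "f \<in> borel_measurable borel" using f by (rule borel_measurable_continuous_onI)
    have "compact (closure S)" using S(3) by (simp add: compact_closure)
    from borel_integrable_compact[OF this continuous_on_subset[OF f subset_UNIV]]
    show ?thesis
      by (rule Bochner_Integration.integrable_bound) (use closure_subset[of S] in \<open>auto simp: indicator_def\<close>)
  qed
  define i where "i = indicat_real S"
  have im[measurable]: "i \<in> borel_measurable borel" unfolding i_def by measurable
  have ii: "integrable lborel i" "(LINT x|lborel. i x) = m"
    using integrable_cut[of "\<lambda>x. 1::real"] by (simp_all add: i_def m_def)
  define q where "q = (LINT x|lborel. i x * (cmod (u x))\<^sup>2)"
  define A where "A = (LINT x|lborel. of_real (i x) * u x)"
  define f where "f = (LINT x|lborel. i x * F x)"
  have qi: "integrable lborel (\<lambda>x. i x * (cmod (u x))\<^sup>2)"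
    using integrable_cut[of "\<lambda>x. (cmod (u x))\<^sup>2"] uc by (simp add: i_def continuous_on_norm continuous_on_power)
  have Ai: "integrable lborel (\<lambda>x. of_real (i x) * u x)"
    using integrable_cut[OF uc] by (simp add: i_def scaleR_conv_of_real)
  have fi: "integrable lborel (\<lambda>x. i x * F x)" using integrable_cut[OF F(1)] by (simp add: i_def)
  have i0: "0 \<le> i x" for x by (simp add: i_def)
  define r where "r c x = Re (of_real (i x) * u x * c)" for c x
  have rei: "integrable lborel (r c)" "(LINT x|lborel. r c x) = Re (A * c)" for c
    unfolding r_def using integrable_Re[OF integrable_mult_left[OF Ai, of c]] integral_Re[OF integrable_mult_left[OF Ai, of c]] Ai
    by (simp_all add: A_def)
  have expand: "(cmod (u x - u y))\<^sup>2 = (cmod (u x))\<^sup>2 + (cmod (u y))\<^sup>2 - 2 * Re (u y * cnj (u x))" for x y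
    unfolding cmod_power2 by (simp add: power2_eq_square algebra_simps)
  define J where "J x = m * (cmod (u x))\<^sup>2 + q - 2 * Re (A * cnj (u x))" for x
  have inner: "(\<integral>\<^sup>+y. indicator S y * ennreal ((cmod (u x - u y))\<^sup>2) \<partial>lborel) = ennreal (J x)" and J0: "0 \<le> J x" for x
  proof -
    have e: "i y * (cmod (u x - u y))\<^sup>2 = i y * (cmod (u x))\<^sup>2 + i y * (cmod (u y))\<^sup>2 - 2 * r (cnj (u x)) y" for y
      unfolding expand r_def by (simp add: algebra_simps)
    have I: "integrable lborel (\<lambda>y. i y * (cmod (u x - u y))\<^sup>2)"
      unfolding e using ii(1) qi rei(1) by (intro Bochner_Integration.integrable_diff Bochner_Integration.integrable_add integrable_mult_right integrable_mult_left)
    have "(LINT y|lborel. i y * (cmod (u x - u y))\<^sup>2) = J x"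
      unfolding e using ii qi rei by (simp add: J_def q_def)
    moreover have "(\<integral>\<^sup>+y. indicator S y * ennreal ((cmod (u x - u y))\<^sup>2) \<partial>lborel) = (\<integral>\<^sup>+y. ennreal (i y * (cmod (u x - u y))\<^sup>2) \<partial>lborel)"
      by (intro nn_integral_cong) (auto simp: i_def indicator_def)
    moreover have "\<dots> = ennreal (LINT y|lborel. i y * (cmod (u x - u y))\<^sup>2)"
      by (rule nn_integral_eq_integral[OF I]) (use i0 in auto)
    moreover have "0 \<le> (LINT y|lborel. i y * (cmod (u x - u y))\<^sup>2)" using i0 by (intro Bochner_Integration.integral_nonneg) auto
    ultimately show "(\<integral>\<^sup>+y. indicator S y * ennreal ((cmod (u x - u y))\<^sup>2) \<partial>lborel) = ennreal (J x)" "0 \<le> J x" by simp_all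
  qed
  have re2: "Re (A * cnj (u x)) = Re (u x * cnj A)" for x by (simp add: algebra_simps)
  have eJ: "i x * J x = m * (i x * (cmod (u x))\<^sup>2) + i x * q - 2 * r (cnj A) x" for x
    unfolding J_def re2 r_def by (simp add: algebra_simps)
  have Ji: "integrable lborel (\<lambda>x. i x * J x)"
    unfolding eJ using ii(1) qi rei(1) by (intro Bochner_Integration.integrable_diff Bochner_Integration.integrable_add integrable_mult_right integrable_mult_left)
  have "Re (A * cnj A) = (cmod A)\<^sup>2" unfolding cmod_power2 by (simp add: power2_eq_square)
  then have JI: "(LINT x|lborel. i x * J x) = 2 * m * q - 2 * (cmod A)\<^sup>2"
    unfolding eJ using ii qi rei by (simp add: q_def)
  have "(\<integral>\<^sup>+x. indicator S x * (\<integral>\<^sup>+y. indicator S y * ennreal ((cmod (u x - u y))\<^sup>2) \<partial>lborel) \<partial>lborel)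
     = (\<integral>\<^sup>+x. ennreal (i x * J x) \<partial>lborel)"
    unfolding inner by (intro nn_integral_cong) (auto simp: i_def indicator_def)
  also have "\<dots> = ennreal (2 * m * q - 2 * (cmod A)\<^sup>2)"
    unfolding JI[symmetric] by (rule nn_integral_eq_integral[OF Ji]) (use i0 J0 in auto)
  finally have "ennreal (2 * m * q - 2 * (cmod A)\<^sup>2)
      \<le> ennreal (4 * d\<^sup>2) * emeasure lborel S * (\<integral>\<^sup>+x. indicator S x * ennreal (F x) \<partial>lborel)"
    using poincare_double_integral[OF u F b S(1,2) d] by simp
  also have "(\<integral>\<^sup>+x. indicator S x * ennreal (F x) \<partial>lborel) = (\<integral>\<^sup>+x. ennreal (i x * F x) \<partial>lborel)"
    by (intro nn_integral_cong) (auto simp: i_def indicator_def)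
  also have "\<dots> = ennreal f"
    unfolding f_def by (rule nn_integral_eq_integral[OF fi]) (use i0 F in auto)
  finally have le: "ennreal (2 * m * q - 2 * (cmod A)\<^sup>2) \<le> ennreal (4 * d\<^sup>2) * ennreal m * ennreal f"
    unfolding em .
  have f0: "0 \<le> f" unfolding f_def using i0 F by (intro Bochner_Integration.integral_nonneg) auto
  have m0: "0 \<le> m" by (simp add: m_def)
  have "ennreal (4 * d\<^sup>2) * ennreal m * ennreal f = ennreal (4 * d\<^sup>2 * m * f)"
    using f0 m0 by (simp only: ennreal_mult[symmetric] mult_nonneg_nonneg zero_le_power2 zero_le_numeral)
  with le have main: "2 * m * q - 2 * (cmod A)\<^sup>2 \<le> 4 * d\<^sup>2 * m * f"
    using f0 m0 by (simp only: ennreal_le_iff mult_nonneg_nonneg zero_le_power2 zero_le_numeral)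
  have "q \<le> 2 * d\<^sup>2 * f + (cmod A)\<^sup>2 / m"
  proof (cases "m = 0")
    case True
    have "(\<integral>\<^sup>+x. ennreal (i x * (cmod (u x))\<^sup>2) \<partial>lborel) = 0"
    proof (subst nn_integral_0_iff_AE)
      \<comment> \<open>division by \<open>0\<close> yields \<open>0\<close>, so a null set needs a separate argument\<close>
      have "AE x in lborel. x \<notin> S" using em True by (intro AE_not_in) (auto simp: null_sets_def)
      then show "AE x in lborel. ennreal (i x * (cmod (u x))\<^sup>2) = 0" by eventually_elim (simp add: i_def)
    qed auto
    then have "q = 0" unfolding q_def by (subst integral_eq_nn_integral) (use i0 in auto)
    then show ?thesis using True f0 by simp
  next
    case False
    then have "m > 0" using m0 by simp
    then show ?thesis using main by (simp add: field_simps)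
  qed
  then show ?thesis by (simp add: q_def f_def A_def m_def i_def)
qed

section \<open>Rellich compactness\<close>

text \<open>Half-open squares of side \<open>1/(k+1)\<close>, indexed by the integer coordinates of their lower left
corners. The floor function makes them a partition of the plane.\<close>

definition cell :: "nat \<Rightarrow> int \<times> int \<Rightarrow> (real^2) set" where
  "cell k z = {x. \<lfloor>real (Suc k) * x$1\<rfloor> = fst z \<and> \<lfloor>real (Suc k) * x$2\<rfloor> = snd z}"

lemma cell_eq: "cell k z = {x. of_int (fst z) \<le> real (Suc k) * x$1} \<inter> {x. real (Suc k) * x$1 < of_int (fst z) + 1}
    \<inter> {x. of_int (snd z) \<le> real (Suc k) * x$2} \<inter> {x. real (Suc k) * x$2 < of_int (snd z) + 1}"
  by (auto simp: cell_def floor_eq_iff)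

lemma cell_borel [measurable]: "cell k z \<in> sets borel"
proof -
  have "(\<lambda>x::real^2. x$j) \<in> borel_measurable borel" for j
    by (rule borel_measurable_continuous_onI) (intro continuous_intros)
  note [measurable] = this
  show ?thesis unfolding cell_eq by measurable
qed

lemma cell_convex: "convex (cell k z)"
proof -
  have "linear (\<lambda>x::real^2. real (Suc k) * x$j)" for j
    by (intro linearI) (auto simp: algebra_simps)
  then have "convex ((\<lambda>x::real^2. real (Suc k) * x$j) -` {of_int c..<of_int c + 1})" for j c
    by (intro convex_linear_vimage) auto
  from convex_Int[OF this[of 1 "fst z"] this[of 2 "snd z"]] show ?thesis
    by (rule back_subst[where P = convex]) (auto simp: cell_eq)
qed

lemma cell_diam:
  assumes "x \<in> cell k z" "y \<in> cell k z" shows "norm (x - y) \<le> 2 / real (Suc k)"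
proof -
  have "\<bar>real (Suc k) * (x$j - y$j)\<bar> \<le> 1" for j
    using assms exhaust_2[of j] by (auto simp: cell_eq right_diff_distrib abs_le_iff)
  then have "real (Suc k) * \<bar>x$j - y$j\<bar> \<le> 1" for j by (simp only: abs_mult abs_of_nat)
  then have "\<bar>x$j - y$j\<bar> \<le> 1 / real (Suc k)" for j
    by (simp add: pos_le_divide_eq mult.commute del: of_nat_Suc)
  then have "(\<Sum>j\<in>UNIV. \<bar>(x - y)$j\<bar>) \<le> (\<Sum>j\<in>(UNIV::2 set). 1 / real (Suc k))"
    by (intro sum_mono) simp
  then show ?thesis using norm_le_l1_cart[of "x - y"] by (simp add: sum_2)
qed

lemma cell_bounded: "bounded (cell k z)"
proof (cases "cell k z = {}")
  case False
  then obtain y where "y \<in> cell k z" by blast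
  then have "cell k z \<subseteq> cball y (2 / real (Suc k))"
    unfolding subset_iff mem_cball dist_norm using cell_diam by blast
  then show ?thesis using bounded_subset[OF bounded_cball] by blast
qed simp

lemma norm_frechet_le:
  assumes "(\<phi> has_derivative D) (at x)"
  shows "(cmod (D h))\<^sup>2 \<le> (\<Sum>i\<in>UNIV. (cmod (D (axis i 1)))\<^sup>2) * (norm (h::real^2))\<^sup>2"
proof -
  have l: "linear D" by (rule has_derivative_linear[OF assms])
  have h: "h = (\<Sum>i\<in>UNIV. h$i *\<^sub>R axis i 1)" by (simp add: vec_eq_iff forall_2 sum_2 axis_def)
  have "D h = D (\<Sum>i\<in>UNIV. h$i *\<^sub>R axis i 1)" using h by simp
  also have "\<dots> = h$1 *\<^sub>R D (axis 1 1) + h$2 *\<^sub>R D (axis 2 1)"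
    by (simp add: sum_2 linear_add[OF l] linear_scale[OF l])
  finally have "cmod (D h) \<le> \<bar>h$1\<bar> * cmod (D (axis 1 1)) + \<bar>h$2\<bar> * cmod (D (axis 2 1))"
    by (metis norm_scaleR norm_triangle_ineq)
  then have "(cmod (D h))\<^sup>2 \<le> (\<bar>h$1\<bar> * cmod (D (axis 1 1)) + \<bar>h$2\<bar> * cmod (D (axis 2 1)))\<^sup>2"
    by (intro power_mono) auto
  also have "\<dots> \<le> ((cmod (D (axis 1 1)))\<^sup>2 + (cmod (D (axis 2 1)))\<^sup>2) * ((h$1)\<^sup>2 + (h$2)\<^sup>2)"
  proof -
    have "(a * c + b * e)\<^sup>2 \<le> (c\<^sup>2 + e\<^sup>2) * (a\<^sup>2 + b\<^sup>2)" for a b c e :: real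
      using zero_le_power2[of "a * e - b * c"] by (simp add: power2_eq_square algebra_simps)
    from this[of "\<bar>h$1\<bar>" _ "\<bar>h$2\<bar>"] show ?thesis by simp
  qed
  also have "(h$1)\<^sup>2 + (h$2)\<^sup>2 = (norm h)\<^sup>2" by (simp add: norm_vec_def L2_set_def sum_2)
  finally show ?thesis by (simp add: sum_2)
qed

context bounded_open begin

definition cells :: "nat \<Rightarrow> (int \<times> int) set" where
  "cells k = {z. cell k z \<inter> \<Omega> \<noteq> {}}"

lemma finite_cells: "finite (cells k)"
proof -
  obtain R where R: "\<And>x. x \<in> \<Omega> \<Longrightarrow> norm x \<le> R" using bd bounded_iff by blast
  define n where "n = \<lceil>real (Suc k) * R\<rceil> + 1"
  have "cells k \<subseteq> {-n..n} \<times> {-n..n}"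
  proof
    fix z assume "z \<in> cells k"
    then obtain x where x: "x \<in> cell k z" "x \<in> \<Omega>" by (auto simp: cells_def)
    have "\<bar>x$j\<bar> \<le> R" for j using component_le_norm_cart[of x j] R[OF x(2)] by linarith
    then have "\<bar>real (Suc k) * x$j\<bar> \<le> real (Suc k) * R" for j by (simp add: abs_mult del: of_nat_Suc)
    then have *: "-n \<le> \<lfloor>real (Suc k) * x$j\<rfloor> \<and> \<lfloor>real (Suc k) * x$j\<rfloor> \<le> n" for j
      unfolding n_def abs_le_iff by (smt (verit) floor_mono le_of_int_ceiling of_int_floor_le floor_le_iff le_floor_iff of_int_add of_int_minus of_int_1)
    show "z \<in> {-n..n} \<times> {-n..n}" using *[of 1] *[of 2] x(1) by (cases z) (auto simp: cell_def)
  qed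
  then show ?thesis by (rule finite_subset) simp
qed

definition cell_ind :: "nat \<Rightarrow> int \<times> int \<Rightarrow> real^2 \<Rightarrow> complex" where
  "cell_ind k z x = of_real (indicat_real (cell k z) x)"

lemma cell_ind_L2: "cell_ind k z \<in> L2 \<Omega>"
  by (rule L2_bounded[where C = 1]) (auto simp: cell_ind_def[abs_def] intro!: borel_measurable_M)

lemma sqnorm_test:
  assumes "\<phi> \<in> test_functions \<Omega>"
  shows "sqnorm \<Omega> \<phi> = (LINT x|lborel. (cmod (\<phi> x))\<^sup>2)" "integrable lborel (\<lambda>x. (cmod (\<phi> x))\<^sup>2)"
proof -
  have "(\<lambda>x. \<phi> x * cnj (\<phi> x)) \<in> test_functions \<Omega>"
    by (rule test_functions_mult[OF test_functions_bounded_linear[OF assms bounded_linear_cnj] test_functionsD(1)[OF assms]])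
  also have "(\<lambda>x. \<phi> x * cnj (\<phi> x)) = (\<lambda>x. complex_of_real ((cmod (\<phi> x))\<^sup>2))" by (simp only: complex_norm_square)
  finally have t: "(\<lambda>x. complex_of_real ((cmod (\<phi> x))\<^sup>2)) \<in> test_functions \<Omega>" .
  have "complex_of_real (sqnorm \<Omega> \<phi>) = complex_of_real (LINT x|lborel. (cmod (\<phi> x))\<^sup>2)"
    using test_integral(2)[OF t] unfolding sqnorm_def by (simp only: integral_complex_of_real)
  then show "sqnorm \<Omega> \<phi> = (LINT x|lborel. (cmod (\<phi> x))\<^sup>2)" by simp
  show "integrable lborel (\<lambda>x. (cmod (\<phi> x))\<^sup>2)" using integrable_Re[OF test_integral(1)[OF t]] by simp
qed

text \<open>The Poincare inequality on every square of the grid, summed up. A test function vanishes outside the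
domain, so squares that cross the boundary need no special treatment. The diameter of a square is
at most \<open>2/(k+1)\<close>, which explains the factor \<open>8/(k+1)\<^sup>2\<close>.\<close>

lemma rellich_inequality_test:
  assumes p: "\<phi> \<in> test_functions \<Omega>"
  shows "sqnorm \<Omega> \<phi> \<le> 8 / (real (Suc k))\<^sup>2 * (\<Sum>i\<in>UNIV. sqnorm \<Omega> (pderiv_classical i \<phi>))
    + (\<Sum>z\<in>cells k. (cmod (L2_inner \<Omega> \<phi> (cell_ind k z)))\<^sup>2 / measure lborel (cell k z))"
proof -
  note pd = pderiv_classical_test_function[OF p]
  define F where "F x = (\<Sum>i\<in>UNIV. (cmod (pderiv_classical i \<phi> x))\<^sup>2)" for x
  have Fc: "continuous_on UNIV F" unfolding F_def using test_functionsD(2)[OF pd] by (intro continuous_intros) auto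
  have F0: "0 \<le> F x" for x unfolding F_def by (intro sum_nonneg) auto
  have Fb: "(cmod (frechet_derivative \<phi> (at x) h))\<^sup>2 \<le> F x * (norm h)\<^sup>2" for x h
    using norm_frechet_le[OF test_functionsD(3)[OF p]] by (simp add: F_def pderiv_classical_def)
  have Fi: "integrable lborel F" unfolding F_def by (intro Bochner_Integration.integrable_sum sqnorm_test(2) pd)
  have FI: "(LINT x|lborel. F x) = (\<Sum>i\<in>UNIV. sqnorm \<Omega> (pderiv_classical i \<phi>))"
    unfolding F_def using sqnorm_test[OF pd] by (subst Bochner_Integration.integral_sum) auto
  have outside: "\<phi> x = 0" "F x = 0" if "x \<notin> \<Omega>" for x
    using test_functionsD(4)[OF p that] test_functionsD(4)[OF pd that] by (simp_all add: F_def)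
  have part: "(\<Sum>z\<in>cells k. indicat_real (cell k z) x) = 1" if x: "x \<in> \<Omega>" for x
  proof -
    define z0 where "z0 = (\<lfloor>real (Suc k) * x$1\<rfloor>, \<lfloor>real (Suc k) * x$2\<rfloor>)"
    have "z0 \<in> cells k" using x by (auto simp: cells_def cell_def z0_def)
    moreover have "indicat_real (cell k z) x = (if z = z0 then 1 else 0)" for z
      by (cases z) (auto simp: cell_def z0_def indicator_def)
    ultimately show ?thesis using finite_cells by simp
  qed
  have split: "(LINT x|lborel. g x) = (\<Sum>z\<in>cells k. LINT x|lborel. indicat_real (cell k z) x * g x)"
    if "integrable lborel g" "\<And>x. x \<notin> \<Omega> \<Longrightarrow> g x = 0" for g
  proof -
    have "integrable lborel (\<lambda>x. indicat_real (cell k z) x * g x)" for z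
      using integrable_mult_indicator[OF _ that(1), of "cell k z"] by simp
    then have "(\<Sum>z\<in>cells k. LINT x|lborel. indicat_real (cell k z) x * g x) = (LINT x|lborel. (\<Sum>z\<in>cells k. indicat_real (cell k z) x * g x))"
      by (subst Bochner_Integration.integral_sum) auto
    also have "\<dots> = (LINT x|lborel. g x)"
    proof (rule Bochner_Integration.integral_cong)
      show "(\<Sum>z\<in>cells k. indicat_real (cell k z) x * g x) = g x" for x
        using part[of x] that(2)[of x] by (cases "x \<in> \<Omega>") (simp_all flip: sum_distrib_right)
    qed simp
    finally show ?thesis ..
  qed
  have A: "(LINT x|lborel. complex_of_real (indicat_real (cell k z) x) * \<phi> x) = L2_inner \<Omega> \<phi> (cell_ind k z)" for z
  proof -
    note [measurable] = test_integral(3)[OF p]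
    have e: "(\<lambda>x. if x \<in> \<Omega> then complex_of_real (indicat_real (cell k z) x) * \<phi> x else 0)
        = (\<lambda>x. complex_of_real (indicat_real (cell k z) x) * \<phi> x)" using outside by auto
    have "(LINT x|lborel. complex_of_real (indicat_real (cell k z) x) * \<phi> x)
        = (LINT x|lebesgue. complex_of_real (indicat_real (cell k z) x) * \<phi> x)"
      by (rule integral_completion[symmetric]) measurable
    also have "\<dots> = (LINT x|M. complex_of_real (indicat_real (cell k z) x) * \<phi> x)"
      by (subst Lebesgue_Measure.integral_restrict_UNIV[OF sets_Omega, symmetric]) (simp add: e)
    finally show ?thesis by (simp add: L2_inner_def cell_ind_def mult.commute)
  qed
  have "sqnorm \<Omega> \<phi> = (\<Sum>z\<in>cells k. LINT x|lborel. indicat_real (cell k z) x * (cmod (\<phi> x))\<^sup>2)"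
    unfolding sqnorm_test(1)[OF p] by (rule split[OF sqnorm_test(2)[OF p]]) (simp add: outside)
  also have "\<dots> \<le> (\<Sum>z\<in>cells k. 2 * (2 / real (Suc k))\<^sup>2 * (LINT x|lborel. indicat_real (cell k z) x * F x)
      + (cmod (L2_inner \<Omega> \<phi> (cell_ind k z)))\<^sup>2 / measure lborel (cell k z))"
    unfolding A[symmetric]
    by (intro sum_mono variance_le_gradient[OF test_functionsD(3)[OF p] Fc F0 Fb cell_borel cell_convex cell_bounded cell_diam])
  also have "\<dots> = 2 * (2 / real (Suc k))\<^sup>2 * (LINT x|lborel. F x)
      + (\<Sum>z\<in>cells k. (cmod (L2_inner \<Omega> \<phi> (cell_ind k z)))\<^sup>2 / measure lborel (cell k z))"
  proof -
    have sF: "integral\<^sup>L lborel F = (\<Sum>z\<in>cells k. LINT x|lborel. indicat_real (cell k z) x * F x)"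
      by (rule split[OF Fi outside(2)])
    show ?thesis unfolding sF by (simp only: sum.distrib sum_distrib_left[symmetric])
  qed
  also have "2 * (2 / real (Suc k))\<^sup>2 = 8 / (real (Suc k))\<^sup>2" by (simp add: power_divide)
  finally show ?thesis unfolding FI .
qed

text \<open>Up to a small multiple of the gradient, finitely many mean values control the norm: a
quantitative form of Rellich's theorem.\<close>

lemma rellich_inequality:
  assumes u: "u \<in> H10 \<Omega>"
  shows "sqnorm \<Omega> u \<le> 8 / (real (Suc k))\<^sup>2 * (\<Sum>i\<in>UNIV. sqnorm \<Omega> (wpderiv \<Omega> i u))
    + (\<Sum>z\<in>cells k. (cmod (L2_inner \<Omega> u (cell_ind k z)))\<^sup>2 / measure lborel (cell k z))"
proof -
  obtain \<phi> where p: "\<And>n::nat. \<phi> n \<in> test_functions \<Omega>" "(\<lambda>n. sqnorm \<Omega> (lcf 1 (\<phi> n) (-1) u)) \<longlonglongrightarrow> 0"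
    "\<And>i. (\<lambda>n. sqnorm \<Omega> (lcf 1 (pderiv_classical i (\<phi> n)) (-1) (wpderiv \<Omega> i u))) \<longlonglongrightarrow> 0" using H10E[OF u] by blast
  note pL = test_L2[OF p(1)] and pdL = test_L2[OF pderiv_classical_test_function[OF p(1)]]
  have "(\<lambda>n. sqnorm \<Omega> (\<phi> n)) \<longlonglongrightarrow> sqnorm \<Omega> u" by (rule sqnorm_tendsto[OF pL H10_L2[OF u] p(2)])
  moreover have "(\<lambda>n. 8 / (real (Suc k))\<^sup>2 * (\<Sum>i\<in>UNIV. sqnorm \<Omega> (pderiv_classical i (\<phi> n)))
    + (\<Sum>z\<in>cells k. (cmod (L2_inner \<Omega> (\<phi> n) (cell_ind k z)))\<^sup>2 / measure lborel (cell k z)))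
    \<longlonglongrightarrow> 8 / (real (Suc k))\<^sup>2 * (\<Sum>i\<in>UNIV. sqnorm \<Omega> (wpderiv \<Omega> i u))
    + (\<Sum>z\<in>cells k. (cmod (L2_inner \<Omega> u (cell_ind k z)))\<^sup>2 / measure lborel (cell k z))"
    unfolding divide_inverse
    by (intro tendsto_add tendsto_mult tendsto_const tendsto_sum tendsto_power tendsto_norm
      L2_inner_tendsto[OF pL H10_L2[OF u] cell_ind_L2 p(2)] sqnorm_tendsto[OF pdL H10_wpderiv_L2[OF u] p(3)])
  ultimately show ?thesis by (rule LIMSEQ_le) (use rellich_inequality_test[OF p(1)] in blast)
qed

end

context bounded_open begin

section \<open>The pencil of the twisted Laplacian\<close>

definition radius :: real where "radius = (SOME R. 0 < R \<and> (\<forall>x\<in>\<Omega>. norm x \<le> R))"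

lemma radius: "0 < radius" "x \<in> \<Omega> \<Longrightarrow> norm x \<le> radius"
proof -
  have "\<exists>R. 0 < R \<and> (\<forall>x\<in>\<Omega>. norm x \<le> R)" using bd bounded_pos by auto
  from someI_ex[OF this] show "0 < radius" "x \<in> \<Omega> \<Longrightarrow> norm x \<le> radius" unfolding radius_def by auto
qed

text \<open>The operator \<open>i \<beta> \<partial>\<^sub>\<phi>\<close>, which enters the form through \<open>twist \<beta> u - p u\<close>.\<close>

definition twist :: "real \<Rightarrow> (real^2 \<Rightarrow> complex) \<Rightarrow> real^2 \<Rightarrow> complex" where
  "twist \<beta> u x = \<i> * of_real \<beta> * angular_deriv \<Omega> u x"

lemma coord_L2:
  assumes "u \<in> L2 \<Omega>" shows "(\<lambda>x. of_real (x$j) * u x) \<in> L2 \<Omega>"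
proof (rule L2_dominated[OF assms, where C = radius])
  have "(\<lambda>x::real^2. x$j) \<in> borel_measurable borel"
    by (rule borel_measurable_continuous_onI) (intro continuous_intros)
  from borel_measurable_M[OF this] have [measurable]: "(\<lambda>x. x$j) \<in> borel_measurable M" .
  note [measurable] = L2_measurable[OF assms]
  show "(\<lambda>x. of_real (x$j) * u x) \<in> borel_measurable M" by measurable
  fix x assume "x \<in> \<Omega>"
  then have "\<bar>x$j\<bar> \<le> radius" using radius(2) component_le_norm_cart[of x j] by force
  then show "cmod (of_real (x$j) * u x) \<le> radius * cmod (u x)"
    by (simp add: norm_mult mult_right_mono)
qed

lemma twist_L2:
  assumes "u \<in> H10 \<Omega>" shows "twist \<beta> u \<in> L2 \<Omega>"
proof -
  have e: "twist \<beta> u = lcf (\<i> * of_real \<beta>) (\<lambda>x. of_real (x$1) * wpderiv \<Omega> 2 u x) (- \<i> * of_real \<beta>) (\<lambda>x. of_real (x$2) * wpderiv \<Omega> 1 u x)"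
    by (auto simp: twist_def angular_deriv_def lcf_def algebra_simps)
  show ?thesis unfolding e by (intro L2_lcf coord_L2 H10_wpderiv_L2 assms)
qed

lemma twist_lcf:
  assumes "u \<in> H10 \<Omega>" "v \<in> H10 \<Omega>"
  shows "AE x in M. twist \<beta> (lcf a u b v) x = lcf a (twist \<beta> u) b (twist \<beta> v) x"
  using H10_lcf(2)[OF assms, of 1 a b] H10_lcf(2)[OF assms, of 2 a b]
  by eventually_elim (simp add: twist_def angular_deriv_def lcf_def algebra_simps)

lemma sqnorm_twist_le:
  assumes "u \<in> H10 \<Omega>"
  shows "sqnorm \<Omega> (twist \<beta> u) \<le> 2 * \<beta>\<^sup>2 * radius\<^sup>2 * (\<Sum>i\<in>UNIV. sqnorm \<Omega> (wpderiv \<Omega> i u))"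
proof -
  note w = H10_wpderiv_L2[OF assms, THEN L2_integrable_sq]
  have "sqnorm \<Omega> (twist \<beta> u) \<le> (LINT x|M. 2 * \<beta>\<^sup>2 * radius\<^sup>2 * ((cmod (wpderiv \<Omega> 1 u x))\<^sup>2 + (cmod (wpderiv \<Omega> 2 u x))\<^sup>2))"
    unfolding sqnorm_def
  proof (rule Bochner_Integration.integral_mono)
    fix x assume "x \<in> space M"
    then have "norm x \<le> radius" using radius by simp
    then have c: "\<bar>x$j\<bar> \<le> radius" for j using component_le_norm_cart[of x j] by linarith
    let ?a = "cmod (wpderiv \<Omega> 1 u x)" and ?b = "cmod (wpderiv \<Omega> 2 u x)"
    have "cmod (angular_deriv \<Omega> u x) \<le> \<bar>x$1\<bar> * ?b + \<bar>x$2\<bar> * ?a"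
      unfolding angular_deriv_def by (rule order_trans[OF norm_triangle_ineq4]) (simp add: norm_mult)
    also have "\<dots> \<le> radius * ?b + radius * ?a" by (intro add_mono mult_right_mono c) auto
    finally have "cmod (angular_deriv \<Omega> u x) \<le> radius * (?a + ?b)" by (simp add: algebra_simps)
    then have "(cmod (angular_deriv \<Omega> u x))\<^sup>2 \<le> (radius * (?a + ?b))\<^sup>2" by (intro power_mono) auto
    also have "\<dots> \<le> radius\<^sup>2 * (2 * (?a\<^sup>2 + ?b\<^sup>2))"
      unfolding power_mult_distrib using sum_squares_bound[of ?a ?b]
      by (intro mult_left_mono) (auto simp: power2_sum)
    finally have "\<beta>\<^sup>2 * (cmod (angular_deriv \<Omega> u x))\<^sup>2 \<le> \<beta>\<^sup>2 * (radius\<^sup>2 * (2 * (?a\<^sup>2 + ?b\<^sup>2)))" by (intro mult_left_mono) auto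
    then show "(cmod (twist \<beta> u x))\<^sup>2 \<le> 2 * \<beta>\<^sup>2 * radius\<^sup>2 * (?a\<^sup>2 + ?b\<^sup>2)"
      by (simp add: twist_def norm_mult power_mult_distrib algebra_simps)
  qed (use twist_L2[OF assms, THEN L2_integrable_sq] w in auto)
  also have "\<dots> = 2 * \<beta>\<^sup>2 * radius\<^sup>2 * (\<Sum>i\<in>UNIV. sqnorm \<Omega> (wpderiv \<Omega> i u))"
    using w by (simp add: sum_2 sqnorm_def)
  finally show ?thesis .
qed

text \<open>The coefficients of \<open>p\<^sup>0\<close> and \<open>p\<^sup>1\<close> in the sesquilinear form.\<close>

definition Aform :: "real \<Rightarrow> (real^2 \<Rightarrow> complex) \<Rightarrow> (real^2 \<Rightarrow> complex) \<Rightarrow> complex" where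
  "Aform \<beta> u v = (\<Sum>i\<in>UNIV. L2_inner \<Omega> (wpderiv \<Omega> i u) (wpderiv \<Omega> i v)) + L2_inner \<Omega> (twist \<beta> u) (twist \<beta> v)"

definition Bform :: "real \<Rightarrow> (real^2 \<Rightarrow> complex) \<Rightarrow> (real^2 \<Rightarrow> complex) \<Rightarrow> complex" where
  "Bform \<beta> u v = - (L2_inner \<Omega> (twist \<beta> u) v + L2_inner \<Omega> u (twist \<beta> v))"

lemma sform_eq:
  assumes u: "u \<in> H10 \<Omega>" and v: "v \<in> H10 \<Omega>"
  shows "sform \<Omega> p \<beta> u v = Aform \<beta> u v + of_real p * Bform \<beta> u v + of_real (p\<^sup>2) * L2_inner \<Omega> u v"
proof -
  note L = H10_wpderiv_L2[OF u] H10_wpderiv_L2[OF v] twist_L2[OF u, of \<beta>] twist_L2[OF v, of \<beta>] H10_L2[OF u] H10_L2[OF v]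
  have "sform \<Omega> p \<beta> u v = (LINT x|M. (\<Sum>i\<in>UNIV. wpderiv \<Omega> i u x * cnj (wpderiv \<Omega> i v x))
        + lcf 1 (twist \<beta> u) (- of_real p) u x * cnj (lcf 1 (twist \<beta> v) (- of_real p) v x))"
    by (simp add: sform_def twist_def lcf_def)
  also have "\<dots> = (\<Sum>i\<in>UNIV. L2_inner \<Omega> (wpderiv \<Omega> i u) (wpderiv \<Omega> i v))
      + L2_inner \<Omega> (lcf 1 (twist \<beta> u) (- of_real p) u) (lcf 1 (twist \<beta> v) (- of_real p) v)"
    unfolding L2_inner_def
    using L2_mult_integrable(2)[OF L(1,2)] L2_mult_integrable(2)[OF L2_lcf[OF L(3,5)] L2_lcf[OF L(4,6)]]
    by (subst Bochner_Integration.integral_add) (auto intro!: Bochner_Integration.integral_sum)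
  also have "L2_inner \<Omega> (lcf 1 (twist \<beta> u) (- of_real p) u) (lcf 1 (twist \<beta> v) (- of_real p) v)
    = L2_inner \<Omega> (twist \<beta> u) (twist \<beta> v) + of_real p * Bform \<beta> u v + of_real (p\<^sup>2) * L2_inner \<Omega> u v"
    using L by (simp add: L2.lin L2.lin_right L2_lcf Bform_def power2_eq_square algebra_simps)
  finally show ?thesis by (simp add: Aform_def add.assoc)
qed

lemma N_form: "hermitian_form (H10 \<Omega>) lcf (L2_inner \<Omega>)"
  by (rule hermitian_form_subset[OF L2_form]) (use H10_L2 H10_lcf(1) in auto)

lemma inner_wpderiv_lcf:
  assumes "u \<in> H10 \<Omega>" "v \<in> H10 \<Omega>" "f \<in> L2 \<Omega>"
  shows "L2_inner \<Omega> (wpderiv \<Omega> i (lcf a u b v)) f = a * L2_inner \<Omega> (wpderiv \<Omega> i u) f + b * L2_inner \<Omega> (wpderiv \<Omega> i v) f"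
    "L2_inner \<Omega> (twist \<beta> (lcf a u b v)) f = a * L2_inner \<Omega> (twist \<beta> u) f + b * L2_inner \<Omega> (twist \<beta> v) f"
proof -
  note l = H10_lcf[OF assms(1,2), where a = a and b = b]
  have "L2_inner \<Omega> (wpderiv \<Omega> i (lcf a u b v)) f = L2_inner \<Omega> (lcf a (wpderiv \<Omega> i u) b (wpderiv \<Omega> i v)) f"
    by (rule L2_inner_cong_AE[OF l(2)]) (use assms H10_wpderiv_L2 l(1) L2_lcf in auto)
  then show "L2_inner \<Omega> (wpderiv \<Omega> i (lcf a u b v)) f = a * L2_inner \<Omega> (wpderiv \<Omega> i u) f + b * L2_inner \<Omega> (wpderiv \<Omega> i v) f"
    using assms H10_wpderiv_L2 by (simp add: L2.lin)
  have "L2_inner \<Omega> (twist \<beta> (lcf a u b v)) f = L2_inner \<Omega> (lcf a (twist \<beta> u) b (twist \<beta> v)) f"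
    by (rule L2_inner_cong_AE[OF twist_lcf[OF assms(1,2)]]) (use assms twist_L2 l(1) L2_lcf in auto)
  then show "L2_inner \<Omega> (twist \<beta> (lcf a u b v)) f = a * L2_inner \<Omega> (twist \<beta> u) f + b * L2_inner \<Omega> (twist \<beta> v) f"
    using assms twist_L2 by (simp add: L2.lin)
qed

lemma inner_herm: "u \<in> L2 \<Omega> \<Longrightarrow> v \<in> L2 \<Omega> \<Longrightarrow> cnj (L2_inner \<Omega> u v) = L2_inner \<Omega> v u"
  using L2.herm[of u \<Omega> v] by simp

lemma A_form: "hermitian_form (H10 \<Omega>) lcf (Aform \<beta>)"
proof
  fix u v w a b assume uvw: "u \<in> H10 \<Omega>" "v \<in> H10 \<Omega>" "w \<in> H10 \<Omega>"
  show "Aform \<beta> (lcf a u b v) w = a * Aform \<beta> u w + b * Aform \<beta> v w"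
    unfolding Aform_def
    by (simp add: inner_wpderiv_lcf[OF uvw(1,2) H10_wpderiv_L2[OF uvw(3)]] inner_wpderiv_lcf[OF uvw(1,2) twist_L2[OF uvw(3)]]
       sum.distrib sum_distrib_left distrib_left)
next
  fix u v assume "u \<in> H10 \<Omega>" "v \<in> H10 \<Omega>"
  then show "Aform \<beta> v u = cnj (Aform \<beta> u v)"
    by (simp add: Aform_def inner_herm H10_wpderiv_L2 twist_L2)
qed (rule H10_lcf(1))

lemma B_form: "hermitian_form (H10 \<Omega>) lcf (Bform \<beta>)"
proof
  fix u v w a b assume uvw: "u \<in> H10 \<Omega>" "v \<in> H10 \<Omega>" "w \<in> H10 \<Omega>"
  show "Bform \<beta> (lcf a u b v) w = a * Bform \<beta> u w + b * Bform \<beta> v w"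
    unfolding Bform_def using uvw
    by (simp add: inner_wpderiv_lcf(2)[OF uvw(1,2) H10_L2[OF uvw(3)]] L2.lin H10_L2 twist_L2 algebra_simps)
next
  fix u v assume "u \<in> H10 \<Omega>" "v \<in> H10 \<Omega>"
  then show "Bform \<beta> v u = cnj (Bform \<beta> u v)"
    by (simp add: Bform_def inner_herm H10_L2 twist_L2)
qed (rule H10_lcf(1))

lemma Aform_diag: "Re (Aform \<beta> u u) = (\<Sum>i\<in>UNIV. sqnorm \<Omega> (wpderiv \<Omega> i u)) + sqnorm \<Omega> (twist \<beta> u)"
  by (simp add: Aform_def sqnorm_inner(2))

lemma sqnorm_wpderiv_le: "sqnorm \<Omega> (wpderiv \<Omega> i u) \<le> Re (Aform \<beta> u u)"
  using member_le_sum[of i UNIV "\<lambda>i. sqnorm \<Omega> (wpderiv \<Omega> i u)"] sqnorm_nonneg[of \<Omega> "twist \<beta> u"]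
  unfolding Aform_diag by (simp add: sqnorm_nonneg add_increasing2)

lemma Aform_le_gradient:
  assumes "u \<in> H10 \<Omega>"
  shows "Re (Aform \<beta> u u) \<le> (1 + 2 * \<beta>\<^sup>2 * radius\<^sup>2) * (\<Sum>i\<in>UNIV. sqnorm \<Omega> (wpderiv \<Omega> i u))"
  using sqnorm_twist_le[OF assms, of \<beta>] unfolding Aform_diag by (simp add: algebra_simps)

text \<open>A countable product of closed discs is compact by Tychonoff's theorem and metrizable, hence
sequentially compact; this replaces a diagonal argument.\<close>

lemma bounded_functionals_subsequence:
  fixes l :: "'i::countable \<Rightarrow> nat \<Rightarrow> complex"
  assumes "\<And>i n. cmod (l i n) \<le> c i"
  shows "\<exists>r::nat \<Rightarrow> nat. strict_mono r \<and> (\<forall>i. Cauchy (\<lambda>n. l i (r n)))"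
proof -
  have "compactin (product_topology (\<lambda>i::'i. (euclidean::complex topology)) UNIV) (PiE UNIV (\<lambda>i. cball 0 (c i)))"
    by (subst compactin_PiE) (auto simp: compactin_euclidean_iff)
  then have "compact (PiE UNIV (\<lambda>i::'i. cball (0::complex) (c i)))"
    by (simp add: euclidean_product_topology compactin_euclidean_iff)
  then have "seq_compact (PiE UNIV (\<lambda>i::'i. cball (0::complex) (c i)))" by (simp add: compact_imp_seq_compact)
  moreover have "(\<lambda>i. l i n) \<in> PiE UNIV (\<lambda>i. cball 0 (c i))" for n using assms by auto
  ultimately obtain f r where r: "strict_mono r" and f: "((\<lambda>n i. l i n) \<circ> r) \<longlonglongrightarrow> f"
    unfolding seq_compact_def by metis
  have "(\<lambda>n. l i (r n)) \<longlonglongrightarrow> f i" for i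
  proof -
    have "isCont (\<lambda>g::'i \<Rightarrow> complex. g i) f"
      using continuous_on_eq_continuous_at[OF open_UNIV, THEN iffD1, OF continuous_on_product_coordinates] by blast
    from isCont_tendsto_compose[OF this f] show ?thesis by (simp add: o_def)
  qed
  then show ?thesis using r LIMSEQ_imp_Cauchy by blast
qed

text \<open>Along a subsequence the mean values over all squares of all grids converge. Applied to differences,
\<open>rellich_inequality\<close> on a grid that is fine enough then leaves only finitely many mean values, and
these are small.\<close>

lemma rellich_compactness:
  assumes s: "\<And>n::nat. s n \<in> H10 \<Omega>" and C: "\<And>n. (\<Sum>i\<in>UNIV. sqnorm \<Omega> (wpderiv \<Omega> i (s n))) + sqnorm \<Omega> (s n) \<le> C"
  shows "\<exists>r::nat \<Rightarrow> nat. strict_mono r \<and> (\<forall>e>0. \<exists>K. \<forall>m\<ge>K. \<forall>n\<ge>K. sqnorm \<Omega> (lcf 1 (s (r m)) (-1) (s (r n))) < e)"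
proof -
  define l where "l kz n = L2_inner \<Omega> (s n) (cell_ind (fst kz) (snd kz))" for kz :: "nat \<times> int \<times> int" and n
  have g0: "0 \<le> (\<Sum>i\<in>UNIV. sqnorm \<Omega> (wpderiv \<Omega> i u))" for u by (intro sum_nonneg sqnorm_nonneg)
  have sC: "sqnorm \<Omega> (s n) \<le> C" for n using C[of n] g0[of "s n"] by linarith
  have C0: "0 \<le> C" using sC[of 0] sqnorm_nonneg[of \<Omega> "s 0"] by linarith
  have "cmod (l kz n) \<le> sqrt C * sqrt (sqnorm \<Omega> (cell_ind (fst kz) (snd kz)))" for kz n
    unfolding l_def
    by (rule order_trans[OF L2_Cauchy_Schwarz[OF H10_L2[OF s] cell_ind_L2]])
      (use sC sqnorm_nonneg in \<open>auto intro!: mult_right_mono\<close>)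
  from bounded_functionals_subsequence[of l, OF this]
  obtain r where r: "strict_mono r" and rc: "\<And>kz. Cauchy (\<lambda>n. l kz (r n))" by blast
  have "\<exists>K. \<forall>m\<ge>K. \<forall>n\<ge>K. sqnorm \<Omega> (lcf 1 (s (r m)) (-1) (s (r n))) < e" if e: "e > 0" for e
  proof -
    \<comment> \<open>the gradient term for a difference is at most \<open>8/(k+1)\<^sup>2 * 4 C\<close>, and it has to be below \<open>e/2\<close>\<close>
    obtain k :: nat where k: "64 * C / e < real k" using reals_Archimedean2 by blast
    have k1: "8 / (real (Suc k))\<^sup>2 * (4 * C) \<le> e / 2"
    proof -
      have "64 * C \<le> e * real (Suc k)" using k e by (simp add: divide_less_eq mult.commute algebra_simps)
      also have "\<dots> \<le> e * (real (Suc k))\<^sup>2" using e by (intro mult_left_mono) (auto simp: power2_eq_square)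
      finally show ?thesis by (simp add: divide_le_eq del: of_nat_Suc)
    qed
    define w where "w z = measure lborel (cell k z)" for z
    define g where "g m n = (\<Sum>z\<in>cells k. (cmod (l (k, z) (r m) - l (k, z) (r n)))\<^sup>2 / w z)" for m n
    have "\<exists>K. \<forall>m\<ge>K. \<forall>n\<ge>K. g m n < e / 2"
    proof -
      define N where "N = real (card (cells k)) + 1"
      have Np: "N > 0" by (simp add: N_def add_nonneg_pos)
      have "\<exists>K. \<forall>m\<ge>K. \<forall>n\<ge>K. (cmod (l (k, z) (r m) - l (k, z) (r n)))\<^sup>2 / w z \<le> e / (2 * N)" for z
      proof (cases "w z = 0")
        case False
        then have wp: "w z > 0" by (simp add: w_def less_le)
        define q where "q = sqrt (w z * (e / (2 * N)))"
        have "q > 0" using wp e Np by (simp add: q_def)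
        with rc[of "(k, z)"] obtain K where K: "\<And>m n. m \<ge> K \<Longrightarrow> n \<ge> K \<Longrightarrow> cmod (l (k, z) (r m) - l (k, z) (r n)) < q"
          by (auto simp: Cauchy_def dist_norm) (metis)
        have "(cmod (l (k, z) (r m) - l (k, z) (r n)))\<^sup>2 / w z \<le> e / (2 * N)" if "m \<ge> K" "n \<ge> K" for m n
        proof -
          have "(cmod (l (k, z) (r m) - l (k, z) (r n)))\<^sup>2 \<le> q\<^sup>2" using K[OF that] by (intro power_mono) auto
          also have "\<dots> = e / (2 * N) * w z" using wp e Np by (simp add: q_def)
          finally show ?thesis using wp by (simp add: pos_divide_le_eq)
        qed
        then show ?thesis by blast
      qed (use e Np in auto)
      then obtain K where K: "\<And>z m n. m \<ge> K z \<Longrightarrow> n \<ge> K z \<Longrightarrow> (cmod (l (k, z) (r m) - l (k, z) (r n)))\<^sup>2 / w z \<le> e / (2 * N)" by metis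
      have "g m n < e / 2" if mn: "m \<ge> (\<Sum>z\<in>cells k. K z)" "n \<ge> (\<Sum>z\<in>cells k. K z)" for m n
      proof -
        have "g m n \<le> (\<Sum>z\<in>cells k. e / (2 * N))"
          unfolding g_def
        proof (intro sum_mono K)
          fix z assume "z \<in> cells k"
          then have "K z \<le> (\<Sum>z\<in>cells k. K z)" using finite_cells by (intro member_le_sum) auto
          then show "K z \<le> m" "K z \<le> n" using mn by auto
        qed
        also have "\<dots> = (N - 1) / N * (e / 2)" by (simp add: N_def)
        also have "\<dots> < 1 * (e / 2)" using e Np by (intro mult_strict_right_mono) auto
        finally show ?thesis by simp
      qed
      then show ?thesis by blast
    qed
    then obtain K where K: "\<And>m n. m \<ge> K \<Longrightarrow> n \<ge> K \<Longrightarrow> g m n < e / 2" by blast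
    have "sqnorm \<Omega> (lcf 1 (s (r m)) (-1) (s (r n))) < e" if mn: "m \<ge> K" "n \<ge> K" for m n
    proof -
      let ?d = "lcf 1 (s (r m)) (-1) (s (r n))"
      have dH: "?d \<in> H10 \<Omega>" by (rule H10_lcf(1)[OF s s])
      have "(\<Sum>i\<in>UNIV. sqnorm \<Omega> (wpderiv \<Omega> i ?d)) \<le> (\<Sum>i\<in>UNIV. 2 * sqnorm \<Omega> (wpderiv \<Omega> i (s (r m))) + 2 * sqnorm \<Omega> (wpderiv \<Omega> i (s (r n))))"
      proof (rule sum_mono)
        fix i :: 2
        have "sqnorm \<Omega> (wpderiv \<Omega> i ?d) = sqnorm \<Omega> (lcf 1 (wpderiv \<Omega> i (s (r m))) (-1) (wpderiv \<Omega> i (s (r n))))"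
          by (rule sqnorm_cong_AE[OF H10_lcf(2)[OF s s]]) (intro H10_wpderiv_L2 dH L2_lcf s)+
        also have "\<dots> \<le> 2 * sqnorm \<Omega> (wpderiv \<Omega> i (s (r m))) + 2 * sqnorm \<Omega> (wpderiv \<Omega> i (s (r n)))"
          using sqnorm_lcf_le[OF H10_wpderiv_L2[OF s] H10_wpderiv_L2[OF s], where a = 1 and b = "-1"] by simp
        finally show "sqnorm \<Omega> (wpderiv \<Omega> i ?d) \<le> 2 * sqnorm \<Omega> (wpderiv \<Omega> i (s (r m))) + 2 * sqnorm \<Omega> (wpderiv \<Omega> i (s (r n)))" .
      qed
      also have "\<dots> = 2 * (\<Sum>i\<in>UNIV. sqnorm \<Omega> (wpderiv \<Omega> i (s (r m)))) + 2 * (\<Sum>i\<in>UNIV. sqnorm \<Omega> (wpderiv \<Omega> i (s (r n))))"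
        by (simp add: sum.distrib sum_distrib_left)
      also have "\<dots> \<le> 4 * C"
        using C[of "r m"] C[of "r n"] sqnorm_nonneg[of \<Omega> "s (r m)"] sqnorm_nonneg[of \<Omega> "s (r n)"] by linarith
      finally have "8 / (real (Suc k))\<^sup>2 * (\<Sum>i\<in>UNIV. sqnorm \<Omega> (wpderiv \<Omega> i ?d)) \<le> 8 / (real (Suc k))\<^sup>2 * (4 * C)"
        by (intro mult_left_mono) auto
      moreover have "(\<Sum>z\<in>cells k. (cmod (L2_inner \<Omega> ?d (cell_ind k z)))\<^sup>2 / measure lborel (cell k z)) = g m n"
        unfolding g_def l_def w_def using L2.lin[OF H10_L2[OF s] H10_L2[OF s] cell_ind_L2, where a = 1 and b = "-1"] by simp
      ultimately show ?thesis using rellich_inequality[OF dH, of k] K[OF mn] k1 by linarith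
    qed
    then show ?thesis by blast
  qed
  then show ?thesis using r by blast
qed

text \<open>The form norm given by \<open>A + N\<close> is equivalent to the norm of \<open>H\<^sup>1\<close>, because \<open>\<partial>\<^sub>\<phi>\<close> has bounded coefficients
on a bounded domain. Completeness is then that of \<open>L\<^sup>2\<close> for the function and its derivatives,
combined with closedness of the weak derivative; compactness is Rellich's theorem.\<close>

lemma pencil: "form_pencil (H10 \<Omega>) lcf (Aform \<beta>) (Bform \<beta>) (L2_inner \<Omega>)"
proof (intro form_pencil.intro A_form B_form N_form form_pencil_axioms.intro)
  fix u assume "u \<in> H10 \<Omega>"
  show "0 \<le> Re (Aform \<beta> u u)" unfolding Aform_diag by (intro add_nonneg_nonneg sum_nonneg sqnorm_nonneg)
  show "0 \<le> Re (L2_inner \<Omega> u u)" by (simp add: sqnorm_inner(2) sqnorm_nonneg)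
next
  fix u v assume u: "u \<in> H10 \<Omega>" and v: "v \<in> H10 \<Omega>"
  have t: "sqrt (sqnorm \<Omega> (twist \<beta> w)) \<le> sqrt (Re (Aform \<beta> w w))" for w
    unfolding Aform_diag by (simp add: sum_nonneg sqnorm_nonneg)
  have "cmod (Bform \<beta> u v) \<le> cmod (L2_inner \<Omega> (twist \<beta> u) v) + cmod (L2_inner \<Omega> u (twist \<beta> v))"
    unfolding Bform_def norm_minus_cancel by (rule norm_triangle_ineq)
  also have "\<dots> \<le> sqrt (sqnorm \<Omega> (twist \<beta> u)) * sqrt (sqnorm \<Omega> v) + sqrt (sqnorm \<Omega> u) * sqrt (sqnorm \<Omega> (twist \<beta> v))"
    by (intro add_mono L2_Cauchy_Schwarz twist_L2 H10_L2 u v)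
  also have "\<dots> \<le> sqrt (Re (Aform \<beta> u u)) * sqrt (sqnorm \<Omega> v) + sqrt (sqnorm \<Omega> u) * sqrt (Re (Aform \<beta> v v))"
    by (intro add_mono mult_left_mono mult_right_mono t) (auto simp: sqnorm_nonneg)
  finally show "cmod (Bform \<beta> u v) \<le> sqrt (Re (Aform \<beta> u u)) * sqrt (Re (L2_inner \<Omega> v v)) + sqrt (Re (L2_inner \<Omega> u u)) * sqrt (Re (Aform \<beta> v v))"
    by (simp add: sqnorm_inner(2))
next
  fix s :: "nat \<Rightarrow> _" and C assume s: "\<And>n. s n \<in> H10 \<Omega>" and C: "\<And>n. Re (Aform \<beta> (s n) (s n)) + Re (L2_inner \<Omega> (s n) (s n)) \<le> C"
  have "(\<Sum>i\<in>UNIV. sqnorm \<Omega> (wpderiv \<Omega> i (s n))) + sqnorm \<Omega> (s n) \<le> C" for n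
    using C[of n] sqnorm_nonneg[of \<Omega> "twist \<beta> (s n)"] unfolding Aform_diag sqnorm_inner(2) by linarith
  from rellich_compactness[OF s this]
  show "\<exists>r::nat \<Rightarrow> nat. strict_mono r \<and> (\<forall>e>0. \<exists>M. \<forall>m\<ge>M. \<forall>n\<ge>M.
          Re (L2_inner \<Omega> (lcf 1 (s (r m)) (-1) (s (r n))) (lcf 1 (s (r m)) (-1) (s (r n)))) < e)"
    unfolding sqnorm_inner(2) .
next
  fix s :: "nat \<Rightarrow> _" assume s: "\<And>n. s n \<in> H10 \<Omega>"
    and C: "\<And>e. e > 0 \<Longrightarrow> \<exists>M. \<forall>m\<ge>M. \<forall>n\<ge>M. Re (Aform \<beta> (lcf 1 (s m) (-1) (s n)) (lcf 1 (s m) (-1) (s n)))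
            + Re (L2_inner \<Omega> (lcf 1 (s m) (-1) (s n)) (lcf 1 (s m) (-1) (s n))) < e"
  note sL = H10_L2[OF s] and swL = H10_wpderiv_L2[OF s]
  have dH: "lcf 1 (s m) (-1) (s n) \<in> H10 \<Omega>" for m n by (rule H10_lcf(1)[OF s s])
  have w: "sqnorm \<Omega> (wpderiv \<Omega> i (lcf 1 (s m) (-1) (s n))) = sqnorm \<Omega> (lcf 1 (wpderiv \<Omega> i (s m)) (-1) (wpderiv \<Omega> i (s n)))" for i m n
    by (rule sqnorm_cong_AE[OF H10_lcf(2)[OF s s]]) (intro H10_wpderiv_L2 dH L2_lcf s)+
  have A0: "0 \<le> Re (Aform \<beta> u u)" for u unfolding Aform_diag by (intro add_nonneg_nonneg sum_nonneg sqnorm_nonneg)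
  have "\<exists>K. \<forall>m\<ge>K. \<forall>n\<ge>K. sqnorm \<Omega> (lcf 1 (s m) (-1) (s n)) < e" if "e > 0" for e
    using C[OF that] A0 unfolding sqnorm_inner(2) by (meson le_less_trans le_add_same_cancel2)
  from L2_complete[OF sL this] obtain u where u: "u \<in> L2 \<Omega>" "(\<lambda>n. sqnorm \<Omega> (lcf 1 (s n) (-1) u)) \<longlonglongrightarrow> 0" by blast
  have "\<exists>K. \<forall>m\<ge>K. \<forall>n\<ge>K. sqnorm \<Omega> (lcf 1 (wpderiv \<Omega> i (s m)) (-1) (wpderiv \<Omega> i (s n))) < e" if e: "e > 0" for e i
  proof -
    obtain K where K: "\<And>m n. m \<ge> K \<Longrightarrow> n \<ge> K \<Longrightarrow> Re (Aform \<beta> (lcf 1 (s m) (-1) (s n)) (lcf 1 (s m) (-1) (s n)))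
            + sqnorm \<Omega> (lcf 1 (s m) (-1) (s n)) < e" using C[OF e] unfolding sqnorm_inner(2) by blast
    have "sqnorm \<Omega> (lcf 1 (wpderiv \<Omega> i (s m)) (-1) (wpderiv \<Omega> i (s n))) < e" if "m \<ge> K" "n \<ge> K" for m n
      using K[OF that] sqnorm_wpderiv_le[of i "lcf 1 (s m) (-1) (s n)" \<beta>] sqnorm_nonneg[of \<Omega> "lcf 1 (s m) (-1) (s n)"]
      unfolding w by linarith
    then show ?thesis by blast
  qed
  from L2_complete[OF swL this] have "\<exists>g\<in>L2 \<Omega>. (\<lambda>n. sqnorm \<Omega> (lcf 1 (wpderiv \<Omega> i (s n)) (-1) g)) \<longlonglongrightarrow> 0" for i .
  then obtain g where g: "\<And>i. g i \<in> L2 \<Omega>" "\<And>i. (\<lambda>n. sqnorm \<Omega> (lcf 1 (wpderiv \<Omega> i (s n)) (-1) (g i))) \<longlonglongrightarrow> 0" by metis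
  have uH: "u \<in> H10 \<Omega>" and gu: "\<And>i. AE x in M. wpderiv \<Omega> i u x = g i x"
    using H10_complete[OF s u(1) g(1) u(2) g(2)] by auto
  have duH: "lcf 1 (s n) (-1) u \<in> H10 \<Omega>" for n by (rule H10_lcf(1)[OF s uH])
  have w': "sqnorm \<Omega> (wpderiv \<Omega> i (lcf 1 (s n) (-1) u)) = sqnorm \<Omega> (lcf 1 (wpderiv \<Omega> i (s n)) (-1) (g i))" for i n
  proof (rule sqnorm_cong_AE)
    show "AE x in M. wpderiv \<Omega> i (lcf 1 (s n) (-1) u) x = lcf 1 (wpderiv \<Omega> i (s n)) (-1) (g i) x"
      using H10_lcf(2)[OF s[of n] uH, of i 1 "-1"] gu[of i] by eventually_elim (simp add: lcf_def)
  qed (intro H10_wpderiv_L2 duH L2_lcf swL g)+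
  have "(\<lambda>n. Re (Aform \<beta> (lcf 1 (s n) (-1) u) (lcf 1 (s n) (-1) u)) + sqnorm \<Omega> (lcf 1 (s n) (-1) u)) \<longlonglongrightarrow> 0"
  proof (rule tendsto_sandwich[OF _ _ tendsto_const])
    have "(\<lambda>n. (1 + 2 * \<beta>\<^sup>2 * radius\<^sup>2) * (\<Sum>i\<in>UNIV. sqnorm \<Omega> (lcf 1 (wpderiv \<Omega> i (s n)) (-1) (g i))) + sqnorm \<Omega> (lcf 1 (s n) (-1) u))
       \<longlonglongrightarrow> (1 + 2 * \<beta>\<^sup>2 * radius\<^sup>2) * (\<Sum>i\<in>(UNIV::2 set). 0) + 0"
      by (intro tendsto_intros g u)
    then show "(\<lambda>n. (1 + 2 * \<beta>\<^sup>2 * radius\<^sup>2) * (\<Sum>i\<in>UNIV. sqnorm \<Omega> (lcf 1 (wpderiv \<Omega> i (s n)) (-1) (g i))) + sqnorm \<Omega> (lcf 1 (s n) (-1) u)) \<longlonglongrightarrow> 0"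
      by simp
    show "\<forall>\<^sub>F n in sequentially. Re (Aform \<beta> (lcf 1 (s n) (-1) u) (lcf 1 (s n) (-1) u)) + sqnorm \<Omega> (lcf 1 (s n) (-1) u)
       \<le> (1 + 2 * \<beta>\<^sup>2 * radius\<^sup>2) * (\<Sum>i\<in>UNIV. sqnorm \<Omega> (lcf 1 (wpderiv \<Omega> i (s n)) (-1) (g i))) + sqnorm \<Omega> (lcf 1 (s n) (-1) u)"
      using Aform_le_gradient[OF duH, of \<beta>] unfolding w' by simp
    show "\<forall>\<^sub>F n in sequentially. 0 \<le> Re (Aform \<beta> (lcf 1 (s n) (-1) u) (lcf 1 (s n) (-1) u)) + sqnorm \<Omega> (lcf 1 (s n) (-1) u)"
      by (intro always_eventually allI add_nonneg_nonneg A0 sqnorm_nonneg)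
  qed
  then show "\<exists>u\<in>H10 \<Omega>. (\<lambda>n. Re (Aform \<beta> (lcf 1 (s n) (-1) u) (lcf 1 (s n) (-1) u))
            + Re (L2_inner \<Omega> (lcf 1 (s n) (-1) u) (lcf 1 (s n) (-1) u))) \<longlonglongrightarrow> 0"
    using uH unfolding sqnorm_inner(2) by blast
qed

end

section \<open>The diamagnetic inequality\<close>

text \<open>By the arithmetic-geometric mean inequality \<open>2|X||t| \<le> m + c X\<^sup>2\<close>.\<close>

lemma completing_square_le:
  fixes X t m c :: real
  assumes "t\<^sup>2 \<le> c * m" "0 \<le> m" "0 \<le> c"
  shows "(X - t)\<^sup>2 \<le> (1 + c) * (X\<^sup>2 + m)"
proof -
  have "(2 * \<bar>X\<bar> * \<bar>t\<bar>)\<^sup>2 = 4 * X\<^sup>2 * t\<^sup>2" by (simp add: power_mult_distrib)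
  also have "\<dots> \<le> 4 * X\<^sup>2 * (c * m)" using assms(1) by (intro mult_left_mono) auto
  also have "\<dots> \<le> (m + c * X\<^sup>2)\<^sup>2"
    using zero_le_power2[of "m - c * X\<^sup>2"] by (simp add: power2_eq_square algebra_simps)
  finally have "2 * \<bar>X\<bar> * \<bar>t\<bar> \<le> m + c * X\<^sup>2" by (rule power2_le_imp_le) (use assms in auto)
  moreover have "- (2 * X * t) \<le> 2 * \<bar>X\<bar> * \<bar>t\<bar>"
    by (metis abs_ge_minus_self abs_mult abs_numeral mult.assoc)
  moreover have "(1 + c) * (X\<^sup>2 + m) = X\<^sup>2 + (m + c * X\<^sup>2) + c * m" by (simp add: algebra_simps)
  moreover have "(X - t)\<^sup>2 = X\<^sup>2 - 2 * X * t + t\<^sup>2" by (simp add: power2_diff)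
  ultimately show ?thesis using assms(1) by linarith
qed

text \<open>Here \<open>z\<close> is the value of a function at \<open>(x1,x2)\<close> and \<open>a\<close>, \<open>b\<close> are its partial derivatives. After
multiplication by the phase \<open>cnj z / |z|\<close> the real parts of \<open>a\<close>, \<open>b\<close> are the derivatives of the modulus
and the imaginary parts are \<open>|z|\<close> times the derivatives of the phase. The real parts alone give the
form of the modulus at \<open>p = 0\<close>. The imaginary parts contribute
\<open>m + (p|z| + t)\<^sup>2\<close>, where \<open>m\<close> is the sum of their squares and \<open>t\<^sup>2 \<le> \<beta>\<^sup>2 R\<^sup>2 m\<close> for their rotational part,
and this is at least \<open>p\<^sup>2|z|\<^sup>2/(1 + \<beta>\<^sup>2 R\<^sup>2)\<close>. A number \<open>s\<close> above \<open>|z|\<close> is admitted in the denominators to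
cover smoothed moduli.\<close>

lemma diamagnetic_pointwise:
  fixes z a b :: complex and x1 x2 \<beta> p s R :: real
  assumes s: "cmod z \<le> s" "0 < s" and R: "x1\<^sup>2 + x2\<^sup>2 \<le> R\<^sup>2"
  shows "(Re (cnj z * a) / s)\<^sup>2 + (Re (cnj z * b) / s)\<^sup>2
      + \<beta>\<^sup>2 * (x1 * (Re (cnj z * b) / s) - x2 * (Re (cnj z * a) / s))\<^sup>2 + p\<^sup>2 / (1 + \<beta>\<^sup>2 * R\<^sup>2) * (cmod z)\<^sup>2
    \<le> (cmod a)\<^sup>2 + (cmod b)\<^sup>2 + (cmod (\<i> * of_real \<beta> * (of_real x1 * b - of_real x2 * a) - of_real p * z))\<^sup>2"
proof (cases "z = 0")
  case True then show ?thesis by simp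
next
  case False
  define r where "r = cmod z"
  have r: "r > 0" using False by (simp add: r_def)
  define w where "w = cnj z / of_real r"
  have wn: "cmod w = 1" using False by (simp add: w_def norm_divide r_def)
  have wz: "w * z = of_real r"
    using False complex_norm_square[of z] by (simp add: w_def r_def power2_eq_square field_simps)
  have cz: "cnj z = of_real r * w" using r by (simp add: w_def)
  define A where "A = w * a" define B where "B = w * b"
  have na: "(cmod a)\<^sup>2 = (Re A)\<^sup>2 + (Im A)\<^sup>2" "(cmod b)\<^sup>2 = (Re B)\<^sup>2 + (Im B)\<^sup>2"
    unfolding cmod_power2[symmetric] by (simp_all add: A_def B_def norm_mult wn)
  have nt: "(cmod (\<i> * of_real \<beta> * (of_real x1 * b - of_real x2 * a) - of_real p * z))\<^sup>2
     = (p * r + \<beta> * (x1 * Im B - x2 * Im A))\<^sup>2 + (\<beta> * (x1 * Re B - x2 * Re A))\<^sup>2"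
  proof -
    have "cmod (\<i> * of_real \<beta> * (of_real x1 * b - of_real x2 * a) - of_real p * z)
      = cmod (w * (\<i> * of_real \<beta> * (of_real x1 * b - of_real x2 * a) - of_real p * z))" by (simp add: norm_mult wn)
    also have "w * (\<i> * of_real \<beta> * (of_real x1 * b - of_real x2 * a) - of_real p * z)
      = \<i> * of_real \<beta> * (of_real x1 * B - of_real x2 * A) - of_real p * (w * z)" by (simp add: A_def B_def algebra_simps)
    finally have e: "cmod (\<i> * of_real \<beta> * (of_real x1 * b - of_real x2 * a) - of_real p * z)
      = cmod (\<i> * of_real \<beta> * (of_real x1 * B - of_real x2 * A) - of_real p * of_real r)" unfolding wz .
    show ?thesis unfolding e unfolding cmod_power2 by (simp add: power2_eq_square algebra_simps)
  qed
  have ra: "Re (cnj z * a) / s = (r / s) * Re A" "Re (cnj z * b) / s = (r / s) * Re B"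
    unfolding cz by (simp_all add: A_def B_def mult.assoc)
  have k: "(r / s)\<^sup>2 \<le> 1" using s r by (simp add: r_def power_le_one)
  have p1: "((r / s) * Re A)\<^sup>2 + ((r / s) * Re B)\<^sup>2 + \<beta>\<^sup>2 * (x1 * ((r / s) * Re B) - x2 * ((r / s) * Re A))\<^sup>2
     \<le> (Re A)\<^sup>2 + (Re B)\<^sup>2 + (\<beta> * (x1 * Re B - x2 * Re A))\<^sup>2"
  proof -
    have "((r / s) * Re A)\<^sup>2 + ((r / s) * Re B)\<^sup>2 + \<beta>\<^sup>2 * (x1 * ((r / s) * Re B) - x2 * ((r / s) * Re A))\<^sup>2
       = (r / s)\<^sup>2 * ((Re A)\<^sup>2 + (Re B)\<^sup>2 + (\<beta> * (x1 * Re B - x2 * Re A))\<^sup>2)"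
      by (simp add: power2_eq_square algebra_simps)
    also have "\<dots> \<le> 1 * ((Re A)\<^sup>2 + (Re B)\<^sup>2 + (\<beta> * (x1 * Re B - x2 * Re A))\<^sup>2)"
      by (rule mult_right_mono[OF k]) simp
    finally show ?thesis by simp
  qed
  define m where "m = (Im A)\<^sup>2 + (Im B)\<^sup>2"
  define t where "t = \<beta> * (x1 * Im B - x2 * Im A)"
  have "(x1 * Im B - x2 * Im A)\<^sup>2 \<le> (x1\<^sup>2 + x2\<^sup>2) * m"
    using zero_le_power2[of "x1 * Im A + x2 * Im B"] by (simp add: m_def power2_eq_square algebra_simps)
  also have "\<dots> \<le> R\<^sup>2 * m" using R by (intro mult_right_mono) (auto simp: m_def)
  finally have "\<beta>\<^sup>2 * (x1 * Im B - x2 * Im A)\<^sup>2 \<le> \<beta>\<^sup>2 * (R\<^sup>2 * m)" by (intro mult_left_mono) auto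
  then have tm: "t\<^sup>2 \<le> \<beta>\<^sup>2 * R\<^sup>2 * m" by (simp add: t_def power_mult_distrib)
  have "(p * r)\<^sup>2 \<le> (1 + \<beta>\<^sup>2 * R\<^sup>2) * ((p * r + t)\<^sup>2 + m)"
    using completing_square_le[OF tm, of "p * r + t"] by (simp add: m_def)
  moreover have pos: "0 < 1 + \<beta>\<^sup>2 * R\<^sup>2" by (intro add_pos_nonneg) auto
  ultimately have "p\<^sup>2 / (1 + \<beta>\<^sup>2 * R\<^sup>2) * r\<^sup>2 \<le> (p * r + t)\<^sup>2 + m"
    by (simp add: pos_divide_le_eq power_mult_distrib mult.commute)
  then show ?thesis
    using p1 unfolding nt na ra r_def[symmetric] t_def m_def by linarith
qed

context bounded_open begin

lemma test_qform:
  assumes f: "\<phi> \<in> test_functions \<Omega>"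
  shows "qform \<Omega> p \<beta> \<phi> = (LINT x|M. (cmod (pderiv_classical 1 \<phi> x))\<^sup>2 + (cmod (pderiv_classical 2 \<phi> x))\<^sup>2
     + (cmod (\<i> * of_real \<beta> * (of_real (x$1) * pderiv_classical 2 \<phi> x - of_real (x$2) * pderiv_classical 1 \<phi> x) - of_real p * \<phi> x))\<^sup>2)"
    (is "_ = (LINT x|M. ?g x)")
   and "integrable M (\<lambda>x. (cmod (pderiv_classical 1 \<phi> x))\<^sup>2 + (cmod (pderiv_classical 2 \<phi> x))\<^sup>2
     + (cmod (\<i> * of_real \<beta> * (of_real (x$1) * pderiv_classical 2 \<phi> x - of_real (x$2) * pderiv_classical 1 \<phi> x) - of_real p * \<phi> x))\<^sup>2)"
proof -
  note pd = test_L2[OF pderiv_classical_test_function[OF f]]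
  have fH: "\<phi> \<in> H10 \<Omega>" by (rule test_H10(1)[OF f])
  have t: "(\<lambda>x. \<i> * of_real \<beta> * (of_real (x$1) * pderiv_classical 2 \<phi> x - of_real (x$2) * pderiv_classical 1 \<phi> x) - of_real p * \<phi> x) \<in> L2 \<Omega>"
  proof -
    have "lcf 1 (lcf (\<i> * of_real \<beta>) (\<lambda>x. of_real (x$1) * pderiv_classical 2 \<phi> x) (- \<i> * of_real \<beta>) (\<lambda>x. of_real (x$2) * pderiv_classical 1 \<phi> x)) (- of_real p) \<phi> \<in> L2 \<Omega>"
      by (intro L2_lcf coord_L2 pd test_L2 f)
    then show ?thesis by (rule back_subst[where P = "\<lambda>u. u \<in> L2 \<Omega>"]) (auto simp: lcf_def algebra_simps)
  qed
  show i: "integrable M ?g"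
    by (intro Bochner_Integration.integrable_add L2_integrable_sq pd t)
  have t2: "(\<lambda>x. twist \<beta> \<phi> x - of_real p * \<phi> x) \<in> L2 \<Omega>"
    using L2_lcf[OF twist_L2[OF fH] H10_L2[OF fH], of 1 \<beta> "- of_real p"] by (simp add: lcf_def)
  have i2: "integrable M (\<lambda>x. (\<Sum>i\<in>UNIV. (cmod (wpderiv \<Omega> i \<phi> x))\<^sup>2)
        + (cmod (\<i> * of_real \<beta> * angular_deriv \<Omega> \<phi> x - of_real p * \<phi> x))\<^sup>2)"
    using t2 H10_wpderiv_L2[OF fH] unfolding twist_def
    by (intro Bochner_Integration.integrable_add Bochner_Integration.integrable_sum L2_integrable_sq) auto
  show "qform \<Omega> p \<beta> \<phi> = (LINT x|M. ?g x)"
    unfolding qform_def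
  proof (rule integral_cong_AE)
    show "AE x in M. (\<Sum>i\<in>UNIV. (cmod (wpderiv \<Omega> i \<phi> x))\<^sup>2)
        + (cmod (\<i> * of_real \<beta> * angular_deriv \<Omega> \<phi> x - of_real p * \<phi> x))\<^sup>2 = ?g x"
      using test_H10(2)[OF f, of 1] test_H10(2)[OF f, of 2]
      by eventually_elim (simp add: sum_2 angular_deriv_def)
  qed (use i i2 in \<open>auto dest: borel_measurable_integrable\<close>)
qed

text \<open>The modulus itself is not smooth at zeros of \<open>\<phi>\<close>. Subtracting \<open>e\<close> makes the smoothed one vanish
wherever \<open>\<phi>\<close> does, so it is again a test function.\<close>

definition smooth_mod :: "real \<Rightarrow> (real^2 \<Rightarrow> complex) \<Rightarrow> real^2 \<Rightarrow> real" where
  "smooth_mod e \<phi> x = sqrt ((cmod (\<phi> x))\<^sup>2 + e\<^sup>2) - e"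

lemma smooth_mod_bounds:
  assumes "e > 0"
  shows "0 \<le> smooth_mod e \<phi> x" "smooth_mod e \<phi> x \<le> cmod (\<phi> x)" "cmod (\<phi> x) - e \<le> smooth_mod e \<phi> x"
proof -
  have "e \<le> sqrt ((cmod (\<phi> x))\<^sup>2 + e\<^sup>2)" "cmod (\<phi> x) \<le> sqrt ((cmod (\<phi> x))\<^sup>2 + e\<^sup>2)"
    by (auto intro: real_le_rsqrt)
  moreover have "sqrt ((cmod (\<phi> x))\<^sup>2 + e\<^sup>2) \<le> cmod (\<phi> x) + e"
    by (rule real_le_lsqrt) (use assms in \<open>auto simp: power2_sum\<close>)
  ultimately show "0 \<le> smooth_mod e \<phi> x" "smooth_mod e \<phi> x \<le> cmod (\<phi> x)" "cmod (\<phi> x) - e \<le> smooth_mod e \<phi> x"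
    by (auto simp: smooth_mod_def)
qed

lemma smooth_mod_test:
  assumes f: "\<phi> \<in> test_functions \<Omega>" and e: "e > 0"
  shows "(\<lambda>x. complex_of_real (smooth_mod e \<phi> x)) \<in> test_functions \<Omega>"
    "pderiv_classical i (\<lambda>x. complex_of_real (smooth_mod e \<phi> x)) x
      = of_real (Re (cnj (\<phi> x) * pderiv_classical i \<phi> x) / sqrt ((cmod (\<phi> x))\<^sup>2 + e\<^sup>2))"
proof -
  define g where "g x = Re (\<phi> x) * Re (\<phi> x) + Im (\<phi> x) * Im (\<phi> x) + e\<^sup>2" for x
  have g: "g x = (cmod (\<phi> x))\<^sup>2 + e\<^sup>2" for x unfolding cmod_power2 by (simp add: g_def power2_eq_square)
  have gpos: "0 < g x" for x unfolding g using e by (intro add_nonneg_pos) auto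
  have Ckg: "Ck k g" for k
    unfolding g_def by (intro Ck_add Ck_mult Ck_const Ck_bounded_linear[OF bounded_linear_Re] Ck_bounded_linear[OF bounded_linear_Im] test_functionsD(1)[OF f])
  have sm: "smooth_mod e \<phi> x = g x powr (1/2) - e" for x
    unfolding smooth_mod_def g[symmetric] using gpos by (simp add: powr_half_sqrt less_imp_le)
  show "(\<lambda>x. complex_of_real (smooth_mod e \<phi> x)) \<in> test_functions \<Omega>"
  proof (rule test_functions_dominated[OF f])
    have "Ck k (\<lambda>x. g x powr (1/2) + (- e))" for k by (intro Ck_add Ck_const Ck_powr gpos Ckg)
    then show "Ck k (\<lambda>x. complex_of_real (smooth_mod e \<phi> x))" for k
      by (intro Ck_bounded_linear[OF bounded_linear_of_real]) (simp add: sm[abs_def])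
  qed (use e in \<open>simp add: smooth_mod_def\<close>)
  let ?D = "frechet_derivative \<phi> (at x)"
  have D: "(\<phi> has_derivative ?D) (at x)" by (rule test_functionsD(3)[OF f])
  note DR = bounded_linear.has_derivative[OF bounded_linear_Re D] and DI = bounded_linear.has_derivative[OF bounded_linear_Im D]
  have "(g has_derivative (\<lambda>h. 2 * (Re (\<phi> x) * Re (?D h) + Im (\<phi> x) * Im (?D h)))) (at x)"
    unfolding g_def
    by (rule has_derivative_eq_rhs[OF has_derivative_add[OF has_derivative_add[OF has_derivative_mult[OF DR DR] has_derivative_mult[OF DI DI]] has_derivative_const]])
      (auto simp: algebra_simps)
  from has_derivative_powr_const[OF this gpos, of "1/2"]
  have "((\<lambda>x. g x powr (1/2)) has_derivative (\<lambda>h. (Re (\<phi> x) * Re (?D h) + Im (\<phi> x) * Im (?D h)) * g x powr (- (1/2)))) (at x)"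
    by (rule has_derivative_eq_rhs) (auto simp: algebra_simps)
  then have "((\<lambda>x. g x powr (1/2) - e) has_derivative (\<lambda>h. (Re (\<phi> x) * Re (?D h) + Im (\<phi> x) * Im (?D h)) * g x powr (- (1/2)) - 0)) (at x)"
    by (rule has_derivative_diff) simp
  then have "((\<lambda>x. complex_of_real (smooth_mod e \<phi> x)) has_derivative (\<lambda>h. of_real ((Re (\<phi> x) * Re (?D h) + Im (\<phi> x) * Im (?D h)) * g x powr (- (1/2)) - 0))) (at x)"
    unfolding sm by (rule bounded_linear.has_derivative[OF bounded_linear_of_real])
  from pderiv_classical_eq[OF this]
  have "pderiv_classical i (\<lambda>x. complex_of_real (smooth_mod e \<phi> x)) x
     = of_real ((Re (\<phi> x) * Re (?D (axis i 1)) + Im (\<phi> x) * Im (?D (axis i 1))) * g x powr (- (1/2)))" by simp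
  also have "g x powr (- (1/2)) = 1 / sqrt (g x)"
    using gpos[of x] by (simp add: powr_minus powr_half_sqrt less_imp_le inverse_eq_divide)
  finally show "pderiv_classical i (\<lambda>x. complex_of_real (smooth_mod e \<phi> x)) x
      = of_real (Re (cnj (\<phi> x) * pderiv_classical i \<phi> x) / sqrt ((cmod (\<phi> x))\<^sup>2 + e\<^sup>2))"
    by (simp add: g pderiv_classical_def)
qed

definition gap :: "real \<Rightarrow> real" where "gap \<beta> = 1 / (1 + \<beta>\<^sup>2 * radius\<^sup>2)"

lemma gap_pos: "0 < gap \<beta>"
  unfolding gap_def by (intro divide_pos_pos add_pos_nonneg) auto

text \<open>Integration of the pointwise inequality, with \<open>s = sqrt (|\<phi>|\<^sup>2 + e\<^sup>2)\<close>: the derivatives of the smoothed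
modulus are exactly \<open>Re (cnj \<phi> \<partial>\<phi>) / s\<close>.\<close>

proposition diamagnetic_inequality:
  assumes f: "\<phi> \<in> test_functions \<Omega>" and e: "e > 0"
  shows "qform \<Omega> 0 \<beta> (\<lambda>x. complex_of_real (smooth_mod e \<phi> x)) + gap \<beta> * p\<^sup>2 * sqnorm \<Omega> \<phi> \<le> qform \<Omega> p \<beta> \<phi>"
proof -
  let ?\<psi> = "\<lambda>x. complex_of_real (smooth_mod e \<phi> x)"
  note t = smooth_mod_test(1)[OF f e]
  let ?g = "\<lambda>p \<phi> x. (cmod (pderiv_classical 1 \<phi> x))\<^sup>2 + (cmod (pderiv_classical 2 \<phi> x))\<^sup>2
     + (cmod (\<i> * of_real \<beta> * (of_real (x$1) * pderiv_classical 2 \<phi> x - of_real (x$2) * pderiv_classical 1 \<phi> x) - of_real p * \<phi> x))\<^sup>2"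
  have "qform \<Omega> 0 \<beta> ?\<psi> + gap \<beta> * p\<^sup>2 * sqnorm \<Omega> \<phi> = (LINT x|M. ?g 0 ?\<psi> x + gap \<beta> * p\<^sup>2 * (cmod (\<phi> x))\<^sup>2)"
    unfolding test_qform(1)[OF t] sqnorm_def
    using test_qform(2)[OF t, of \<beta> 0] L2_integrable_sq[OF test_L2[OF f]] by simp
  also have "\<dots> \<le> (LINT x|M. ?g p \<phi> x)"
  proof (rule Bochner_Integration.integral_mono)
    show "integrable M (\<lambda>x. ?g 0 ?\<psi> x + gap \<beta> * p\<^sup>2 * (cmod (\<phi> x))\<^sup>2)"
      using test_qform(2)[OF t, of \<beta> 0] L2_integrable_sq[OF test_L2[OF f]] by simp
    show "integrable M (?g p \<phi>)" by (rule test_qform(2)[OF f])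
    fix x assume "x \<in> space M"
    then have "(norm x)\<^sup>2 \<le> radius\<^sup>2" using radius by (intro power_mono) auto
    then have R: "(x$1)\<^sup>2 + (x$2)\<^sup>2 \<le> radius\<^sup>2" by (simp add: norm_vec_def L2_set_def sum_2)
    have s: "cmod (\<phi> x) \<le> sqrt ((cmod (\<phi> x))\<^sup>2 + e\<^sup>2)" "0 < sqrt ((cmod (\<phi> x))\<^sup>2 + e\<^sup>2)"
      using e by (auto intro: real_le_rsqrt add_nonneg_pos)
    define a' where "a' = Re (cnj (\<phi> x) * pderiv_classical 1 \<phi> x) / sqrt ((cmod (\<phi> x))\<^sup>2 + e\<^sup>2)"
    define b' where "b' = Re (cnj (\<phi> x) * pderiv_classical 2 \<phi> x) / sqrt ((cmod (\<phi> x))\<^sup>2 + e\<^sup>2)"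
    have "cmod (\<i> * of_real \<beta> * (of_real (x$1) * complex_of_real b' - of_real (x$2) * of_real a') - of_real 0 * ?\<psi> x) = \<bar>\<beta> * (x$1 * b' - x$2 * a')\<bar>"
      by (simp add: norm_mult abs_mult flip: of_real_mult of_real_diff)
    then have "?g 0 ?\<psi> x = a'\<^sup>2 + b'\<^sup>2 + \<beta>\<^sup>2 * (x$1 * b' - x$2 * a')\<^sup>2"
      unfolding smooth_mod_test(2)[OF f e] a'_def[symmetric] b'_def[symmetric] by (simp add: power_mult_distrib)
    then show "?g 0 ?\<psi> x + gap \<beta> * p\<^sup>2 * (cmod (\<phi> x))\<^sup>2 \<le> ?g p \<phi> x"
      using diamagnetic_pointwise[OF s R, of "pderiv_classical 1 \<phi> x" "pderiv_classical 2 \<phi> x" \<beta> p]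
      unfolding a'_def[symmetric] b'_def[symmetric] by (simp add: gap_def)
  qed
  also have "\<dots> = qform \<Omega> p \<beta> \<phi>" by (rule test_qform(1)[OF f, symmetric])
  finally show ?thesis .
qed

end

section \<open>Ground states\<close>

locale cross_section = bounded_open +
  fixes \<beta> :: real
  assumes nonempty: "\<Omega> \<noteq> {}" and conn: "connected \<Omega>"
begin

sublocale P: form_pencil "H10 \<Omega>" lcf "Aform \<beta>" "Bform \<beta>" "L2_inner \<Omega>" by (rule pencil)

lemma sform_Q: "u \<in> H10 \<Omega> \<Longrightarrow> v \<in> H10 \<Omega> \<Longrightarrow> sform \<Omega> p \<beta> u v = P.Q p u v"
  by (simp add: sform_eq P.Q_def)

lemma qform_Q: "u \<in> H10 \<Omega> \<Longrightarrow> qform \<Omega> p \<beta> u = Re (P.Q p u u)"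
  using sform_diagonal[of \<Omega> p \<beta> u] sform_Q[of u u p] by (metis Re_complex_of_real)

lemma box_in_Omega:
  assumes "x \<in> \<Omega>" obtains a b where "cbox a b \<subseteq> \<Omega>" "x \<in> box a b"
  by (rule open_contains_cbox[OF op assms]) (rule that)

lemma H10_nontrivial: "\<exists>v\<in>H10 \<Omega>. 0 < Re (L2_inner \<Omega> v v)"
proof -
  obtain x where "x \<in> \<Omega>" using nonempty by blast
  then obtain a b where ab: "cbox a b \<subseteq> \<Omega>" and x: "x \<in> box a b" by (rule box_in_Omega)
  let ?v = "\<lambda>x. complex_of_real (box_bump 1 a b x)"
  have t: "?v \<in> test_functions \<Omega>" by (rule box_bump_test_function[OF ab])
  have "sqnorm \<Omega> ?v \<noteq> 0"
  proof
    assume "sqnorm \<Omega> ?v = 0"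
    then have "AE x in M. ?v x = 0" using sqnorm_eq_0[OF test_L2[OF t]] by simp
    then have "AE x in lebesgue. x \<in> \<Omega> \<longrightarrow> ?v x = 0" by (subst (asm) AE_restrict_space_iff) auto
    then have "AE x in lebesgue. x \<notin> box a b"
      by eventually_elim (use ab box_subset_cbox[of a b] box_bump_pos_iff[of 1 a b] in \<open>force\<close>)
    then have "negligible (box a b)" by (simp add: AE_iff_null_sets negligible_iff_null_sets)
    then show False using x by (metis open_box open_not_negligible empty_iff)
  qed
  then show ?thesis using test_H10(1)[OF t] sqnorm_nonneg[of \<Omega> ?v] by (intro bexI[of _ ?v]) (auto simp: sqnorm_inner(2))
qed

lemma H10_closed_subspace: "P.closed_subspace (H10 \<Omega>)"
  unfolding P.closed_subspace_def using H10_lcf(1) by auto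

text \<open>A minimiser of the Rayleigh quotient solves the weak eigenvalue equation, and an eigenvalue is the
Rayleigh quotient of its eigenvector. Hence the least eigenvalue exists and equals the minimum.\<close>

lemma E1_ground_state:
  shows "\<exists>u\<in>H10 \<Omega>. sqnorm \<Omega> u = 1 \<and> (\<forall>v\<in>H10 \<Omega>. P.Q p u v = of_real (E1 \<Omega> p \<beta>) * L2_inner \<Omega> u v)"
    and E1_min: "v \<in> H10 \<Omega> \<Longrightarrow> E1 \<Omega> p \<beta> * sqnorm \<Omega> v \<le> Re (P.Q p v v)"
proof -
  obtain v0 where v0: "v0 \<in> H10 \<Omega>" "0 < Re (L2_inner \<Omega> v0 v0)" using H10_nontrivial by blast
  obtain u where u: "u \<in> H10 \<Omega>" "Re (L2_inner \<Omega> u u) = 1"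
    and min: "\<And>v. v \<in> H10 \<Omega> \<Longrightarrow> Re (P.Q p u u) * Re (L2_inner \<Omega> v v) \<le> Re (P.Q p v v)"
    using P.minimizer_exists[OF H10_closed_subspace v0, of p] by blast
  define l where "l = Re (P.Q p u u)"
  have eq: "P.Q p u v = of_real l * L2_inner \<Omega> u v" if "v \<in> H10 \<Omega>" for v
    by (rule P.minimizer_equation[of "H10 \<Omega>"]) (use H10_lcf(1) min u that in \<open>auto simp: l_def\<close>)
  have scal: "L2_inner \<Omega> (\<lambda>x. of_real e * w x) v = of_real e * L2_inner \<Omega> w v" for e w v
    by (simp add: L2_inner_def mult.assoc)
  have El: "E1 \<Omega> p \<beta> = l"
    unfolding E1_def
  proof (rule Least_equality)
    have "(\<lambda>x. complex_of_real l * u x) \<in> L2 \<Omega>"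
      using L2_lcf[OF H10_L2[OF u(1)] H10_L2[OF u(1)], of "of_real l" 0] by (simp add: lcf_def)
    then have "(u, \<lambda>x. complex_of_real l * u x) \<in> h_op \<Omega> p \<beta>"
      unfolding h_op_def form_operator_def using u eq sform_Q by (auto simp: scal)
    moreover have "\<not> (AE x in M. u x = 0)"
      using u(2) sqnorm_eq_0[OF H10_L2[OF u(1)]] by (simp add: sqnorm_inner(2))
    ultimately show "is_eigenvalue \<Omega> (h_op \<Omega> p \<beta>) (of_real l)" unfolding is_eigenvalue_def by blast
  next
    fix e assume "is_eigenvalue \<Omega> (h_op \<Omega> p \<beta>) (complex_of_real e)"
    then obtain w where w: "w \<in> H10 \<Omega>" "\<And>v. v \<in> H10 \<Omega> \<Longrightarrow> sform \<Omega> p \<beta> w v = L2_inner \<Omega> (\<lambda>x. of_real e * w x) v"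
      and nz: "\<not> (AE x in M. w x = 0)"
      by (auto simp: is_eigenvalue_def h_op_def form_operator_def)
    have "P.Q p w w = of_real (e * sqnorm \<Omega> w)" using w(2)[OF w(1)] sform_Q[OF w(1) w(1)] by (simp add: scal sqnorm_inner(1))
    then have "l * sqnorm \<Omega> w \<le> e * sqnorm \<Omega> w" using min[OF w(1)] by (simp add: l_def sqnorm_inner(2))
    moreover have "0 < sqnorm \<Omega> w" using nz sqnorm_eq_0[OF H10_L2[OF w(1)]] sqnorm_nonneg[of \<Omega> w] by simp
    ultimately show "l \<le> e" by simp
  qed
  have "sqnorm \<Omega> u = 1 \<and> (\<forall>v\<in>H10 \<Omega>. P.Q p u v = of_real (E1 \<Omega> p \<beta>) * L2_inner \<Omega> u v)"
    unfolding El using u(2) eq by (simp add: sqnorm_inner(2))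
  then show "\<exists>u\<in>H10 \<Omega>. sqnorm \<Omega> u = 1 \<and> (\<forall>v\<in>H10 \<Omega>. P.Q p u v = of_real (E1 \<Omega> p \<beta>) * L2_inner \<Omega> u v)"
    using u(1) by (rule bexI)
  show "E1 \<Omega> p \<beta> * sqnorm \<Omega> v \<le> Re (P.Q p v v)" if "v \<in> H10 \<Omega>"
    using min[OF that] unfolding El l_def sqnorm_inner(2) .
qed

text \<open>The zero function is included, so that these functions form a subspace.\<close>

definition ground :: "(real^2 \<Rightarrow> complex) \<Rightarrow> bool" where
  "ground u \<longleftrightarrow> u \<in> H10 \<Omega> \<and> (\<forall>v\<in>H10 \<Omega>. P.Q 0 u v = of_real (E1 \<Omega> 0 \<beta>) * L2_inner \<Omega> u v)"

text \<open>The functions that attain the minimum of the Rayleigh quotient are the solutions of a linear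
equation; that is why combinations of ground states are ground states.\<close>

lemma ground_iff: "ground u \<longleftrightarrow> u \<in> H10 \<Omega> \<and> Re (P.Q 0 u u) = E1 \<Omega> 0 \<beta> * sqnorm \<Omega> u"
proof
  assume "ground u" then show "u \<in> H10 \<Omega> \<and> Re (P.Q 0 u u) = E1 \<Omega> 0 \<beta> * sqnorm \<Omega> u"
    by (auto simp: ground_def sqnorm_inner(1))
next
  assume u: "u \<in> H10 \<Omega> \<and> Re (P.Q 0 u u) = E1 \<Omega> 0 \<beta> * sqnorm \<Omega> u"
  have "P.Q 0 u v = of_real (E1 \<Omega> 0 \<beta>) * L2_inner \<Omega> u v" if "v \<in> H10 \<Omega>" for v
    by (rule P.minimizer_equation[of "H10 \<Omega>"]) (use H10_lcf(1) E1_min u that in \<open>auto simp: sqnorm_inner(2)\<close>)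
  then show "ground u" using u by (simp add: ground_def)
qed

lemma ground_lcf:
  assumes u: "ground u" and v: "ground v"
  shows "ground (lcf a u b v)"
  unfolding ground_def
proof (intro conjI ballI)
  have H: "u \<in> H10 \<Omega>" "v \<in> H10 \<Omega>" using u v by (auto simp: ground_def)
  show "lcf a u b v \<in> H10 \<Omega>" by (rule H10_lcf(1)[OF H])
  fix w assume w: "w \<in> H10 \<Omega>"
  have "P.Q 0 u w = of_real (E1 \<Omega> 0 \<beta>) * L2_inner \<Omega> u w" "P.Q 0 v w = of_real (E1 \<Omega> 0 \<beta>) * L2_inner \<Omega> v w"
    using u v w by (simp_all add: ground_def)
  then show "P.Q 0 (lcf a u b v) w = of_real (E1 \<Omega> 0 \<beta>) * L2_inner \<Omega> (lcf a u b v) w"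
    unfolding hermitian_form.lin[OF P.Q_form H w] P.N.lin[OF H w] by (simp only: distrib_left mult.left_commute)
qed

lemma H10_approx:
  assumes u: "u \<in> H10 \<Omega>"
  obtains \<phi> where "\<And>n::nat. \<phi> n \<in> test_functions \<Omega>" "P.V_converges \<phi> u" "(\<lambda>n. sqnorm \<Omega> (lcf 1 (\<phi> n) (-1) u)) \<longlonglongrightarrow> 0"
proof -
  obtain \<phi> where p: "\<And>n::nat. \<phi> n \<in> test_functions \<Omega>" "(\<lambda>n. sqnorm \<Omega> (lcf 1 (\<phi> n) (-1) u)) \<longlonglongrightarrow> 0"
    "\<And>i. (\<lambda>n. sqnorm \<Omega> (lcf 1 (pderiv_classical i (\<phi> n)) (-1) (wpderiv \<Omega> i u))) \<longlonglongrightarrow> 0" using H10E[OF u] by blast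
  have pH: "\<phi> n \<in> H10 \<Omega>" for n by (rule test_H10(1)[OF p(1)])
  have dH: "lcf 1 (\<phi> n) (-1) u \<in> H10 \<Omega>" for n by (rule H10_lcf(1)[OF pH u])
  have w: "sqnorm \<Omega> (wpderiv \<Omega> i (lcf 1 (\<phi> n) (-1) u)) = sqnorm \<Omega> (lcf 1 (pderiv_classical i (\<phi> n)) (-1) (wpderiv \<Omega> i u))" for i n
  proof (rule sqnorm_cong_AE)
    show "AE x in M. wpderiv \<Omega> i (lcf 1 (\<phi> n) (-1) u) x = lcf 1 (pderiv_classical i (\<phi> n)) (-1) (wpderiv \<Omega> i u) x"
      using H10_lcf(2)[OF pH[of n] u, of i 1 "-1"] test_H10(2)[OF p(1)[of n], of i] by eventually_elim (simp add: lcf_def)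
  qed (intro H10_wpderiv_L2 dH L2_lcf u test_L2 pderiv_classical_test_function p)+
  have "P.V_converges \<phi> u"
    unfolding P.V_converges_def
  proof (rule tendsto_sandwich[OF _ _ tendsto_const])
    have "(\<lambda>n. (1 + 2 * \<beta>\<^sup>2 * radius\<^sup>2) * (\<Sum>i\<in>UNIV. sqnorm \<Omega> (lcf 1 (pderiv_classical i (\<phi> n)) (-1) (wpderiv \<Omega> i u))) + sqnorm \<Omega> (lcf 1 (\<phi> n) (-1) u))
       \<longlonglongrightarrow> (1 + 2 * \<beta>\<^sup>2 * radius\<^sup>2) * (\<Sum>i\<in>(UNIV::2 set). 0) + 0"
      by (intro tendsto_intros p)
    then show "(\<lambda>n. (1 + 2 * \<beta>\<^sup>2 * radius\<^sup>2) * (\<Sum>i\<in>UNIV. sqnorm \<Omega> (lcf 1 (pderiv_classical i (\<phi> n)) (-1) (wpderiv \<Omega> i u))) + sqnorm \<Omega> (lcf 1 (\<phi> n) (-1) u)) \<longlonglongrightarrow> 0"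
      by simp
    show "\<forall>\<^sub>F n in sequentially. P.W (P.dif (\<phi> n) u) \<le> (1 + 2 * \<beta>\<^sup>2 * radius\<^sup>2) * (\<Sum>i\<in>UNIV. sqnorm \<Omega> (lcf 1 (pderiv_classical i (\<phi> n)) (-1) (wpderiv \<Omega> i u))) + sqnorm \<Omega> (lcf 1 (\<phi> n) (-1) u)"
      using Aform_le_gradient[OF dH, of \<beta>] unfolding w by (simp add: P.W_def P.dif_def sqnorm_inner(2))
    show "\<forall>\<^sub>F n in sequentially. 0 \<le> P.W (P.dif (\<phi> n) u)"
      using P.W_nonneg dH by (simp add: P.dif_def)
  qed
  then show ?thesis using that p by blast
qed

text \<open>The modulus is a contraction, and smoothing with parameter \<open>e\<close> changes it by at most \<open>e\<close>.\<close>

lemma smooth_mod_tendsto: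
  assumes p: "\<And>n::nat. \<phi> n \<in> test_functions \<Omega>" and u: "u \<in> L2 \<Omega>" and 0: "(\<lambda>n. sqnorm \<Omega> (lcf 1 (\<phi> n) (-1) u)) \<longlonglongrightarrow> 0"
  shows "(\<lambda>n. sqnorm \<Omega> (lcf 1 (\<lambda>x. complex_of_real (smooth_mod (1 / real (Suc n)) (\<phi> n) x)) (-1) (\<lambda>x. complex_of_real (cmod (u x))))) \<longlonglongrightarrow> 0"
proof -
  define e where "e n = 1 / real (Suc n)" for n
  have e: "e n > 0" for n by (simp add: e_def)
  note [measurable] = L2_measurable[OF u]
  have uL: "(\<lambda>x. complex_of_real (cmod (u x))) \<in> L2 \<Omega>" by (rule L2_dominated[OF u, where C = 1]) auto
  have sL: "(\<lambda>x. complex_of_real (smooth_mod (e n) (\<phi> n) x)) \<in> L2 \<Omega>" for n by (rule test_L2[OF smooth_mod_test(1)[OF p e]])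
  have "sqnorm \<Omega> (lcf 1 (\<lambda>x. complex_of_real (smooth_mod (e n) (\<phi> n) x)) (-1) (\<lambda>x. complex_of_real (cmod (u x))))
      \<le> 2 * sqnorm \<Omega> (\<lambda>x. 1) * (e n)\<^sup>2 + 2 * sqnorm \<Omega> (lcf 1 (\<phi> n) (-1) u)" for n
  proof -
    have "(LINT x|M. (cmod (lcf 1 (\<lambda>x. complex_of_real (smooth_mod (e n) (\<phi> n) x)) (-1) (\<lambda>x. complex_of_real (cmod (u x))) x))\<^sup>2)
        \<le> (LINT x|M. 2 * (cmod (1::complex))\<^sup>2 * (e n)\<^sup>2 + 2 * (cmod (lcf 1 (\<phi> n) (-1) u x))\<^sup>2)"
    proof (rule Bochner_Integration.integral_mono)
      show "(cmod (lcf 1 (\<lambda>x. complex_of_real (smooth_mod (e n) (\<phi> n) x)) (-1) (\<lambda>x. complex_of_real (cmod (u x))) x))\<^sup>2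
          \<le> 2 * (cmod (1::complex))\<^sup>2 * (e n)\<^sup>2 + 2 * (cmod (lcf 1 (\<phi> n) (-1) u x))\<^sup>2" for x
      proof -
        have "cmod (lcf 1 (\<lambda>x. complex_of_real (smooth_mod (e n) (\<phi> n) x)) (-1) (\<lambda>x. complex_of_real (cmod (u x))) x) = \<bar>smooth_mod (e n) (\<phi> n) x - cmod (u x)\<bar>"
          by (simp add: lcf_def flip: of_real_diff)
        also have "\<dots> \<le> e n + cmod (\<phi> n x - u x)"
          using smooth_mod_bounds[OF e[of n], of "\<phi> n" x] norm_triangle_ineq3[of "\<phi> n x" "u x"] by linarith
        finally have "(cmod (lcf 1 (\<lambda>x. complex_of_real (smooth_mod (e n) (\<phi> n) x)) (-1) (\<lambda>x. complex_of_real (cmod (u x))) x))\<^sup>2 \<le> (e n + cmod (\<phi> n x - u x))\<^sup>2"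
          by (intro power_mono) auto
        also have "\<dots> \<le> 2 * (e n)\<^sup>2 + 2 * (cmod (\<phi> n x - u x))\<^sup>2"
          using sum_squares_bound[of "e n" "cmod (\<phi> n x - u x)"] by (simp add: power2_sum)
        finally show ?thesis by (simp add: lcf_def)
      qed
    qed (use L2_integrable_sq[OF L2_lcf[OF sL uL]] L2_integrable_sq[OF L2_lcf[OF test_L2[OF p] u]] in auto)
    also have "\<dots> = 2 * sqnorm \<Omega> (\<lambda>x. 1) * (e n)\<^sup>2 + 2 * sqnorm \<Omega> (lcf 1 (\<phi> n) (-1) u)"
      using L2_integrable_sq[OF L2_lcf[OF test_L2[OF p] u]] by (simp add: sqnorm_def)
    finally show ?thesis by (simp add: sqnorm_def)
  qed
  note le = this
  have lim: "(\<lambda>n. 2 * sqnorm \<Omega> (\<lambda>x. 1) * (e n)\<^sup>2 + 2 * sqnorm \<Omega> (lcf 1 (\<phi> n) (-1) u)) \<longlonglongrightarrow> 2 * sqnorm \<Omega> (\<lambda>x. 1) * 0\<^sup>2 + 2 * 0"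
    unfolding e_def by (intro tendsto_intros 0 LIMSEQ_Suc[OF lim_1_over_n])
  show ?thesis
    unfolding e_def[symmetric]
  proof (rule tendsto_sandwich[OF _ _ tendsto_const])
    show "(\<lambda>n. 2 * sqnorm \<Omega> (\<lambda>x. 1) * (e n)\<^sup>2 + 2 * sqnorm \<Omega> (lcf 1 (\<phi> n) (-1) u)) \<longlonglongrightarrow> 0"
      using lim by simp
  qed (simp_all add: sqnorm_nonneg le)
qed

lemma sqnorm_cmod: "sqnorm \<Omega> (\<lambda>x. complex_of_real (cmod (u x))) = sqnorm \<Omega> u"
  by (simp add: sqnorm_def)

lemma L2_cmod:
  assumes "u \<in> L2 \<Omega>" shows "(\<lambda>x. complex_of_real (cmod (u x))) \<in> L2 \<Omega>"
proof -
  note [measurable] = L2_measurable[OF assms]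
  show ?thesis by (rule L2_dominated[OF assms, where C = 1]) auto
qed

text \<open>Test functions approximating an eigenvector at \<open>p\<close> are replaced by their smoothed moduli, which are
trial functions at \<open>0\<close> with asymptotically the same norm; the diamagnetic inequality compares the
forms.\<close>

proposition E1_lower_bound: "E1 \<Omega> 0 \<beta> + gap \<beta> * p\<^sup>2 \<le> E1 \<Omega> p \<beta>"
proof -
  obtain u where u: "u \<in> H10 \<Omega>" "sqnorm \<Omega> u = 1" and eq: "\<And>v. v \<in> H10 \<Omega> \<Longrightarrow> P.Q p u v = of_real (E1 \<Omega> p \<beta>) * L2_inner \<Omega> u v"
    using E1_ground_state(1)[where p = p] by blast
  obtain \<phi> where p: "\<And>n::nat. \<phi> n \<in> test_functions \<Omega>" "P.V_converges \<phi> u" "(\<lambda>n. sqnorm \<Omega> (lcf 1 (\<phi> n) (-1) u)) \<longlonglongrightarrow> 0"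
    using H10_approx[OF u(1)] by blast
  define \<psi> where "\<psi> n x = complex_of_real (smooth_mod (1 / real (Suc n)) (\<phi> n) x)" for n x
  have \<psi>: "\<psi> n \<in> test_functions \<Omega>" for n unfolding \<psi>_def by (rule smooth_mod_test(1)[OF p(1)]) simp
  note H = test_H10(1)[OF p(1)] and H' = test_H10(1)[OF \<psi>]
  have "(\<lambda>n. sqnorm \<Omega> (\<psi> n)) \<longlonglongrightarrow> sqnorm \<Omega> (\<lambda>x. complex_of_real (cmod (u x)))"
    by (rule sqnorm_tendsto[OF test_L2[OF \<psi>] L2_cmod[OF H10_L2[OF u(1)]]])
      (use smooth_mod_tendsto[OF p(1) H10_L2[OF u(1)] p(3)] in \<open>simp add: \<psi>_def[abs_def]\<close>)
  then have 1: "(\<lambda>n. sqnorm \<Omega> (\<psi> n)) \<longlonglongrightarrow> 1" by (simp add: sqnorm_cmod u)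
  have 2: "(\<lambda>n. sqnorm \<Omega> (\<phi> n)) \<longlonglongrightarrow> 1"
    using sqnorm_tendsto[OF test_L2[OF p(1)] H10_L2[OF u(1)] p(3)] u by simp
  have 3: "(\<lambda>n. Re (P.Q p (\<phi> n) (\<phi> n))) \<longlonglongrightarrow> E1 \<Omega> p \<beta>"
    using tendsto_Re[OF P.N_dif_tendsto(2)[OF H u(1) p(2) u(1)], of p] eq[OF u(1)] u(2) by (simp add: sqnorm_inner(1))
  have "E1 \<Omega> 0 \<beta> * sqnorm \<Omega> (\<psi> n) + gap \<beta> * p\<^sup>2 * sqnorm \<Omega> (\<phi> n) \<le> Re (P.Q p (\<phi> n) (\<phi> n))" for n
    using diamagnetic_inequality[OF p(1)[of n], where e = "1 / real (Suc n)" and \<beta> = \<beta> and p = p] E1_min[OF H'[of n], where p = 0]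
      qform_Q[OF H[of n], where p = p] qform_Q[OF H'[of n], where p = 0] by (simp add: \<psi>_def[abs_def])
  moreover have "(\<lambda>n. E1 \<Omega> 0 \<beta> * sqnorm \<Omega> (\<psi> n) + gap \<beta> * p\<^sup>2 * sqnorm \<Omega> (\<phi> n)) \<longlonglongrightarrow> E1 \<Omega> 0 \<beta> * 1 + gap \<beta> * p\<^sup>2 * 1"
    by (intro tendsto_intros 1 2)
  ultimately show ?thesis using LIMSEQ_le[OF _ 3] by fastforce
qed

text \<open>The smoothed moduli of test functions approximating \<open>f\<close> have at \<open>p = 0\<close> no larger form than the test
functions, so they are a minimising sequence and converge in the form norm along a subsequence;
in \<open>L\<^sup>2\<close> they converge to the modulus of \<open>f\<close>. This avoids a chain rule for the modulus in Sobolev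
spaces, and the nonnegative smooth approximants \<open>\<psi>\<close> are needed for the logarithmic estimate below.\<close>

lemma ground_modulus:
  assumes f: "ground f" and n1: "sqnorm \<Omega> f = 1"
  obtains h \<psi> where "ground h" "sqnorm \<Omega> h = 1" "AE x in M. h x = of_real (cmod (f x))"
    "\<And>n::nat. (\<lambda>x. complex_of_real (\<psi> n x)) \<in> test_functions \<Omega>" "\<And>n x. 0 \<le> \<psi> n x"
    "P.V_converges (\<lambda>n x. complex_of_real (\<psi> n x)) h"
proof -
  have fH: "f \<in> H10 \<Omega>" using f by (simp add: ground_def)
  have Qf: "Re (P.Q 0 f f) = E1 \<Omega> 0 \<beta>" using f n1 by (simp add: ground_iff)
  obtain \<phi> where p: "\<And>n::nat. \<phi> n \<in> test_functions \<Omega>" "P.V_converges \<phi> f" "(\<lambda>n. sqnorm \<Omega> (lcf 1 (\<phi> n) (-1) f)) \<longlonglongrightarrow> 0"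
    using H10_approx[OF fH] by blast
  define s where "s n = smooth_mod (1 / real (Suc n)) (\<phi> n)" for n
  define \<psi> where "\<psi> n x = complex_of_real (s n x)" for n x
  have s0: "0 \<le> s n x" for n x unfolding s_def by (rule smooth_mod_bounds(1)) simp
  have \<psi>: "\<psi> n \<in> test_functions \<Omega>" for n unfolding \<psi>_def s_def by (rule smooth_mod_test(1)[OF p(1)]) simp
  note H = test_H10(1)[OF p(1)] and H' = test_H10(1)[OF \<psi>]
  note fL = L2_cmod[OF H10_L2[OF fH]]
  have lim: "(\<lambda>n. sqnorm \<Omega> (lcf 1 (\<psi> n) (-1) (\<lambda>x. complex_of_real (cmod (f x))))) \<longlonglongrightarrow> 0"
    using smooth_mod_tendsto[OF p(1) H10_L2[OF fH] p(3)] by (simp add: \<psi>_def[abs_def] s_def)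
  have 1: "(\<lambda>n. sqnorm \<Omega> (\<psi> n)) \<longlonglongrightarrow> 1"
    using sqnorm_tendsto[OF test_L2[OF \<psi>] fL lim] n1 by (simp add: sqnorm_cmod)
  have up: "Re (P.Q 0 (\<psi> n) (\<psi> n)) \<le> Re (P.Q 0 (\<phi> n) (\<phi> n))" for n
    using diamagnetic_inequality[OF p(1)[of n], where e = "1 / real (Suc n)" and \<beta> = \<beta> and p = 0]
      qform_Q[OF H[of n], where p = 0] qform_Q[OF H'[of n], where p = 0] by (simp add: \<psi>_def[abs_def] s_def)
  have Ql: "(\<lambda>n. Re (P.Q 0 (\<phi> n) (\<phi> n))) \<longlonglongrightarrow> E1 \<Omega> 0 \<beta>"
    using tendsto_Re[OF P.N_dif_tendsto(2)[OF H fH p(2) fH], of 0] Qf by simp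
  have 2: "(\<lambda>n. Re (P.Q 0 (\<psi> n) (\<psi> n))) \<longlonglongrightarrow> E1 \<Omega> 0 \<beta>"
  proof (rule tendsto_sandwich[OF _ _ _ Ql])
    show "\<forall>\<^sub>F n in sequentially. E1 \<Omega> 0 \<beta> * sqnorm \<Omega> (\<psi> n) \<le> Re (P.Q 0 (\<psi> n) (\<psi> n))" using E1_min[OF H'] by simp
    show "\<forall>\<^sub>F n in sequentially. Re (P.Q 0 (\<psi> n) (\<psi> n)) \<le> Re (P.Q 0 (\<phi> n) (\<phi> n))" using up by simp
    show "(\<lambda>n. E1 \<Omega> 0 \<beta> * sqnorm \<Omega> (\<psi> n)) \<longlonglongrightarrow> E1 \<Omega> 0 \<beta>" using tendsto_mult[OF tendsto_const 1] by fastforce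
  qed
  have "\<exists>u\<in>H10 \<Omega>. \<exists>r::nat \<Rightarrow> nat. strict_mono r \<and> P.V_converges (\<psi> \<circ> r) u \<and> Re (L2_inner \<Omega> u u) = 1 \<and> Re (P.Q 0 u u) = E1 \<Omega> 0 \<beta>"
    by (rule P.minimizing_sequence_converges[OF H10_closed_subspace H']) (use E1_min 1 2 in \<open>auto simp: sqnorm_inner(2)\<close>)
  then obtain h r where h: "h \<in> H10 \<Omega>" "sqnorm \<Omega> h = 1" "Re (P.Q 0 h h) = E1 \<Omega> 0 \<beta>" and r: "strict_mono r" and V: "P.V_converges (\<psi> \<circ> r) h"
    by (auto simp: sqnorm_inner(2))
  have gh: "ground h" using h by (simp add: ground_iff)
  have hL: "h \<in> L2 \<Omega>" by (rule H10_L2[OF h(1)])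
  have l2: "(\<lambda>n. sqnorm \<Omega> (lcf 1 (\<psi> (r n)) (-1) h)) \<longlonglongrightarrow> 0"
  proof (rule tendsto_sandwich[OF _ _ tendsto_const])
    show "(\<lambda>n. P.W (P.dif ((\<psi> \<circ> r) n) h)) \<longlonglongrightarrow> 0" using V by (simp add: P.V_converges_def)
    have "sqnorm \<Omega> (lcf 1 (\<psi> (r n)) (-1) h) \<le> P.W (P.dif ((\<psi> \<circ> r) n) h)" for n
      using P.A_nonneg[OF H10_lcf(1)[OF H'[of "r n"] h(1)]] by (simp add: P.W_def P.dif_def sqnorm_inner(2))
    then show "\<forall>\<^sub>F n in sequentially. sqnorm \<Omega> (lcf 1 (\<psi> (r n)) (-1) h) \<le> P.W (P.dif ((\<psi> \<circ> r) n) h)" by simp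
  qed (simp add: sqnorm_nonneg)
  have "sqnorm \<Omega> (lcf 1 h (-1) (\<lambda>x. complex_of_real (cmod (f x)))) \<le> 0"
  proof (rule LIMSEQ_le_const)
    show "(\<lambda>n. 2 * sqnorm \<Omega> (lcf 1 (\<psi> (r n)) (-1) h) + 2 * sqnorm \<Omega> (lcf 1 (\<psi> (r n)) (-1) (\<lambda>x. complex_of_real (cmod (f x))))) \<longlonglongrightarrow> 0"
      using tendsto_add[OF tendsto_mult[OF tendsto_const[of 2] l2] tendsto_mult[OF tendsto_const[of 2] LIMSEQ_subseq_LIMSEQ[OF lim r, unfolded o_def]]] by simp
    have sw: "sqnorm \<Omega> (lcf 1 a (-1) b) = sqnorm \<Omega> (lcf 1 b (-1) a)" for a b
      by (simp add: sqnorm_def lcf_def norm_minus_commute)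
    show "\<exists>N. \<forall>n\<ge>N. sqnorm \<Omega> (lcf 1 h (-1) (\<lambda>x. complex_of_real (cmod (f x))))
        \<le> 2 * sqnorm \<Omega> (lcf 1 (\<psi> (r n)) (-1) h) + 2 * sqnorm \<Omega> (lcf 1 (\<psi> (r n)) (-1) (\<lambda>x. complex_of_real (cmod (f x))))"
      using sqnorm_triangle[OF hL test_L2[OF \<psi>] fL] by (subst sw[of "\<psi> _" h]) blast
  qed
  then have "sqnorm \<Omega> (lcf 1 h (-1) (\<lambda>x. complex_of_real (cmod (f x)))) = 0"
    using sqnorm_nonneg by (metis order_antisym)
  then have "AE x in M. lcf 1 h (-1) (\<lambda>x. complex_of_real (cmod (f x))) x = 0"
    using sqnorm_eq_0[OF L2_lcf[OF hL fL]] by blast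
  then have ae: "AE x in M. h x = of_real (cmod (f x))" by eventually_elim (simp add: lcf_def)
  show ?thesis
    by (rule that[of h "\<lambda>n. s (r n)"]) (use gh h ae \<psi> s0 V in \<open>auto simp: \<psi>_def[abs_def] o_def\<close>)
qed

end

section \<open>Positivity of ground states\<close>

text \<open>On a pair of points with \<open>H x > 1/(j+1)\<close> and \<open>H y = 0\<close> the logarithms differ by at least
\<open>ln (1/((j+1) e))\<close>, which is unbounded as \<open>e\<close> tends to \<open>0\<close>. A bound on the mean square oscillation
that does not depend on \<open>e\<close> therefore makes the set of such pairs null, for every \<open>j\<close>.\<close>

lemma log_oscillation_dichotomy:
  fixes H :: "real^2 \<Rightarrow> real"
  assumes Hm[measurable]: "H \<in> borel_measurable borel" and S[measurable]: "S \<in> sets borel"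
    and fin: "emeasure lborel S < \<infinity>" and nn: "AE x in lborel. x \<in> S \<longrightarrow> 0 \<le> H x"
    and K: "\<And>e. e > 0 \<Longrightarrow> (\<integral>\<^sup>+x. indicator S x * (\<integral>\<^sup>+y. indicator S y * ennreal ((ln (H x + e) - ln (H y + e))\<^sup>2) \<partial>lborel) \<partial>lborel) \<le> ennreal K"
  shows "(AE x in lborel. x \<in> S \<longrightarrow> H x = 0) \<or> (AE x in lborel. x \<in> S \<longrightarrow> 0 < H x)"
proof -
  define Z where "Z = {x \<in> S. H x = 0}"
  define P where "P j = {x \<in> S. 1 / real (Suc j) < H x}" for j
  have Zm[measurable]: "Z \<in> sets borel" unfolding Z_def by measurable
  have Pm[measurable]: "P j \<in> sets borel" for j unfolding P_def by measurable
  have finZ: "emeasure lborel Z < \<infinity>" and finP: "emeasure lborel (P j) < \<infinity>" for j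
    using emeasure_mono[of Z S lborel] emeasure_mono[of "P j" S lborel] fin by (auto simp: Z_def P_def intro: le_less_trans)
  have prod: "measure lborel Z * measure lborel (P j) = 0" for j
  proof (rule ccontr)
    define m where "m = measure lborel Z * measure lborel (P j)"
    assume "measure lborel Z * measure lborel (P j) \<noteq> 0"
    then have m: "m > 0" by (simp add: m_def less_le)
    \<comment> \<open>then \<open>t\<^sup>2 m > |K|\<close>, and the oscillation reaches \<open>t\<close> once \<open>1/e\<close> exceeds \<open>(j+1) exp t\<close>\<close>
    define t where "t = \<bar>K\<bar> / m + 1"
    have t: "t \<ge> 1" using m by (simp add: t_def)
    obtain k :: nat where k: "real (Suc j) * exp t < real k" using reals_Archimedean2 by blast
    then have kp: "real k > 0" by (smt (verit) exp_gt_zero mult_pos_pos of_nat_0_less_iff zero_less_Suc)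
    define e where "e = 1 / real k"
    have e: "e > 0" using kp by (simp add: e_def)
    have big: "t\<^sup>2 \<le> (ln (H x + e) - ln (H y + e))\<^sup>2" if "x \<in> P j" "y \<in> Z" for x y
    proof -
      have hx: "1 / real (Suc j) < H x" and hy: "H y = 0" using that by (auto simp: P_def Z_def)
      have hx0: "0 < H x" using hx by (rule less_trans[rotated]) simp
      have "exp t \<le> real k * (1 / real (Suc j))" using k by (simp add: field_simps)
      also have "\<dots> \<le> real k * H x" using hx kp by (intro mult_left_mono) auto
      also have "\<dots> \<le> (H x + e) / e" using kp hx0 by (simp add: e_def field_simps)
      finally have "t \<le> ln ((H x + e) / e)" using hx0 e by (simp add: ln_ge_iff)
      then have "t \<le> ln (H x + e) - ln (H y + e)" using hx0 e hy by (simp add: ln_div)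
      then show ?thesis using t by (intro power_mono) auto
    qed
    have "ennreal (t\<^sup>2) * emeasure lborel Z * emeasure lborel (P j)
      = (\<integral>\<^sup>+x. (ennreal (t\<^sup>2) * emeasure lborel Z) * indicator (P j) x \<partial>lborel)"
      by (subst nn_integral_cmult_indicator) auto
    also have "\<dots> \<le> (\<integral>\<^sup>+x. indicator S x * (\<integral>\<^sup>+y. indicator S y * ennreal ((ln (H x + e) - ln (H y + e))\<^sup>2) \<partial>lborel) \<partial>lborel)"
    proof (rule nn_integral_mono)
      fix x
      show "(ennreal (t\<^sup>2) * emeasure lborel Z) * indicator (P j) x \<le> indicator S x * (\<integral>\<^sup>+y. indicator S y * ennreal ((ln (H x + e) - ln (H y + e))\<^sup>2) \<partial>lborel)"
      proof (cases "x \<in> P j")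
        case True
        have "ennreal (t\<^sup>2) * emeasure lborel Z = (\<integral>\<^sup>+y. ennreal (t\<^sup>2) * indicator Z y \<partial>lborel)"
          by (subst nn_integral_cmult_indicator) auto
        also have "\<dots> \<le> (\<integral>\<^sup>+y. indicator S y * ennreal ((ln (H x + e) - ln (H y + e))\<^sup>2) \<partial>lborel)"
          using big[OF True] by (intro nn_integral_mono) (auto simp: indicator_def Z_def intro: ennreal_leI)
        finally show ?thesis using True by (simp add: P_def)
      qed simp
    qed
    also have "\<dots> \<le> ennreal K" by (rule K[OF e])
    finally have "ennreal (t\<^sup>2) * emeasure lborel Z * emeasure lborel (P j) \<le> ennreal K" .
    also have "ennreal (t\<^sup>2) * emeasure lborel Z * emeasure lborel (P j) = ennreal (t\<^sup>2 * m)"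
      using emeasure_eq_ennreal_measure[of lborel Z] emeasure_eq_ennreal_measure[of lborel "P j"] finZ finP[of j]
      by (simp add: m_def ennreal_mult mult.assoc)
    finally have "t\<^sup>2 * m \<le> \<bar>K\<bar>"
      using m by (metis abs_ge_self ennreal_le_iff2 ennreal_leI mult_nonneg_nonneg not_less order_trans zero_le_power2 abs_ge_zero less_imp_le)
    moreover have "\<bar>K\<bar> < t * m" using m by (simp add: t_def field_simps)
    moreover have "t * m \<le> t\<^sup>2 * m" using t m by (simp add: power2_eq_square)
    ultimately show False by linarith
  qed
  have null: "AE x in lborel. x \<notin> A" if "measure lborel A = 0" "A \<in> sets borel" "emeasure lborel A < \<infinity>" for A
    using that by (intro AE_not_in) (auto simp: null_sets_def emeasure_eq_ennreal_measure)
  show ?thesis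
  proof (cases "measure lborel Z = 0")
    case True
    have "AE x in lborel. x \<in> S \<longrightarrow> 0 < H x"
      using null[OF True Zm finZ] nn by eventually_elim (auto simp: Z_def)
    then show ?thesis ..
  next
    case False
    then have "measure lborel (P j) = 0" for j using prod[of j] by simp
    then have "AE x in lborel. x \<notin> P j" for j by (rule null[OF _ Pm finP])
    then have "AE x in lborel. \<forall>j. x \<notin> P j" by (simp add: AE_all_countable)
    then have "AE x in lborel. x \<in> S \<longrightarrow> H x = 0"
      using nn
    proof eventually_elim
      case (elim x)
      show ?case
      proof
        assume x: "x \<in> S"
        then have "H x \<le> 1 / real (Suc j)" for j using elim(1) by (auto simp: P_def not_less)
        then have "H x \<le> 0" using LIMSEQ_le_const[OF LIMSEQ_Suc[OF lim_1_over_n], of "H x"] by blast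
        then show "H x = 0" using elim(2) x by simp
      qed
    qed
    then show ?thesis ..
  qed
qed

text \<open>By Lindelof's theorem countably many of the neighbourhoods cover.\<close>

lemma AE_locally_imp_AE:
  fixes U :: "(real^2) set"
  assumes "\<And>x. x \<in> U \<Longrightarrow> \<exists>V. open V \<and> x \<in> V \<and> (AE y in lborel. y \<in> V \<longrightarrow> Q y)"
  shows "AE y in lborel. y \<in> U \<longrightarrow> Q y"
proof -
  define F where "F = {V. open V \<and> (AE y in lborel. y \<in> V \<longrightarrow> Q y)}"
  obtain G where G: "G \<subseteq> F" "countable G" "\<Union>G = \<Union>F"
    using Lindelof[of F] by (auto simp: F_def)
  have "AE y in lborel. \<forall>V\<in>G. y \<in> V \<longrightarrow> Q y"
    using G by (subst AE_ball_countable) (auto simp: F_def)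
  then show ?thesis
  proof eventually_elim
    case (elim y)
    show ?case
    proof
      assume "y \<in> U"
      then have "y \<in> \<Union>F" using assms by (auto simp: F_def)
      then show "Q y" using elim G by auto
    qed
  qed
qed

text \<open>The two alternatives hold on open sets that cover \<open>U\<close>. These are disjoint, because a nonempty open
set is not a null set, so connectedness leaves only one of them.\<close>

lemma connected_AE_dichotomy:
  fixes U :: "(real^2) set" and H :: "real^2 \<Rightarrow> real"
  assumes U: "connected U"
    and loc: "\<And>x. x \<in> U \<Longrightarrow> \<exists>V. open V \<and> x \<in> V \<and>
      ((AE y in lborel. y \<in> V \<longrightarrow> H y = 0) \<or> (AE y in lborel. y \<in> V \<longrightarrow> 0 < H y))"
  shows "(AE y in lborel. y \<in> U \<longrightarrow> H y = 0) \<or> (AE y in lborel. y \<in> U \<longrightarrow> 0 < H y)"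
proof -
  define A where "A = \<Union>{V. open V \<and> (AE y in lborel. y \<in> V \<longrightarrow> H y = 0)}"
  define B where "B = \<Union>{V. open V \<and> (AE y in lborel. y \<in> V \<longrightarrow> 0 < H y)}"
  have op: "open A" "open B" unfolding A_def B_def by auto
  have cov: "U \<subseteq> A \<union> B" using loc unfolding A_def B_def by blast
  have "A \<inter> B = {}"
  proof (rule ccontr)
    assume "A \<inter> B \<noteq> {}"
    then obtain x V W where x: "x \<in> V" "x \<in> W" and VW: "open V" "open W" "AE y in lborel. y \<in> V \<longrightarrow> H y = 0" "AE y in lborel. y \<in> W \<longrightarrow> 0 < H y"
      unfolding A_def B_def by blast
    have "AE y in lborel. y \<notin> V \<inter> W" using VW(3,4) by eventually_elim auto
    then have "AE y in lebesgue. y \<notin> V \<inter> W" by (rule AE_completion)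
    then have "negligible (V \<inter> W)" by (simp add: AE_iff_null_sets negligible_iff_null_sets VW open_Int)
    then show False using open_not_negligible[of "V \<inter> W"] VW x by (auto simp: open_Int)
  qed
  then have "A \<inter> U = {} \<or> B \<inter> U = {}" using connectedD[OF U op] cov by blast
  then show ?thesis
  proof
    assume "A \<inter> U = {}"
    then have "U \<subseteq> B" using cov by blast
    then have "AE y in lborel. y \<in> U \<longrightarrow> 0 < H y" by (intro AE_locally_imp_AE) (auto simp: B_def)
    then show ?thesis ..
  next
    assume "B \<inter> U = {}"
    then have "U \<subseteq> A" using cov by blast
    then have "AE y in lborel. y \<in> U \<longrightarrow> H y = 0" by (intro AE_locally_imp_AE) (auto simp: A_def)
    then show ?thesis ..
  qed
qed

context bounded_open begin

text \<open>Real test functions, with \<open>rd\<close> and \<open>rot\<close> below for their partial and angular derivatives, spare the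
logarithmic estimates all conjugations.\<close>

definition rtest :: "(real^2 \<Rightarrow> real) \<Rightarrow> bool" where
  "rtest s \<longleftrightarrow> (\<lambda>x. complex_of_real (s x)) \<in> test_functions \<Omega>"

definition rd :: "2 \<Rightarrow> (real^2 \<Rightarrow> real) \<Rightarrow> real^2 \<Rightarrow> real" where
  "rd i s x = frechet_derivative s (at x) (axis i 1)"

lemma rtest_Ck: "rtest s \<Longrightarrow> Ck k s"
  using Ck_bounded_linear[OF bounded_linear_Re test_functionsD(1)] by (fastforce simp: rtest_def)

lemma rtest_has_derivative: "rtest s \<Longrightarrow> (s has_derivative frechet_derivative s (at x)) (at x)"
  by (rule Ck_SucD(1)[OF rtest_Ck])

lemma rd_eq: "(s has_derivative s') (at x) \<Longrightarrow> rd i s x = s' (axis i 1)"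
  using frechet_derivative_at unfolding rd_def by metis

lemma pderiv_rtest:
  assumes "rtest s" shows "pderiv_classical i (\<lambda>x. complex_of_real (s x)) x = of_real (rd i s x)"
  using pderiv_classical_eq[OF bounded_linear.has_derivative[OF bounded_linear_of_real rtest_has_derivative[OF assms]]]
  by (simp add: rd_def)

lemma rd_rtest: "rtest s \<Longrightarrow> rtest (rd i s)"
  using pderiv_classical_test_function[of "\<lambda>x. complex_of_real (s x)" \<Omega> i]
  unfolding rtest_def by (rule back_subst[where P = "\<lambda>f. f \<in> test_functions \<Omega>"]) (auto simp: pderiv_rtest rtest_def)

lemma rtest_integrable_mult: "rtest s \<Longrightarrow> rtest t \<Longrightarrow> integrable M (\<lambda>x. s x * t x)"
  using integrable_Re[OF L2_mult_integrable(1)[OF test_L2 test_L2]] by (fastforce simp: rtest_def)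

lemma rtest_continuous: "rtest s \<Longrightarrow> continuous_on UNIV s"
  by (rule Ck_continuous[OF rtest_Ck])

lemma rtest_bounded: "rtest s \<Longrightarrow> \<exists>C\<ge>0. \<forall>x. \<bar>s x\<bar> \<le> C"
  using test_bounded[of "\<lambda>x. complex_of_real (s x)"] by (metis norm_of_real rtest_def)

lemma coord_rtest: "rtest s \<Longrightarrow> rtest (\<lambda>x. x$j * s x)"
proof -
  assume s: "rtest s"
  have x: "Ck k (\<lambda>x::real^2. x$j)" for k
  proof -
    have "Ck k (\<lambda>x::real^2. x)"
    proof (cases k)
      case (Suc n) show ?thesis unfolding Suc by (rule Ck_SucI[OF has_derivative_ident]) (rule Ck_const)
    qed simp
    then show ?thesis by (rule Ck_bounded_linear[OF bounded_linear_vec_nth])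
  qed
  show ?thesis unfolding rtest_def
    by (rule test_functions_dominated[OF s[unfolded rtest_def]])
      (auto intro!: Ck_bounded_linear[OF bounded_linear_of_real] Ck_mult x rtest_Ck[OF s])
qed

lemma rtest_diff: "rtest s \<Longrightarrow> rtest t \<Longrightarrow> rtest (\<lambda>x. s x - t x)"
  unfolding rtest_def using test_functions_lc[of "\<lambda>x. complex_of_real (s x)" \<Omega> "\<lambda>x. complex_of_real (t x)" 1 "-1"] by simp

definition rot :: "(real^2 \<Rightarrow> real) \<Rightarrow> real^2 \<Rightarrow> real" where
  "rot s x = x$1 * rd 2 s x - x$2 * rd 1 s x"

lemma rot_rtest: "rtest s \<Longrightarrow> rtest (rot s)"
  unfolding rot_def[abs_def] by (intro rtest_diff coord_rtest rd_rtest)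

lemma Aform_rtest:
  assumes s: "rtest s" and t: "rtest t"
  shows "Re (Aform \<beta> (\<lambda>x. of_real (s x)) (\<lambda>x. of_real (t x)))
    = (LINT x|M. rd 1 s x * rd 1 t x + rd 2 s x * rd 2 t x + \<beta>\<^sup>2 * (rot s x * rot t x))"
proof -
  let ?s = "\<lambda>x. complex_of_real (s x)" and ?t = "\<lambda>x. complex_of_real (t x)"
  have L: "(\<lambda>x. complex_of_real (f x)) \<in> L2 \<Omega>" if "rtest f" for f using test_L2 that by (simp add: rtest_def)
  have ip: "L2_inner \<Omega> (\<lambda>x. complex_of_real (f x)) (\<lambda>x. complex_of_real (g x)) = of_real (LINT x|M. f x * g x)" for f g
    by (simp add: L2_inner_def flip: of_real_mult)
  have w: "AE x in M. wpderiv \<Omega> i (\<lambda>x. of_real (f x)) x = of_real (rd i f x)" if "rtest f" for f i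
    using test_H10(2)[OF that[unfolded rtest_def], of i] by eventually_elim (simp add: pderiv_rtest[OF that])
  have H: "(\<lambda>x. complex_of_real (f x)) \<in> H10 \<Omega>" if "rtest f" for f using test_H10(1) that by (simp add: rtest_def)
  have 1: "L2_inner \<Omega> (wpderiv \<Omega> i ?s) (wpderiv \<Omega> i ?t) = of_real (LINT x|M. rd i s x * rd i t x)" for i
    unfolding ip[symmetric] by (rule L2_inner_cong_AE[OF w[OF s] w[OF t]]) (intro H10_wpderiv_L2 H s t L rd_rtest)+
  have tw: "AE x in M. twist \<beta> (\<lambda>x. of_real (f x)) x = lcf (\<i> * of_real \<beta>) (\<lambda>x. of_real (rot f x)) 0 (\<lambda>x. of_real (rot f x)) x" if "rtest f" for f
    using w[OF that, of 1] w[OF that, of 2] by eventually_elim (simp add: twist_def angular_deriv_def rot_def lcf_def)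
  have "L2_inner \<Omega> (twist \<beta> ?s) (twist \<beta> ?t)
     = L2_inner \<Omega> (lcf (\<i> * of_real \<beta>) (\<lambda>x. of_real (rot s x)) 0 (\<lambda>x. of_real (rot s x))) (lcf (\<i> * of_real \<beta>) (\<lambda>x. of_real (rot t x)) 0 (\<lambda>x. of_real (rot t x)))"
    by (rule L2_inner_cong_AE[OF tw[OF s] tw[OF t]]) (intro twist_L2 H s t L2_lcf L rot_rtest)+
  also have "\<dots> = (\<i> * of_real \<beta>) * cnj (\<i> * of_real \<beta>) * L2_inner \<Omega> (\<lambda>x. of_real (rot s x)) (\<lambda>x. of_real (rot t x))"
    using L[OF rot_rtest[OF s]] L[OF rot_rtest[OF t]] by (simp add: L2.lin L2.lin_right L2_lcf)
  also have "(\<i> * complex_of_real \<beta>) * cnj (\<i> * of_real \<beta>) = of_real (\<beta>\<^sup>2)"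
    by (simp add: complex_eq_iff power2_eq_square)
  finally have 2: "L2_inner \<Omega> (twist \<beta> ?s) (twist \<beta> ?t) = of_real (\<beta>\<^sup>2 * (LINT x|M. rot s x * rot t x))"
    by (simp add: ip)
  have "Re (Aform \<beta> ?s ?t) = (LINT x|M. rd 1 s x * rd 1 t x) + (LINT x|M. rd 2 s x * rd 2 t x) + \<beta>\<^sup>2 * (LINT x|M. rot s x * rot t x)"
    by (simp add: Aform_def 1 2 sum_2)
  also have "\<dots> = (LINT x|M. rd 1 s x * rd 1 t x + rd 2 s x * rd 2 t x + \<beta>\<^sup>2 * (rot s x * rot t x))"
    using rtest_integrable_mult[OF rd_rtest[OF s] rd_rtest[OF t]] rtest_integrable_mult[OF rot_rtest[OF s] rot_rtest[OF t]] by simp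
  finally show ?thesis .
qed

text \<open>The function \<open>c\<^sup>2/(s + e)\<close> is the classical test function for logarithmic estimates: the gradient of
\<open>s\<close> paired with its gradient produces, besides a cross term with the gradient of
\<open>c\<close>, the negative term \<open>- c\<^sup>2 |\<nabla> ln (s + e)|\<^sup>2\<close>.\<close>

lemma cutoff_quotient:
  assumes s: "rtest s" "\<And>x. 0 \<le> s x" and c: "rtest c" and e: "e > 0"
  shows "rtest (\<lambda>x. (c x)\<^sup>2 / (s x + e))"
    "rd i (\<lambda>x. (c x)\<^sup>2 / (s x + e)) x = 2 * c x * rd i c x / (s x + e) - (c x)\<^sup>2 * rd i s x / (s x + e)\<^sup>2"
proof -
  have pos: "0 < s x + e" for x using s(2)[of x] e by simp
  have form: "(c x)\<^sup>2 / (s x + e) = c x * c x * (s x + e) powr (-1)" for x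
    using pos[of x] by (simp add: powr_minus_divide power2_eq_square)
  have inv: "Ck k (\<lambda>x. (s x + e) powr (-1))" for k by (intro Ck_powr pos Ck_add rtest_Ck s Ck_const)
  have "Ck k (\<lambda>x. (c x)\<^sup>2 / (s x + e))" for k
    unfolding form by (intro Ck_mult rtest_Ck[OF c] inv)
  then show "rtest (\<lambda>x. (c x)\<^sup>2 / (s x + e))"
    unfolding rtest_def by (intro test_functions_dominated[OF c[unfolded rtest_def]] Ck_bounded_linear[OF bounded_linear_of_real]) auto
  let ?s' = "frechet_derivative s (at x)" and ?c' = "frechet_derivative c (at x)"
  note ds = rtest_has_derivative[OF s(1), of x] and dc = rtest_has_derivative[OF c, of x]
  have "((\<lambda>x. (c x)\<^sup>2 / (s x + e)) has_derivative (\<lambda>h. 2 * c x * ?c' h / (s x + e) - (c x)\<^sup>2 * ?s' h / (s x + e)\<^sup>2)) (at x)"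
  proof (rule has_derivative_eq_rhs[OF has_derivative_divide'])
    show "((\<lambda>x. (c x)\<^sup>2) has_derivative (\<lambda>h. 2 * c x * ?c' h)) (at x)"
      by (rule has_derivative_eq_rhs[OF has_derivative_power[OF dc]]) (auto simp: mult_ac)
    show "((\<lambda>x. s x + e) has_derivative ?s') (at x)"
      by (rule has_derivative_eq_rhs[OF has_derivative_add[OF ds has_derivative_const]]) auto
    show "s x + e \<noteq> 0" using pos[of x] by simp
    then show "(\<lambda>h. (2 * c x * ?c' h * (s x + e) - (c x)\<^sup>2 * ?s' h) / ((s x + e) * (s x + e)))
       = (\<lambda>h. 2 * c x * ?c' h / (s x + e) - (c x)\<^sup>2 * ?s' h / (s x + e)\<^sup>2)"
      by (simp add: diff_divide_distrib power2_eq_square)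
  qed
  from rd_eq[OF this] show "rd i (\<lambda>x. (c x)\<^sup>2 / (s x + e)) x = 2 * c x * rd i c x / (s x + e) - (c x)\<^sup>2 * rd i s x / (s x + e)\<^sup>2"
    by (simp add: rd_def)
qed

text \<open>With \<open>k = c/(s + e)\<close>, a derivative \<open>p\<close> of \<open>s\<close> and the corresponding derivative \<open>q\<close> of \<open>c\<close>, the left side
is \<open>p\<close> times that derivative of \<open>c\<^sup>2/(s + e)\<close>.\<close>

lemma caccioppoli_pointwise:
  fixes p q k :: real
  shows "p * (2 * k * q - k\<^sup>2 * p) \<le> 2 * q\<^sup>2 - (k * p)\<^sup>2 / 2"
  using zero_le_power2[of "2 * q - k * p"] by (simp add: power2_eq_square algebra_simps)

text \<open>The pointwise inequality is integrated for the two partial derivatives; for the angular one the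
negative square is simply dropped.\<close>

lemma log_caccioppoli:
  assumes s: "rtest s" "\<And>x. 0 \<le> s x" and c: "rtest c" and e: "e > 0"
  shows "(LINT x|M. (c x)\<^sup>2 * (((rd 1 s x)\<^sup>2 + (rd 2 s x)\<^sup>2) / (s x + e)\<^sup>2)) / 2
    \<le> 2 * Re (Aform \<beta> (\<lambda>x. of_real (c x)) (\<lambda>x. of_real (c x)))
      - Re (Aform \<beta> (\<lambda>x. of_real (s x)) (\<lambda>x. of_real ((c x)\<^sup>2 / (s x + e))))" (is "?L / 2 \<le> _")
    and "integrable M (\<lambda>x. (c x)\<^sup>2 * (((rd 1 s x)\<^sup>2 + (rd 2 s x)\<^sup>2) / (s x + e)\<^sup>2))"
proof -
  let ?t = "\<lambda>x. (c x)\<^sup>2 / (s x + e)"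
  note t = cutoff_quotient[OF s c e]
  have pos: "0 < s x + e" for x using s(2)[of x] e by simp
  define k where "k x = c x / (s x + e)" for x
  have rt: "rd i ?t x = 2 * k x * rd i c x - (k x)\<^sup>2 * rd i s x" for i x
    unfolding t(2) k_def by (simp add: power_divide)
  have rotc: "rot ?t x = 2 * k x * rot c x - (k x)\<^sup>2 * rot s x" for x
    unfolding rot_def rt by (simp add: algebra_simps)
  let ?f = "\<lambda>x. (c x)\<^sup>2 * (((rd 1 s x)\<^sup>2 + (rd 2 s x)\<^sup>2) / (s x + e)\<^sup>2)"
  have fk: "?f x = (k x * rd 1 s x)\<^sup>2 + (k x * rd 2 s x)\<^sup>2" for x
    unfolding k_def by (simp add: power_mult_distrib power_divide add_divide_distrib distrib_left)
  have kd: "rtest (\<lambda>x. k x * rd i s x)" for i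
  proof -
    have "Ck n (\<lambda>x. c x * ((s x + e) powr (-1)) * rd i s x)" for n
      by (intro Ck_mult rtest_Ck c rd_rtest s Ck_powr pos Ck_add Ck_const)
    moreover have "c x * ((s x + e) powr (-1)) * rd i s x = k x * rd i s x" for x
      using pos[of x] by (simp add: k_def powr_minus_divide)
    ultimately have "Ck n (\<lambda>x. k x * rd i s x)" for n by simp
    then show ?thesis unfolding rtest_def
      by (intro test_functions_dominated[OF c[unfolded rtest_def]] Ck_bounded_linear[OF bounded_linear_of_real]) (auto simp: k_def)
  qed
  have sq: "integrable M (\<lambda>x. (f x)\<^sup>2)" if "rtest f" for f
    using rtest_integrable_mult[OF that that] by (simp add: power2_eq_square)
  show i: "integrable M ?f" unfolding fk by (intro Bochner_Integration.integrable_add sq kd)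
  have i1: "integrable M (\<lambda>x. rd 1 c x * rd 1 c x + rd 2 c x * rd 2 c x + \<beta>\<^sup>2 * (rot c x * rot c x))"
    by (intro Bochner_Integration.integrable_add integrable_mult_right rtest_integrable_mult rd_rtest rot_rtest c)
  have i2: "integrable M (\<lambda>x. rd 1 s x * rd 1 ?t x + rd 2 s x * rd 2 ?t x + \<beta>\<^sup>2 * (rot s x * rot ?t x))"
    by (intro Bochner_Integration.integrable_add integrable_mult_right rtest_integrable_mult rd_rtest rot_rtest s t)
  have "?L / 2 = (LINT x|M. ?f x / 2)" by (rule integral_divide_zero[symmetric])
  also have "\<dots> \<le> (LINT x|M. 2 * (rd 1 c x * rd 1 c x + rd 2 c x * rd 2 c x + \<beta>\<^sup>2 * (rot c x * rot c x))
     - (rd 1 s x * rd 1 ?t x + rd 2 s x * rd 2 ?t x + \<beta>\<^sup>2 * (rot s x * rot ?t x)))"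
  proof (rule Bochner_Integration.integral_mono)
    fix x
    have "\<beta>\<^sup>2 * (rot s x * rot ?t x) \<le> \<beta>\<^sup>2 * (2 * (rot c x)\<^sup>2)"
      using caccioppoli_pointwise[of "rot s x" "k x" "rot c x"] zero_le_power2[of "k x * rot s x"]
      unfolding rotc by (intro mult_left_mono) (linarith, simp)
    then show "?f x / 2 \<le> 2 * (rd 1 c x * rd 1 c x + rd 2 c x * rd 2 c x + \<beta>\<^sup>2 * (rot c x * rot c x))
     - (rd 1 s x * rd 1 ?t x + rd 2 s x * rd 2 ?t x + \<beta>\<^sup>2 * (rot s x * rot ?t x))"
      using caccioppoli_pointwise[of "rd 1 s x" "k x" "rd 1 c x"] caccioppoli_pointwise[of "rd 2 s x" "k x" "rd 2 c x"]
      unfolding fk rt by (simp add: power2_eq_square)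
  qed (intro integrable_divide_zero Bochner_Integration.integrable_diff integrable_mult_right i i1 i2)+
  also have "\<dots> = 2 * Re (Aform \<beta> (\<lambda>x. of_real (c x)) (\<lambda>x. of_real (c x))) - Re (Aform \<beta> (\<lambda>x. of_real (s x)) (\<lambda>x. of_real (?t x)))"
    unfolding Aform_rtest[OF c c] Aform_rtest[OF s(1) t(1)]
    by (subst Bochner_Integration.integral_diff[OF integrable_mult_right[OF i1] i2]) (simp only: integral_mult_right_zero)
  finally show "?L / 2 \<le> 2 * Re (Aform \<beta> (\<lambda>x. of_real (c x)) (\<lambda>x. of_real (c x)))
      - Re (Aform \<beta> (\<lambda>x. of_real (s x)) (\<lambda>x. of_real ((c x)\<^sup>2 / (s x + e))))" .
qed

text \<open>The Poincare inequality for the function \<open>ln (s + e)\<close>. Its energy on \<open>S\<close> is controlled with the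
cutoff \<open>c\<close>, which is at least \<open>c0\<close> there.\<close>

lemma log_poincare:
  assumes s: "rtest s" "\<And>x. 0 \<le> s x" and c: "rtest c" and e: "e > 0"
    and S: "S \<in> sets borel" "convex S" "S \<subseteq> \<Omega>" and d: "\<And>x y. x \<in> S \<Longrightarrow> y \<in> S \<Longrightarrow> norm (x - y) \<le> d"
    and c0: "c0 > 0" "\<And>x. x \<in> S \<Longrightarrow> c0 \<le> c x"
  shows "(\<integral>\<^sup>+x. indicator S x * (\<integral>\<^sup>+y. indicator S y * ennreal ((ln (s x + e) - ln (s y + e))\<^sup>2) \<partial>lborel) \<partial>lborel)
    \<le> ennreal (4 * d\<^sup>2) * emeasure lborel S * ennreal ((LINT x|M. (c x)\<^sup>2 * (((rd 1 s x)\<^sup>2 + (rd 2 s x)\<^sup>2) / (s x + e)\<^sup>2)) / c0\<^sup>2)"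
proof -
  have pos: "0 < s x + e" for x using s(2)[of x] e by simp
  define F where "F x = ((rd 1 s x)\<^sup>2 + (rd 2 s x)\<^sup>2) / (s x + e)\<^sup>2" for x
  let ?u = "\<lambda>x. complex_of_real (ln (s x + e))"
  let ?s' = "\<lambda>x. frechet_derivative s (at x)"
  let ?u' = "\<lambda>x h. complex_of_real (?s' x h / (s x + e))"
  have u: "(?u has_derivative ?u' x) (at x)" for x
  proof -
    have "((\<lambda>x. ln (s x + e)) has_derivative (\<lambda>h. ?s' x h / (s x + e))) (at x)"
      using pos[of x] by (auto intro!: derivative_eq_intros rtest_has_derivative[OF s(1)] simp: field_simps)
    then show ?thesis by (rule bounded_linear.has_derivative[OF bounded_linear_of_real])
  qed
  have Fc: "continuous_on UNIV F"
    unfolding F_def using pos rtest_continuous[OF s(1)] rtest_continuous[OF rd_rtest[OF s(1)]]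
    by (intro continuous_intros) (auto simp: less_imp_neq[symmetric])
  have F0: "0 \<le> F x" for x by (simp add: F_def)
  have Fb: "(cmod (?u' x h))\<^sup>2 \<le> F x * (norm h)\<^sup>2" for x h
  proof -
    have D: "((\<lambda>x. complex_of_real (s x)) has_derivative (\<lambda>h. complex_of_real (?s' x h))) (at x)"
      by (rule bounded_linear.has_derivative[OF bounded_linear_of_real rtest_has_derivative[OF s(1)]])
    have "(?s' x h)\<^sup>2 \<le> ((rd 1 s x)\<^sup>2 + (rd 2 s x)\<^sup>2) * (norm h)\<^sup>2"
      using norm_frechet_le[OF D, of h] by (simp add: sum_2 rd_def)
    then have "(?s' x h)\<^sup>2 / (s x + e)\<^sup>2 \<le> ((rd 1 s x)\<^sup>2 + (rd 2 s x)\<^sup>2) * (norm h)\<^sup>2 / (s x + e)\<^sup>2"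
      by (rule divide_right_mono) simp
    then show ?thesis by (simp only: F_def norm_of_real power2_abs power_divide times_divide_eq_left)
  qed
  have "(\<integral>\<^sup>+x. indicator S x * (\<integral>\<^sup>+y. indicator S y * ennreal ((ln (s x + e) - ln (s y + e))\<^sup>2) \<partial>lborel) \<partial>lborel)
      = (\<integral>\<^sup>+x. indicator S x * (\<integral>\<^sup>+y. indicator S y * ennreal ((cmod (?u x - ?u y))\<^sup>2) \<partial>lborel) \<partial>lborel)"
    by (simp flip: of_real_diff)
  also have "\<dots> \<le> ennreal (4 * d\<^sup>2) * emeasure lborel S * (\<integral>\<^sup>+x. indicator S x * ennreal (F x) \<partial>lborel)"
    by (rule poincare_double_integral[OF u Fc F0 Fb S(1,2) d])
  also have "(\<integral>\<^sup>+x. indicator S x * ennreal (F x) \<partial>lborel) \<le> ennreal ((LINT x|M. (c x)\<^sup>2 * F x) / c0\<^sup>2)"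
  proof -
    have "(\<integral>\<^sup>+x. indicator S x * ennreal (F x) \<partial>lborel) \<le> (\<integral>\<^sup>+x. ennreal ((c x)\<^sup>2 * F x / c0\<^sup>2) * indicator \<Omega> x \<partial>lborel)"
    proof (rule nn_integral_mono)
      fix x
      show "indicator S x * ennreal (F x) \<le> ennreal ((c x)\<^sup>2 * F x / c0\<^sup>2) * indicator \<Omega> x"
      proof (cases "x \<in> S")
        case True
        have "c0\<^sup>2 \<le> (c x)\<^sup>2" using c0(1) c0(2)[OF True] by (intro power_mono) auto
        then have "c0\<^sup>2 * F x \<le> (c x)\<^sup>2 * F x" using F0 by (intro mult_right_mono)
        then have "F x \<le> (c x)\<^sup>2 * F x / c0\<^sup>2" using c0(1) by (simp add: pos_le_divide_eq mult.commute)
        moreover have "x \<in> \<Omega>" using True S(3) by blast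
        ultimately show ?thesis using True by (simp add: ennreal_leI)
      qed simp
    qed
    also have "\<dots> = (\<integral>\<^sup>+x. ennreal ((c x)\<^sup>2 * F x / c0\<^sup>2) * indicator \<Omega> x \<partial>lebesgue)" by (rule nn_integral_completion[symmetric])
    also have "\<dots> = (\<integral>\<^sup>+x. ennreal ((c x)\<^sup>2 * F x / c0\<^sup>2) \<partial>M)" by (subst nn_integral_restrict_space) auto
    also have "\<dots> = ennreal (LINT x|M. (c x)\<^sup>2 * F x / c0\<^sup>2)"
    proof (rule nn_integral_eq_integral)
      show "integrable M (\<lambda>x. (c x)\<^sup>2 * F x / c0\<^sup>2)"
        unfolding F_def by (intro integrable_divide_zero log_caccioppoli(2)[OF s c e])
    qed (use F0 in simp)
    finally show ?thesis by simp
  qed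
  finally show ?thesis by (simp add: F_def mult_left_mono)
qed

lemma rtest_H10: "rtest s \<Longrightarrow> (\<lambda>x. complex_of_real (s x)) \<in> H10 \<Omega>"
  using test_H10(1) by (simp add: rtest_def)

lemma rtest_sq_integrable: "rtest s \<Longrightarrow> integrable M (\<lambda>x. (s x)\<^sup>2)"
  using rtest_integrable_mult[of s s] by (simp add: power2_eq_square)

lemma sqnorm_rtest: "sqnorm \<Omega> (\<lambda>x. complex_of_real (s x)) = (LINT x|M. (s x)\<^sup>2)"
  by (simp add: sqnorm_def)

lemma sqnorm_wpderiv_rtest:
  assumes s: "rtest s"
  shows "sqnorm \<Omega> (wpderiv \<Omega> i (\<lambda>x. complex_of_real (s x))) = (LINT x|M. (rd i s x)\<^sup>2)"
proof -
  have "AE x in M. wpderiv \<Omega> i (\<lambda>x. complex_of_real (s x)) x = of_real (rd i s x)"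
    using test_H10(2)[OF s[unfolded rtest_def], of i] by eventually_elim (simp add: pderiv_rtest[OF s])
  then have "sqnorm \<Omega> (wpderiv \<Omega> i (\<lambda>x. complex_of_real (s x))) = sqnorm \<Omega> (\<lambda>x. complex_of_real (rd i s x))"
    by (rule sqnorm_cong_AE) (use H10_wpderiv_L2[OF rtest_H10[OF s]] test_L2 rd_rtest[OF s] in \<open>auto simp: rtest_def\<close>)
  then show ?thesis by (simp add: sqnorm_rtest)
qed

end

context cross_section begin

text \<open>For fixed \<open>e\<close> the quotients are bounded in the form norm uniformly in \<open>n\<close>, so that pairing them with
the error \<open>s n - h\<close> of an approximation gives something that tends to \<open>0\<close>.\<close>

lemma cutoff_quotient_norm_bound:
  assumes s: "\<And>n::nat. rtest (s n)" "\<And>n x. 0 \<le> s n x" and c: "rtest c" "\<And>x. 0 \<le> c x" "\<And>x. c x \<le> 1" and e: "e > 0"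
    and B: "\<And>n i. sqnorm \<Omega> (wpderiv \<Omega> i (\<lambda>x. complex_of_real (s n x))) \<le> B"
  shows "\<exists>C. \<forall>n. P.nrm (\<lambda>x. complex_of_real ((c x)\<^sup>2 / (s n x + e))) \<le> C"
proof -
  obtain C1 where C1: "C1 \<ge> 0" "\<And>i x. \<bar>rd i c x\<bar> \<le> C1"
  proof -
    obtain a b where "a \<ge> 0" "\<forall>x. \<bar>rd 1 c x\<bar> \<le> a" "b \<ge> 0" "\<forall>x. \<bar>rd 2 c x\<bar> \<le> b"
      using rtest_bounded[OF rd_rtest[OF c(1)], of 1] rtest_bounded[OF rd_rtest[OF c(1)], of 2] by auto
    then have "\<bar>rd i c x\<bar> \<le> max a b" for i x using exhaust_2[of i] by (auto simp: le_max_iff_disj)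
    then show ?thesis using that[of "max a b"] \<open>a \<ge> 0\<close> by simp
  qed
  define m where "m = measure M \<Omega>"
  define B1 where "B1 = 8 * C1\<^sup>2 / e\<^sup>2 * m + 2 / e ^ 4 * B"
  define B0 where "B0 = (1 / e)\<^sup>2 * m"
  have "P.W (\<lambda>x. complex_of_real ((c x)\<^sup>2 / (s n x + e))) \<le> (1 + 2 * \<beta>\<^sup>2 * radius\<^sup>2) * (2 * B1) + B0" for n
  proof -
    let ?t = "\<lambda>x. (c x)\<^sup>2 / (s n x + e)"
    note t = cutoff_quotient[OF s(1)[of n] s(2) c(1) e]
    have pos: "e \<le> s n x + e" for x using s(2)[of n x] by simp
    have c2: "(c x)\<^sup>2 \<le> 1" for x using c by (simp add: power_le_one)
    have t0: "0 \<le> ?t x \<and> ?t x \<le> 1 / e" for x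
      using frac_le[of 1 "(c x)\<^sup>2" e "s n x + e"] c2[of x] pos[of x] e by simp
    have const: "(LINT x|M. k) = k * m" for k :: real by (simp add: m_def)
    have "sqnorm \<Omega> (\<lambda>x. complex_of_real (?t x)) \<le> (LINT x|M. (1 / e)\<^sup>2)"
      unfolding sqnorm_rtest
      by (rule Bochner_Integration.integral_mono[OF rtest_sq_integrable[OF t(1)]]) (use t0 in \<open>auto intro!: power_mono simp del: power_divide\<close>)
    then have 0: "sqnorm \<Omega> (\<lambda>x. complex_of_real (?t x)) \<le> B0" unfolding B0_def const .
    have 1: "sqnorm \<Omega> (wpderiv \<Omega> i (\<lambda>x. complex_of_real (?t x))) \<le> B1" for i
    proof -
      have "(rd i ?t x)\<^sup>2 \<le> 8 * C1\<^sup>2 / e\<^sup>2 + 2 / e ^ 4 * (rd i (s n) x)\<^sup>2" for x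
      proof -
        have p1: "\<bar>2 * c x * rd i c x / (s n x + e)\<bar> \<le> 2 * C1 / e"
        proof -
          have "\<bar>2 * c x * rd i c x / (s n x + e)\<bar> = 2 * (c x * \<bar>rd i c x\<bar>) / (s n x + e)"
            using c(2)[of x] pos[of x] e by (simp add: abs_mult)
          also have "\<dots> \<le> 2 * (1 * C1) / e"
            using c(2,3)[of x] C1 pos[of x] e by (intro frac_le mult_left_mono mult_mono) auto
          finally show ?thesis by simp
        qed
        have p2: "\<bar>(c x)\<^sup>2 * rd i (s n) x / (s n x + e)\<^sup>2\<bar> \<le> \<bar>rd i (s n) x\<bar> / e\<^sup>2"
        proof -
          have "\<bar>(c x)\<^sup>2 * rd i (s n) x / (s n x + e)\<^sup>2\<bar> = (c x)\<^sup>2 * \<bar>rd i (s n) x\<bar> / (s n x + e)\<^sup>2"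
            by (simp add: abs_mult)
          also have "\<dots> \<le> 1 * \<bar>rd i (s n) x\<bar> / e\<^sup>2"
            using c2[of x] pos[of x] e by (intro frac_le mult_right_mono power_mono) auto
          finally show ?thesis by simp
        qed
        have "\<bar>rd i ?t x\<bar> \<le> 2 * C1 / e + \<bar>rd i (s n) x\<bar> / e\<^sup>2"
          unfolding t(2) using p1 p2 by linarith
        then have "\<bar>rd i ?t x\<bar>\<^sup>2 \<le> (2 * C1 / e + \<bar>rd i (s n) x\<bar> / e\<^sup>2)\<^sup>2"
          by (rule power_mono) simp
        then have "(rd i ?t x)\<^sup>2 \<le> (2 * C1 / e + \<bar>rd i (s n) x\<bar> / e\<^sup>2)\<^sup>2"
          by (simp only: power2_abs)
        also have "\<dots> \<le> 2 * (2 * C1 / e)\<^sup>2 + 2 * (\<bar>rd i (s n) x\<bar> / e\<^sup>2)\<^sup>2"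
          using sum_squares_bound[of "2 * C1 / e" "\<bar>rd i (s n) x\<bar> / e\<^sup>2"] by (simp only: power2_sum)
        also have "\<dots> = 8 * C1\<^sup>2 / e\<^sup>2 + 2 / e ^ 4 * (rd i (s n) x)\<^sup>2"
          by (simp add: power_divide power_mult_distrib)
        finally show ?thesis .
      qed
      then have "(LINT x|M. (rd i ?t x)\<^sup>2) \<le> (LINT x|M. 8 * C1\<^sup>2 / e\<^sup>2 + 2 / e ^ 4 * (rd i (s n) x)\<^sup>2)"
        by (intro Bochner_Integration.integral_mono rtest_sq_integrable rd_rtest t Bochner_Integration.integrable_add integrable_mult_right s) auto
      also have "\<dots> = 8 * C1\<^sup>2 / e\<^sup>2 * m + 2 / e ^ 4 * (LINT x|M. (rd i (s n) x)\<^sup>2)"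
        using rtest_sq_integrable[OF rd_rtest[OF s(1)]] by (subst Bochner_Integration.integral_add) (auto simp: m_def)
      also have "\<dots> \<le> B1"
        unfolding B1_def using B[of i n] e by (intro add_left_mono mult_left_mono) (auto simp: sqnorm_wpderiv_rtest[OF s(1)])
      finally show ?thesis unfolding sqnorm_wpderiv_rtest[OF t(1)] .
    qed
    have "Re (Aform \<beta> (\<lambda>x. complex_of_real (?t x)) (\<lambda>x. complex_of_real (?t x))) \<le> (1 + 2 * \<beta>\<^sup>2 * radius\<^sup>2) * (\<Sum>i\<in>UNIV. sqnorm \<Omega> (wpderiv \<Omega> i (\<lambda>x. complex_of_real (?t x))))"
      by (rule Aform_le_gradient[OF rtest_H10[OF t(1)]])
    also have "\<dots> \<le> (1 + 2 * \<beta>\<^sup>2 * radius\<^sup>2) * (2 * B1)"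
      using 1[of 1] 1[of 2] by (intro mult_left_mono) (auto simp: sum_2)
    finally show ?thesis unfolding P.W_def sqnorm_inner(2) using 0 by linarith
  qed
  then have "P.nrm (\<lambda>x. complex_of_real ((c x)\<^sup>2 / (s n x + e))) \<le> sqrt ((1 + 2 * \<beta>\<^sup>2 * radius\<^sup>2) * (2 * B1) + B0)" for n
    unfolding P.nrm_def by (rule real_sqrt_le_mono)
  then show ?thesis by blast
qed

lemma E1_0_nonneg: "0 \<le> E1 \<Omega> 0 \<beta>"
proof -
  obtain u where u: "u \<in> H10 \<Omega>" "sqnorm \<Omega> u = 1" "P.Q 0 u u = of_real (E1 \<Omega> 0 \<beta>) * L2_inner \<Omega> u u"
    using E1_ground_state(1)[where p = 0] by blast
  then show ?thesis using P.A_nonneg[OF u(1)] by (simp add: P.Q_def sqnorm_inner(1))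
qed

text \<open>Since \<open>h\<close> is a nonnegative eigenfunction and \<open>E(0) \<ge> 0\<close>, one has \<open>A(h,t) = E(0) \<langle>h,t\<rangle> \<ge> 0\<close> for the
nonnegative test function \<open>t = c\<^sup>2/(s + e)\<close>. Replacing \<open>h\<close> by the smooth approximation \<open>s\<close> costs at most
the form norm of \<open>t\<close> times that of \<open>s - h\<close>.\<close>

lemma log_energy_bound:
  assumes h: "ground h" and hn: "AE x in M. 0 \<le> Re (h x)"
    and s: "rtest s" "\<And>x. 0 \<le> s x" and c: "rtest c" and e: "e > 0"
    and C: "P.nrm (\<lambda>x. complex_of_real ((c x)\<^sup>2 / (s x + e))) \<le> C"
  shows "(LINT x|M. (c x)\<^sup>2 * (((rd 1 s x)\<^sup>2 + (rd 2 s x)\<^sup>2) / (s x + e)\<^sup>2))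
    \<le> 4 * Re (Aform \<beta> (\<lambda>x. of_real (c x)) (\<lambda>x. of_real (c x))) + 2 * (C * P.nrm (P.dif (\<lambda>x. of_real (s x)) h))"
proof -
  let ?s = "\<lambda>x. complex_of_real (s x)" and ?t = "\<lambda>x. complex_of_real ((c x)\<^sup>2 / (s x + e))"
  note t = cutoff_quotient(1)[OF s c e]
  have H: "h \<in> H10 \<Omega>" "?s \<in> H10 \<Omega>" "?t \<in> H10 \<Omega>" using h rtest_H10[OF s(1)] rtest_H10[OF t] by (auto simp: ground_def)
  have "Aform \<beta> h ?t = of_real (E1 \<Omega> 0 \<beta>) * L2_inner \<Omega> h ?t" using h H(3) by (simp add: ground_def P.Q_def)
  then have "Re (Aform \<beta> h ?t) = E1 \<Omega> 0 \<beta> * Re (L2_inner \<Omega> h ?t)" by simp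
  moreover have "0 \<le> Re (L2_inner \<Omega> h ?t)"
  proof -
    have "integrable M (\<lambda>x. h x * cnj (?t x))" by (rule L2_mult_integrable(2)[OF H10_L2[OF H(1)] H10_L2[OF H(3)]])
    then have "Re (L2_inner \<Omega> h ?t) = (LINT x|M. Re (h x * cnj (?t x)))" by (simp only: L2_inner_def integral_Re)
    also have "0 \<le> \<dots>"
    proof (rule integral_nonneg_AE)
      show "AE x in M. 0 \<le> Re (h x * cnj (?t x))"
        using hn by eventually_elim (use s(2) e in \<open>auto intro!: mult_nonneg_nonneg divide_nonneg_pos add_nonneg_pos\<close>)
    qed
    finally show ?thesis .
  qed
  ultimately have 1: "0 \<le> Re (Aform \<beta> h ?t)" using E1_0_nonneg by simp
  have dH: "P.dif ?s h \<in> H10 \<Omega>" by (rule P.dif_in[OF H(2,1)])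
  have "Aform \<beta> (P.dif ?s h) ?t = Aform \<beta> ?s ?t - Aform \<beta> h ?t"
    unfolding P.dif_def using P.A.lin[OF H(2,1,3), of 1 "-1"] by simp
  moreover have "cmod (Aform \<beta> (P.dif ?s h) ?t) \<le> P.nrm (P.dif ?s h) * P.nrm ?t" by (rule P.A_le[OF dH H(3)])
  moreover have "P.nrm (P.dif ?s h) * P.nrm ?t \<le> P.nrm (P.dif ?s h) * C"
    by (intro mult_left_mono C P.nrm_nonneg dH)
  ultimately have "- (C * P.nrm (P.dif ?s h)) \<le> Re (Aform \<beta> ?s ?t)"
    using 1 abs_Re_le_cmod[of "Aform \<beta> (P.dif ?s h) ?t"] by (simp add: mult.commute)
  then show ?thesis using log_caccioppoli(1)[OF s c e, of \<beta>] by simp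
qed

text \<open>The modulus \<open>h\<close> of \<open>f\<close> is the limit of nonnegative test functions \<open>s n\<close>. The logarithmic energy bound
for these, with the error term vanishing as \<open>n\<close> tends to infinity, and Fatou's lemma bound the
oscillation of \<open>ln (h + e)\<close> on a small box by a constant that does not depend on \<open>e\<close>. So \<open>h\<close> is
zero almost everywhere or positive almost everywhere on the box, and by connectedness on the
domain; the first is excluded by the normalisation.\<close>

proposition ground_nonzero:
  assumes f: "ground f" and n1: "sqnorm \<Omega> f = 1"
  shows "AE x in M. f x \<noteq> 0"
proof -
  obtain h \<psi> where h: "ground h" "sqnorm \<Omega> h = 1" and hf: "AE x in M. h x = of_real (cmod (f x))"
    and p0: "\<And>n::nat. (\<lambda>x. complex_of_real (\<psi> n x)) \<in> test_functions \<Omega>" "\<And>n x. 0 \<le> \<psi> n x"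
    and V: "P.V_converges (\<lambda>n x. complex_of_real (\<psi> n x)) h"
    by (rule ground_modulus[OF f n1]) (rule that)
  have p: "\<And>n. rtest (\<psi> n)" "\<And>n x. 0 \<le> \<psi> n x" using p0 by (simp_all add: rtest_def)
  have hH: "h \<in> H10 \<Omega>" using h by (simp add: ground_def)
  note pH = rtest_H10[OF p(1)]
  note dH = P.dif_in[OF pH hH]
  define g where "g n x = (cmod (lcf 1 (\<lambda>x. complex_of_real (\<psi> n x)) (-1) h x))\<^sup>2" for n x
  have gi: "integrable M (g n)" for n
    unfolding g_def by (intro L2_integrable_sq L2_lcf H10_L2 pH hH)
  have "(\<lambda>n. sqnorm \<Omega> (lcf 1 (\<lambda>x. complex_of_real (\<psi> n x)) (-1) h)) \<longlonglongrightarrow> 0"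
  proof (rule tendsto_sandwich[OF _ _ tendsto_const])
    show "(\<lambda>n. P.W (P.dif (\<lambda>x. complex_of_real (\<psi> n x)) h)) \<longlonglongrightarrow> 0" using V by (simp add: P.V_converges_def)
    show "\<forall>\<^sub>F n in sequentially. sqnorm \<Omega> (lcf 1 (\<lambda>x. complex_of_real (\<psi> n x)) (-1) h) \<le> P.W (P.dif (\<lambda>x. complex_of_real (\<psi> n x)) h)"
      using P.A_nonneg[OF dH] by (simp add: P.W_def P.dif_def sqnorm_inner(2))
  qed (simp add: sqnorm_nonneg)
  then have "(\<lambda>n. LINT x|M. norm (g n x)) \<longlonglongrightarrow> 0" by (simp add: g_def sqnorm_def)
  from tendsto_L1_AE_subseq[OF gi this] obtain r :: "nat \<Rightarrow> nat" where r: "strict_mono r" and rc: "AE x in M. (\<lambda>n. g (r n) x) \<longlonglongrightarrow> 0"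
    by blast
  define s where "s n = \<psi> (r n)" for n
  have s: "rtest (s n)" "0 \<le> s n x" for n x using p by (simp_all add: s_def)
  have sm[measurable]: "s n \<in> borel_measurable borel" for n
    by (rule borel_measurable_continuous_onI[OF rtest_continuous[OF s(1)]])
  \<comment> \<open>a Borel representative of the modulus of \<open>f\<close>, defined on the whole plane\<close>
  define H where "H x = lim (\<lambda>n. s n x)" for x
  have Hm[measurable]: "H \<in> borel_measurable borel" unfolding H_def by measurable
  have "AE x in M. (\<lambda>n. s n x) \<longlonglongrightarrow> H x \<and> 0 \<le> H x \<and> H x = cmod (f x)"
    using rc hf
  proof eventually_elim
    case (elim x)
    have "(\<lambda>n. sqrt (g (r n) x)) \<longlonglongrightarrow> sqrt 0" by (intro tendsto_real_sqrt elim)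
    then have "(\<lambda>n. cmod (complex_of_real (s n x) - of_real (cmod (f x)))) \<longlonglongrightarrow> 0" by (simp add: g_def lcf_def s_def elim(2))
    then have "(\<lambda>n. \<bar>s n x - cmod (f x)\<bar>) \<longlonglongrightarrow> 0" by (simp flip: of_real_diff)
    then have l: "(\<lambda>n. s n x) \<longlonglongrightarrow> cmod (f x)" by (simp add: tendsto_rabs_zero_iff LIM_zero_iff)
    then have "H x = cmod (f x)" unfolding H_def by (rule limI)
    then show ?case using l by simp
  qed
  then have "AE x in lebesgue. x \<in> \<Omega> \<longrightarrow> ((\<lambda>n. s n x) \<longlonglongrightarrow> H x \<and> 0 \<le> H x \<and> H x = cmod (f x))"
    by (subst (asm) AE_restrict_space_iff) auto
  then have good: "AE x in lborel. x \<in> \<Omega> \<longrightarrow> ((\<lambda>n. s n x) \<longlonglongrightarrow> H x \<and> 0 \<le> H x \<and> H x = cmod (f x))"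
    by (simp only: AE_completion_iff)
  have Wlim: "(\<lambda>n. P.W (P.dif (\<lambda>x. complex_of_real (s n x)) h)) \<longlonglongrightarrow> 0"
    using LIMSEQ_subseq_LIMSEQ[OF V[unfolded P.V_converges_def] r] by (simp add: o_def s_def)
  then have nlim: "(\<lambda>n. P.nrm (P.dif (\<lambda>x. complex_of_real (s n x)) h)) \<longlonglongrightarrow> 0"
    unfolding P.nrm_def using tendsto_real_sqrt by fastforce
  have Vs: "P.V_converges (\<lambda>n x. complex_of_real (s n x)) h" using Wlim by (simp add: P.V_converges_def)
  have "(\<lambda>n. P.Q 0 (\<lambda>x. complex_of_real (s n x)) (\<lambda>x. complex_of_real (s n x))) \<longlonglongrightarrow> P.Q 0 h h"
    by (rule P.N_dif_tendsto(2)[OF rtest_H10[OF s(1)] hH Vs hH])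
  then have "Bseq (\<lambda>n. P.Q 0 (\<lambda>x. complex_of_real (s n x)) (\<lambda>x. complex_of_real (s n x)))"
    by (rule convergent_imp_Bseq[OF convergentI])
  then obtain B where B: "\<And>n. cmod (P.Q 0 (\<lambda>x. complex_of_real (s n x)) (\<lambda>x. complex_of_real (s n x))) \<le> B" by (auto simp: Bseq_def)
  have Bd: "sqnorm \<Omega> (wpderiv \<Omega> i (\<lambda>x. complex_of_real (s n x))) \<le> B" for i n
    using sqnorm_wpderiv_le[of i "\<lambda>x. complex_of_real (s n x)" \<beta>] B[of n]
      complex_Re_le_cmod[of "Aform \<beta> (\<lambda>x. complex_of_real (s n x)) (\<lambda>x. complex_of_real (s n x))"]
    by (simp add: P.Q_def)
  have hn: "AE x in M. 0 \<le> Re (h x)" using hf by eventually_elim simp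
  have "\<exists>W. open W \<and> x0 \<in> W \<and> ((AE y in lborel. y \<in> W \<longrightarrow> H y = 0) \<or> (AE y in lborel. y \<in> W \<longrightarrow> 0 < H y))"
    if x0: "x0 \<in> \<Omega>" for x0
  proof -
    \<comment> \<open>nested boxes: the cutoff lives on the outer one and is bounded below on the inner one\<close>
    obtain a b where ab: "cbox a b \<subseteq> \<Omega>" "x0 \<in> box a b" using box_in_Omega[OF x0] .
    obtain a' b' where ab': "cbox a' b' \<subseteq> box a b" "x0 \<in> box a' b'" by (rule open_contains_cbox[OF open_box ab(2)])
    define S where "S = box a' b'"
    have S: "S \<in> sets borel" "convex S" "S \<subseteq> \<Omega>" "bounded S"
      using ab ab' box_subset_cbox[of a' b'] box_subset_cbox[of a b] by (auto simp: S_def convex_box)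
    define c where "c = box_bump 1 a b"
    have c: "rtest c" "\<And>x. 0 \<le> c x" "\<And>x. c x \<le> 1"
      using box_bump_test_function[OF ab(1), of 1] box_bump_bounds[of 1 a b] by (auto simp: c_def rtest_def)
    have "cbox a' b' \<noteq> {}" using ab'(2) box_subset_cbox[of a' b'] by blast
    then obtain z where z: "z \<in> cbox a' b'" "\<And>x. x \<in> cbox a' b' \<Longrightarrow> c z \<le> c x"
      using continuous_attains_inf[OF compact_cbox, of a' b' c] continuous_on_subset[OF rtest_continuous[OF c(1)]] by auto
    define c0 where "c0 = c z"
    have c0: "c0 > 0" "\<And>x. x \<in> S \<Longrightarrow> c0 \<le> c x"
      using z ab' box_bump_pos_iff[of 1 a b z] box_subset_cbox[of a' b'] by (auto simp: c0_def c_def S_def)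
    define d where "d = diameter S"
    have d: "norm (x - y) \<le> d" if "x \<in> S" "y \<in> S" for x y
      using diameter_bounded_bound[OF S(4) that] by (simp add: d_def dist_norm)
    have finS: "emeasure lborel S < \<infinity>" by (rule emeasure_bounded_finite[OF S(4)])
    define mS where "mS = measure lborel S"
    have emS: "emeasure lborel S = ennreal mS" unfolding mS_def by (rule emeasure_eq_ennreal_measure) (use finS in auto)
    define A where "A = Re (Aform \<beta> (\<lambda>x. complex_of_real (c x)) (\<lambda>x. complex_of_real (c x)))"
    \<comment> \<open>the limit, as \<open>n\<close> tends to infinity, of the bound \<open>k n\<close> below; the parameter \<open>e\<close> has disappeared\<close>
    define K where "K = 4 * d\<^sup>2 * mS * (4 * A / c0\<^sup>2)"
    have bound: "(\<integral>\<^sup>+x. indicator S x * (\<integral>\<^sup>+y. indicator S y * ennreal ((ln (H x + e) - ln (H y + e))\<^sup>2) \<partial>lborel) \<partial>lborel) \<le> ennreal K"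
      if e: "e > 0" for e
    proof -
      obtain C where C: "\<And>n. P.nrm (\<lambda>x. complex_of_real ((c x)\<^sup>2 / (s n x + e))) \<le> C"
        using cutoff_quotient_norm_bound[of s c e B, OF s c e Bd] by blast
      define k where "k n = 4 * d\<^sup>2 * mS * ((4 * A + 2 * (C * P.nrm (P.dif (\<lambda>x. complex_of_real (s n x)) h))) / c0\<^sup>2)" for n
      have klim: "k \<longlonglongrightarrow> K"
      proof -
        have "k \<longlonglongrightarrow> 4 * d\<^sup>2 * mS * ((4 * A + 2 * (C * 0)) / c0\<^sup>2)"
          unfolding k_def using c0(1) by (intro tendsto_intros nlim) auto
        then show ?thesis by (simp add: K_def)
      qed
      define F where "F n x y = ennreal ((ln (s n x + e) - ln (s n y + e))\<^sup>2)" for n x y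
      note S(1)[measurable]
      have Fm[measurable]: "F n x \<in> borel_measurable lborel" for n x unfolding F_def[abs_def] by measurable
      have est: "(\<integral>\<^sup>+x. indicator S x * (\<integral>\<^sup>+y. indicator S y * F n x y \<partial>lborel) \<partial>lborel) \<le> ennreal (k n)" for n
      proof -
        have "(\<integral>\<^sup>+x. indicator S x * (\<integral>\<^sup>+y. indicator S y * F n x y \<partial>lborel) \<partial>lborel)
          \<le> ennreal (4 * d\<^sup>2) * emeasure lborel S * ennreal ((LINT x|M. (c x)\<^sup>2 * (((rd 1 (s n) x)\<^sup>2 + (rd 2 (s n) x)\<^sup>2) / (s n x + e)\<^sup>2)) / c0\<^sup>2)"
          unfolding F_def by (rule log_poincare[OF s c(1) e S(1-3) d c0])
        also have "\<dots> \<le> ennreal (4 * d\<^sup>2) * emeasure lborel S * ennreal ((4 * A + 2 * (C * P.nrm (P.dif (\<lambda>x. complex_of_real (s n x)) h))) / c0\<^sup>2)"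
          using log_energy_bound[OF h(1) hn s c(1) e C, of n]
          by (intro mult_left_mono ennreal_leI divide_right_mono) (auto simp: A_def)
        also have "\<dots> = ennreal (k n)"
        proof -
          have "0 \<le> mS" by (simp add: mS_def)
          then show ?thesis unfolding emS k_def
            by (simp only: ennreal_mult'[symmetric] mult_nonneg_nonneg zero_le_power2 zero_le_numeral)
        qed
        finally show ?thesis .
      qed
      have goodF: "AE y in lborel. y \<in> S \<longrightarrow> (\<lambda>n. F n x y) \<longlonglongrightarrow> ennreal ((ln (H x + e) - ln (H y + e))\<^sup>2)"
        if x: "(\<lambda>n. s n x) \<longlonglongrightarrow> H x" "0 \<le> H x" for x
        using good
      proof eventually_elim
        case (elim y)
        show ?case
        proof
          assume "y \<in> S"
          then have y: "(\<lambda>n. s n y) \<longlonglongrightarrow> H y" "0 \<le> H y" using elim S(3) by auto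
          show "(\<lambda>n. F n x y) \<longlonglongrightarrow> ennreal ((ln (H x + e) - ln (H y + e))\<^sup>2)"
            unfolding F_def using x y e by (intro tendsto_ennrealI tendsto_intros) auto
        qed
      qed
      have Gm[measurable]: "(\<lambda>x. \<integral>\<^sup>+y. indicator S y * F n x y \<partial>lborel) \<in> borel_measurable borel" for n
        unfolding F_def using S(1) by measurable
      have "(\<integral>\<^sup>+x. indicator S x * (\<integral>\<^sup>+y. indicator S y * ennreal ((ln (H x + e) - ln (H y + e))\<^sup>2) \<partial>lborel) \<partial>lborel)
        \<le> (\<integral>\<^sup>+x. liminf (\<lambda>n. indicator S x * (\<integral>\<^sup>+y. indicator S y * F n x y \<partial>lborel)) \<partial>lborel)"
      proof (rule nn_integral_mono_AE)
        show "AE x in lborel. indicator S x * (\<integral>\<^sup>+y. indicator S y * ennreal ((ln (H x + e) - ln (H y + e))\<^sup>2) \<partial>lborel)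
          \<le> liminf (\<lambda>n. indicator S x * (\<integral>\<^sup>+y. indicator S y * F n x y \<partial>lborel))"
          using good
        proof eventually_elim
          case (elim x)
          show ?case
          proof (cases "x \<in> S")
            case True
            then have x: "(\<lambda>n. s n x) \<longlonglongrightarrow> H x" "0 \<le> H x" using elim S(3) by auto
            have "(\<integral>\<^sup>+y. indicator S y * ennreal ((ln (H x + e) - ln (H y + e))\<^sup>2) \<partial>lborel)
              = (\<integral>\<^sup>+y. liminf (\<lambda>n. indicator S y * F n x y) \<partial>lborel)"
            proof (rule nn_integral_cong_AE)
              show "AE y in lborel. indicator S y * ennreal ((ln (H x + e) - ln (H y + e))\<^sup>2) = liminf (\<lambda>n. indicator S y * F n x y)"
                using goodF[OF x]
              proof eventually_elim
                case (elim y)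
                show ?case
                proof (cases "y \<in> S")
                  case True
                  then show ?thesis using lim_imp_Liminf[OF trivial_limit_sequentially] elim by fastforce
                qed (simp add: Liminf_const)
              qed
            qed
            also have "\<dots> \<le> liminf (\<lambda>n. \<integral>\<^sup>+y. indicator S y * F n x y \<partial>lborel)"
              by (intro nn_integral_liminf) measurable
            finally show ?thesis using True by simp
          qed simp
        qed
      qed
      also have "\<dots> \<le> liminf (\<lambda>n. \<integral>\<^sup>+x. indicator S x * (\<integral>\<^sup>+y. indicator S y * F n x y \<partial>lborel) \<partial>lborel)"
        using S(1) by (intro nn_integral_liminf) measurable
      also have "\<dots> \<le> liminf (\<lambda>n. ennreal (k n))"
        by (intro Liminf_mono always_eventually allI est)
      also have "\<dots> = ennreal K"
        by (intro lim_imp_Liminf tendsto_ennrealI klim) simp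
      finally show ?thesis .
    qed
    have nn: "AE x in lborel. x \<in> S \<longrightarrow> 0 \<le> H x" using good by eventually_elim (use S(3) in auto)
    have "(AE x in lborel. x \<in> S \<longrightarrow> H x = 0) \<or> (AE x in lborel. x \<in> S \<longrightarrow> 0 < H x)"
      by (rule log_oscillation_dichotomy[OF Hm S(1) finS nn bound])
    then show ?thesis using ab'(2) by (intro exI[of _ S]) (auto simp: S_def)
  qed
  from connected_AE_dichotomy[OF conn this]
  consider "AE y in lborel. y \<in> \<Omega> \<longrightarrow> H y = 0" | "AE y in lborel. y \<in> \<Omega> \<longrightarrow> 0 < H y" by blast
  then show ?thesis
  proof cases
    case 1
    have "AE x in lborel. x \<in> \<Omega> \<longrightarrow> f x = 0" using 1 good by eventually_elim auto
    then have "AE x in lebesgue. x \<in> \<Omega> \<longrightarrow> f x = 0" by (rule AE_completion)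
    then have "AE x in M. f x = 0" by (subst AE_restrict_space_iff) auto
    moreover have "f \<in> L2 \<Omega>" using f H10_L2 by (simp add: ground_def)
    ultimately show ?thesis using n1 sqnorm_eq_0[of f \<Omega>] by simp
  next
    case 2
    have "AE x in lborel. x \<in> \<Omega> \<longrightarrow> f x \<noteq> 0" using 2 good by eventually_elim auto
    then have "AE x in lebesgue. x \<in> \<Omega> \<longrightarrow> f x \<noteq> 0" by (rule AE_completion)
    then show ?thesis by (subst AE_restrict_space_iff) auto
  qed
qed

end

context bounded_open begin

section \<open>Simplicity of the ground state\<close>

lemma H10_cnj:
  assumes u: "u \<in> H10 \<Omega>"
  shows "(\<lambda>x. cnj (u x)) \<in> H10 \<Omega>" "AE x in M. wpderiv \<Omega> i (\<lambda>x. cnj (u x)) x = cnj (wpderiv \<Omega> i u x)"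
proof -
  obtain \<phi> where p: "\<And>n::nat. \<phi> n \<in> test_functions \<Omega>" "(\<lambda>n. sqnorm \<Omega> (lcf 1 (\<phi> n) (-1) u)) \<longlonglongrightarrow> 0"
    "\<And>i. (\<lambda>n. sqnorm \<Omega> (lcf 1 (pderiv_classical i (\<phi> n)) (-1) (wpderiv \<Omega> i u))) \<longlonglongrightarrow> 0" using H10E[OF u] by blast
  have t: "(\<lambda>x. cnj (\<phi> n x)) \<in> test_functions \<Omega>" for n
    by (rule test_functions_bounded_linear[OF p(1) bounded_linear_cnj])
  have e: "sqnorm \<Omega> (lcf 1 (\<lambda>x. cnj (f x)) (-1) (\<lambda>x. cnj (g x))) = sqnorm \<Omega> (lcf 1 f (-1) g)" for f g
    unfolding sqnorm_def lcf_def by (simp flip: complex_cnj_diff)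
  have d: "pderiv_classical i (\<lambda>x. cnj (\<phi> n x)) = (\<lambda>x. cnj (pderiv_classical i (\<phi> n) x))" for i n
    by (rule ext) (rule pderiv_classical_bounded_linear[OF p(1) bounded_linear_cnj])
  show "(\<lambda>x. cnj (u x)) \<in> H10 \<Omega>" "AE x in M. wpderiv \<Omega> i (\<lambda>x. cnj (u x)) x = cnj (wpderiv \<Omega> i u x)"
    by (rule H10I[OF L2_cnj[OF H10_L2[OF u]] L2_cnj[OF H10_wpderiv_L2[OF u]] t], unfold d e, rule p, rule p)+
qed

text \<open>Conjugation turns \<open>i\<beta>\<partial>\<^sub>\<phi> u\<close> into the negative of its conjugate, so it preserves the form at \<open>p = 0\<close>.\<close>

lemma Aform_cnj:
  assumes u: "u \<in> H10 \<Omega>"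
  shows "Re (Aform \<beta> (\<lambda>x. cnj (u x)) (\<lambda>x. cnj (u x))) = Re (Aform \<beta> u u)"
proof -
  have e: "sqnorm \<Omega> (\<lambda>x. cnj (f x)) = sqnorm \<Omega> f" for f by (simp add: sqnorm_def)
  have "sqnorm \<Omega> (wpderiv \<Omega> i (\<lambda>x. cnj (u x))) = sqnorm \<Omega> (\<lambda>x. cnj (wpderiv \<Omega> i u x))" for i
    by (rule sqnorm_cong_AE[OF H10_cnj(2)[OF u]]) (intro H10_wpderiv_L2 H10_cnj(1) u L2_cnj)+
  moreover have "sqnorm \<Omega> (twist \<beta> (\<lambda>x. cnj (u x))) = sqnorm \<Omega> (lcf (-1) (\<lambda>x. cnj (twist \<beta> u x)) 0 (\<lambda>x. cnj (twist \<beta> u x)))"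
  proof (rule sqnorm_cong_AE)
    show "AE x in M. twist \<beta> (\<lambda>x. cnj (u x)) x = lcf (-1) (\<lambda>x. cnj (twist \<beta> u x)) 0 (\<lambda>x. cnj (twist \<beta> u x)) x"
      using H10_cnj(2)[OF u, of 1] H10_cnj(2)[OF u, of 2]
      by eventually_elim (simp add: twist_def angular_deriv_def lcf_def)
  qed (intro twist_L2 H10_cnj(1) u L2_lcf L2_cnj)+
  moreover have "sqnorm \<Omega> (lcf (-1) (\<lambda>x. cnj (twist \<beta> u x)) 0 (\<lambda>x. cnj (twist \<beta> u x))) = sqnorm \<Omega> (twist \<beta> u)"
    by (simp add: sqnorm_def lcf_def)
  ultimately show ?thesis unfolding Aform_diag e by simp
qed

end

context cross_section begin

lemma ground_L2: "ground f \<Longrightarrow> f \<in> L2 \<Omega>" by (simp add: ground_def H10_L2)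

lemma ground_cnj: "ground f \<Longrightarrow> ground (\<lambda>x. cnj (f x))"
  using H10_cnj(1)[of f] Aform_cnj[of f \<beta>] by (simp add: ground_iff P.Q_def sqnorm_def)

lemma ground_scale: "ground f \<Longrightarrow> ground (\<lambda>x. a * f x)"
  using ground_lcf[of f f a 0] by (simp add: lcf_def)

lemma ground_Re_Im:
  assumes "ground f"
  shows "ground (\<lambda>x. of_real (Re (f x)))" "ground (\<lambda>x. of_real (Im (f x)))"
proof -
  have "lcf (1/2) f (1/2) (\<lambda>x. cnj (f x)) = (\<lambda>x. of_real (Re (f x)))" "lcf (-\<i>/2) f (\<i>/2) (\<lambda>x. cnj (f x)) = (\<lambda>x. of_real (Im (f x)))"
    by (auto simp: lcf_def complex_eq_iff)
  then show "ground (\<lambda>x. of_real (Re (f x)))" "ground (\<lambda>x. of_real (Im (f x)))"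
    using ground_lcf[OF assms ground_cnj[OF assms]] by metis+
qed

lemma ground_normalize:
  assumes "ground f" "sqnorm \<Omega> f \<noteq> 0"
  obtains a :: real where "a > 0" "ground (\<lambda>x. of_real a * f x)" "sqnorm \<Omega> (\<lambda>x. of_real a * f x) = 1"
proof -
  have pos: "sqnorm \<Omega> f > 0" using assms(2) sqnorm_nonneg[of \<Omega> f] by simp
  define a where "a = 1 / sqrt (sqnorm \<Omega> f)"
  have "a > 0" using pos by (simp add: a_def)
  moreover have "sqnorm \<Omega> (\<lambda>x. of_real a * f x) = a\<^sup>2 * sqnorm \<Omega> f" by (simp add: sqnorm_def norm_mult power_mult_distrib)
  moreover have "a\<^sup>2 * sqnorm \<Omega> f = 1" using pos by (simp add: a_def power_divide)
  ultimately show ?thesis using that ground_scale[OF assms(1)] by metis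
qed

lemma ground_zero_or_nonzero:
  assumes "ground f"
  shows "(AE x in M. f x = 0) \<or> (AE x in M. f x \<noteq> 0)"
proof (cases "sqnorm \<Omega> f = 0")
  case True then show ?thesis using sqnorm_eq_0[OF ground_L2[OF assms]] by simp
next
  case False
  then obtain a :: real where a: "a > 0" "ground (\<lambda>x. of_real a * f x)" "sqnorm \<Omega> (\<lambda>x. of_real a * f x) = 1"
    using ground_normalize[OF assms] by blast
  have "AE x in M. f x \<noteq> 0" using ground_nonzero[OF a(2,3)] by eventually_elim auto
  then show ?thesis ..
qed

text \<open>The positive part \<open>(|g| + g)/2\<close> is a combination of ground states, hence a ground state itself, and
thus vanishes either almost everywhere or almost nowhere.\<close>

lemma ground_real_sign:
  assumes f: "ground (\<lambda>x. complex_of_real (g x))"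
  shows "(AE x in M. 0 < g x) \<or> (AE x in M. g x \<le> 0)"
proof (cases "sqnorm \<Omega> (\<lambda>x. complex_of_real (g x)) = 0")
  case True
  then have "AE x in M. complex_of_real (g x) = 0" using sqnorm_eq_0[OF ground_L2[OF f]] by simp
  then have "AE x in M. g x \<le> 0" by eventually_elim simp
  then show ?thesis ..
next
  case False
  then obtain a :: real where a: "a > 0" "ground (\<lambda>x. of_real a * complex_of_real (g x))" "sqnorm \<Omega> (\<lambda>x. of_real a * complex_of_real (g x)) = 1"
    using ground_normalize[OF f] by blast
  obtain h where h: "ground h" "AE x in M. h x = of_real (cmod (of_real a * complex_of_real (g x)))"
    by (rule ground_modulus[OF a(2,3)]) (rule that)
  define p where "p = lcf (1/2) h (1/2) (\<lambda>x. of_real a * complex_of_real (g x))"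
  have p: "ground p" unfolding p_def by (rule ground_lcf[OF h(1) a(2)])
  have pe: "AE x in M. p x = of_real (max (a * g x) 0)"
    using h(2) by eventually_elim (auto simp: p_def lcf_def max_def complex_eq_iff simp del: of_real_mult simp flip: of_real_mult)
  from ground_zero_or_nonzero[OF p] show ?thesis
  proof
    assume "AE x in M. p x = 0"
    then have "AE x in M. g x \<le> 0" using pe
      by eventually_elim (use a(1) in \<open>auto simp: max_def mult_le_0_iff split: if_splits\<close>)
    then show ?thesis ..
  next
    assume "AE x in M. p x \<noteq> 0"
    then have "AE x in M. 0 < g x" using pe
      by eventually_elim (use a(1) in \<open>auto simp: max_def zero_less_mult_iff not_le split: if_splits\<close>)
    then show ?thesis ..
  qed
qed

lemma not_AE_False: "\<not> (AE x in M. False)"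
proof
  assume F: "AE x in M. False"
  obtain u where u: "u \<in> H10 \<Omega>" "sqnorm \<Omega> u = 1" using E1_ground_state(1)[where p = 0] by blast
  have "AE x in M. u x = 0" using F by eventually_elim simp
  then show False using sqnorm_eq_0[OF H10_L2[OF u(1)]] u(2) by simp
qed

text \<open>A function of strict sign cannot be orthogonal to the positive function \<open>k\<close>; so neither \<open>g\<close> nor \<open>-g\<close>
is positive almost everywhere.\<close>

lemma ground_orthogonal_zero:
  assumes f: "ground (\<lambda>x. complex_of_real (g x))" and k: "AE x in M. 0 < k x" "integrable M (\<lambda>x. g x * k x)" "(LINT x|M. g x * k x) = 0"
  shows "AE x in M. g x = 0"
proof -
  have no: "\<not> (AE x in M. 0 < g' x)" if "integrable M (\<lambda>x. g' x * k x)" "(LINT x|M. g' x * k x) = 0" for g' :: "real^2 \<Rightarrow> real"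
  proof
    assume p: "AE x in M. 0 < g' x"
    have "AE x in M. 0 \<le> g' x * k x" using p k(1) by eventually_elim simp
    then have "AE x in M. g' x * k x = 0" using integral_nonneg_eq_0_iff_AE[OF that(1)] that(2) by simp
    then have "AE x in M. False" using p k(1) by eventually_elim simp
    then show False using not_AE_False by simp
  qed
  have "ground (\<lambda>x. complex_of_real (- g x))" using ground_scale[OF f, of "-1"] by simp
  from ground_real_sign[OF this] have "AE x in M. 0 \<le> g x" using no[of "\<lambda>x. - g x"] k(2,3) by simp
  moreover have "AE x in M. g x \<le> 0" using ground_real_sign[OF f] no[of g] k(2,3) by simp
  ultimately show ?thesis by eventually_elim simp
qed

text \<open>The modulus of any ground state serves as \<open>u0\<close>. It is positive, so the real and imaginary parts of
a ground state orthogonal to it both vanish.\<close>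

proposition ground_state_simple:
  obtains u0 where "ground u0" "sqnorm \<Omega> u0 = 1" "\<And>w. ground w \<Longrightarrow> L2_inner \<Omega> w u0 = 0 \<Longrightarrow> sqnorm \<Omega> w = 0"
proof -
  obtain u where u: "u \<in> H10 \<Omega>" "sqnorm \<Omega> u = 1" "\<And>v. v \<in> H10 \<Omega> \<Longrightarrow> P.Q 0 u v = of_real (E1 \<Omega> 0 \<beta>) * L2_inner \<Omega> u v"
    using E1_ground_state(1)[where p = 0] by blast
  have gu: "ground u" using u by (simp add: ground_def)
  obtain h where h: "ground h" "sqnorm \<Omega> h = 1" "AE x in M. h x = of_real (cmod (u x))"
    by (rule ground_modulus[OF gu u(2)]) (rule that)
  define k where "k x = cmod (u x)" for x
  have kpos: "AE x in M. 0 < k x" using ground_nonzero[OF gu u(2)] by eventually_elim (simp add: k_def)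
  have hk: "AE x in M. h x = of_real (k x)" using h(3) by (simp add: k_def)
  have "sqnorm \<Omega> w = 0" if w: "ground w" "L2_inner \<Omega> w h = 0" for w
  proof -
    have kL: "(\<lambda>x. complex_of_real (k x)) \<in> L2 \<Omega>" unfolding k_def by (rule L2_cmod[OF H10_L2[OF u(1)]])
    have wi: "integrable M (\<lambda>x. w x * cnj (of_real (k x)))" by (rule L2_mult_integrable(2)[OF ground_L2[OF w(1)] kL])
    have "L2_inner \<Omega> w h = L2_inner \<Omega> w (\<lambda>x. of_real (k x))"
      by (rule L2_inner_cong_AE[OF _ hk]) (use ground_L2 w h kL in auto)
    then have z: "(LINT x|M. w x * cnj (of_real (k x))) = 0" using w(2) by (simp add: L2_inner_def)
    have "AE x in M. Re (w x) = 0"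
      by (rule ground_orthogonal_zero[OF ground_Re_Im(1)[OF w(1)] kpos])
        (use integrable_Re[OF wi] integral_Re[OF wi] z in simp_all)
    moreover have "AE x in M. Im (w x) = 0"
      by (rule ground_orthogonal_zero[OF ground_Re_Im(2)[OF w(1)] kpos])
        (use integrable_Im[OF wi] integral_Im[OF wi] z in simp_all)
    ultimately have "AE x in M. w x = 0" by eventually_elim (simp add: complex_eq_iff)
    then show ?thesis using sqnorm_eq_0[OF ground_L2[OF w(1)]] by simp
  qed
  then show ?thesis using that h by blast
qed

section \<open>Expansion of the lowest eigenvalue\<close>

proposition E1_second_order_expansion:
  "\<exists>k d M' E'. d > 0 \<and> k > 0 \<and> (\<forall>p. \<bar>p\<bar> < d \<longrightarrow> ((\<lambda>p. E1 \<Omega> p \<beta>) has_real_derivative E' p) (at p)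
      \<and> \<bar>E' p - 2 * k * p\<bar> \<le> M' * p\<^sup>2 \<and> \<bar>E1 \<Omega> p \<beta> - E1 \<Omega> 0 \<beta> - k * p\<^sup>2\<bar> \<le> M' * \<bar>p\<bar> ^ 3)"
proof -
  obtain u0 where u0: "ground u0" "sqnorm \<Omega> u0 = 1" "\<And>w. ground w \<Longrightarrow> L2_inner \<Omega> w u0 = 0 \<Longrightarrow> sqnorm \<Omega> w = 0"
    by (rule ground_state_simple) (rule that)
  interpret S: simple_ground_state "H10 \<Omega>" lcf "Aform \<beta>" "Bform \<beta>" "L2_inner \<Omega>" "\<lambda>p. E1 \<Omega> p \<beta>" u0 "gap \<beta>"
  proof
    show "\<exists>u\<in>H10 \<Omega>. Re (L2_inner \<Omega> u u) = 1 \<and> (\<forall>v\<in>H10 \<Omega>. P.Q p u v = of_real (E1 \<Omega> p \<beta>) * L2_inner \<Omega> u v)" for p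
      using E1_ground_state(1)[where p = p] by (simp add: sqnorm_inner(2))
    show "E1 \<Omega> p \<beta> * Re (L2_inner \<Omega> v v) \<le> Re (P.Q p v v)" if "v \<in> H10 \<Omega>" for v p
      using E1_min[OF that] by (simp add: sqnorm_inner(2))
    show "Re (L2_inner \<Omega> u u) = 0" if "u \<in> H10 \<Omega>" "Re (P.Q 0 u u) = E1 \<Omega> 0 \<beta> * Re (L2_inner \<Omega> u u)" "L2_inner \<Omega> u u0 = 0" for u
      using u0(3)[of u] that by (simp add: ground_iff sqnorm_inner(2))
    show "P.Q 0 u0 v = of_real (E1 \<Omega> 0 \<beta>) * L2_inner \<Omega> u0 v" if "v \<in> H10 \<Omega>" for v
      using u0(1) that by (simp add: ground_def)
  qed (use gap_pos E1_lower_bound u0 in \<open>auto simp: ground_def sqnorm_inner(1)\<close>)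
  show ?thesis by (rule S.second_order_expansion)
qed

end

theorem corollary3p3:
  fixes \<omega> :: "(real^2) set" and \<beta> :: real
  assumes "open \<omega>" and "connected \<omega>" and "bounded \<omega>" and "C2_boundary \<omega>" and "0 \<in> \<omega>"
  shows "(\<forall>\<^sub>F p in nhds 0. (\<lambda>p. E1 \<omega> p \<beta>) differentiable at p)
       \<and> deriv (\<lambda>p. E1 \<omega> p \<beta>) differentiable at 0
       \<and> deriv (\<lambda>p. E1 \<omega> p \<beta>) 0 = 0
       \<and> mu \<omega> \<beta> > 0
       \<and> (\<lambda>p. E1 \<omega> p \<beta> - (E1 \<omega> 0 \<beta> + mu \<omega> \<beta> * p^2)) \<in> O[at 0](\<lambda>p. p^3)
       \<and> (\<forall>p. p \<noteq> 0 \<longrightarrow> E1 \<omega> p \<beta> > E1 \<omega> 0 \<beta>)"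
proof -
  interpret cross_section \<omega> \<beta>
    by unfold_locales (use assms in auto)
  define E where "E = (\<lambda>p. E1 \<omega> p \<beta>)"
  obtain k d C E' where d: "d > 0" and k: "k > 0"
    and der: "\<And>p. \<bar>p\<bar> < d \<Longrightarrow> (E has_real_derivative E' p) (at p)"
    and E'b: "\<And>p. \<bar>p\<bar> < d \<Longrightarrow> \<bar>E' p - 2 * k * p\<bar> \<le> C * p\<^sup>2"
    and Eb: "\<And>p. \<bar>p\<bar> < d \<Longrightarrow> \<bar>E p - E 0 - k * p\<^sup>2\<bar> \<le> C * \<bar>p\<bar> ^ 3"
    using E1_second_order_expansion unfolding E_def by blast
  have near: "\<forall>\<^sub>F p in nhds (0::real). \<bar>p\<bar> < d"
    using eventually_nhds_ball[OF d, of 0] by eventually_elim (simp add: dist_norm)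
  have nearA: "\<forall>\<^sub>F p in at (0::real). \<bar>p\<bar> < d \<and> p \<noteq> 0"
    unfolding eventually_at using d by (intro exI[of _ d]) (auto simp: dist_norm)
  have dE: "deriv E p = E' p" if "\<bar>p\<bar> < d" for p using der[OF that] by (rule DERIV_imp_deriv)
  have d0: "deriv E 0 = 0" using dE[of 0] E'b[of 0] d by simp
  \<comment> \<open>only the first derivative is known near \<open>0\<close>; its expansion \<open>2 k p + O(p\<^sup>2)\<close> supplies the second one at \<open>0\<close>\<close>
  have dd: "(deriv E has_real_derivative 2 * k) (at 0)"
    unfolding has_field_derivative_iff
  proof (rule LIM_zero_cancel, rule Lim_null_comparison)
    show "\<forall>\<^sub>F h in at 0. norm ((deriv E h - deriv E 0) / (h - 0) - 2 * k) \<le> \<bar>C\<bar> * \<bar>h\<bar>"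
      using nearA
    proof eventually_elim
      case (elim h)
      have "(deriv E h - deriv E 0) / (h - 0) - 2 * k = (E' h - 2 * k * h) / h"
        using elim by (simp add: dE d0 diff_divide_distrib)
      also have "\<bar>\<dots>\<bar> \<le> (C * h\<^sup>2) / \<bar>h\<bar>"
        unfolding abs_divide using E'b[of h] elim by (intro divide_right_mono) auto
      also have "\<dots> = C * \<bar>h\<bar>" using elim by (simp add: power2_eq_square field_simps)
      also have "\<dots> \<le> \<bar>C\<bar> * \<bar>h\<bar>" by (intro mult_right_mono) auto
      finally show ?case by simp
    qed
    have "((\<lambda>h. \<bar>C\<bar> * \<bar>h\<bar>) \<longlongrightarrow> \<bar>C\<bar> * \<bar>0\<bar>) (at (0::real))" by (intro tendsto_intros)
    then show "((\<lambda>h. \<bar>C\<bar> * \<bar>h\<bar>) \<longlongrightarrow> 0) (at (0::real))" by simp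
  qed
  have mu: "mu \<omega> \<beta> = k" unfolding mu_def E_def[symmetric] using DERIV_imp_deriv[OF dd] by simp
  have 1: "\<forall>\<^sub>F p in nhds 0. E differentiable at p"
    using near by eventually_elim (use der in \<open>auto simp: real_differentiable_def\<close>)
  have 2: "deriv E differentiable at 0" using dd by (auto simp: real_differentiable_def)
  have 3: "(\<lambda>p. E p - (E 0 + mu \<omega> \<beta> * p^2)) \<in> O[at 0](\<lambda>p. p^3)"
  proof (rule bigoI)
    show "\<forall>\<^sub>F p in at 0. norm (E p - (E 0 + mu \<omega> \<beta> * p^2)) \<le> C * norm (p^3)"
      using nearA
    proof eventually_elim
      case (elim p)
      then show ?case using Eb[of p] by (simp add: mu power_abs algebra_simps)
    qed
  qed
  have 4: "E p > E 0" if "p \<noteq> 0" for p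
  proof -
    have "0 < gap \<beta> * p\<^sup>2" using gap_pos that by simp
    then show ?thesis using E1_lower_bound[of p] by (simp add: E_def)
  qed
  show ?thesis
    using 1 2 d0 mu k 3 4 unfolding E_def by blast
qed

end
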